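(* Let $1<\alpha<2$ and let $\xi=(\xi_t)_{t\in\mathbb{R}}$ be a real, or a complex isotropic, symmetric $\alpha$-stable process satisfying (I) and (II) of the context, with associated random measure $d\xi$ and $F(A,B)=[d\xi(A),d\xi(B)]_{\alpha}$. Suppose that $d\xi$ satisfies the additivity condition $\mathcal{A}$ and that $F$ satisfies the bounded variation condition (BV) of the context. Let $X_t=\int_{\mathbb{R}}f(t,\lambda)\,d\xi(\lambda)$, where the $f(t,\cdot)$ are known deterministic bounded functions in $\Lambda_{\alpha}(d\xi)$. Then $F$ is the unique bimeasure characterizing $X$ and satisfying the integral representation $$\left[\int_{\mathbb{R}}h\,d\xi,\int_{\mathbb{R}}g\,d\xi\right]_{\alpha}=\int_{\mathbb{R}}\int_{\mathbb{R}}h(\lambda)\,(g(\lambda'))^{<\alpha-1>}F(d\lambda,d\lambda')\quad\text{for all bounded }h,g\in\Lambda_{\alpha}(d\xi);\qquad( * )$$ that is: (a) if a bimeasure $F'$ on $\mathcal{B}(\mathbb{R})\times\mathcal{B}(\mathbb{R})$ satisfies $( * )$ in place of $F$, then $F'=F$; (b) the finite-dimensional distributions of $X$ are determined by $F$ and the functions $f(t,\cdot)$: if $\xi'$ is another process of the same type (real, respectively complex isotropic) satisfying the same assumptions, with the same bimeasure $F$ and with each $f(t,\cdot)\in\Lambda_{\alpha}(d\xi')$, then $X'_t=\int_{\mathbb{R}}f(t,\lambda)\,d\xi'(\lambda)$ has the same finite-dimensional distributions as $X$.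
   Context: A real random vector $(X_1,\dots,X_d)$ is symmetric $\alpha$-stable (S$\alpha$S) if its characteristic function is $\exp\{-\int_{\mathbb{S}_d}|\sum_i t_is_i|^{\alpha}d\Gamma(s)\}$ for a (unique) finite symmetric measure $\Gamma=\Gamma_{X^d}$ on the unit sphere $\mathbb{S}_d\subset\mathbb{R}^d$ (spectral measure). A complex vector with $X_j=X_j^1+\imath X_j^2$ is S$\alpha$S if $(X_1^1,X_1^2,\dots,X_d^1,X_d^2)$ is; $\Gamma_{X^d}$ is then the spectral measure of that real vector on $\mathbb{S}_{2d}\subset\mathbb{R}^{2d}$, and one writes $s_j=s_j^1+\imath s_j^2$. A process is S$\alpha$S if all its finite-dimensional vectors are. A complex random variable $Y$ is isotropic if $Y$ and $Ye^{\imath\omega}$ have the same distribution for all real $\omega$; a complex process is isotropic if all finite complex linear combinations of its values are. For $z\in\mathbb{C}$, $z^{<\beta>}=|z|^{\beta-1}\overline{z}$ ($0^{<\beta>}=0$). The covariation is $[X_1,X_2]_{\alpha}=\int s_1s_2^{<\alpha-1>}d\Gamma_{(X_1,X_2)}$ (over $\mathbb{S}_2$ in the real case, $\mathbb{S}_4$ in the complex case), and $\|X\|_{\alpha}=([X,X]_{\alpha})^{1/\alpha}$. Conditions on $\xi$: (I) $\xi$ is right continuous with respect to convergence in probability; (II) for every linear combination $\zeta$ of increments of $\xi$, the map $t\mapsto[\xi(t),\zeta]_{\alpha}$ is of bounded variation. Under (I) and (II), the map $d\xi([s,t[)=\xi_t-\xi_s$ extends to a complex S$\alpha$S random measure $d\xi$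 on $\mathcal{B}(\mathbb{R})$ (all vectors $(d\xi(A_1),\dots,d\xi(A_n))$ are S$\alpha$S). Condition $\mathcal{A}$: for all $n\ge2$ and all pairwise disjoint Borel sets $A_1,\dots,A_n$, the S$\alpha$S vector $X^n=(d\xi(A_1),\dots,d\xi(A_n))$ satisfies: for all $i,j,k\in\{1,\dots,n\}$ not all equal, $\frac{\partial^3\phi}{\overline{\partial}\theta_i\overline{\partial}\theta_j\overline{\partial}\theta_k}\equiv0$, where $\phi(\theta)=\int_{\mathbb{S}_{2n}}\cos(\mathrm{Re}\sum_i\theta_i\overline{s_i})\,d\Gamma_{X^n}$, $\theta\in\mathbb{C}^n$, and $\frac{\partial}{\overline{\partial}\theta_j}=\frac{\partial}{\partial\theta_j^1}+\imath\frac{\partial}{\partial\theta_j^2}$ for $\theta_j=\theta_j^1+\imath\theta_j^2$ (in the real case: $\phi(\theta)=\int_{\mathbb{S}_n}\cos(\sum_i\theta_is_i)\,d\Gamma_{X^n}$, $\theta\in\mathbb{R}^n$, and usual partial derivatives). A bimeasure is a complex function on $\mathcal{B}(\mathbb{R})\times\mathcal{B}(\mathbb{R})$ that is $\sigma$-additive in each variable separately; under condition $\mathcal{A}$, $F$ is a bimeasure. Condition (BV): $\sup\{\sum_{i=1}^n\sum_{j=1}^n a_i(a_j)^{<\alpha-1>}F(A_i,A_j)\}<\infty$, the supremum being over $n$, pairwise disjoint $A_1,\dots,A_n\in\mathcal{B}(\mathbb{R})$ and complex $a_i$ with $|a_i|<1$. Then the complex measures $F_B:A\mapsto F(A,B)$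 and $\tilde F_A:B\mapsto F(A,B)$ have finite total variation. Morse–Transue integral (the double integral above): for bounded $f,h$ put $\tilde I_1(f,B)=\int f\,dF_B$ and $\tilde I_2(A,h)=\int h\,d\tilde F_A$, which are complex measures of finite total variation in $B$ and $A$ respectively, and $I_1(f,h)=\int h(\lambda)\,\tilde I_1(f,d\lambda)$, $I_2(f,h)=\int f(\lambda)\,\tilde I_2(d\lambda,h)$. The pair $(f,h)$ is Morse–Transue integrable if $I_1(f,h)=I_2(f,h)$; the common value is denoted $\int\int f(\lambda)h(\lambda')F(d\lambda,d\lambda')$. Total variation: $v(d\xi,A)=\sup\{\sum_{i\in I}|d\xi(A_i)|:\ I\text{ finite},\ (A_i)_{i\in I}\text{ a Borel partition of }A\}$, and $\nu$ is the positive measure $\nu(A)=\mathbb{E}(v(d\xi,A))$. $\Lambda_{\alpha}(d\xi)$ is the completion, for the $L^1(\nu)$ norm, of the complex simple functions with bounded support. For a simple function $f=\sum_if_i\mathbf{1}_{A_i}$, $\int f\,d\xi=\sum_if_i\,d\xi(A_i)$; for $f\in\Lambda_{\alpha}(d\xi)$, $\int f\,d\xi$ is the limit in $\|\cdot\|_{\alpha}$ (equivalently in probability) of $\int f_n\,d\xi$ for simple $f_n\to f$ in $L^1(\nu)$. *)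

theory Defs
  imports "HOL-Probability.Probability"
begin

text \<open>
  A vector of dimension \<open>d\<close> is a function \<open>nat \<Rightarrow> 'a\<close> of which the components below \<open>d\<close> matter.
  Everything in the first part is used with \<open>'a = real\<close> (real vectors, spheres in \<open>R^d\<close>) and with
  \<open>'a = complex\<close>: as \<open>z \<bullet> w = Re z * Re w + Im z * Im w\<close> and
  \<open>(norm z)^2 = (Re z)^2 + (Im z)^2\<close>, a complex vector of dimension \<open>d\<close> is then literally treated as
  the real vector of dimension \<open>2 * d\<close> of its real and imaginary parts.
\<close>

section \<open>Symmetric stable vectors and processes\<close>

definition sphere_space :: "nat \<Rightarrow> (nat \<Rightarrow> 'a::euclidean_space) measure" where
  "sphere_space d =
     restrict_space (\<Pi>\<^sub>M i\<in>{..<d}. borel) {s. (\<Sum>i<d. (norm (s i))\<^sup>2) = 1}"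

definition is_spectral_measure ::
  "real \<Rightarrow> 'w measure \<Rightarrow> nat \<Rightarrow> (nat \<Rightarrow> 'w \<Rightarrow> 'a::euclidean_space) \<Rightarrow> (nat \<Rightarrow> 'a) measure \<Rightarrow> bool" where
  "is_spectral_measure \<alpha> M d X \<Gamma> \<longleftrightarrow>
     sets \<Gamma> = sets (sphere_space d) \<and> finite_measure \<Gamma> \<and>
     distr \<Gamma> \<Gamma> (\<lambda>s. \<lambda>i\<in>{..<d}. - s i) = \<Gamma> \<and>
     (\<forall>\<theta>::nat \<Rightarrow> 'a. (CLINT \<omega>|M. iexp (\<Sum>i<d. \<theta> i \<bullet> X i \<omega>)) =
        of_real (exp (- (LINT s|\<Gamma>. \<bar>\<Sum>i<d. \<theta> i \<bullet> s i\<bar> powr \<alpha>))))"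

definition sas_vector ::
  "real \<Rightarrow> 'w measure \<Rightarrow> nat \<Rightarrow> (nat \<Rightarrow> 'w \<Rightarrow> 'a::euclidean_space) \<Rightarrow> bool" where
  "sas_vector \<alpha> M d X \<longleftrightarrow>
     (\<forall>i<d. X i \<in> borel_measurable M) \<and> (\<exists>\<Gamma>. is_spectral_measure \<alpha> M d X \<Gamma>)"

text \<open>For \<open>0 < \<alpha> < 2\<close> there is at most one symmetric spectral measure.\<close>

definition spectral_measure ::
  "real \<Rightarrow> 'w measure \<Rightarrow> nat \<Rightarrow> (nat \<Rightarrow> 'w \<Rightarrow> 'a::euclidean_space) \<Rightarrow> (nat \<Rightarrow> 'a) measure" where
  "spectral_measure \<alpha> M d X = (SOME \<Gamma>. is_spectral_measure \<alpha> M d X \<Gamma>)"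

definition sas_process ::
  "real \<Rightarrow> 'w measure \<Rightarrow> (real \<Rightarrow> 'w \<Rightarrow> 'a::euclidean_space) \<Rightarrow> bool" where
  "sas_process \<alpha> M \<xi> \<longleftrightarrow> (\<forall>n (t::nat \<Rightarrow> real). sas_vector \<alpha> M n (\<lambda>i. \<xi> (t i)))"

definition isotropic :: "'w measure \<Rightarrow> ('w \<Rightarrow> complex) \<Rightarrow> bool" where
  "isotropic M Y \<longleftrightarrow> (\<forall>r::real. distr M borel (\<lambda>\<omega>. Y \<omega> * iexp r) = distr M borel Y)"

definition isotropic_process :: "'w measure \<Rightarrow> (real \<Rightarrow> 'w \<Rightarrow> complex) \<Rightarrow> bool" where
  "isotropic_process M \<xi> \<longleftrightarrow>
     (\<forall>n (c::nat \<Rightarrow> complex) (t::nat \<Rightarrow> real). isotropic M (\<lambda>\<omega>. \<Sum>i<n. c i * \<xi> (t i) \<omega>))"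

section \<open>Covariation\<close>

definition spow_real :: "real \<Rightarrow> real \<Rightarrow> real" where
  "spow_real \<beta> x = \<bar>x\<bar> powr (\<beta> - 1) * x"

definition spow :: "real \<Rightarrow> complex \<Rightarrow> complex" where
  "spow \<beta> z = of_real (norm z powr (\<beta> - 1)) * cnj z"

definition pair_vector :: "('w \<Rightarrow> 'a) \<Rightarrow> ('w \<Rightarrow> 'a) \<Rightarrow> nat \<Rightarrow> 'w \<Rightarrow> 'a" where
  "pair_vector X Y i = (if i = 0 then X else Y)"

definition covariation_real :: "real \<Rightarrow> 'w measure \<Rightarrow> ('w \<Rightarrow> real) \<Rightarrow> ('w \<Rightarrow> real) \<Rightarrow> real" where
  "covariation_real \<alpha> M X Y =
     (LINT s|spectral_measure \<alpha> M 2 (pair_vector X Y). s 0 * spow_real (\<alpha> - 1) (s 1))"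

definition covariation :: "real \<Rightarrow> 'w measure \<Rightarrow> ('w \<Rightarrow> complex) \<Rightarrow> ('w \<Rightarrow> complex) \<Rightarrow> complex" where
  "covariation \<alpha> M X Y =
     (CLINT s|spectral_measure \<alpha> M 2 (pair_vector X Y). s 0 * spow (\<alpha> - 1) (s 1))"

text \<open>\<open>covariation \<alpha> M X X\<close> is a nonnegative real number.\<close>

definition cov_norm :: "real \<Rightarrow> 'w measure \<Rightarrow> ('w \<Rightarrow> complex) \<Rightarrow> real" where
  "cov_norm \<alpha> M X = Re (covariation \<alpha> M X X) powr (1 / \<alpha>)"

section \<open>Conditions (I) and (II) and the associated random measure\<close>

definition tendsto_in_prob ::
  "'w measure \<Rightarrow> ('i \<Rightarrow> 'w \<Rightarrow> 'a::real_normed_vector) \<Rightarrow> ('w \<Rightarrow> 'a) \<Rightarrow> 'i filter \<Rightarrow> bool" where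
  "tendsto_in_prob M X Y \<F> \<longleftrightarrow>
     (\<forall>\<epsilon>>0. ((\<lambda>i. measure M {\<omega> \<in> space M. norm (X i \<omega> - Y \<omega>) \<ge> \<epsilon>}) \<longlongrightarrow> 0) \<F>)"

definition condition_I :: "'w measure \<Rightarrow> (real \<Rightarrow> 'w \<Rightarrow> 'a::real_normed_vector) \<Rightarrow> bool" where
  "condition_I M \<xi> \<longleftrightarrow> (\<forall>t. tendsto_in_prob M \<xi> (\<xi> t) (at_right t))"

definition bounded_variation :: "(real \<Rightarrow> 'a::real_normed_vector) \<Rightarrow> bool" where
  "bounded_variation g \<longleftrightarrow>
     (\<exists>C. \<forall>n t. mono_on {..n::nat} t \<longrightarrow> (\<Sum>i<n. norm (g (t (Suc i)) - g (t i))) \<le> C)"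

text \<open>
  The first argument is \<open>covariation_real \<alpha> M\<close> or \<open>covariation \<alpha> M\<close>; the scalars of the linear
  combinations are real for a real and complex for a complex process.
\<close>

definition condition_II ::
  "(('w \<Rightarrow> 'a::real_normed_field) \<Rightarrow> ('w \<Rightarrow> 'a) \<Rightarrow> 'a) \<Rightarrow> (real \<Rightarrow> 'w \<Rightarrow> 'a) \<Rightarrow> bool" where
  "condition_II cov \<xi> \<longleftrightarrow>
     (\<forall>n (c::nat \<Rightarrow> 'a) (u::nat \<Rightarrow> real) (v::nat \<Rightarrow> real).
        bounded_variation
          (\<lambda>t. cov (\<xi> t) (\<lambda>\<omega>. \<Sum>i<n. c i * (\<xi> (v i) \<omega> - \<xi> (u i) \<omega>))))"

definition associated_random_measure ::
  "real \<Rightarrow> 'w measure \<Rightarrow> (real \<Rightarrow> 'w \<Rightarrow> 'a::euclidean_space) \<Rightarrow> (real set \<Rightarrow> 'w \<Rightarrow> 'a) \<Rightarrow> bool" where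
  "associated_random_measure \<alpha> M \<xi> d\<xi> \<longleftrightarrow>
     (\<forall>s t. s \<le> t \<longrightarrow> (AE \<omega> in M. d\<xi> {s..<t} \<omega> = \<xi> t \<omega> - \<xi> s \<omega>)) \<and>
     (\<forall>n (A::nat \<Rightarrow> real set). (\<forall>i<n. A i \<in> sets borel) \<longrightarrow> sas_vector \<alpha> M n (\<lambda>i. d\<xi> (A i))) \<and>
     (\<forall>A::nat \<Rightarrow> real set. range A \<subseteq> sets borel \<longrightarrow> disjoint_family A \<longrightarrow>
        tendsto_in_prob M (\<lambda>n \<omega>. \<Sum>i<n. d\<xi> (A i) \<omega>) (d\<xi> (\<Union>i. A i)) sequentially)"

section \<open>The additivity condition\<close>

definition phi_real :: "nat \<Rightarrow> (nat \<Rightarrow> real) measure \<Rightarrow> (nat \<Rightarrow> real) \<Rightarrow> real" where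
  "phi_real n \<Gamma> \<theta> = (LINT s|\<Gamma>. cos (\<Sum>i<n. \<theta> i * s i))"

definition partial_real :: "nat \<Rightarrow> ((nat \<Rightarrow> real) \<Rightarrow> real) \<Rightarrow> (nat \<Rightarrow> real) \<Rightarrow> real" where
  "partial_real j f \<theta> = deriv (\<lambda>x. f (\<theta>(j := x))) (\<theta> j)"

definition condition_A_real ::
  "real \<Rightarrow> 'w measure \<Rightarrow> (real set \<Rightarrow> 'w \<Rightarrow> real) \<Rightarrow> bool" where
  "condition_A_real \<alpha> M d\<xi> \<longleftrightarrow>
     (\<forall>n\<ge>2. \<forall>A::nat \<Rightarrow> real set.
        (\<forall>i<n. A i \<in> sets borel) \<longrightarrow> disjoint_family_on A {..<n} \<longrightarrow>
        (\<forall>i<n. \<forall>j<n. \<forall>k<n. \<not> (i = j \<and> j = k) \<longrightarrow>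
           (\<forall>\<theta>. partial_real i (partial_real j (partial_real k
              (phi_real n (spectral_measure \<alpha> M n (\<lambda>i. d\<xi> (A i)))))) \<theta> = 0)))"

definition phi_complex :: "nat \<Rightarrow> (nat \<Rightarrow> complex) measure \<Rightarrow> (nat \<Rightarrow> complex) \<Rightarrow> complex" where
  "phi_complex n \<Gamma> \<theta> = of_real (LINT s|\<Gamma>. cos (Re (\<Sum>i<n. \<theta> i * cnj (s i))))"

definition partial_bar :: "nat \<Rightarrow> ((nat \<Rightarrow> complex) \<Rightarrow> complex) \<Rightarrow> (nat \<Rightarrow> complex) \<Rightarrow> complex" where
  "partial_bar j f \<theta> =
     vector_derivative (\<lambda>x. f (\<theta>(j := Complex x (Im (\<theta> j))))) (at (Re (\<theta> j))) +
     \<i> * vector_derivative (\<lambda>y. f (\<theta>(j := Complex (Re (\<theta> j)) y))) (at (Im (\<theta> j)))"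

definition condition_A_complex ::
  "real \<Rightarrow> 'w measure \<Rightarrow> (real set \<Rightarrow> 'w \<Rightarrow> complex) \<Rightarrow> bool" where
  "condition_A_complex \<alpha> M d\<xi> \<longleftrightarrow>
     (\<forall>n\<ge>2. \<forall>A::nat \<Rightarrow> real set.
        (\<forall>i<n. A i \<in> sets borel) \<longrightarrow> disjoint_family_on A {..<n} \<longrightarrow>
        (\<forall>i<n. \<forall>j<n. \<forall>k<n. \<not> (i = j \<and> j = k) \<longrightarrow>
           (\<forall>\<theta>. partial_bar i (partial_bar j (partial_bar k
              (phi_complex n (spectral_measure \<alpha> M n (\<lambda>i. d\<xi> (A i)))))) \<theta> = 0)))"

section \<open>The two types of processes\<close>

text \<open>
  Real processes are given as complex-valued functions with vanishing imaginary part, so that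
  complex integrands make sense in both cases; all conditions on a real process are those for
  real-valued random variables and real spectral measures.
\<close>

datatype process_type = Real_Process | Isotropic_Process

fun stable_setting ::
  "process_type \<Rightarrow> real \<Rightarrow> 'w measure \<Rightarrow> (real \<Rightarrow> 'w \<Rightarrow> complex) \<Rightarrow> (real set \<Rightarrow> 'w \<Rightarrow> complex) \<Rightarrow> bool"
where
  "stable_setting Real_Process \<alpha> M \<xi> d\<xi> \<longleftrightarrow>
     prob_space M \<and>
     (\<forall>t \<omega>. Im (\<xi> t \<omega>) = 0) \<and> (\<forall>A\<in>sets borel. \<forall>\<omega>. Im (d\<xi> A \<omega>) = 0) \<and>
     sas_process \<alpha> M (\<lambda>t \<omega>. Re (\<xi> t \<omega>)) \<and>
     condition_I M (\<lambda>t \<omega>. Re (\<xi> t \<omega>)) \<and>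
     condition_II (covariation_real \<alpha> M) (\<lambda>t \<omega>. Re (\<xi> t \<omega>)) \<and>
     associated_random_measure \<alpha> M (\<lambda>t \<omega>. Re (\<xi> t \<omega>)) (\<lambda>A \<omega>. Re (d\<xi> A \<omega>)) \<and>
     condition_A_real \<alpha> M (\<lambda>A \<omega>. Re (d\<xi> A \<omega>))"
| "stable_setting Isotropic_Process \<alpha> M \<xi> d\<xi> \<longleftrightarrow>
     prob_space M \<and>
     sas_process \<alpha> M \<xi> \<and> isotropic_process M \<xi> \<and>
     condition_I M \<xi> \<and>
     condition_II (covariation \<alpha> M) \<xi> \<and>
     associated_random_measure \<alpha> M \<xi> d\<xi> \<and>
     condition_A_complex \<alpha> M d\<xi>"

fun covariation_bimeasure ::
  "process_type \<Rightarrow> real \<Rightarrow> 'w measure \<Rightarrow> (real set \<Rightarrow> 'w \<Rightarrow> complex) \<Rightarrow> real set \<Rightarrow> real set \<Rightarrow> complex"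
where
  "covariation_bimeasure Real_Process \<alpha> M d\<xi> A B =
     of_real (covariation_real \<alpha> M (\<lambda>\<omega>. Re (d\<xi> A \<omega>)) (\<lambda>\<omega>. Re (d\<xi> B \<omega>)))"
| "covariation_bimeasure Isotropic_Process \<alpha> M d\<xi> A B = covariation \<alpha> M (d\<xi> A) (d\<xi> B)"

section \<open>Bimeasures and the Morse--Transue integral\<close>

definition bimeasure :: "(real set \<Rightarrow> real set \<Rightarrow> complex) \<Rightarrow> bool" where
  "bimeasure F \<longleftrightarrow>
     (\<forall>B\<in>sets borel. \<forall>A::nat \<Rightarrow> real set. range A \<subseteq> sets borel \<longrightarrow> disjoint_family A \<longrightarrow>
        (\<lambda>i. F (A i) B) sums F (\<Union>i. A i) B) \<and>
     (\<forall>A\<in>sets borel. \<forall>B::nat \<Rightarrow> real set. range B \<subseteq> sets borel \<longrightarrow> disjoint_family B \<longrightarrow>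
        (\<lambda>i. F A (B i)) sums F A (\<Union>i. B i))"

definition condition_BV :: "real \<Rightarrow> (real set \<Rightarrow> real set \<Rightarrow> complex) \<Rightarrow> bool" where
  "condition_BV \<alpha> F \<longleftrightarrow>
     (\<exists>C. \<forall>n (A::nat \<Rightarrow> real set) (a::nat \<Rightarrow> complex).
        (\<forall>i<n. A i \<in> sets borel) \<longrightarrow> disjoint_family_on A {..<n} \<longrightarrow> (\<forall>i<n. norm (a i) < 1) \<longrightarrow>
        norm (\<Sum>i<n. \<Sum>j<n. a i * spow (\<alpha> - 1) (a j) * F (A i) (A j)) \<le> C)"

text \<open>
  Integrals against a complex measure are defined through the Jordan decompositions of its real and
  imaginary parts; \<open>pos_part_measure \<mu>\<close> is the positive part of a finite signed measure \<open>\<mu>\<close>.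
\<close>

definition pos_part_measure :: "(real set \<Rightarrow> real) \<Rightarrow> real measure" where
  "pos_part_measure \<mu> =
     measure_of UNIV (sets borel) (\<lambda>A. SUP B\<in>{B \<in> sets borel. B \<subseteq> A}. ennreal (\<mu> B))"

definition signed_integral :: "(real set \<Rightarrow> real) \<Rightarrow> (real \<Rightarrow> complex) \<Rightarrow> complex" where
  "signed_integral \<mu> f =
     (CLINT x|pos_part_measure \<mu>. f x) - (CLINT x|pos_part_measure (\<lambda>A. - \<mu> A). f x)"

definition complex_measure_integral :: "(real set \<Rightarrow> complex) \<Rightarrow> (real \<Rightarrow> complex) \<Rightarrow> complex" where
  "complex_measure_integral \<mu> f =
     signed_integral (\<lambda>A. Re (\<mu> A)) f + \<i> * signed_integral (\<lambda>A. Im (\<mu> A)) f"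

definition MT_I1 ::
  "(real set \<Rightarrow> real set \<Rightarrow> complex) \<Rightarrow> (real \<Rightarrow> complex) \<Rightarrow> (real \<Rightarrow> complex) \<Rightarrow> complex" where
  "MT_I1 F f h = complex_measure_integral (\<lambda>B. complex_measure_integral (\<lambda>A. F A B) f) h"

definition MT_I2 ::
  "(real set \<Rightarrow> real set \<Rightarrow> complex) \<Rightarrow> (real \<Rightarrow> complex) \<Rightarrow> (real \<Rightarrow> complex) \<Rightarrow> complex" where
  "MT_I2 F f h = complex_measure_integral (\<lambda>A. complex_measure_integral (\<lambda>B. F A B) h) f"

definition has_MT_integral ::
  "(real set \<Rightarrow> real set \<Rightarrow> complex) \<Rightarrow> (real \<Rightarrow> complex) \<Rightarrow> (real \<Rightarrow> complex) \<Rightarrow> complex \<Rightarrow> bool" where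
  "has_MT_integral F f h I \<longleftrightarrow> MT_I1 F f h = I \<and> MT_I2 F f h = I"

section \<open>Stochastic integration\<close>

text \<open>
  The values \<open>d\<xi> A\<close> are random variables, determined only up to null sets, and uncountably many
  partitions are involved, so the supremum in the total variation is the supremum in the lattice of
  random variables modulo null sets (a pointwise supremum would depend on the versions chosen and
  need not be additive).
\<close>

definition is_ess_supremum :: "'w measure \<Rightarrow> ('w \<Rightarrow> ennreal) set \<Rightarrow> ('w \<Rightarrow> ennreal) \<Rightarrow> bool" where
  "is_ess_supremum M G v \<longleftrightarrow>
     v \<in> borel_measurable M \<and> (\<forall>g\<in>G. AE \<omega> in M. g \<omega> \<le> v \<omega>) \<and>
     (\<forall>w\<in>borel_measurable M. (\<forall>g\<in>G. AE \<omega> in M. g \<omega> \<le> w \<omega>) \<longrightarrow> (AE \<omega> in M. v \<omega> \<le> w \<omega>))"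

definition total_variation ::
  "'w measure \<Rightarrow> (real set \<Rightarrow> 'w \<Rightarrow> complex) \<Rightarrow> real set \<Rightarrow> 'w \<Rightarrow> ennreal" where
  "total_variation M d\<xi> A =
     (SOME v. is_ess_supremum M
        {(\<lambda>\<omega>. \<Sum>B\<in>P. ennreal (norm (d\<xi> B \<omega>))) | P. finite P \<and> partition_on A P \<and> P \<subseteq> sets borel} v)"

definition variation_measure :: "'w measure \<Rightarrow> (real set \<Rightarrow> 'w \<Rightarrow> complex) \<Rightarrow> real measure" where
  "variation_measure M d\<xi> = measure_of UNIV (sets borel) (\<lambda>A. \<integral>\<^sup>+ \<omega>. total_variation M d\<xi> A \<omega> \<partial>M)"

definition bounded_simple :: "(real \<Rightarrow> complex) \<Rightarrow> bool" where
  "bounded_simple f \<longleftrightarrow> simple_function borel f \<and> bounded {x. f x \<noteq> 0}"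

definition simple_stoch_integral ::
  "(real set \<Rightarrow> 'w \<Rightarrow> complex) \<Rightarrow> (real \<Rightarrow> complex) \<Rightarrow> 'w \<Rightarrow> complex" where
  "simple_stoch_integral d\<xi> f \<omega> = (\<Sum>y\<in>range f. y * d\<xi> (f -` {y}) \<omega>)"

definition L1_approx ::
  "'w measure \<Rightarrow> (real set \<Rightarrow> 'w \<Rightarrow> complex) \<Rightarrow> (nat \<Rightarrow> real \<Rightarrow> complex) \<Rightarrow> (real \<Rightarrow> complex) \<Rightarrow> bool" where
  "L1_approx M d\<xi> s f \<longleftrightarrow>
     (\<forall>n. bounded_simple (s n)) \<and>
     (\<lambda>n. \<integral>\<^sup>+ x. ennreal (norm (s n x - f x)) \<partial>variation_measure M d\<xi>) \<longlonglongrightarrow> 0"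

text \<open>
  The completion is realised by Borel functions. Simple functions with bounded support belong to
  it by definition, even on sets where the variation measure is infinite.
\<close>

definition Lambda :: "'w measure \<Rightarrow> (real set \<Rightarrow> 'w \<Rightarrow> complex) \<Rightarrow> (real \<Rightarrow> complex) set" where
  "Lambda M d\<xi> = {f. f \<in> borel_measurable borel \<and> (\<exists>s. L1_approx M d\<xi> s f)}"

definition is_stoch_integral ::
  "real \<Rightarrow> 'w measure \<Rightarrow> (real set \<Rightarrow> 'w \<Rightarrow> complex) \<Rightarrow> (real \<Rightarrow> complex) \<Rightarrow> ('w \<Rightarrow> complex) \<Rightarrow> bool" where
  "is_stoch_integral \<alpha> M d\<xi> f Y \<longleftrightarrow>
     Y \<in> borel_measurable M \<and>
     (\<forall>s. L1_approx M d\<xi> s f \<longrightarrow>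
        (\<forall>n. sas_vector \<alpha> M 1 (\<lambda>_ \<omega>. simple_stoch_integral d\<xi> (s n) \<omega> - Y \<omega>)) \<and>
        (\<lambda>n. cov_norm \<alpha> M (\<lambda>\<omega>. simple_stoch_integral d\<xi> (s n) \<omega> - Y \<omega>)) \<longlonglongrightarrow> 0)"

text \<open>For \<open>f \<in> Lambda M d\<xi>\<close> the integral is determined up to almost sure equality.\<close>

definition stoch_integral ::
  "real \<Rightarrow> 'w measure \<Rightarrow> (real set \<Rightarrow> 'w \<Rightarrow> complex) \<Rightarrow> (real \<Rightarrow> complex) \<Rightarrow> 'w \<Rightarrow> complex" where
  "stoch_integral \<alpha> M d\<xi> f = (SOME Y. is_stoch_integral \<alpha> M d\<xi> f Y)"

definition integral_representation ::
  "real \<Rightarrow> 'w measure \<Rightarrow> (real set \<Rightarrow> 'w \<Rightarrow> complex) \<Rightarrow> (real set \<Rightarrow> real set \<Rightarrow> complex) \<Rightarrow> bool" where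
  "integral_representation \<alpha> M d\<xi> F \<longleftrightarrow>
     (\<forall>h g. h \<in> Lambda M d\<xi> \<longrightarrow> bounded (range h) \<longrightarrow> g \<in> Lambda M d\<xi> \<longrightarrow> bounded (range g) \<longrightarrow>
        has_MT_integral F h (\<lambda>x. spow (\<alpha> - 1) (g x))
          (covariation \<alpha> M (stoch_integral \<alpha> M d\<xi> h) (stoch_integral \<alpha> M d\<xi> g)))"

definition same_fdd ::
  "'w measure \<Rightarrow> (real \<Rightarrow> 'w \<Rightarrow> complex) \<Rightarrow> 'v measure \<Rightarrow> (real \<Rightarrow> 'v \<Rightarrow> complex) \<Rightarrow> bool" where
  "same_fdd M X M' X' \<longleftrightarrow>
     (\<forall>n (t::nat \<Rightarrow> real).
        distr M (\<Pi>\<^sub>M i\<in>{..<n}. borel) (\<lambda>\<omega>. \<lambda>i\<in>{..<n}. X (t i) \<omega>) =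
        distr M' (\<Pi>\<^sub>M i\<in>{..<n}. borel) (\<lambda>\<omega>. \<lambda>i\<in>{..<n}. X' (t i) \<omega>))"

end

theory Submission
  imports Defs "HOL-Library.Nat_Bijection"
begin

text \<open>
  Condition \<open>\<A>\<close> says that \<open>s\<^sub>i s\<^sub>j s\<^sub>k\<close> times the spectral measure has vanishing Fourier transform, so by
  uniqueness of Fourier transforms \<open>s\<^sub>i s\<^sub>j = 0\<close> almost everywhere for \<open>i \<noteq> j\<close>: the spectral measure sits on
  the coordinate axes and \<open>d\<xi>\<close> is independently scattered. Hence there is a finite measure \<open>m\<close> and a law
  \<open>\<rho>\<close> on the unit circle (uniform on \<open>{1, -1}\<close> for real processes, uniform on the circle for isotropic
  ones) such that \<open>\<integral> f d\<xi>\<close> has characteristic exponent \<open>\<integral>\<integral> \<bar>\<theta> \<bullet> f(x) u\<bar>\<^sup>\<alpha> d\<rho>(u) dm(x)\<close>, jointly in several \<open>f\<close>,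
  and \<open>F(A, B) = m(A \<inter> B)\<close>.

  The covariation is read off the characteristic exponent: its derivative at \<open>0\<close> in the first argument,
  averaged over the directions of the second, is \<open>\<integral> s\<^sub>1 s\<^sub>2\<^sup>\<langle>\<^sup>\<alpha>\<^sup>-\<^sup>1\<^sup>\<rangle> d\<Gamma>\<close> up to a constant, so uniqueness of the
  spectral measure is never needed. This gives \<open>[\<integral> h d\<xi>, \<integral> g d\<xi>] = \<integral> h g\<^sup>\<langle>\<^sup>\<alpha>\<^sup>-\<^sup>1\<^sup>\<rangle> dm\<close>, which is the
  Morse--Transue integral for the diagonal bimeasure. Convergence in \<open>L\<^sup>1(\<nu>)\<close> controls convergence in
  \<open>L\<^sup>\<alpha>(m)\<close> because \<open>\<nu>(A) \<ge> E \<bar>d\<xi>(A)\<bar> \<ge> c m(A)\<^sup>1\<^sup>/\<^sup>\<alpha>\<close> and \<open>\<ell>\<^sup>1 \<subseteq> \<ell>\<^sup>\<alpha>\<close>.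
\<close>

section \<open>Characteristic functions determine distributions\<close>

text \<open>The third order of the derivatives matters because \<phi> is a cosine transform: an odd
  number of derivatives leaves the sine transform of an odd weight, and against a symmetric measure
  this is already its whole Fourier transform. The index triple i, i, j is enough. One obstacle is
  that the variation measure may be infinite, even on bounded sets. Simple integrals then may have
  no mean, and only differences of late terms of an approximating sequence are controlled in L^1.
  Another is that a stochastic integral is merely some variable approached in
  \<open>cov_norm\<close> by every approximating sequence. Joint laws are therefore recovered by
  exchanging one integral at a time for a simple one, at a cost that depends on the law of a single
  error. Finally, indicators are certain to lie in \<open>Lambda\<close> only for bounded sets.
  Uniqueness of F is tested there and extended through unit intervals by \<sigma>-additivity in each
  variable.\<close>

lemma distr_real_cf_eq:
  assumes P: "finite_measure P" and Q: "finite_measure Q"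
    and [measurable]: "X \<in> borel_measurable P" "X' \<in> borel_measurable Q"
    and cf: "\<And>t::real. (CLINT x|P. iexp (t * X x)) = (CLINT x|Q. iexp (t * X' x))"
  shows "distr P borel X = distr Q borel X'"
proof -
  interpret P: finite_measure P by fact
  interpret Q: finite_measure Q by fact
  \<comment> \<open>At t = 0 both characteristic functions return the total mass, so a single
    constant \<open>c\<close> normalises both measures to the probability laws that
    \<open>Levy_uniqueness\<close> expects. Mass 0 cannot be normalised and is treated
    apart.\<close>
  have mass: "measure P (space P) = measure Q (space Q)"
    using cf[of 0] by simp
  show ?thesis
  proof (cases "measure P (space P) = 0")
    case True
    then have "emeasure P (space P) = 0" "emeasure Q (space Q) = 0"
      using mass by (simp_all add: P.emeasure_eq_measure Q.emeasure_eq_measure)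
    then have "emeasure P A = 0" "emeasure Q B = 0" for A B
      by (metis emeasure_space le_zero_eq)+
    then show ?thesis by (intro measure_eqI) (simp_all add: emeasure_distr)
  next
    case False
    define c where "c = measure P (space P)"
    have c: "c > 0" using False unfolding c_def by (simp add: zero_less_measure_iff)
    define DP where "DP = distr (density P (\<lambda>_. ennreal (1/c))) borel X"
    define DQ where "DQ = distr (density Q (\<lambda>_. ennreal (1/c))) borel X'"
    have eP: "emeasure DP A = ennreal (1/c) * emeasure (distr P borel X) A" if "A \<in> sets borel" for A
      using that unfolding DP_def by (simp add: emeasure_distr emeasure_density nn_integral_cmult_indicator)
    have eQ: "emeasure DQ A = ennreal (1/c) * emeasure (distr Q borel X') A" if "A \<in> sets borel" for A
      using that unfolding DQ_def by (simp add: emeasure_distr emeasure_density nn_integral_cmult_indicator)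
    have "real_distribution DP"
      unfolding DP_def
      apply (intro prob_space.real_distribution_distr prob_spaceI)
      using c by (simp_all add: emeasure_density P.emeasure_eq_measure c_def[symmetric] ennreal_mult[symmetric])
    moreover have "real_distribution DQ"
      unfolding DQ_def
      apply (intro prob_space.real_distribution_distr prob_spaceI)
      using c by (simp_all add: emeasure_density Q.emeasure_eq_measure mass[symmetric] c_def[symmetric] ennreal_mult[symmetric])
    moreover have "char DP = char DQ"
    proof
      fix t
      have "char DP t = of_real (1/c) * (CLINT x|P. iexp (t * X x))"
        using c by (simp add: DP_def char_def integral_distr integral_density scaleR_conv_of_real)
      also have "\<dots> = char DQ t"
        using c by (simp add: DQ_def char_def integral_distr integral_density scaleR_conv_of_real cf[simplified])
      finally show "char DP t = char DQ t" .
    qed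
    ultimately have eq: "DP = DQ" by (rule Levy_uniqueness)
    show ?thesis
    proof (rule measure_eqI)
      fix A assume "A \<in> sets (distr P borel X)"
      then have A: "A \<in> sets borel" by simp
      have "ennreal c * emeasure DP A = ennreal c * emeasure DQ A" by (simp add: eq)
      then show "emeasure (distr P borel X) A = emeasure (distr Q borel X') A"
        using c unfolding eP[OF A] eQ[OF A]
        by (simp add: mult.assoc[symmetric] ennreal_mult[symmetric])
    qed simp
  qed
qed

lemma (in finite_measure) integrable_boundedI:
  fixes f :: "'a \<Rightarrow> 'b::{banach,second_countable_topology}"
  assumes "f \<in> borel_measurable M" "\<And>x. norm (f x) \<le> B"
  shows "integrable M f"
  by (rule integrable_const_bound[where B=B]) (use assms in auto)

lemma borel_measurable_cnj[measurable (raw)]: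
  "f \<in> borel_measurable M \<Longrightarrow> (\<lambda>x. cnj (f x)) \<in> borel_measurable M"
  by (rule measurable_compose[OF _ borel_measurable_continuous_onI]) (auto intro: continuous_intros)

text \<open>A signed weight bounded by 1 becomes the nonnegative density \<open>1 + w\<close>.
  Uniqueness for the measures with this density and for the unweighted ones, followed by
  subtraction, isolates the contribution of the weight.\<close>

lemma cf_weight_eq_real:
  fixes w :: "'a \<Rightarrow> real" and w' :: "'b \<Rightarrow> real"
  assumes P: "finite_measure P" and Q: "finite_measure Q"
    and [measurable]: "X \<in> borel_measurable P" "X' \<in> borel_measurable Q"
      "w \<in> borel_measurable P" "w' \<in> borel_measurable Q"
    and w: "\<And>x. \<bar>w x\<bar> \<le> 1" "\<And>x. \<bar>w' x\<bar> \<le> 1"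
    and cf: "\<And>t::real. (CLINT x|P. iexp (t * X x)) = (CLINT x|Q. iexp (t * X' x))"
    and cfw: "\<And>t::real. (CLINT x|P. w x * iexp (t * X x)) = (CLINT x|Q. w' x * iexp (t * X' x))"
    and B[measurable]: "B \<in> sets borel"
  shows "(LINT x|P. w x * indicator B (X x)) = (LINT x|Q. w' x * indicator B (X' x))"
proof -
  interpret P: finite_measure P by fact
  interpret Q: finite_measure Q by fact
  have w0: "0 \<le> 1 + w x" "0 \<le> 1 + w' y" for x y using w(1)[of x] w(2)[of y] by auto
  define DP where "DP = density P (\<lambda>x. ennreal (1 + w x))"
  define DQ where "DQ = density Q (\<lambda>x. ennreal (1 + w' x))"
  have intP: "integrable P (\<lambda>x. complex_of_real (w x) * iexp (t * X x))" "integrable P (\<lambda>x. iexp (t * X x))" for t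
    by (rule P.integrable_boundedI[where B=1]; use w in \<open>simp add: norm_mult\<close>)+
  have intQ: "integrable Q (\<lambda>x. complex_of_real (w' x) * iexp (t * X' x))" "integrable Q (\<lambda>x. iexp (t * X' x))" for t
    by (rule Q.integrable_boundedI[where B=1]; use w in \<open>simp add: norm_mult\<close>)+
  have iw: "integrable P (\<lambda>x. w x * indicator B (X x))" "integrable P (\<lambda>x. indicator B (X x) :: real)"
    by (rule P.integrable_boundedI[where B=1]; use w in \<open>auto simp: indicator_def abs_mult\<close>)+
  have iw': "integrable Q (\<lambda>x. w' x * indicator B (X' x))" "integrable Q (\<lambda>x. indicator B (X' x) :: real)"
    by (rule Q.integrable_boundedI[where B=1]; use w in \<open>auto simp: indicator_def abs_mult\<close>)+
  have fP: "finite_measure DP" unfolding DP_def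
    apply (rule finite_measureI)
    apply (simp add: emeasure_density)
    apply (subst nn_integral_eq_integral)
    using w0 w by (auto intro!: P.integrable_boundedI[where B=2] simp: abs_le_iff intro: order_trans[of _ "1::real"])
  have fQ: "finite_measure DQ" unfolding DQ_def
    apply (rule finite_measureI)
    apply (simp add: emeasure_density)
    apply (subst nn_integral_eq_integral)
    using w0 w by (auto intro!: Q.integrable_boundedI[where B=2] simp: abs_le_iff intro: order_trans[of _ "1::real"])
  have "distr DP borel X = distr DQ borel X'"
  proof (rule distr_real_cf_eq[OF fP fQ])
    fix t :: real
    have "(CLINT x|DP. iexp (t * X x)) = (CLINT x|P. iexp (t * X x)) + (CLINT x|P. w x * iexp (t * X x))"
      unfolding DP_def using w0 intP[of t]
      by (subst integral_density) (simp_all add: scaleR_conv_of_real algebra_simps)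
    also have "\<dots> = (CLINT x|DQ. iexp (t * X' x))"
      unfolding DQ_def using w0 intQ[of t] cf cfw
      by (subst integral_density) (simp_all add: scaleR_conv_of_real algebra_simps)
    finally show "(CLINT x|DP. iexp (t * X x)) = (CLINT x|DQ. iexp (t * X' x))" .
  qed (simp_all add: DP_def DQ_def)
  then have "(LINT y|distr DP borel X. indicator B y) = (LINT y|distr DQ borel X'. indicator B y :: real)"
    by simp
  then have 1: "(LINT x|DP. indicator B (X x)) = (LINT x|DQ. indicator B (X' x) :: real)"
    by (subst (asm) (1 2) integral_distr) (simp_all add: DP_def DQ_def)
  have "distr P borel X = distr Q borel X'"
    by (rule distr_real_cf_eq[OF P Q]) (use cf in auto)
  then have "(LINT y|distr P borel X. indicator B y) = (LINT y|distr Q borel X'. indicator B y :: real)"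
    by simp
  then have 2: "(LINT x|P. indicator B (X x)) = (LINT x|Q. indicator B (X' x) :: real)"
    by (subst (asm) (1 2) integral_distr) (simp_all)
  have "(LINT x|DP. indicator B (X x)) = (LINT x|P. indicator B (X x)) + (LINT x|P. w x * indicator B (X x))"
    unfolding DP_def using w0 iw by (subst integral_density) (simp_all add: algebra_simps)
  moreover have "(LINT x|DQ. indicator B (X' x)) = (LINT x|Q. indicator B (X' x)) + (LINT x|Q. w' x * indicator B (X' x))"
    unfolding DQ_def using w0 iw' by (subst integral_density) (simp_all add: algebra_simps)
  ultimately show ?thesis using 1 2 by simp
qed

text \<open>Conjugating the weighted identity at -t gives the same identity for
  \<open>cnj w\<close>. It therefore holds for the real and imaginary parts of the weight, where the
  real case applies.\<close>

lemma cf_weight_eq: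
  fixes w :: "'a \<Rightarrow> complex" and w' :: "'b \<Rightarrow> complex"
  assumes P: "finite_measure P" and Q: "finite_measure Q"
    and [measurable]: "X \<in> borel_measurable P" "X' \<in> borel_measurable Q"
      "w \<in> borel_measurable P" "w' \<in> borel_measurable Q"
    and w: "\<And>x. norm (w x) \<le> 1" "\<And>x. norm (w' x) \<le> 1"
    and cf: "\<And>t::real. (CLINT x|P. iexp (t * X x)) = (CLINT x|Q. iexp (t * X' x))"
    and cfw: "\<And>t::real. (CLINT x|P. w x * iexp (t * X x)) = (CLINT x|Q. w' x * iexp (t * X' x))"
    and B[measurable]: "B \<in> sets borel"
  shows "(CLINT x|P. w x * indicator B (X x)) = (CLINT x|Q. w' x * indicator B (X' x))"
proof -
  interpret P: finite_measure P by fact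
  interpret Q: finite_measure Q by fact
  have iP: "integrable P (\<lambda>x. w x * iexp (t * X x))" "integrable P (\<lambda>x. cnj (w x) * iexp (t * X x))" for t
    by (rule P.integrable_boundedI[where B=1], measurable, simp add: norm_mult w)+
  have iQ: "integrable Q (\<lambda>x. w' x * iexp (t * X' x))" "integrable Q (\<lambda>x. cnj (w' x) * iexp (t * X' x))" for t
    by (rule Q.integrable_boundedI[where B=1], measurable, simp add: norm_mult w)+
  have cfc: "(CLINT x|P. cnj (w x) * iexp (t * X x)) = (CLINT x|Q. cnj (w' x) * iexp (t * X' x))" for t :: real
  proof -
    have "(CLINT x|P. cnj (w x) * iexp (t * X x)) = cnj (CLINT x|P. w x * iexp ((-t) * X x))"
      using Bochner_Integration.integral_cnj[of P "\<lambda>x. w x * iexp ((-t) * X x)"] by (simp add: exp_cnj)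
    also have "\<dots> = cnj (CLINT x|Q. w' x * iexp ((-t) * X' x))" by (simp only: cfw)
    also have "\<dots> = (CLINT x|Q. cnj (w' x) * iexp (t * X' x))"
      using Bochner_Integration.integral_cnj[of Q "\<lambda>x. w' x * iexp ((-t) * X' x)"] by (simp add: exp_cnj)
    finally show ?thesis .
  qed
  have re: "complex_of_real (Re z) = (z + cnj z) / 2" "complex_of_real (Im z) = (z - cnj z) / (2*\<i>)" for z
    by (auto simp: complex_eq_iff)
  have cfr: "(CLINT x|P. of_real (Re (w x)) * iexp (t * X x)) = (CLINT x|Q. of_real (Re (w' x)) * iexp (t * X' x))" for t :: real
    unfolding re add_divide_distrib distrib_right times_divide_eq_left
    using iP[of t] iQ[of t] cfw[of t] cfc[of t] by simp
  have cfi: "(CLINT x|P. of_real (Im (w x)) * iexp (t * X x)) = (CLINT x|Q. of_real (Im (w' x)) * iexp (t * X' x))" for t :: real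
    unfolding re diff_divide_distrib left_diff_distrib times_divide_eq_left
    using iP[of t] iQ[of t] cfw[of t] cfc[of t] by simp
  have b: "\<bar>Re (w x)\<bar> \<le> 1" "\<bar>Im (w x)\<bar> \<le> 1" "\<bar>Re (w' y)\<bar> \<le> 1" "\<bar>Im (w' y)\<bar> \<le> 1" for x y
    using w(1)[of x] w(2)[of y] abs_Re_le_cmod[of "w x"] abs_Im_le_cmod[of "w x"]
      abs_Re_le_cmod[of "w' y"] abs_Im_le_cmod[of "w' y"] by linarith+
  have 1: "(LINT x|P. Re (w x) * indicator B (X x)) = (LINT x|Q. Re (w' x) * indicator B (X' x))"
    by (rule cf_weight_eq_real[OF P Q]) (use b cf cfr in auto)
  have 2: "(LINT x|P. Im (w x) * indicator B (X x)) = (LINT x|Q. Im (w' x) * indicator B (X' x))"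
    by (rule cf_weight_eq_real[OF P Q]) (use b cf cfi in auto)
  have iwP: "integrable P (\<lambda>x. w x * indicator B (X x))"
    by (rule P.integrable_boundedI[where B=1]; use w in \<open>auto simp: norm_mult indicator_def\<close>)
  have iwQ: "integrable Q (\<lambda>x. w' x * indicator B (X' x))"
    by (rule Q.integrable_boundedI[where B=1]; use w in \<open>auto simp: norm_mult indicator_def\<close>)
  have ind: "Re (z * indicator B y) = Re z * indicator B y" "Im (z * indicator B y) = Im z * indicator B y" for z y
    by (auto simp: indicator_def)
  note ind' = integral_Re[OF iwP, unfolded ind] integral_Re[OF iwQ, unfolded ind]
    integral_Im[OF iwP, unfolded ind] integral_Im[OF iwQ, unfolded ind]
  show ?thesis
    unfolding complex_eq_iff using 1 2 ind' by metis
qed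

text \<open>Multivariate uniqueness follows from the one-dimensional one by trading exponentials for
  indicators, one coordinate at a time. In the step for \<open>k\<close>, the indicators already
  gained and the exponentials still present form a complex weight of modulus at most 1. The vector
  \<open>t\<close> stays arbitrary because the induction hypothesis is used with every value at
  \<open>k\<close>.\<close>

lemma cf_rectangles_eq:
  fixes X :: "'j \<Rightarrow> 'a \<Rightarrow> real" and X' :: "'j \<Rightarrow> 'b \<Rightarrow> real"
  assumes P: "finite_measure P" and Q: "finite_measure Q" and K: "finite K"
    and J: "finite J" "K \<subseteq> J"
    and X: "\<And>j. j \<in> J \<Longrightarrow> X j \<in> borel_measurable P" "\<And>j. j \<in> J \<Longrightarrow> X' j \<in> borel_measurable Q"
    and cf: "\<And>t::'j \<Rightarrow> real. (CLINT x|P. iexp (\<Sum>j\<in>J. t j * X j x)) = (CLINT x|Q. iexp (\<Sum>j\<in>J. t j * X' j x))"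
    and B: "\<And>j. B j \<in> sets borel"
  shows "(CLINT x|P. (\<Prod>k\<in>K. indicator (B k) (X k x)) * iexp (\<Sum>j\<in>J-K. t j * X j x))
       = (CLINT x|Q. (\<Prod>k\<in>K. indicator (B k) (X' k x)) * iexp (\<Sum>j\<in>J-K. t j * X' j x))"
  using K J(2)
proof (induction K arbitrary: t)
  case empty
  then show ?case using cf by simp
next
  case (insert k K)
  have kJ: "k \<in> J" and KJ: "K \<subseteq> J" using insert.prems by auto
  note [measurable] = X(1)[OF kJ] X(2)[OF kJ] B
  have m1[measurable]: "(\<lambda>x. \<Sum>j\<in>J-insert k K. t j * X j x) \<in> borel_measurable P"
    "(\<lambda>x. \<Sum>j\<in>J-insert k K. t j * X' j x) \<in> borel_measurable Q"
    using X by (auto intro!: borel_measurable_sum borel_measurable_times)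
  have m2[measurable]: "(\<lambda>x. \<Prod>k\<in>K. indicator (B k) (X k x) :: complex) \<in> borel_measurable P"
    using X KJ B by (auto intro!: borel_measurable_prod measurable_compose[OF X(1)])
  have m3[measurable]: "(\<lambda>x. \<Prod>k\<in>K. indicator (B k) (X' k x) :: complex) \<in> borel_measurable Q"
    using X KJ B by (auto intro!: borel_measurable_prod measurable_compose[OF X(2)])
  have bd: "norm (\<Prod>k\<in>K. indicator (B k) (Y k) :: complex) \<le> 1" for Y :: "'j \<Rightarrow> real"
    by (simp add: prod_norm[symmetric]) (intro prod_le_1, auto simp: indicator_def)
  have split: "J - K = insert k (J - insert k K)" using kJ insert.hyps by auto
  define w where "w x = (\<Prod>k\<in>K. indicator (B k) (X k x)) * iexp (\<Sum>j\<in>J-insert k K. t j * X j x)" for x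
  define w' where "w' x = (\<Prod>k\<in>K. indicator (B k) (X' k x)) * iexp (\<Sum>j\<in>J-insert k K. t j * X' j x)" for x
  have "(CLINT x|P. w x * indicator (B k) (X k x)) = (CLINT x|Q. w' x * indicator (B k) (X' k x))"
  proof (rule cf_weight_eq[OF P Q])
    show "norm (w x) \<le> 1" for x using bd by (simp add: w_def norm_mult)
    show "norm (w' x) \<le> 1" for x using bd by (simp add: w'_def norm_mult)
    fix s :: real
    have eq: "(\<Sum>j\<in>J. (if j = k then s else 0) * y j) = s * y k" for y :: "'j \<Rightarrow> real"
      using kJ J by (simp add: if_distrib[of "\<lambda>u. u * _"] cong: if_cong)
    show "(CLINT x|P. iexp (s * X k x)) = (CLINT x|Q. iexp (s * X' k x))"
      using cf[of "\<lambda>j. if j = k then s else 0"] by (simp only: eq)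
    have eq2: "iexp (\<Sum>j\<in>J-K. (t(k:=s)) j * y j) = iexp (\<Sum>j\<in>J-insert k K. t j * y j) * iexp (s * y k)"
      for y :: "'j \<Rightarrow> real"
    proof -
      have "(\<Sum>j\<in>J-K. (t(k:=s)) j * y j) = (\<Sum>j\<in>J-insert k K. t j * y j) + s * y k"
        unfolding split using J by (subst sum.insert) (auto intro!: sum.cong)
      then show ?thesis by (simp add: exp_add distrib_left)
    qed
    show "(CLINT x|P. w x * iexp (s * X k x)) = (CLINT x|Q. w' x * iexp (s * X' k x))"
      using insert.IH[OF KJ, of "t(k:=s)"] unfolding eq2 w_def w'_def by (simp only: mult.assoc)
  qed (unfold w_def w'_def, measurable)
  then show ?case using insert.hyps by (simp add: w_def w'_def mult_ac)
qed

text \<open>The case \<open>K = J\<close> of the exchange leaves only indicators of rectangles, and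
  these generate the product \<sigma>-algebra and are stable under intersection.\<close>

lemma distr_PiM_cf_eq:
  fixes X :: "'j \<Rightarrow> 'a \<Rightarrow> real" and X' :: "'j \<Rightarrow> 'b \<Rightarrow> real"
  assumes P: "finite_measure P" and Q: "finite_measure Q" and J: "finite J"
    and X: "\<And>j. j \<in> J \<Longrightarrow> X j \<in> borel_measurable P" "\<And>j. j \<in> J \<Longrightarrow> X' j \<in> borel_measurable Q"
    and cf: "\<And>t::'j \<Rightarrow> real. (CLINT x|P. iexp (\<Sum>j\<in>J. t j * X j x)) = (CLINT x|Q. iexp (\<Sum>j\<in>J. t j * X' j x))"
  shows "distr P (\<Pi>\<^sub>M j\<in>J. borel) (\<lambda>x. \<lambda>j\<in>J. X j x) = distr Q (\<Pi>\<^sub>M j\<in>J. borel) (\<lambda>x. \<lambda>j\<in>J. X' j x)"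
proof -
  interpret P: finite_measure P by fact
  interpret Q: finite_measure Q by fact
  have mP[measurable]: "(\<lambda>x. \<lambda>j\<in>J. X j x) \<in> measurable P (\<Pi>\<^sub>M j\<in>J. borel)"
    by (rule measurable_restrict) (use X in auto)
  have mQ[measurable]: "(\<lambda>x. \<lambda>j\<in>J. X' j x) \<in> measurable Q (\<Pi>\<^sub>M j\<in>J. borel)"
    by (rule measurable_restrict) (use X in auto)
  show ?thesis
  proof (rule measure_eqI_PiM_finite[OF J, where A="\<lambda>_. \<Pi>\<^sub>E j\<in>J. UNIV" and M="\<lambda>_. borel"])
    fix A :: "'j \<Rightarrow> real set" assume A: "\<And>i. i \<in> J \<Longrightarrow> A i \<in> sets borel"
    \<comment> \<open>\<open>cf_rectangles_eq\<close> asks for Borel sets at every index, while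
      \<open>A\<close> is known to be Borel only on \<open>J\<close>.\<close>
    define B where "B j = (if j \<in> J then A j else {})" for j
    have B: "B j \<in> sets borel" for j using A by (auto simp: B_def)
    have PiB: "Pi\<^sub>E J A = Pi\<^sub>E J B" by (intro PiE_cong) (simp add: B_def)
    have S: "Pi\<^sub>E J B \<in> sets (\<Pi>\<^sub>M j\<in>J. borel)" using B J by (intro sets_PiM_I_finite) auto
    have prod: "(\<Prod>k\<in>J. indicator (B k) (f k)) = (indicator (Pi\<^sub>E J B) (\<lambda>j\<in>J. f j) :: complex)" for f
      using J by (auto simp: indicator_def PiE_def Pi_def intro!: prod.neutral)
    have 1: "(CLINT x|P. indicator (Pi\<^sub>E J B) (\<lambda>j\<in>J. X j x)) = (CLINT x|Q. indicator (Pi\<^sub>E J B) (\<lambda>j\<in>J. X' j x))"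
      using cf_rectangles_eq[where B=B, OF P Q J J subset_refl X cf B, where t="\<lambda>_. 0"] by (simp add: prod)
    have ind: "(CLINT x|N. indicator S (f x)) = of_real (measure N (f -` S \<inter> space N))"
      for N :: "'z measure" and f :: "'z \<Rightarrow> 'j \<Rightarrow> real" and S
    proof -
      have "(\<lambda>x. indicator S (f x)) = (\<lambda>x. complex_of_real (indicator (f -` S) x))"
        by (auto simp: indicator_def)
      then show ?thesis by (simp add: integral_complex_of_real)
    qed
    have 2: "measure P ((\<lambda>x. \<lambda>j\<in>J. X j x) -` Pi\<^sub>E J B \<inter> space P) = measure Q ((\<lambda>x. \<lambda>j\<in>J. X' j x) -` Pi\<^sub>E J B \<inter> space Q)"
      using 1 unfolding ind by (simp only: of_real_eq_iff)
    show "emeasure (distr P (\<Pi>\<^sub>M j\<in>J. borel) (\<lambda>x. \<lambda>j\<in>J. X j x)) (Pi\<^sub>E J A) = emeasure (distr Q (\<Pi>\<^sub>M j\<in>J. borel) (\<lambda>x. \<lambda>j\<in>J. X' j x)) (Pi\<^sub>E J A)"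
      using 2 S unfolding PiB by (simp add: emeasure_distr P.emeasure_eq_measure Q.emeasure_eq_measure)
  next
    show "range (\<lambda>_::nat. \<Pi>\<^sub>E j\<in>J. UNIV) \<subseteq> prod_algebra J (\<lambda>_. borel)"
      using J by (auto intro!: prod_algebraI_finite)
    show "emeasure (distr P (Pi\<^sub>M J (\<lambda>j. borel)) (\<lambda>x. \<lambda>j\<in>J. X j x)) (J \<rightarrow>\<^sub>E UNIV) \<noteq> \<infinity>"
      using finite_measure.emeasure_finite[OF P.finite_measure_distr[OF mP]] by simp
  qed (auto simp: space_PiM)
qed

text \<open>The real coordinates of a vector are indexed by pairs of an index and a basis vector.\<close>

lemma distr_PiM_cf_eq_euclidean:
  fixes X :: "nat \<Rightarrow> 'a \<Rightarrow> 'c::euclidean_space" and X' :: "nat \<Rightarrow> 'b \<Rightarrow> 'c"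
  assumes P: "finite_measure P" and Q: "finite_measure Q"
    and X: "\<And>j. j < n \<Longrightarrow> X j \<in> borel_measurable P" "\<And>j. j < n \<Longrightarrow> X' j \<in> borel_measurable Q"
    and cf: "\<And>\<theta>::nat \<Rightarrow> 'c. (CLINT x|P. iexp (\<Sum>j<n. \<theta> j \<bullet> X j x)) = (CLINT x|Q. iexp (\<Sum>j<n. \<theta> j \<bullet> X' j x))"
  shows "distr P (\<Pi>\<^sub>M j\<in>{..<n}. borel) (\<lambda>x. \<lambda>j\<in>{..<n}. X j x) = distr Q (\<Pi>\<^sub>M j\<in>{..<n}. borel) (\<lambda>x. \<lambda>j\<in>{..<n}. X' j x)"
proof -
  define J where "J = {..<n} \<times> (Basis :: 'c set)"
  have J: "finite J" by (simp add: J_def)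
  define Y where "Y p x = X (fst p) x \<bullet> snd p" for p x
  define Y' where "Y' p x = X' (fst p) x \<bullet> snd p" for p x
  define R where "R y = (\<lambda>j\<in>{..<n}. \<Sum>b\<in>Basis. y (j, b) *\<^sub>R b)" for y :: "nat \<times> 'c \<Rightarrow> real"
  have mY: "j \<in> J \<Longrightarrow> Y j \<in> borel_measurable P" for j
    unfolding Y_def J_def using X(1) by (auto intro!: borel_measurable_inner)
  have mY': "j \<in> J \<Longrightarrow> Y' j \<in> borel_measurable Q" for j
    unfolding Y'_def J_def using X(2) by (auto intro!: borel_measurable_inner)
  have e: "(\<Sum>p\<in>J. t p * (x (fst p) \<bullet> snd p)) = (\<Sum>j<n. (\<Sum>b\<in>Basis. t (j, b) *\<^sub>R b) \<bullet> x j)"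
    for t :: "nat \<times> 'c \<Rightarrow> real" and x :: "nat \<Rightarrow> 'c"
    unfolding J_def by (simp add: sum.cartesian_product' inner_sum_left inner_commute[of "x _"])
  have eq: "distr P (\<Pi>\<^sub>M j\<in>J. borel) (\<lambda>x. \<lambda>j\<in>J. Y j x) = distr Q (\<Pi>\<^sub>M j\<in>J. borel) (\<lambda>x. \<lambda>j\<in>J. Y' j x)"
  proof (rule distr_PiM_cf_eq[OF P Q J mY mY'])
    fix t :: "nat \<times> 'c \<Rightarrow> real"
    show "(CLINT x|P. iexp (\<Sum>j\<in>J. t j * Y j x)) = (CLINT x|Q. iexp (\<Sum>j\<in>J. t j * Y' j x))"
      using cf[of "\<lambda>j. \<Sum>b\<in>Basis. t (j, b) *\<^sub>R b"]
      unfolding Y_def Y'_def e[of t "\<lambda>j. X j x" for x] e[of t "\<lambda>j. X' j x" for x] .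
  qed
  have R[measurable]: "R \<in> measurable (\<Pi>\<^sub>M j\<in>J. borel) (\<Pi>\<^sub>M j\<in>{..<n}. borel)"
    unfolding R_def
    by (intro measurable_restrict borel_measurable_sum borel_measurable_scaleR measurable_component_singleton)
      (auto simp: J_def)
  have mP[measurable]: "(\<lambda>x. \<lambda>j\<in>J. Y j x) \<in> measurable P (\<Pi>\<^sub>M j\<in>J. borel)"
    by (rule measurable_restrict) (use mY in auto)
  have mQ[measurable]: "(\<lambda>x. \<lambda>j\<in>J. Y' j x) \<in> measurable Q (\<Pi>\<^sub>M j\<in>J. borel)"
    by (rule measurable_restrict) (use mY' in auto)
  have 1: "R (\<lambda>j\<in>J. Y j x) = (\<lambda>j\<in>{..<n}. X j x)" for x
    by (auto simp: R_def Y_def J_def euclidean_representation)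
  have 2: "R (\<lambda>j\<in>J. Y' j x) = (\<lambda>j\<in>{..<n}. X' j x)" for x
    by (auto simp: R_def Y'_def J_def euclidean_representation)
  show ?thesis
    using arg_cong[OF eq, of "\<lambda>D. distr D (\<Pi>\<^sub>M j\<in>{..<n}. borel) R"]
    by (simp add: distr_distr comp_def 1 2)
qed

section \<open>Spectral measures and the additivity condition\<close>

text \<open>The quadratic Taylor remainder of \<open>g\<close> is uniform, so it can be integrated:
  the difference quotient differs from the claimed derivative by at most
  \<open>Cm * \<bar>y - x\<bar>\<close>. The form g(a + x b) is what a function of a linear form
  becomes when one real coordinate varies.\<close>

lemma has_vector_derivative_integral_quadratic:
  fixes w :: "'s \<Rightarrow> 'b::{banach,second_countable_topology}" and g g' :: "real \<Rightarrow> real"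
  assumes G: "finite_measure G"
    and [measurable]: "a \<in> borel_measurable G" "b \<in> borel_measurable G" "w \<in> borel_measurable G"
      "g \<in> borel_measurable borel" "g' \<in> borel_measurable borel"
    and b: "\<And>s. s \<in> space G \<Longrightarrow> \<bar>b s\<bar> \<le> 1" and w: "\<And>s. s \<in> space G \<Longrightarrow> norm (w s) \<le> C"
    and g1: "\<And>u. \<bar>g u\<bar> \<le> 1" "\<And>u. \<bar>g' u\<bar> \<le> 1"
    and g: "\<And>u v. \<bar>g (u + v) - g u - v * g' u\<bar> \<le> v\<^sup>2"
  shows "((\<lambda>x. LINT s|G. g (a s + x * b s) *\<^sub>R w s) has_vector_derivative
           (LINT s|G. (b s * g' (a s + x * b s)) *\<^sub>R w s)) (at x)"
proof -
  interpret finite_measure G by fact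
  have int1: "integrable G (\<lambda>s. g (a s + x * b s) *\<^sub>R w s)" for x
  proof (rule integrable_const_bound[where B=C])
    show "AE s in G. norm (g (a s + x * b s) *\<^sub>R w s) \<le> C"
      using mult_mono[OF g1(1) w] by (intro AE_I2) (simp add: order_trans[OF norm_ge_zero w])
  qed measurable
  have int2: "integrable G (\<lambda>s. (b s * g' (a s + x * b s)) *\<^sub>R w s)" for x
  proof (rule integrable_const_bound[where B=C])
    show "AE s in G. norm ((b s * g' (a s + x * b s)) *\<^sub>R w s) \<le> C"
    proof (intro AE_I2)
      fix s assume s: "s \<in> space G"
      have "\<bar>b s\<bar> * \<bar>g' (a s + x * b s)\<bar> \<le> 1 * 1" by (intro mult_mono b g1 s) auto
      then have "\<bar>b s\<bar> * \<bar>g' (a s + x * b s)\<bar> * norm (w s) \<le> 1 * C"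
        by (intro mult_mono w s) auto
      then show "norm ((b s * g' (a s + x * b s)) *\<^sub>R w s) \<le> C" by (simp add: abs_mult)
    qed
  qed measurable
  define Cm where "Cm = \<bar>C\<bar> * measure G (space G)"
  have Cm: "0 \<le> Cm" by (simp add: Cm_def)
  have est: "norm ((LINT s|G. g (a s + y * b s) *\<^sub>R w s) - (LINT s|G. g (a s + x * b s) *\<^sub>R w s)
     - (y - x) *\<^sub>R (LINT s|G. (b s * g' (a s + x * b s)) *\<^sub>R w s)) \<le> Cm * (y - x)\<^sup>2" for y
  proof -
    define R where "R s = (g (a s + y * b s) - g (a s + x * b s) - (y - x) * (b s * g' (a s + x * b s))) *\<^sub>R w s" for s
    have eq: "(LINT s|G. g (a s + y * b s) *\<^sub>R w s) - (LINT s|G. g (a s + x * b s) *\<^sub>R w s)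
       - (y - x) *\<^sub>R (LINT s|G. (b s * g' (a s + x * b s)) *\<^sub>R w s) = (LINT s|G. R s)"
      unfolding R_def using int1[of x] int1[of y] int2[of x]
      by (simp add: scaleR_left_diff_distrib flip: scaleR_scaleR)
    have "norm (R s) \<le> (y - x)\<^sup>2 * \<bar>C\<bar>" if s: "s \<in> space G" for s
    proof -
      have "\<bar>g (a s + y * b s) - g (a s + x * b s) - (y - x) * (b s * g' (a s + x * b s))\<bar> \<le> ((y - x) * b s)\<^sup>2"
        using g[of "a s + x * b s" "(y - x) * b s"] by (simp add: algebra_simps)
      also have "\<dots> \<le> (y - x)\<^sup>2 * 1"
        unfolding power_mult_distrib using b[OF s]
        by (intro mult_left_mono) (auto simp: abs_square_le_1)
      finally show ?thesis
        unfolding R_def norm_scaleR using w[OF s] by (intro mult_mono) auto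
    qed
    moreover have "integrable G R"
    proof -
      have "integrable G (\<lambda>s. g (a s + y * b s) *\<^sub>R w s - g (a s + x * b s) *\<^sub>R w s
          - (y - x) *\<^sub>R ((b s * g' (a s + x * b s)) *\<^sub>R w s))"
        by (intro Bochner_Integration.integrable_diff integrable_scaleR_right int1 int2)
      then show ?thesis by (simp add: R_def[abs_def] scaleR_left_diff_distrib)
    qed
    ultimately have "norm (LINT s|G. R s) \<le> (LINT s|G. (y - x)\<^sup>2 * \<bar>C\<bar>)"
      by (intro order_trans[OF integral_norm_bound integral_mono]) auto
    then show ?thesis unfolding eq by (simp add: Cm_def mult_ac)
  qed
  show ?thesis
    unfolding has_vector_derivative_def has_derivative_within
  proof (intro conjI bounded_linear_scaleR_left)
    define D where "D = (LINT s|G. (b s * g' (a s + x * b s)) *\<^sub>R w s)"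
    show "((\<lambda>y. (1 / norm (y - x)) *\<^sub>R ((LINT s|G. g (a s + y * b s) *\<^sub>R w s) - ((LINT s|G. g (a s + x * b s) *\<^sub>R w s)
       + (y - x) *\<^sub>R (LINT s|G. (b s * g' (a s + x * b s)) *\<^sub>R w s)))) \<longlongrightarrow> 0) (at x)"
    proof (rule Lim_null_comparison)
      show "\<forall>\<^sub>F y in at x. norm ((1 / norm (y - x)) *\<^sub>R ((LINT s|G. g (a s + y * b s) *\<^sub>R w s) - ((LINT s|G. g (a s + x * b s) *\<^sub>R w s)
       + (y - x) *\<^sub>R (LINT s|G. (b s * g' (a s + x * b s)) *\<^sub>R w s)))) \<le> Cm * \<bar>y - x\<bar>"
        unfolding eventually_at_filter
      proof (intro always_eventually allI impI)
        fix y assume "y \<noteq> x"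
        then show "norm ((1 / norm (y - x)) *\<^sub>R ((LINT s|G. g (a s + y * b s) *\<^sub>R w s) - ((LINT s|G. g (a s + x * b s) *\<^sub>R w s)
       + (y - x) *\<^sub>R (LINT s|G. (b s * g' (a s + x * b s)) *\<^sub>R w s)))) \<le> Cm * \<bar>y - x\<bar>"
          using est[of y] by (simp add: divide_simps diff_diff_eq power2_eq_square mult_ac flip: abs_mult)
      qed
      have "((\<lambda>y. Cm * \<bar>y - x\<bar>) \<longlongrightarrow> Cm * \<bar>x - x\<bar>) (at x)" by (intro tendsto_intros)
      then show "((\<lambda>y. Cm * \<bar>y - x\<bar>) \<longlongrightarrow> 0) (at x)" by simp
    qed
  qed
qed

text \<open>The two bounds are the real and imaginary parts of one estimate: the first-order
  remainder of \<open>iexp\<close> at v is at most v^2/2, and the factor \<open>iexp u\<close> has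
  modulus 1.\<close>

lemma cos_sin_taylor_bound:
  fixes u v :: real
  shows "\<bar>cos (u + v) - cos u - v * - sin u\<bar> \<le> v\<^sup>2" "\<bar>sin (u + v) - sin u - v * cos u\<bar> \<le> v\<^sup>2"
proof -
  define z where "z = iexp (u + v) - iexp u - v * (\<i> * iexp u)"
  have "z = iexp u * (iexp v - (\<Sum>k\<le>1. (\<i> * v)^k / fact k))"
    by (simp add: z_def exp_add algebra_simps)
  then have "norm z \<le> \<bar>v\<bar>^2 / 2"
    using iexp_approx1[of v 1] by (simp add: norm_mult numeral_2_eq_2)
  then have "norm z \<le> v\<^sup>2" using norm_ge_zero[of z] zero_le_power2[of v] unfolding power2_abs by linarith
  moreover have "Re z = cos (u + v) - cos u - v * - sin u" "Im z = sin (u + v) - sin u - v * cos u"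
    by (simp_all add: z_def Re_exp Im_exp)
  ultimately show "\<bar>cos (u + v) - cos u - v * - sin u\<bar> \<le> v\<^sup>2" "\<bar>sin (u + v) - sin u - v * cos u\<bar> \<le> v\<^sup>2"
    using abs_Re_le_cmod[of z] abs_Im_le_cmod[of z] by auto
qed

section \<open>Finite measures on spheres and their symmetry\<close>

locale sphere_measure = finite_measure G for G :: "(nat \<Rightarrow> 'a::euclidean_space) measure" +
  fixes n :: nat
  assumes sets_G: "sets G = sets (sphere_space n)"
begin

lemma space_G: "space G = {s \<in> space (\<Pi>\<^sub>M i\<in>{..<n}. borel). (\<Sum>i<n. (norm (s i))\<^sup>2) = 1}"
  using sets_eq_imp_space_eq[OF sets_G] by (auto simp: sphere_space_def space_restrict_space)

lemma component_measurable[measurable]: "j < n \<Longrightarrow> (\<lambda>s. s j) \<in> borel_measurable G"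
  unfolding measurable_cong_sets[OF sets_G refl] sphere_space_def
  by (intro measurable_restrict_space1 measurable_component_singleton) simp

lemma norm_component_le: assumes "s \<in> space G" "j < n" shows "norm (s j) \<le> 1"
proof -
  have "(norm (s j))\<^sup>2 \<le> (\<Sum>i<n. (norm (s i))\<^sup>2)" using assms(2) by (intro member_le_sum) auto
  then show ?thesis using assms(1) by (simp add: space_G power_le_one_iff abs_square_le_1)
qed

lemma inner_measurable[measurable]: "(\<lambda>s. \<Sum>i<n. \<theta> i \<bullet> s i) \<in> borel_measurable G"
  by (intro borel_measurable_sum borel_measurable_inner) auto

text \<open>The densities \<open>1 + w\<close> and \<open>1 - w\<close> give finite measures with
  the same characteristic function, hence the same measure. Densities being unique almost
  everywhere, w = -w.\<close>

lemma AE_eq_0_if_cf_0: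
  fixes w :: "(nat \<Rightarrow> 'a) \<Rightarrow> real"
  assumes [measurable]: "w \<in> borel_measurable G" and w: "\<And>s. s \<in> space G \<Longrightarrow> \<bar>w s\<bar> \<le> 1"
    and 0: "\<And>\<theta>. (CLINT s|G. w s * iexp (\<Sum>i<n. \<theta> i \<bullet> s i)) = 0"
  shows "AE s in G. w s = 0"
proof -
  define D where "D c = density G (\<lambda>s. ennreal (1 + c * w s))" for c :: real
  have pos: "0 \<le> 1 + c * w s" if "c \<in> {1, -1}" "s \<in> space G" for c s
    using w[OF that(2)] that(1) by auto
  have iw: "integrable G (\<lambda>s. w s * iexp (\<Sum>i<n. \<theta> i \<bullet> s i))" for \<theta>
    by (rule integrable_const_bound[where B=1]) (use w in \<open>auto simp: norm_mult\<close>)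
  have i1: "integrable G (\<lambda>s. iexp (\<Sum>i<n. \<theta> i \<bullet> s i))" for \<theta>
    by (rule integrable_const_bound[where B=1]) (auto simp: norm_mult)
  have fin: "finite_measure (D c)" if c: "c \<in> {1, -1}" for c
  proof (rule finite_measureI)
    have "integrable G (\<lambda>s. 1 + c * w s)"
    proof (rule integrable_const_bound[where B=2])
      show "AE s in G. norm (1 + c * w s) \<le> 2"
      proof (intro AE_I2)
        fix s assume "s \<in> space G"
        then show "norm (1 + c * w s) \<le> 2" using w[of s] c by auto
      qed
    qed measurable
    then have "(\<integral>\<^sup>+s. ennreal (1 + c * w s) \<partial>G) < \<infinity>"
      using integrableD(2) by (simp add: less_top)
    then show "emeasure (D c) (space (D c)) \<noteq> \<infinity>"
      unfolding D_def by (simp add: emeasure_density cong: nn_integral_cong)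
  qed
  have cf: "(CLINT s|D c. iexp (\<Sum>i<n. \<theta> i \<bullet> s i)) = (CLINT s|G. iexp (\<Sum>i<n. \<theta> i \<bullet> s i))"
    if c: "c \<in> {1, -1}" for c \<theta>
  proof -
    have "(CLINT s|D c. iexp (\<Sum>i<n. \<theta> i \<bullet> s i)) =
      (CLINT s|G. iexp (\<Sum>i<n. \<theta> i \<bullet> s i) + c * (w s * iexp (\<Sum>i<n. \<theta> i \<bullet> s i)))"
      unfolding D_def
      by (subst integral_density) (use pos[OF c] in \<open>auto simp: scaleR_conv_of_real algebra_simps\<close>)
    also have "\<dots> = (CLINT s|G. iexp (\<Sum>i<n. \<theta> i \<bullet> s i))"
      using i1[of \<theta>] iw[of \<theta>] 0[of \<theta>] by simp
    finally show ?thesis .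
  qed
  have eq: "distr (D 1) (\<Pi>\<^sub>M j\<in>{..<n}. borel) (\<lambda>s. \<lambda>j\<in>{..<n}. s j) = distr (D (-1)) (\<Pi>\<^sub>M j\<in>{..<n}. borel) (\<lambda>s. \<lambda>j\<in>{..<n}. s j)"
    by (rule distr_PiM_cf_eq_euclidean) (auto simp: fin cf simp del: of_real_sum, auto simp: D_def)
  have m[measurable]: "(\<lambda>s. \<lambda>j\<in>{..<n}. s j) \<in> measurable (D c) (\<Pi>\<^sub>M j\<in>{..<n}. borel)" for c
    by (rule measurable_restrict) (simp add: D_def)
  have "D 1 = D (-1)"
  proof (rule measure_eqI)
    fix A assume "A \<in> sets (D 1)"
    then have "A \<in> sets (sphere_space n)" by (simp add: D_def sets_G)
    then obtain B where B: "B \<in> sets (\<Pi>\<^sub>M i\<in>{..<n}. borel)" "A = {s. (\<Sum>i<n. (norm (s i))\<^sup>2) = 1} \<inter> B"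
      by (auto simp: sphere_space_def sets_restrict_space)
    have sp: "space (D c) = space G" for c by (simp add: D_def)
    \<comment> \<open>Points of the sphere space are extensional, so restriction to
      \<open>{..<n}\<close> is the identity there. This brings the equality of the image measures
      back to the measures on the sphere.\<close>
    have "(\<lambda>s. \<lambda>j\<in>{..<n}. s j) -` B \<inter> space (D c) = A" for c
      unfolding sp
    proof (rule set_eqI)
      fix s
      have "restrict s {..<n} = s" if "s \<in> space G"
        using that by (auto simp: space_G space_PiM PiE_def extensional_restrict)
      moreover have "s \<in> space (\<Pi>\<^sub>M i\<in>{..<n}. borel)" if "s \<in> B"
        using that sets.sets_into_space[OF B(1)] by auto
      ultimately show "s \<in> (\<lambda>s. \<lambda>j\<in>{..<n}. s j) -` B \<inter> space G \<longleftrightarrow> s \<in> A"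
        using B(2) by (auto simp: space_G)
    qed
    then show "emeasure (D 1) A = emeasure (D (-1)) A"
      using arg_cong[OF eq, of "\<lambda>N. emeasure N B"] B(1) by (simp add: emeasure_distr)
  qed (simp add: D_def)
  then have "AE s in G. ennreal (1 + 1 * w s) = ennreal (1 + (-1) * w s)"
    unfolding D_def by (subst (asm) density_unique_iff) auto
  then show ?thesis
  proof eventually_elim
    case (elim s)
    then show ?case
      by (cases "1 + w s \<ge> 0"; cases "1 - w s \<ge> 0") (auto simp: ennreal_neg ennreal_eq_0_iff)
  qed
qed

lemma neg_measurable: "(\<lambda>s. \<lambda>i\<in>{..<n}. - s i) \<in> measurable G G"
proof -
  have "(\<lambda>s. \<lambda>i\<in>{..<n}. - s i) \<in> measurable G (restrict_space (\<Pi>\<^sub>M i\<in>{..<n}. borel) {s. (\<Sum>i<n. (norm (s i))\<^sup>2) = 1})"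
  proof (rule measurable_restrict_space2)
    show "(\<lambda>s. \<lambda>i\<in>{..<n}. - s i) \<in> measurable G (\<Pi>\<^sub>M i\<in>{..<n}. borel)"
      by (rule measurable_restrict) auto
  qed (auto simp: space_G)
  then show ?thesis
    using measurable_cong_sets[OF refl sets_G, of G] by (simp add: sphere_space_def)
qed

lemma sum_upd: 
  assumes "j < n"
  shows "(\<Sum>i<n. (\<theta>(j := x)) i \<bullet> s i) = (\<Sum>i\<in>{..<n}-{j}. \<theta> i \<bullet> s i) + x \<bullet> s j"
  using assms by (subst sum.remove[of _ j]) auto

end

locale symmetric_sphere_measure = sphere_measure G n for G :: "(nat \<Rightarrow> 'a::euclidean_space) measure" and n +
  assumes symmetric: "distr G G (\<lambda>s. \<lambda>i\<in>{..<n}. - s i) = G"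
begin

lemma integral_odd:
  fixes f :: "_ \<Rightarrow> 'b::{banach,second_countable_topology}"
  assumes [measurable]: "f \<in> borel_measurable G"
    and odd: "\<And>s. s \<in> space G \<Longrightarrow> f (\<lambda>i\<in>{..<n}. - s i) = - f s"
  shows "(LINT s|G. f s) = 0"
proof -
  have "(LINT s|G. f s) = (LINT s|distr G G (\<lambda>s. \<lambda>i\<in>{..<n}. - s i). f s)" by (simp add: symmetric)
  also have "\<dots> = (LINT s|G. f (\<lambda>i\<in>{..<n}. - s i))"
    by (rule integral_distr[OF neg_measurable]) simp
  also have "\<dots> = (LINT s|G. - f s)" by (rule Bochner_Integration.integral_cong) (auto simp: odd)
  finally have "(LINT s|G. f s) = - (LINT s|G. f s)" by simp
  then have "(LINT s|G. f s) + (LINT s|G. f s) = 0" by (simp only: eq_neg_iff_add_eq_0)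
  then have "2 *\<^sub>R (LINT s|G. f s) = 0" by (simp only: scaleR_2)
  then show ?thesis by simp
qed

text \<open>For an odd weight the cosine half of the Fourier transform vanishes by symmetry of
  \<open>G\<close>, so the sine half alone decides.\<close>

lemma AE_eq_0_if_sin_0:
  fixes w :: "(nat \<Rightarrow> 'a) \<Rightarrow> real"
  assumes [measurable]: "w \<in> borel_measurable G" and w: "\<And>s. s \<in> space G \<Longrightarrow> \<bar>w s\<bar> \<le> 1"
    and odd: "\<And>s. s \<in> space G \<Longrightarrow> w (\<lambda>i\<in>{..<n}. - s i) = - w s"
    and 0: "\<And>\<theta>. (LINT s|G. sin (\<Sum>i<n. \<theta> i \<bullet> s i) * w s) = 0"
  shows "AE s in G. w s = 0"
proof (rule AE_eq_0_if_cf_0)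
  fix \<theta> :: "nat \<Rightarrow> 'a"
  have c: "(LINT s|G. cos (\<Sum>i<n. \<theta> i \<bullet> s i) * w s) = 0"
    by (rule integral_odd) (auto simp: odd sum_negf)
  have i: "integrable G (\<lambda>s. w s * iexp (\<Sum>i<n. \<theta> i \<bullet> s i))"
    by (rule integrable_const_bound[where B=1]) (use w in \<open>auto simp: norm_mult\<close>)
  have "Re (CLINT s|G. w s * iexp (\<Sum>i<n. \<theta> i \<bullet> s i)) = (LINT s|G. cos (\<Sum>i<n. \<theta> i \<bullet> s i) * w s)"
    by (subst integral_Re[OF i, symmetric]) (simp add: Re_exp mult.commute del: of_real_sum)
  moreover have "Im (CLINT s|G. w s * iexp (\<Sum>i<n. \<theta> i \<bullet> s i)) = (LINT s|G. sin (\<Sum>i<n. \<theta> i \<bullet> s i) * w s)"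
    by (subst integral_Im[OF i, symmetric]) (simp add: Im_exp mult.commute del: of_real_sum)
  ultimately show "(CLINT s|G. w s * iexp (\<Sum>i<n. \<theta> i \<bullet> s i)) = 0"
    using c 0 by (simp add: complex_eq_iff)
qed (use w in auto)

end

lemma partial_real_integral:
  fixes G :: "(nat \<Rightarrow> real) measure"
  assumes "sphere_measure G n" and j: "j < n"
    and [measurable]: "w \<in> borel_measurable G" and w: "\<And>s. s \<in> space G \<Longrightarrow> \<bar>w s\<bar> \<le> 1"
  shows "partial_real j (\<lambda>\<theta>. LINT s|G. cos (\<Sum>i<n. \<theta> i * s i) * w s) = (\<lambda>\<theta>. LINT s|G. sin (\<Sum>i<n. \<theta> i * s i) * (- s j * w s))"
    "partial_real j (\<lambda>\<theta>. LINT s|G. sin (\<Sum>i<n. \<theta> i * s i) * w s) = (\<lambda>\<theta>. LINT s|G. cos (\<Sum>i<n. \<theta> i * s i) * (s j * w s))"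
proof -
  interpret sphere_measure G n by fact
  have up: "(\<Sum>i<n. (\<theta>(j := x)) i * s i) = (\<Sum>i\<in>{..<n}-{j}. \<theta> i * s i) + x * s j" for \<theta> x and s :: "nat \<Rightarrow> real"
    using sum_upd[OF j, of \<theta> x s] by (simp only: inner_real_def)
  have up': "(\<Sum>i<n. \<theta> i * s i) = (\<Sum>i\<in>{..<n}-{j}. \<theta> i * s i) + \<theta> j * s j" for \<theta> and s :: "nat \<Rightarrow> real"
    using up[of \<theta> "\<theta> j" s] by simp
  have b: "\<bar>s j\<bar> \<le> 1" if "s \<in> space G" for s using norm_component_le[OF that j] by simp
  have m[measurable]: "(\<lambda>s. \<Sum>i\<in>{..<n}-{j}. \<theta> i * s i) \<in> borel_measurable G" for \<theta>
    by (intro borel_measurable_sum borel_measurable_times) auto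
  have [measurable]: "(\<lambda>s. s j) \<in> borel_measurable G" using j by simp
  show "partial_real j (\<lambda>\<theta>. LINT s|G. cos (\<Sum>i<n. \<theta> i * s i) * w s) = (\<lambda>\<theta>. LINT s|G. sin (\<Sum>i<n. \<theta> i * s i) * (- s j * w s))"
  proof
    fix \<theta>
    have "((\<lambda>x. LINT s|G. cos ((\<Sum>i\<in>{..<n}-{j}. \<theta> i * s i) + x * s j) *\<^sub>R w s) has_vector_derivative
       (LINT s|G. (s j * - sin ((\<Sum>i\<in>{..<n}-{j}. \<theta> i * s i) + \<theta> j * s j)) *\<^sub>R w s)) (at (\<theta> j))"
      by (rule has_vector_derivative_integral_quadratic[where C=1])
        (use cos_sin_taylor_bound w b in \<open>auto simp: finite_measure_axioms\<close>)
    then show "partial_real j (\<lambda>\<theta>. LINT s|G. cos (\<Sum>i<n. \<theta> i * s i) * w s) \<theta> = (LINT s|G. sin (\<Sum>i<n. \<theta> i * s i) * (- s j * w s))"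
      unfolding partial_real_def up up'[of \<theta>]
      by (intro DERIV_imp_deriv) (simp add: has_real_derivative_iff_has_vector_derivative mult_ac)
  qed
  show "partial_real j (\<lambda>\<theta>. LINT s|G. sin (\<Sum>i<n. \<theta> i * s i) * w s) = (\<lambda>\<theta>. LINT s|G. cos (\<Sum>i<n. \<theta> i * s i) * (s j * w s))"
  proof
    fix \<theta>
    have "((\<lambda>x. LINT s|G. sin ((\<Sum>i\<in>{..<n}-{j}. \<theta> i * s i) + x * s j) *\<^sub>R w s) has_vector_derivative
       (LINT s|G. (s j * cos ((\<Sum>i\<in>{..<n}-{j}. \<theta> i * s i) + \<theta> j * s j)) *\<^sub>R w s)) (at (\<theta> j))"
      by (rule has_vector_derivative_integral_quadratic[where C=1])
        (use cos_sin_taylor_bound w b in \<open>auto simp: finite_measure_axioms\<close>)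
    then show "partial_real j (\<lambda>\<theta>. LINT s|G. sin (\<Sum>i<n. \<theta> i * s i) * w s) \<theta> = (LINT s|G. cos (\<Sum>i<n. \<theta> i * s i) * (s j * w s))"
      unfolding partial_real_def up up'[of \<theta>]
      by (intro DERIV_imp_deriv) (simp add: has_real_derivative_iff_has_vector_derivative mult_ac)
  qed
qed

text \<open>The two real partial derivatives bring down \<open>Re (s j)\<close> and
  \<open>Im (s j)\<close>, and the factor \<i> in \<open>partial_bar\<close> joins them into the
  single complex factor \<open>s j\<close>. Hence \<open>partial_bar\<close> acts on these
  transforms as a real partial derivative does in the real case.\<close>

lemma partial_bar_integral:
  fixes G :: "(nat \<Rightarrow> complex) measure"
  assumes "sphere_measure G n" and j: "j < n"
    and [measurable]: "w \<in> borel_measurable G" and w: "\<And>s. s \<in> space G \<Longrightarrow> norm (w s) \<le> 1"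
  shows "partial_bar j (\<lambda>\<theta>. LINT s|G. cos (\<Sum>i<n. \<theta> i \<bullet> s i) *\<^sub>R w s) = (\<lambda>\<theta>. LINT s|G. sin (\<Sum>i<n. \<theta> i \<bullet> s i) *\<^sub>R (- s j * w s))"
    "partial_bar j (\<lambda>\<theta>. LINT s|G. sin (\<Sum>i<n. \<theta> i \<bullet> s i) *\<^sub>R w s) = (\<lambda>\<theta>. LINT s|G. cos (\<Sum>i<n. \<theta> i \<bullet> s i) *\<^sub>R (s j * w s))"
proof -
  interpret sphere_measure G n by fact
  define A where "A \<theta> s = (\<Sum>i\<in>{..<n}-{j}. \<theta> i \<bullet> s i)" for \<theta> s :: "nat \<Rightarrow> complex"
  have up: "(\<Sum>i<n. (\<theta>(j := Complex x y)) i \<bullet> s i) = A \<theta> s + (x * Re (s j) + y * Im (s j))" for \<theta> x y and s :: "nat \<Rightarrow> complex"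
    using sum_upd[OF j, of \<theta> "Complex x y" s] by (simp add: A_def inner_complex_def)
  have up': "(\<Sum>i<n. \<theta> i \<bullet> s i) = A \<theta> s + (Re (\<theta> j) * Re (s j) + Im (\<theta> j) * Im (s j))" for \<theta> and s :: "nat \<Rightarrow> complex"
    using up[of \<theta> "Re (\<theta> j)" "Im (\<theta> j)" s] by simp
  have b: "\<bar>Re (s j)\<bar> \<le> 1" "\<bar>Im (s j)\<bar> \<le> 1" if "s \<in> space G" for s
    using norm_component_le[OF that j] abs_Re_le_cmod[of "s j"] abs_Im_le_cmod[of "s j"] by linarith+
  have m[measurable]: "A \<theta> \<in> borel_measurable G" for \<theta>
    unfolding A_def by (intro borel_measurable_sum borel_measurable_inner) auto
  have [measurable]: "(\<lambda>s. s j) \<in> borel_measurable G" using j by simp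
  have int: "integrable G (\<lambda>s. (v s * u s) *\<^sub>R w s)"
    if [measurable]: "u \<in> borel_measurable G" "v \<in> borel_measurable G"
    and "\<And>s. s \<in> space G \<Longrightarrow> \<bar>u s\<bar> \<le> 1" "\<And>s. s \<in> space G \<Longrightarrow> \<bar>v s\<bar> \<le> 1" for u v
  proof (rule integrable_const_bound[where B="1*1*1"])
    show "AE s in G. norm ((v s * u s) *\<^sub>R w s) \<le> 1 * 1 * 1"
      unfolding norm_scaleR real_norm_def abs_mult by (intro AE_I2 mult_mono that w) auto
  qed measurable
  have main: "partial_bar j (\<lambda>\<theta>. LINT s|G. g (\<Sum>i<n. \<theta> i \<bullet> s i) *\<^sub>R w s) \<theta> = (LINT s|G. g' (\<Sum>i<n. \<theta> i \<bullet> s i) *\<^sub>R (s j * w s))"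
    if [measurable]: "g \<in> borel_measurable borel" "g' \<in> borel_measurable borel"
      and g1: "\<And>u. \<bar>g u\<bar> \<le> 1" "\<And>u. \<bar>g' u\<bar> \<le> 1"
      and g: "\<And>u v. \<bar>g (u + v) - g u - v * g' u\<bar> \<le> v\<^sup>2" for g g' :: "real \<Rightarrow> real" and \<theta>
  proof -
    define B where "B s = A \<theta> s + (Re (\<theta> j) * Re (s j) + Im (\<theta> j) * Im (s j))" for s
    have [measurable]: "B \<in> borel_measurable G" unfolding B_def by measurable
    have 1: "((\<lambda>x. LINT s|G. g ((A \<theta> s + Im (\<theta> j) * Im (s j)) + x * Re (s j)) *\<^sub>R w s) has_vector_derivative
       (LINT s|G. (Re (s j) * g' ((A \<theta> s + Im (\<theta> j) * Im (s j)) + Re (\<theta> j) * Re (s j))) *\<^sub>R w s)) (at (Re (\<theta> j)))"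
      by (rule has_vector_derivative_integral_quadratic[where C=1])
        (use that w b in \<open>auto simp: finite_measure_axioms\<close>)
    have 2: "((\<lambda>x. LINT s|G. g ((A \<theta> s + Re (\<theta> j) * Re (s j)) + x * Im (s j)) *\<^sub>R w s) has_vector_derivative
       (LINT s|G. (Im (s j) * g' ((A \<theta> s + Re (\<theta> j) * Re (s j)) + Im (\<theta> j) * Im (s j))) *\<^sub>R w s)) (at (Im (\<theta> j)))"
      by (rule has_vector_derivative_integral_quadratic[where C=1])
        (use that w b in \<open>auto simp: finite_measure_axioms\<close>)
    have "partial_bar j (\<lambda>\<theta>. LINT s|G. g (\<Sum>i<n. \<theta> i \<bullet> s i) *\<^sub>R w s) \<theta>
      = (LINT s|G. (Re (s j) * g' (B s)) *\<^sub>R w s) + \<i> * (LINT s|G. (Im (s j) * g' (B s)) *\<^sub>R w s)"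
      unfolding partial_bar_def up
      using vector_derivative_at[OF 1] vector_derivative_at[OF 2] by (simp add: B_def add_ac)
    also have "\<dots> = (LINT s|G. (Re (s j) * g' (B s)) *\<^sub>R w s + \<i> * ((Im (s j) * g' (B s)) *\<^sub>R w s))"
    proof -
      have m: "(\<lambda>s. g' (B s)) \<in> borel_measurable G" "(\<lambda>s. Re (s j)) \<in> borel_measurable G"
        "(\<lambda>s. Im (s j)) \<in> borel_measurable G" by measurable
      have "integrable G (\<lambda>s. (Re (s j) * g' (B s)) *\<^sub>R w s)" "integrable G (\<lambda>s. (Im (s j) * g' (B s)) *\<^sub>R w s)"
        by (rule int[OF m(1) m(2)] int[OF m(1) m(3)]; simp add: b g1)+
      then show ?thesis
        by (subst Bochner_Integration.integral_add) (simp_all only: integral_mult_right_zero integrable_mult_right)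
    qed
    also have "\<dots> = (LINT s|G. g' (B s) *\<^sub>R (s j * w s))"
    proof (rule Bochner_Integration.integral_cong[OF refl])
      fix s :: "nat \<Rightarrow> complex"
      show "(Re (s j) * g' (B s)) *\<^sub>R w s + \<i> * ((Im (s j) * g' (B s)) *\<^sub>R w s) = g' (B s) *\<^sub>R (s j * w s)"
        by (simp add: complex_eq_iff algebra_simps)
    qed
    finally show ?thesis by (simp add: up' B_def)
  qed
  show "partial_bar j (\<lambda>\<theta>. LINT s|G. cos (\<Sum>i<n. \<theta> i \<bullet> s i) *\<^sub>R w s) = (\<lambda>\<theta>. LINT s|G. sin (\<Sum>i<n. \<theta> i \<bullet> s i) *\<^sub>R (- s j * w s))"
    using main[of cos "\<lambda>u. - sin u"] cos_sin_taylor_bound by auto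
  show "partial_bar j (\<lambda>\<theta>. LINT s|G. sin (\<Sum>i<n. \<theta> i \<bullet> s i) *\<^sub>R w s) = (\<lambda>\<theta>. LINT s|G. cos (\<Sum>i<n. \<theta> i \<bullet> s i) *\<^sub>R (s j * w s))"
    using main[of sin cos] cos_sin_taylor_bound by auto
qed

text \<open>Differentiating twice in \<open>i\<close> and once in \<open>j\<close> gives the sine
  transform of the odd weight s_i^2 s_j. Repeating \<open>i\<close> loses nothing, since s_i^2 s_j =
  0 already forces s_i s_j = 0.\<close>

lemma AE_product_0_real:
  fixes G :: "(nat \<Rightarrow> real) measure"
  assumes "symmetric_sphere_measure G n" and j: "j < n" "i < n"
    and 0: "\<And>\<theta>. partial_real i (partial_real i (partial_real j (phi_real n G))) \<theta> = 0"
  shows "AE s in G. s i * s j = 0"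
proof -
  interpret symmetric_sphere_measure G n by fact
  have [measurable]: "(\<lambda>s. s j) \<in> borel_measurable G" "(\<lambda>s. s i) \<in> borel_measurable G" using j by simp_all
  have b: "\<bar>s j\<bar> \<le> 1" "\<bar>s i\<bar> \<le> 1" if "s \<in> space G" for s
    using norm_component_le[OF that] j by auto
  have b2: "\<bar>s i\<bar> * \<bar>s j\<bar> \<le> 1" if "s \<in> space G" for s
    using mult_mono[OF b(2)[OF that] b(1)[OF that]] by simp
  have b3: "\<bar>s i\<bar> * (\<bar>s i\<bar> * \<bar>s j\<bar>) \<le> 1" if "s \<in> space G" for s
    using mult_mono[OF b(2)[OF that] b2[OF that]] by simp
  have sm: "sphere_measure G n" by unfold_locales
  \<comment> \<open>The weight 1 puts \<open>phi_real\<close> into the shape of the derivative rule,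
    which is then applied three times and leads from cos through sin and cos to sin.\<close>
  have "phi_real n G = (\<lambda>\<theta>. LINT s|G. cos (\<Sum>i<n. \<theta> i * s i) * 1)" by (simp add: phi_real_def fun_eq_iff)
  then have "partial_real j (phi_real n G) = (\<lambda>\<theta>. LINT s|G. sin (\<Sum>i<n. \<theta> i * s i) * (- s j * 1))"
    by (simp only:) (rule partial_real_integral[OF sm j(1)], auto)
  then have "partial_real i (partial_real j (phi_real n G)) = (\<lambda>\<theta>. LINT s|G. cos (\<Sum>i<n. \<theta> i * s i) * (s i * (- s j * 1)))"
    by (simp only:) (rule partial_real_integral[OF sm j(2)], auto simp: b)
  then have "partial_real i (partial_real i (partial_real j (phi_real n G))) = (\<lambda>\<theta>. LINT s|G. sin (\<Sum>i<n. \<theta> i * s i) * (- s i * (s i * (- s j * 1))))"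
    by (simp only:) (rule partial_real_integral[OF sm j(2)], auto simp: b2 abs_mult)
  then have z: "(LINT s|G. sin (\<Sum>i<n. \<theta> i * s i) * (s i * (s i * s j))) = 0" for \<theta>
    using 0[of \<theta>] by simp
  have "AE s in G. s i * (s i * s j) = 0"
    by (rule AE_eq_0_if_sin_0) (use j z in \<open>auto simp: b3 abs_mult\<close>)
  then show ?thesis by eventually_elim simp
qed

text \<open>The weight s_i^2 s_j is now complex. Its real and imaginary parts are odd and bounded by
  1, and each is shown to vanish separately.\<close>

lemma AE_product_0_complex:
  fixes G :: "(nat \<Rightarrow> complex) measure"
  assumes "symmetric_sphere_measure G n" and j: "j < n" "i < n"
    and 0: "\<And>\<theta>. partial_bar i (partial_bar i (partial_bar j (phi_complex n G))) \<theta> = 0"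
  shows "AE s in G. s i * s j = 0"
proof -
  interpret symmetric_sphere_measure G n by fact
  have [measurable]: "(\<lambda>s. s j) \<in> borel_measurable G" "(\<lambda>s. s i) \<in> borel_measurable G" using j by simp_all
  have b: "norm (s j) \<le> 1" "norm (s i) \<le> 1" if "s \<in> space G" for s
    using norm_component_le[OF that] j by auto
  have b2: "norm (s i) * norm (s j) \<le> 1" if "s \<in> space G" for s
    using mult_mono[OF b(2)[OF that] b(1)[OF that]] by simp
  have b3: "norm (s i * (s i * s j)) \<le> 1" if "s \<in> space G" for s
    using mult_mono[OF b(2)[OF that] b2[OF that]] by (simp add: norm_mult)
  have sm: "sphere_measure G n" by unfold_locales
  have "phi_complex n G = (\<lambda>\<theta>. LINT s|G. cos (\<Sum>i<n. \<theta> i \<bullet> s i) *\<^sub>R 1)"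
    by (simp add: phi_complex_def fun_eq_iff inner_complex_def scaleR_conv_of_real
      flip: integral_complex_of_real)
  then have "partial_bar j (phi_complex n G) = (\<lambda>\<theta>. LINT s|G. sin (\<Sum>i<n. \<theta> i \<bullet> s i) *\<^sub>R (- s j * 1))"
    by (simp only:) (rule partial_bar_integral[OF sm j(1)], auto)
  then have "partial_bar i (partial_bar j (phi_complex n G)) = (\<lambda>\<theta>. LINT s|G. cos (\<Sum>i<n. \<theta> i \<bullet> s i) *\<^sub>R (s i * (- s j * 1)))"
    by (simp only:) (rule partial_bar_integral[OF sm j(2)], auto simp: b)
  then have "partial_bar i (partial_bar i (partial_bar j (phi_complex n G))) = (\<lambda>\<theta>. LINT s|G. sin (\<Sum>i<n. \<theta> i \<bullet> s i) *\<^sub>R (- s i * (s i * (- s j * 1))))"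
    by (simp only:) (rule partial_bar_integral[OF sm j(2)], auto simp: b2 norm_mult)
  then have z: "(LINT s|G. sin (\<Sum>i<n. \<theta> i \<bullet> s i) *\<^sub>R (s i * (s i * s j))) = 0" for \<theta>
    using 0[of \<theta>] by simp
  have int: "integrable G (\<lambda>s. sin (\<Sum>i<n. \<theta> i \<bullet> s i) *\<^sub>R (s i * (s i * s j)))" for \<theta>
  proof (rule integrable_const_bound[where B="1*1"])
    show "AE s in G. norm (sin (\<Sum>i<n. \<theta> i \<bullet> s i) *\<^sub>R (s i * (s i * s j))) \<le> 1 * 1"
      unfolding norm_scaleR real_norm_def by (intro AE_I2 mult_mono b3) auto
  qed measurable
  have re: "(LINT s|G. sin (\<Sum>i<n. \<theta> i \<bullet> s i) * Re (s i * (s i * s j))) = 0" for \<theta>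
    using integral_Re[OF int[of \<theta>]] z[of \<theta>] by simp
  have im: "(LINT s|G. sin (\<Sum>i<n. \<theta> i \<bullet> s i) * Im (s i * (s i * s j))) = 0" for \<theta>
    using integral_Im[OF int[of \<theta>]] z[of \<theta>] by simp
  have m: "(\<lambda>s. Re (s i * (s i * s j))) \<in> borel_measurable G" "(\<lambda>s. Im (s i * (s i * s j))) \<in> borel_measurable G"
    by measurable
  have "AE s in G. Re (s i * (s i * s j)) = 0"
    by (rule AE_eq_0_if_sin_0[OF m(1)])
      (use j re in \<open>auto intro: order_trans[OF abs_Re_le_cmod b3] simp del: times_complex.sel\<close>)
  moreover have "AE s in G. Im (s i * (s i * s j)) = 0"
    by (rule AE_eq_0_if_sin_0[OF m(2)])
      (use j im in \<open>auto intro: order_trans[OF abs_Im_le_cmod b3] simp del: times_complex.sel\<close>)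
  ultimately show ?thesis
  proof eventually_elim
    case (elim s)
    then have "s i * (s i * s j) = 0" by (simp only: complex_eq_iff) simp
    then show ?case by simp
  qed
qed

section \<open>Covariation as a derivative of the characteristic exponent\<close>

lemma powr_add_le:
  fixes a b \<alpha> :: real
  assumes "0 \<le> a" "0 \<le> b" "0 < \<alpha>"
  shows "(a + b) powr \<alpha> \<le> 2 powr \<alpha> * (a powr \<alpha> + b powr \<alpha>)"
proof -
  have "(a + b) powr \<alpha> \<le> (2 * max a b) powr \<alpha>"
    using assms by (intro powr_mono2) auto
  also have "\<dots> = 2 powr \<alpha> * max a b powr \<alpha>" using assms by (simp add: powr_mult)
  also have "\<dots> \<le> 2 powr \<alpha> * (a powr \<alpha> + b powr \<alpha>)"
    by (intro mult_left_mono) (auto simp: max_def)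
  finally show ?thesis .
qed

text \<open>Mean value theorem for the power function, with the derivative bounded by its value at
  the larger end point.\<close>

lemma powr_diff_le:
  fixes u v \<alpha> :: real
  assumes "1 < \<alpha>" "0 \<le> u" "0 \<le> v"
  shows "\<bar>u powr \<alpha> - v powr \<alpha>\<bar> \<le> \<alpha> * \<bar>u - v\<bar> * max u v powr (\<alpha> - 1)"
proof -
  have main: "y powr \<alpha> - x powr \<alpha> \<le> \<alpha> * (y - x) * y powr (\<alpha> - 1)" if xy: "0 \<le> x" "x < y" for x y :: real
  proof -
    have "\<exists>z. x < z \<and> z < y \<and> y powr \<alpha> - x powr \<alpha> = (y - x) * (\<alpha> * z powr (\<alpha> - 1))"
    proof -
      have "\<exists>l z. x < z \<and> z < y \<and> ((\<lambda>x. x powr \<alpha>) has_real_derivative l) (at z) \<and> y powr \<alpha> - x powr \<alpha> = (y - x) * l"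
      proof (rule MVT[OF xy(2)])
        show "continuous_on {x..y} (\<lambda>x. x powr \<alpha>)"
          using xy assms by (intro continuous_on_powr') (auto intro: continuous_intros)
        fix z assume "x < z" "z < y"
        then have "((\<lambda>x. x powr \<alpha>) has_real_derivative \<alpha> * z powr (\<alpha> - 1)) (at z)"
          using xy by (intro has_real_derivative_powr) auto
        then show "(\<lambda>x. x powr \<alpha>) differentiable at z" by (auto simp: real_differentiable_def)
      qed
      then obtain l z where z: "x < z" "z < y" "((\<lambda>x. x powr \<alpha>) has_real_derivative l) (at z)"
        "y powr \<alpha> - x powr \<alpha> = (y - x) * l" by auto
      then have "l = \<alpha> * z powr (\<alpha> - 1)"
        using xy by (intro DERIV_unique[OF z(3) has_real_derivative_powr]) auto
      then show ?thesis using z by auto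
    qed
    then obtain z where z: "x < z" "z < y" "y powr \<alpha> - x powr \<alpha> = (y - x) * (\<alpha> * z powr (\<alpha> - 1))" by auto
    have "z powr (\<alpha> - 1) \<le> y powr (\<alpha> - 1)" using z xy assms by (intro powr_mono2) auto
    then have "(y - x) * (\<alpha> * z powr (\<alpha> - 1)) \<le> (y - x) * (\<alpha> * y powr (\<alpha> - 1))"
      using xy assms by (intro mult_left_mono) auto
    then show ?thesis using z(3) by (simp add: mult_ac)
  qed
  have mono: "x powr \<alpha> \<le> y powr \<alpha>" if "0 \<le> x" "x \<le> y" for x y :: real
    using that assms by (intro powr_mono2) auto
  consider "u < v" | "u = v" | "v < u" by linarith
  then show ?thesis
  proof cases
    case 1 then show ?thesis using main[of u v] mono[of u v] assms by (simp add: max_def)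
  next
    case 3 then show ?thesis using main[of v u] mono[of v u] assms by (simp add: max_def)
  qed simp
qed

lemma abs_powr_has_real_derivative:
  fixes x \<alpha> :: real
  assumes "1 < \<alpha>"
  shows "((\<lambda>x. \<bar>x\<bar> powr \<alpha>) has_real_derivative \<alpha> * spow_real (\<alpha> - 1) x) (at x)"
proof -
  consider "x > 0" | "x < 0" | "x = 0" by linarith
  then show ?thesis
  proof cases
    case 1
    have "((\<lambda>x. x powr \<alpha>) has_real_derivative \<alpha> * x powr (\<alpha> - 1)) (at x)"
      using 1 by (intro has_real_derivative_powr) auto
    moreover have "x powr (\<alpha> - 1) = spow_real (\<alpha> - 1) x"
      using 1 powr_add[of x "\<alpha> - 2" 1] by (simp add: spow_real_def)
    moreover have "\<forall>\<^sub>F y in nhds x. y powr \<alpha> = \<bar>y\<bar> powr \<alpha>"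
      using 1 by (auto intro!: eventually_mono[OF eventually_nhds_in_open[of "{0<..}"]])
    ultimately show ?thesis by (subst (asm) DERIV_cong_ev[OF refl _ refl]) auto
  next
    case 2
    have "((\<lambda>x. (- x) powr \<alpha>) has_real_derivative (\<alpha> * (- x) powr (\<alpha> - 1)) * (- 1)) (at x)"
      using 2 by (intro DERIV_chain2[where f="\<lambda>x. x powr \<alpha>"] has_real_derivative_powr) (auto intro!: derivative_eq_intros)
    moreover have F: "(- x) powr (\<alpha> - 1) * (-1) = spow_real (\<alpha> - 1) x"
      using 2 powr_add[of "- x" "\<alpha> - 2" 1] by (simp add: spow_real_def)
    moreover have "\<forall>\<^sub>F y in nhds x. (- y) powr \<alpha> = \<bar>y\<bar> powr \<alpha>"
      using 2 by (auto intro!: eventually_mono[OF eventually_nhds_in_open[of "{..<0}"]])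
    ultimately show ?thesis by (subst (asm) DERIV_cong_ev[OF refl _ refl]) (simp_all only: mult.assoc F)
  next
    case 3
    \<comment> \<open>At 0 the difference quotient has modulus
      \<open>\<bar>h\<bar> powr (\<alpha> - 1)\<close>, which tends to 0 because \<alpha> >
      1.\<close>
    have "((\<lambda>h. \<bar>h\<bar> powr (\<alpha> - 1)) \<longlongrightarrow> \<bar>0\<bar> powr (\<alpha> - 1)) (at 0)"
      using assms by (intro tendsto_powr' tendsto_intros) auto
    then have l: "((\<lambda>h. \<bar>h\<bar> powr (\<alpha> - 1)) \<longlongrightarrow> 0) (at 0)" by simp
    have "((\<lambda>h. (\<bar>0 + h\<bar> powr \<alpha> - \<bar>0\<bar> powr \<alpha>) / h) \<longlongrightarrow> 0) (at 0)"
    proof (rule Lim_null_comparison[OF _ l], intro always_eventually allI)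
      fix h :: real
      show "norm ((\<bar>0 + h\<bar> powr \<alpha> - \<bar>0\<bar> powr \<alpha>) / h) \<le> \<bar>h\<bar> powr (\<alpha> - 1)"
        using powr_add[of "\<bar>h\<bar>" "\<alpha> - 1" 1] by (cases "h = 0") (auto simp: field_simps)
    qed
    then show ?thesis using 3 by (simp add: DERIV_def spow_real_def)
  qed
qed

lemma abs_spow_real: "\<bar>spow_real \<beta> x\<bar> = (if x = 0 then 0 else \<bar>x\<bar> powr \<beta>)"
  using powr_add[of "\<bar>x\<bar>" "\<beta> - 1" 1] by (simp add: spow_real_def abs_mult)

lemma norm_spow: "norm (spow \<beta> z) = (if z = 0 then 0 else norm z powr \<beta>)"
  using powr_add[of "norm z" "\<beta> - 1" 1] by (simp add: spow_def norm_mult)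

lemma spow_real_measurable[measurable]: "spow_real \<beta> \<in> borel_measurable borel"
  unfolding spow_real_def[abs_def] by measurable

lemma spow_measurable[measurable]: "spow \<beta> \<in> borel_measurable borel"
  unfolding spow_def[abs_def] by measurable

lemma integrable_powr_add:
  fixes f g :: "'a \<Rightarrow> real"
  assumes [measurable]: "f \<in> borel_measurable M" "g \<in> borel_measurable M" and "0 < \<alpha>"
    and i: "integrable M (\<lambda>x. \<bar>f x\<bar> powr \<alpha>)" "integrable M (\<lambda>x. \<bar>g x\<bar> powr \<alpha>)"
  shows "integrable M (\<lambda>x. (\<bar>f x\<bar> + \<bar>g x\<bar>) powr \<alpha>)"
proof (rule Bochner_Integration.integrable_bound)
  show "integrable M (\<lambda>x. 2 powr \<alpha> * (\<bar>f x\<bar> powr \<alpha> + \<bar>g x\<bar> powr \<alpha>))" using i by simp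
  show "AE x in M. norm ((\<bar>f x\<bar> + \<bar>g x\<bar>) powr \<alpha>) \<le> norm (2 powr \<alpha> * (\<bar>f x\<bar> powr \<alpha> + \<bar>g x\<bar> powr \<alpha>))"
    using powr_add_le[OF abs_ge_zero abs_ge_zero \<open>0 < \<alpha>\<close>] by (intro AE_I2) (simp add: abs_mult)
qed measurable

lemma integrable_powr_mono:
  fixes f :: "'a \<Rightarrow> 'b::{banach,second_countable_topology}" and g :: "'a \<Rightarrow> real"
  assumes [measurable]: "f \<in> borel_measurable M" and "integrable M (\<lambda>x. g x powr \<alpha>)" "0 < \<alpha>"
    and "\<And>x. x \<in> space M \<Longrightarrow> norm (f x) \<le> g x"
  shows "integrable M (\<lambda>x. norm (f x) powr \<alpha>)"
  by (rule Bochner_Integration.integrable_bound[OF assms(2)])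
    (use assms in \<open>auto intro!: powr_mono2\<close>)

text \<open>This is the derivative at 0 of t -> \<integral> |t h + g|^\<alpha>, taken along t =
  1/(n+1). Dominated convergence applies because \<open>powr_diff_le\<close> keeps the difference
  quotients below \<alpha> (|h| + |g|)^\<alpha>.\<close>

lemma abs_powr_derivative_integral:
  fixes h g :: "'a \<Rightarrow> real"
  assumes \<alpha>: "1 < \<alpha>" and [measurable]: "h \<in> borel_measurable M" "g \<in> borel_measurable M"
    and i: "integrable M (\<lambda>x. \<bar>h x\<bar> powr \<alpha>)" "integrable M (\<lambda>x. \<bar>g x\<bar> powr \<alpha>)"
  shows "(\<lambda>n. real (Suc n) * ((LINT x|M. \<bar>h x / Suc n + g x\<bar> powr \<alpha>) - (LINT x|M. \<bar>g x\<bar> powr \<alpha>)))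
    \<longlonglongrightarrow> \<alpha> * (LINT x|M. h x * spow_real (\<alpha> - 1) (g x))"
proof -
  have isum: "integrable M (\<lambda>x. (\<bar>h x\<bar> + \<bar>g x\<bar>) powr \<alpha>)"
    by (rule integrable_powr_add) (use i \<alpha> in auto)
  have ih: "integrable M (\<lambda>x. \<bar>h x / Suc n + g x\<bar> powr \<alpha>)" for n
  proof -
    have "\<bar>h x / real (Suc n) + g x\<bar> \<le> \<bar>h x\<bar> + \<bar>g x\<bar>" for x
    proof -
      have "\<bar>h x\<bar> / real (Suc n) \<le> \<bar>h x\<bar> / 1" by (rule divide_left_mono) auto
      then show ?thesis using abs_triangle_ineq[of "h x / real (Suc n)" "g x"] by (simp add: abs_divide)
    qed
    then show ?thesis using integrable_powr_mono[OF _ isum, of "\<lambda>x. h x / Suc n + g x"] \<alpha> by simp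
  qed
  have "(\<lambda>n. LINT x|M. real (Suc n) * (\<bar>h x / Suc n + g x\<bar> powr \<alpha> - \<bar>g x\<bar> powr \<alpha>))
    \<longlonglongrightarrow> (LINT x|M. \<alpha> * (h x * spow_real (\<alpha> - 1) (g x)))"
  proof (rule integral_dominated_convergence[where w="\<lambda>x. \<alpha> * (\<bar>h x\<bar> + \<bar>g x\<bar>) powr \<alpha>"])
    show "integrable M (\<lambda>x. \<alpha> * (\<bar>h x\<bar> + \<bar>g x\<bar>) powr \<alpha>)" using isum by simp
    show "AE x in M. (\<lambda>n. real (Suc n) * (\<bar>h x / Suc n + g x\<bar> powr \<alpha> - \<bar>g x\<bar> powr \<alpha>)) \<longlonglongrightarrow> \<alpha> * (h x * spow_real (\<alpha> - 1) (g x))"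
    proof (intro AE_I2)
      fix x
      have d: "((\<lambda>e. \<bar>e * h x + g x\<bar> powr \<alpha>) has_real_derivative (\<alpha> * spow_real (\<alpha> - 1) (0 * h x + g x)) * h x) (at 0)"
        by (rule DERIV_chain2[where f="\<lambda>x. \<bar>x\<bar> powr \<alpha>", OF abs_powr_has_real_derivative[OF \<alpha>]])
          (auto intro!: derivative_eq_intros)
      have "(\<lambda>n. (\<bar>(0 + 1 / real (Suc n)) * h x + g x\<bar> powr \<alpha> - \<bar>0 * h x + g x\<bar> powr \<alpha>) / (1 / real (Suc n)))
         \<longlonglongrightarrow> (\<alpha> * spow_real (\<alpha> - 1) (0 * h x + g x)) * h x"
      proof (rule filterlim_compose[OF d[unfolded DERIV_def]])
        show "filterlim (\<lambda>n. 1 / real (Suc n)) (at 0) sequentially"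
          unfolding filterlim_at using LIMSEQ_inverse_real_of_nat by (auto simp: divide_inverse)
      qed
      then show "(\<lambda>n. real (Suc n) * (\<bar>h x / Suc n + g x\<bar> powr \<alpha> - \<bar>g x\<bar> powr \<alpha>)) \<longlonglongrightarrow> \<alpha> * (h x * spow_real (\<alpha> - 1) (g x))"
        by (simp add: mult_ac)
    qed
    show "AE x in M. norm (real (Suc n) * (\<bar>h x / Suc n + g x\<bar> powr \<alpha> - \<bar>g x\<bar> powr \<alpha>)) \<le> \<alpha> * (\<bar>h x\<bar> + \<bar>g x\<bar>) powr \<alpha>" for n
    proof (intro AE_I2)
      fix x
      define N where "N = real (Suc n)"
      have N: "N \<ge> 1" by (simp add: N_def)
      have hN: "\<bar>h x\<bar> / N \<le> \<bar>h x\<bar>" using divide_left_mono[of 1 N "\<bar>h x\<bar>"] N by simp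
      have tr: "\<bar>h x / N + g x\<bar> \<le> \<bar>h x\<bar> / N + \<bar>g x\<bar>" using abs_triangle_ineq[of "h x / N" "g x"] N by simp
      define S where "S = \<bar>h x\<bar> + \<bar>g x\<bar>"
      have d: "\<bar>\<bar>h x / N + g x\<bar> - \<bar>g x\<bar>\<bar> \<le> \<bar>h x\<bar> / N"
        using abs_triangle_ineq3[of "h x / N + g x" "g x"] N by simp
      have m: "max \<bar>h x / N + g x\<bar> \<bar>g x\<bar> \<le> S" using tr hN by (auto simp: S_def)
      have "\<bar>\<bar>h x / N + g x\<bar> powr \<alpha> - \<bar>g x\<bar> powr \<alpha>\<bar> \<le> \<alpha> * \<bar>\<bar>h x / N + g x\<bar> - \<bar>g x\<bar>\<bar> * max \<bar>h x / N + g x\<bar> \<bar>g x\<bar> powr (\<alpha> - 1)"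
        by (rule powr_diff_le) (use \<alpha> in auto)
      also have "\<dots> \<le> \<alpha> * (\<bar>h x\<bar> / N) * S powr (\<alpha> - 1)"
        using \<alpha> d m N by (intro mult_mono powr_mono2) (auto simp: le_max_iff_disj)
      also have "\<dots> \<le> \<alpha> * (S / N) * S powr (\<alpha> - 1)"
        using \<alpha> N by (intro mult_right_mono mult_left_mono divide_right_mono) (auto simp: S_def)
      finally have "N * \<bar>\<bar>h x / N + g x\<bar> powr \<alpha> - \<bar>g x\<bar> powr \<alpha>\<bar> \<le> N * (\<alpha> * (S / N) * S powr (\<alpha> - 1))"
        using N by (intro mult_left_mono) auto
      also have "\<dots> = \<alpha> * (S powr 1 * S powr (\<alpha> - 1))" using N by (simp add: S_def)
      also have "\<dots> = \<alpha> * S powr \<alpha>" by (simp only: powr_add[symmetric]) simp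
      finally show "norm (real (Suc n) * (\<bar>h x / Suc n + g x\<bar> powr \<alpha> - \<bar>g x\<bar> powr \<alpha>)) \<le> \<alpha> * (\<bar>h x\<bar> + \<bar>g x\<bar>) powr \<alpha>"
        unfolding N_def S_def by (simp add: abs_mult)
    qed
  qed measurable
  then show ?thesis using ih i by simp
qed

text \<open>Both sides are, up to the factor \<alpha>, the derivative at 0 of the same function of
  t. The covariation integral thus depends on the exponent alone, whatever space represents
  it.\<close>

lemma covariation_integral_unique:
  fixes h g :: "'a \<Rightarrow> real" and h' g' :: "'b \<Rightarrow> real"
  assumes \<alpha>: "1 < \<alpha>" and m: "h \<in> borel_measurable M" "g \<in> borel_measurable M"
      "h' \<in> borel_measurable N" "g' \<in> borel_measurable N"
    and i: "integrable M (\<lambda>x. \<bar>h x\<bar> powr \<alpha>)" "integrable M (\<lambda>x. \<bar>g x\<bar> powr \<alpha>)"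
      "integrable N (\<lambda>x. \<bar>h' x\<bar> powr \<alpha>)" "integrable N (\<lambda>x. \<bar>g' x\<bar> powr \<alpha>)"
    and eq: "\<And>t::real. (LINT x|M. \<bar>t * h x + g x\<bar> powr \<alpha>) = (LINT x|N. \<bar>t * h' x + g' x\<bar> powr \<alpha>)"
  shows "(LINT x|M. h x * spow_real (\<alpha> - 1) (g x)) = (LINT x|N. h' x * spow_real (\<alpha> - 1) (g' x))"
proof -
  have e1: "(LINT x|M. \<bar>h x / real (Suc n) + g x\<bar> powr \<alpha>) = (LINT x|N. \<bar>h' x / real (Suc n) + g' x\<bar> powr \<alpha>)" for n
    using eq[of "1 / real (Suc n)"] by (simp del: of_nat_Suc)
  have e2: "(LINT x|M. \<bar>g x\<bar> powr \<alpha>) = (LINT x|N. \<bar>g' x\<bar> powr \<alpha>)" using eq[of 0] by simp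
  have "\<alpha> * (LINT x|M. h x * spow_real (\<alpha> - 1) (g x)) = \<alpha> * (LINT x|N. h' x * spow_real (\<alpha> - 1) (g' x))"
    by (rule LIMSEQ_unique[OF abs_powr_derivative_integral[OF \<alpha> m(1,2) i(1,2), unfolded e1 e2]
          abs_powr_derivative_integral[OF \<alpha> m(3,4) i(3,4)]])
  then show ?thesis using \<alpha> by simp
qed

section \<open>The uniform law on the unit circle and complex signed powers\<close>

definition circle :: "complex measure" where
  "circle = distr (uniform_measure lborel {0..<2 * pi}) borel cis"

lemma cis_measurable[measurable]: "cis \<in> borel_measurable borel"
  by (intro borel_measurable_continuous_onI continuous_intros)

lemma sets_circle[simp, measurable_cong]: "sets circle = sets borel" and space_circle[simp]: "space circle = UNIV"
  by (simp_all add: circle_def)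

lemma prob_space_circle: "prob_space circle"
  unfolding circle_def
  by (intro prob_space.prob_space_distr prob_space_uniform_measure) auto

lemma AE_circle: "AE u in circle. norm u = 1"
proof -
  have m: "cis \<in> measurable (uniform_measure lborel {0..<2 * pi}) borel" by simp
  show ?thesis unfolding circle_def by (subst AE_distr_iff[OF m]) auto
qed

lemma emeasure_circle:
  assumes [measurable]: "B \<in> sets borel"
  shows "emeasure circle B = (\<integral>\<^sup>+t. indicator B (cis t) * indicator {0..<2*pi} t \<partial>lborel) / ennreal (2*pi)"
proof -
  have m: "cis -` B \<in> sets borel" using measurable_sets[OF cis_measurable, of B] by simp
  have "emeasure circle B = emeasure lborel ({0..<2*pi} \<inter> cis -` B) / ennreal (2*pi)"
    unfolding circle_def using m by (subst emeasure_distr) auto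
  also have "emeasure lborel ({0..<2*pi} \<inter> cis -` B) = (\<integral>\<^sup>+t. indicator ({0..<2*pi} \<inter> cis -` B) t \<partial>lborel)"
    using m by (intro nn_integral_indicator[symmetric]) auto
  also have "\<dots> = (\<integral>\<^sup>+t. indicator B (cis t) * indicator {0..<2*pi} t \<partial>lborel)"
    by (intro nn_integral_cong) (auto split: split_indicator)
  finally show ?thesis .
qed

text \<open>Translation by \<psi> moves the parameter interval from [0, 2 pi) to [\<psi>, \<psi> + 2
  pi), and periodicity brings the piece beyond 2 pi back to the start. Subtracting a multiple of 2
  pi reduces every angle to this case.\<close>

lemma circle_rotate: "distr circle borel (\<lambda>u. u * cis \<psi>) = circle"
proof -
  have main: "distr circle borel (\<lambda>u. u * cis \<psi>) = circle" if \<psi>: "0 \<le> \<psi>" "\<psi> < 2 * pi" for \<psi>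
  proof (rule measure_eqI)
    fix B assume "B \<in> sets (distr circle borel (\<lambda>u. u * cis \<psi>))"
    then have B[measurable]: "B \<in> sets borel" by simp
    define g where "g t = (indicator B (cis t) :: ennreal)" for t
    have [measurable]: "g \<in> borel_measurable borel" unfolding g_def by measurable
    have per: "g (t + 2 * pi) = g t" for t by (simp add: g_def cis.ctr)
    have "(\<lambda>u. u * cis \<psi>) -` B \<inter> space circle \<in> sets borel" by measurable
    then have "emeasure (distr circle borel (\<lambda>u. u * cis \<psi>)) B = (\<integral>\<^sup>+t. indicator ((\<lambda>u. u * cis \<psi>) -` B) (cis t) * indicator {0..<2*pi} t \<partial>lborel) / ennreal (2*pi)"
      by (subst emeasure_distr) (auto simp: emeasure_circle)
    also have "(\<integral>\<^sup>+t. indicator ((\<lambda>u. u * cis \<psi>) -` B) (cis t) * indicator {0..<2*pi} t \<partial>lborel)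
       = (\<integral>\<^sup>+t. g (\<psi> + 1 * t) * indicator {\<psi>..<\<psi> + 2*pi} (\<psi> + 1 * t) \<partial>lborel)"
      by (intro nn_integral_cong) (auto simp: g_def cis_mult add.commute split: split_indicator)
    also have "\<dots> = (\<integral>\<^sup>+t. g t * indicator {\<psi>..<\<psi> + 2*pi} t \<partial>lborel)"
      using nn_integral_real_affine[of "\<lambda>t. g t * indicator {\<psi>..<\<psi> + 2*pi} t" 1 \<psi>] by simp
    also have "\<dots> = (\<integral>\<^sup>+t. g t * indicator {\<psi>..<2*pi} t + g t * indicator {2*pi..<\<psi> + 2*pi} t \<partial>lborel)"
      using \<psi> by (intro nn_integral_cong) (auto split: split_indicator)
    also have "\<dots> = (\<integral>\<^sup>+t. g t * indicator {\<psi>..<2*pi} t \<partial>lborel) + (\<integral>\<^sup>+t. g t * indicator {2*pi..<\<psi> + 2*pi} t \<partial>lborel)"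
      by (rule nn_integral_add) auto
    also have "(\<integral>\<^sup>+t. g t * indicator {2*pi..<\<psi> + 2*pi} t \<partial>lborel)
       = (\<integral>\<^sup>+t. g (2*pi + 1 * t) * indicator {2*pi..<\<psi> + 2*pi} (2*pi + 1 * t) \<partial>lborel)"
      using nn_integral_real_affine[of "\<lambda>t. g t * indicator {2*pi..<\<psi> + 2*pi} t" 1 "2*pi"] by simp
    also have "\<dots> = (\<integral>\<^sup>+t. g t * indicator {0..<\<psi>} t \<partial>lborel)"
      using per by (intro nn_integral_cong) (auto simp: add.commute split: split_indicator)
    also have "(\<integral>\<^sup>+t. g t * indicator {\<psi>..<2*pi} t \<partial>lborel) + (\<integral>\<^sup>+t. g t * indicator {0..<\<psi>} t \<partial>lborel)
       = (\<integral>\<^sup>+t. g t * indicator {\<psi>..<2*pi} t + g t * indicator {0..<\<psi>} t \<partial>lborel)"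
      by (rule nn_integral_add[symmetric]) auto
    also have "\<dots> = (\<integral>\<^sup>+t. indicator B (cis t) * indicator {0..<2*pi} t \<partial>lborel)"
      using \<psi> by (intro nn_integral_cong) (auto simp: g_def split: split_indicator)
    finally show "emeasure (distr circle borel (\<lambda>u. u * cis \<psi>)) B = emeasure circle B"
      by (simp add: emeasure_circle)
  qed simp
  define k where "k = \<lfloor>\<psi> / (2*pi)\<rfloor>"
  have "cis \<psi> = cis (\<psi> - 2 * pi * k)"
    using cis_multiple_2pi[of "of_int k"] by (simp flip: cis_divide)
  moreover have "0 \<le> \<psi> - 2 * pi * k" "\<psi> - 2 * pi * k < 2 * pi"
  proof -
    have "of_int k \<le> \<psi> / (2*pi)" "\<psi> / (2*pi) < of_int k + 1" unfolding k_def by linarith+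
    then show "0 \<le> \<psi> - 2 * pi * k" "\<psi> - 2 * pi * k < 2 * pi" by (simp_all add: field_simps)
  qed
  ultimately show ?thesis using main by metis
qed

lemma circle_symmetric: "distr circle borel uminus = circle"
  
proof -
  have "uminus = (\<lambda>u. u * cis pi)" by (auto simp: cis_pi)
  then show ?thesis using circle_rotate[of pi] by simp
qed

lemma integral_circle_rotate:
  fixes f :: "complex \<Rightarrow> 'b::{banach,second_countable_topology}"
  assumes [measurable]: "f \<in> borel_measurable borel"
  shows "(LINT u|circle. f u) = (LINT u|circle. f (u * cis \<psi>))"
proof -
  have "(LINT u|circle. f u) = (LINT u|distr circle borel (\<lambda>u. u * cis \<psi>). f u)" by (simp only: circle_rotate)
  also have "\<dots> = (LINT u|circle. f (u * cis \<psi>))" by (rule integral_distr) auto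
  finally show ?thesis .
qed

text \<open>The \<alpha>-th absolute moment of a projection of a uniform direction. It is the factor
  between the control measure and the exponent of an isotropic random measure at \<theta> =
  1.\<close>

definition circle_const :: "real \<Rightarrow> real" where
  "circle_const \<alpha> = (LINT u|circle. \<bar>Re u\<bar> powr \<alpha>)"

lemma inner_cis: "(u * cis \<psi>) \<bullet> (of_real r * cis \<psi>) = r * Re u"
proof -
  have "(u * cis \<psi>) \<bullet> (of_real r * cis \<psi>)
    = (Re u * cos \<psi> - Im u * sin \<psi>) * (r * cos \<psi>) + (Re u * sin \<psi> + Im u * cos \<psi>) * (r * sin \<psi>)"
    by (simp add: inner_complex_def)
  also have "\<dots> = r * Re u" using sin_cos_squared_add3[of \<psi>] by algebra
  finally show ?thesis .
qed

text \<open>Rotating the circle by the argument of \<theta> replaces \<theta> by its modulus, which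
  then leaves the integral by homogeneity.\<close>

lemma integral_circle_inner_powr:
  "(LINT u|circle. \<bar>\<theta> \<bullet> u\<bar> powr \<alpha>) = norm \<theta> powr \<alpha> * circle_const \<alpha>"
proof -
  obtain r \<psi> where \<theta>: "\<theta> = of_real r * cis \<psi>" and r: "r = norm \<theta>"
    by (metis rcis_cmod_Arg rcis_def)
  have "(LINT u|circle. \<bar>\<theta> \<bullet> u\<bar> powr \<alpha>) = (LINT u|circle. \<bar>(u * cis \<psi>) \<bullet> \<theta>\<bar> powr \<alpha>)"
    by (subst integral_circle_rotate[of _ \<psi>]) (auto simp: inner_commute)
  also have "\<dots> = (LINT u|circle. norm \<theta> powr \<alpha> * \<bar>Re u\<bar> powr \<alpha>)"
    unfolding \<theta> inner_cis by (simp add: abs_mult powr_mult norm_mult)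
  finally show ?thesis by (simp add: circle_const_def)
qed

text \<open>If the moment were 0, then Re u = 0 almost surely and, after a quarter turn, also Im u =
  0, against norm u = 1.\<close>

lemma circle_const_pos: assumes "0 < \<alpha>" shows "0 < circle_const \<alpha>"
proof -
  interpret prob_space circle by (rule prob_space_circle)
  have i: "integrable circle (\<lambda>u. \<bar>Re u\<bar> powr \<alpha>)"
  proof (rule integrable_const_bound[where B=1])
    show "AE u in circle. norm (\<bar>Re u\<bar> powr \<alpha>) \<le> 1"
      using AE_circle
    proof eventually_elim
      case (elim u)
      then show ?case using abs_Re_le_cmod[of u] powr_mono2[of \<alpha> "\<bar>Re u\<bar>" 1] assms by simp
    qed
  qed measurable
  have "circle_const \<alpha> \<noteq> 0"
  proof
    assume "circle_const \<alpha> = 0"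
    then have re: "AE u in circle. Re u = 0"
      unfolding circle_const_def by (subst (asm) integral_nonneg_eq_0_iff_AE[OF i]) auto
    have "AE u in distr circle borel (\<lambda>u. u * cis (pi/2)). Re u = 0" using re by (simp only: circle_rotate)
    then have im: "AE u in circle. Im u = 0"
      by (subst (asm) AE_distr_iff) auto
    have "AE u in circle. False"
      using re im AE_circle by eventually_elim (simp add: cmod_def)
    then show False by simp
  qed
  moreover have "0 \<le> circle_const \<alpha>" by (simp add: circle_const_def)
  ultimately show ?thesis by simp
qed

text \<open>
  Rotation covariance forces the first moment of the real signed powers of \<open>z\<close> in all directions
  to be a multiple of \<open>spow\<close>.
\<close>

lemma integral_circle_spow:
  assumes \<alpha>: "1 < \<alpha>"
  obtains K where "K \<noteq> 0"
    "\<And>z. (CLINT u|circle. of_real (spow_real (\<alpha> - 1) (u \<bullet> z)) * cnj u) = K * spow (\<alpha> - 1) z"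
proof
  interpret prob_space circle by (rule prob_space_circle)
  define K where "K = (CLINT u|circle. of_real (spow_real (\<alpha> - 1) (Re u)) * cnj u)"
  have b: "AE u in circle. norm (of_real (spow_real (\<alpha> - 1) (Re u)) * cnj u) \<le> 1"
    using AE_circle
  proof eventually_elim
    case (elim u)
    then show ?case
      using abs_Re_le_cmod[of u] powr_mono2[of "\<alpha> - 1" "\<bar>Re u\<bar>" 1] \<alpha>
      by (simp add: norm_mult abs_spow_real)
  qed
  have i: "integrable circle (\<lambda>u. of_real (spow_real (\<alpha> - 1) (Re u)) * cnj u)"
    by (rule integrable_const_bound[OF b]) measurable
  \<comment> \<open>\<open>K\<close> is nonzero because its real part is the positive number
    \<open>circle_const \<alpha>\<close>: a real signed power of order \<alpha> - 1 times its
    argument is |x|^\<alpha>.\<close>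
  have "Re K = (LINT u|circle. spow_real (\<alpha> - 1) (Re u) * Re u)"
    unfolding K_def by (subst integral_Re[OF i, symmetric]) simp
  also have "\<dots> = circle_const \<alpha>"
    unfolding circle_const_def
  proof (rule Bochner_Integration.integral_cong[OF refl])
    fix u :: complex
    have "\<bar>Re u\<bar> powr (\<alpha> - 2) * (Re u * Re u) = \<bar>Re u\<bar> powr (\<alpha> - 2) * \<bar>Re u\<bar> powr 2"
      by (simp add: powr_numeral power2_eq_square)
    also have "\<dots> = \<bar>Re u\<bar> powr \<alpha>" by (simp only: powr_add[symmetric]) simp
    finally show "spow_real (\<alpha> - 1) (Re u) * Re u = \<bar>Re u\<bar> powr \<alpha>"
      by (simp add: spow_real_def mult.assoc)
  qed
  finally show "K \<noteq> 0" using circle_const_pos[of \<alpha>] \<alpha> by auto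
  fix z :: complex
  obtain r \<psi> where z: "z = of_real r * cis \<psi>" and r: "r = norm z"
    by (metis rcis_cmod_Arg rcis_def)
  have r0: "0 \<le> r" using r by simp
  have "(CLINT u|circle. of_real (spow_real (\<alpha> - 1) (u \<bullet> z)) * cnj u)
     = (CLINT u|circle. of_real (spow_real (\<alpha> - 1) ((u * cis \<psi>) \<bullet> z)) * cnj (u * cis \<psi>))"
    by (rule integral_circle_rotate) measurable
  also have "\<dots> = (CLINT u|circle. of_real (r powr (\<alpha> - 2) * r) * cnj (cis \<psi>) * (of_real (spow_real (\<alpha> - 1) (Re u)) * cnj u))"
    unfolding z inner_cis using r0
    by (intro Bochner_Integration.integral_cong refl) (simp add: spow_real_def abs_mult powr_mult)
  also have "\<dots> = of_real (r powr (\<alpha> - 2) * r) * cnj (cis \<psi>) * K"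
    unfolding K_def by (rule integral_mult_right_zero)
  also have "\<dots> = K * spow (\<alpha> - 1) z"
    using r0 by (simp add: spow_def z norm_mult mult_ac)
  finally show "(CLINT u|circle. of_real (spow_real (\<alpha> - 1) (u \<bullet> z)) * cnj u) = K * spow (\<alpha> - 1) z" .
qed

text \<open>Differentiating the exponent yields real covariations in fixed directions u. Weighted
  with \<open>cnj u\<close> and averaged over the circle they produce \<open>spow\<close>, up to
  \<open>K\<close>. The interchange of the integrals is dominated by norm v (|h| +
  |g|)^\<alpha>.\<close>

lemma integral_spow_circle_Fubini:
  fixes h g :: "'a \<Rightarrow> complex"
  assumes \<alpha>: "1 < \<alpha>" and M: "sigma_finite_measure M"
    and [measurable]: "h \<in> borel_measurable M" "g \<in> borel_measurable M"
    and i: "integrable M (\<lambda>x. norm (h x) powr \<alpha>)" "integrable M (\<lambda>x. norm (g x) powr \<alpha>)"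
    and K: "\<And>z. (CLINT u|circle. of_real (spow_real (\<alpha> - 1) (u \<bullet> z)) * cnj u) = K * spow (\<alpha> - 1) z"
  shows "integrable M (\<lambda>x. of_real (v \<bullet> h x) * spow (\<alpha> - 1) (g x))"
    "K * (CLINT x|M. of_real (v \<bullet> h x) * spow (\<alpha> - 1) (g x))
      = (CLINT u|circle. cnj u * of_real (LINT x|M. (v \<bullet> h x) * spow_real (\<alpha> - 1) (u \<bullet> g x)))"
proof -
  interpret M: sigma_finite_measure M by fact
  interpret C: prob_space circle by (rule prob_space_circle)
  interpret P: pair_sigma_finite M circle by unfold_locales
  have isum: "integrable M (\<lambda>x. (\<bar>norm (h x)\<bar> + \<bar>norm (g x)\<bar>) powr \<alpha>)"
    by (rule integrable_powr_add) (use i \<alpha> in auto)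
  then have isum': "integrable M (\<lambda>x. norm v * (norm (h x) + norm (g x)) powr \<alpha>)" by simp
  have ab: "a * b powr (\<alpha> - 1) \<le> (a + b) powr \<alpha>" if "0 \<le> a" "0 \<le> b" for a b :: real
  proof -
    have "a * b powr (\<alpha> - 1) \<le> (a + b) * (a + b) powr (\<alpha> - 1)"
      using that \<alpha> by (intro mult_mono powr_mono2) auto
    also have "\<dots> = (a + b) powr 1 * (a + b) powr (\<alpha> - 1)" using that by simp
    finally show ?thesis by (simp only: powr_add[symmetric]) simp
  qed
  have vb: "\<bar>v \<bullet> h x\<bar> * (norm (g x)) powr (\<alpha> - 1) \<le> norm v * (norm (h x) + norm (g x)) powr \<alpha>" for x
  proof -
    have "\<bar>v \<bullet> h x\<bar> * (norm (g x)) powr (\<alpha> - 1) \<le> (norm v * norm (h x)) * (norm (g x)) powr (\<alpha> - 1)"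
      by (intro mult_right_mono Cauchy_Schwarz_ineq2) auto
    also have "\<dots> \<le> norm v * (norm (h x) + norm (g x)) powr \<alpha>"
      using ab[of "norm (h x)" "norm (g x)"] by (simp add: mult.assoc mult_left_mono)
    finally show ?thesis .
  qed
  show "integrable M (\<lambda>x. of_real (v \<bullet> h x) * spow (\<alpha> - 1) (g x))"
  proof (rule Bochner_Integration.integrable_bound[OF isum'])
    show "AE x in M. norm (of_real (v \<bullet> h x) * spow (\<alpha> - 1) (g x)) \<le> norm (norm v * (norm (h x) + norm (g x)) powr \<alpha>)"
      using vb by (auto simp: norm_mult norm_spow)
  qed measurable
  have "integrable (distr (M \<Otimes>\<^sub>M circle) M fst) (\<lambda>x. norm v * (norm (h x) + norm (g x)) powr \<alpha>)"
    using isum' by (simp add: C.distr_pair_fst)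
  then have ip: "integrable (M \<Otimes>\<^sub>M circle) (\<lambda>p. norm v * (norm (h (fst p)) + norm (g (fst p))) powr \<alpha>)"
    by (subst (asm) integrable_distr_eq) auto
  have "AE p in M \<Otimes>\<^sub>M circle. norm (snd p) = 1"
    
  proof (rule P.AE_pair_measure)
    show "{p \<in> space (M \<Otimes>\<^sub>M circle). norm (snd p) = 1} \<in> sets (M \<Otimes>\<^sub>M circle)" by measurable
  qed (use AE_circle in auto)
  then have bp: "AE p in M \<Otimes>\<^sub>M circle. norm (of_real (v \<bullet> h (fst p)) * (of_real (spow_real (\<alpha> - 1) (snd p \<bullet> g (fst p))) * cnj (snd p)))
     \<le> norm (norm v * (norm (h (fst p)) + norm (g (fst p))) powr \<alpha>)"
  proof eventually_elim
    case (elim p)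
    have "\<bar>spow_real (\<alpha> - 1) (snd p \<bullet> g (fst p))\<bar> \<le> norm (g (fst p)) powr (\<alpha> - 1)"
      using Cauchy_Schwarz_ineq2[of "snd p" "g (fst p)"] elim \<alpha> by (auto simp: abs_spow_real intro!: powr_mono2)
    then have "\<bar>v \<bullet> h (fst p)\<bar> * \<bar>spow_real (\<alpha> - 1) (snd p \<bullet> g (fst p))\<bar> \<le> norm v * (norm (h (fst p)) + norm (g (fst p))) powr \<alpha>"
      by (intro order_trans[OF mult_left_mono vb]) auto
    then show ?case using elim by (simp add: norm_mult)
  qed
  have ip': "integrable (M \<Otimes>\<^sub>M circle) (\<lambda>(x, u). of_real (v \<bullet> h x) * (of_real (spow_real (\<alpha> - 1) (u \<bullet> g x)) * cnj u))"
    unfolding split_beta by (rule Bochner_Integration.integrable_bound[OF ip _ bp]) measurable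
  have "K * (CLINT x|M. of_real (v \<bullet> h x) * spow (\<alpha> - 1) (g x)) = (CLINT x|M. of_real (v \<bullet> h x) * (K * spow (\<alpha> - 1) (g x)))"
    by (simp add: mult.left_commute flip: integral_mult_right_zero)
  also have "\<dots> = (CLINT x|M. CLINT u|circle. of_real (v \<bullet> h x) * (of_real (spow_real (\<alpha> - 1) (u \<bullet> g x)) * cnj u))"
    by (simp add: K[symmetric])
  also have "\<dots> = (CLINT u|circle. CLINT x|M. of_real (v \<bullet> h x) * (of_real (spow_real (\<alpha> - 1) (u \<bullet> g x)) * cnj u))"
    by (rule P.Fubini_integral[OF ip', symmetric])
  also have "\<dots> = (CLINT u|circle. CLINT x|M. cnj u * of_real ((v \<bullet> h x) * spow_real (\<alpha> - 1) (u \<bullet> g x)))"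
    by (intro Bochner_Integration.integral_cong refl) (simp add: mult_ac)
  also have "\<dots> = (CLINT u|circle. cnj u * of_real (LINT x|M. (v \<bullet> h x) * spow_real (\<alpha> - 1) (u \<bullet> g x)))"
    by (simp only: integral_mult_right_zero integral_complex_of_real)
  finally show "K * (CLINT x|M. of_real (v \<bullet> h x) * spow (\<alpha> - 1) (g x))
      = (CLINT u|circle. cnj u * of_real (LINT x|M. (v \<bullet> h x) * spow_real (\<alpha> - 1) (u \<bullet> g x)))" .
qed

section \<open>Spectral measures and covariations from L^\<alpha> representations\<close>

lemma integrable_powr_sum:
  fixes f :: "nat \<Rightarrow> 'a \<Rightarrow> 'b::{banach,second_countable_topology}"
  assumes "\<And>i. i < d \<Longrightarrow> f i \<in> borel_measurable M" "0 < \<alpha>"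
    and "\<And>i. i < d \<Longrightarrow> integrable M (\<lambda>x. norm (f i x) powr \<alpha>)"
  shows "integrable M (\<lambda>x. (\<Sum>i<d. norm (f i x)) powr \<alpha>)"
  using assms
proof (induction d)
  case (Suc d)
  have [measurable]: "\<And>i. i < d \<Longrightarrow> f i \<in> borel_measurable M" "f d \<in> borel_measurable M"
    using Suc.prems by auto
  have 1: "integrable M (\<lambda>x. (\<Sum>i<d. norm (f i x)) powr \<alpha>)" using Suc by simp
  have [measurable]: "(\<lambda>x. \<Sum>i<d. norm (f i x)) \<in> borel_measurable M"
    by (intro borel_measurable_sum) auto
  have "integrable M (\<lambda>x. (\<bar>\<Sum>i<d. norm (f i x)\<bar> + \<bar>norm (f d x)\<bar>) powr \<alpha>)"
    by (rule integrable_powr_add) (use Suc 1 in \<open>auto simp: sum_nonneg\<close>)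
  then show ?case by (simp add: sum_nonneg abs_of_nonneg)
qed simp

text \<open>Polar decomposition h = r u with u on the sphere. The measure with density r^\<alpha> is
  pushed forward along u, and homogeneity of degree \<alpha> absorbs the density into the linear
  form. The map \<open>T\<close>, which preserves \<open>N\<close> and reverses the sign of h,
  supplies the symmetry.\<close>

lemma exists_spectral_measure:
  fixes h :: "nat \<Rightarrow> 'b \<Rightarrow> 'a::euclidean_space" and N :: "'b measure"
  assumes \<alpha>: "0 < \<alpha>" and d: "0 < d"
    and T: "T \<in> measurable N N" "distr N N T = N"
    and h: "\<And>i. i < d \<Longrightarrow> h i \<in> borel_measurable N"
    and odd: "\<And>i x. i < d \<Longrightarrow> x \<in> space N \<Longrightarrow> h i (T x) = - h i x"
    and int: "\<And>i. i < d \<Longrightarrow> integrable N (\<lambda>x. norm (h i x) powr \<alpha>)"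
  obtains G where "sets G = sets (sphere_space d :: (nat \<Rightarrow> 'a) measure)" "finite_measure G"
    "distr G G (\<lambda>s. \<lambda>i\<in>{..<d}. - s i) = G"
    "\<And>\<theta>. (LINT s|G. \<bar>\<Sum>i<d. \<theta> i \<bullet> s i\<bar> powr \<alpha>) = (LINT x|N. \<bar>\<Sum>i<d. \<theta> i \<bullet> h i x\<bar> powr \<alpha>)"
proof -
  define S where "S = {s :: nat \<Rightarrow> 'a. (\<Sum>i<d. (norm (s i))\<^sup>2) = 1}"
  define e where "e = (SOME b :: 'a. b \<in> Basis)"
  have e: "norm e = 1" unfolding e_def by (simp add: SOME_Basis)
  define r where "r x = sqrt (\<Sum>i<d. (norm (h i x))\<^sup>2)" for x
  have r0: "0 \<le> r x" for x by (simp add: r_def sum_nonneg)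
  have r2: "(\<Sum>i<d. (norm (h i x))\<^sup>2) = (r x)\<^sup>2" for x by (simp add: r_def sum_nonneg)
  have [measurable]: "r \<in> borel_measurable N"
  proof -
    have [measurable]: "(\<lambda>x. \<Sum>i<d. (norm (h i x))\<^sup>2) \<in> borel_measurable N"
    proof (rule borel_measurable_sum)
      fix i assume "i \<in> {..<d}"
      then have [measurable]: "h i \<in> borel_measurable N" using h by auto
      show "(\<lambda>x. (norm (h i x))\<^sup>2) \<in> borel_measurable N" by measurable
    qed
    show ?thesis unfolding r_def[abs_def] by measurable
  qed
  \<comment> \<open>Where r = 0 there is no direction to take. The unit vector \<open>e\<close> in
    coordinate 0, available because d > 0, gives some point of the sphere; it receives no mass from
    this region, as the density r^\<alpha> vanishes there.\<close>
  define u where "u x = (\<lambda>i\<in>{..<d}. if r x = 0 then if i = 0 then e else 0 else h i x /\<^sub>R r x)" for x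
  have ru: "r x *\<^sub>R u x i = h i x" if "i < d" for x i
  proof (cases "r x = 0")
    case True
    then have "(\<Sum>i<d. (norm (h i x))\<^sup>2) = 0" using r2[of x] by simp
    then have "h i x = 0" using that by (subst (asm) sum_nonneg_eq_0_iff) auto
    then show ?thesis using True by simp
  next
    case False
    then show ?thesis using that by (simp add: u_def)
  qed
  have uS: "u x \<in> S" for x
  proof (cases "r x = 0")
    case True
    have "(\<Sum>i<d. (norm (u x i))\<^sup>2) = (\<Sum>i<d. if i = 0 then 1 else 0)"
      using True by (intro sum.cong) (auto simp: u_def e)
    then show ?thesis using d by (simp add: S_def)
  next
    case False
    have "(\<Sum>i<d. (norm (u x i))\<^sup>2) = (\<Sum>i<d. (norm (h i x))\<^sup>2 / (r x)\<^sup>2)"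
      using False by (intro sum.cong) (auto simp: u_def power_divide divide_inverse power_mult_distrib power_inverse)
    also have "\<dots> = 1" using False by (simp add: sum_divide_distrib[symmetric] r2)
    finally show ?thesis by (simp add: S_def)
  qed
  have u[measurable]: "u \<in> measurable N (sphere_space d)"
    unfolding sphere_space_def
  proof (rule measurable_restrict_space2)
    show "u \<in> measurable N (\<Pi>\<^sub>M i\<in>{..<d}. borel)"
      unfolding u_def[abs_def] by (rule measurable_restrict) (use h in \<open>auto intro!: measurable_If borel_measurable_scaleR\<close>)
    show "u \<in> space N \<rightarrow> {s. (\<Sum>i<d. (norm (s i))\<^sup>2) = 1}" using uS by (auto simp: S_def)
  qed
  define D where "D = density N (\<lambda>x. ennreal (r x powr \<alpha>))"
  define G where "G = distr D (sphere_space d) u"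
  have uD[measurable]: "u \<in> measurable D (sphere_space d)" by (simp add: D_def)
  have sets_G: "sets G = sets (sphere_space d)" by (simp add: G_def)
  have intr: "integrable N (\<lambda>x. r x powr \<alpha>)"
  proof (rule Bochner_Integration.integrable_bound)
    show "integrable N (\<lambda>x. (\<Sum>i<d. norm (h i x)) powr \<alpha>)"
      by (rule integrable_powr_sum) (use h int \<alpha> in auto)
    have "r x \<le> (\<Sum>i<d. norm (h i x))" for x
      using L2_set_le_sum[of "{..<d}" "\<lambda>i. norm (h i x)"] by (simp add: r_def L2_set_def)
    then show "AE x in N. norm (r x powr \<alpha>) \<le> norm ((\<Sum>i<d. norm (h i x)) powr \<alpha>)"
      using r0 \<alpha> by (auto intro!: powr_mono2)
  qed measurable
  have "finite_measure D"
    using integrableD(2)[OF intr] unfolding D_def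
    by (intro finite_measureI) (simp add: emeasure_density cong: nn_integral_cong)
  then interpret D: finite_measure D .
  have fG: "finite_measure G" unfolding G_def by (rule D.finite_measure_distr) simp
  interpret G: sphere_measure G d by (intro sphere_measure.intro fG sphere_measure_axioms.intro sets_G)
  note neg = G.neg_measurable
  have rT: "r (T x) = r x" if "x \<in> space N" for x
    using odd that by (simp add: r_def)
  have uT: "(\<lambda>i\<in>{..<d}. - u x i) = u (T x)" if "x \<in> space N" "r x \<noteq> 0" for x
    using odd that rT by (auto simp: u_def)
  have emG: "emeasure G A = (\<integral>\<^sup>+x. ennreal (r x powr \<alpha>) * indicator A (u x) \<partial>N)" if A: "A \<in> sets G" for A
  proof -
    have A': "u -` A \<inter> space N \<in> sets N" using measurable_sets[OF u] A sets_G by simp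
    have "emeasure G A = emeasure D (u -` A \<inter> space N)"
      unfolding G_def using A sets_G by (subst emeasure_distr) (auto simp: D_def)
    also have "\<dots> = (\<integral>\<^sup>+x. ennreal (r x powr \<alpha>) * indicator (u -` A \<inter> space N) x \<partial>N)"
      unfolding D_def using A' by (subst emeasure_density) auto
    also have "\<dots> = (\<integral>\<^sup>+x. ennreal (r x powr \<alpha>) * indicator A (u x) \<partial>N)"
      by (intro nn_integral_cong) (auto split: split_indicator)
    finally show ?thesis .
  qed
  have sym: "distr G G (\<lambda>s. \<lambda>i\<in>{..<d}. - s i) = G"
  proof (rule measure_eqI)
    fix A assume "A \<in> sets (distr G G (\<lambda>s. \<lambda>i\<in>{..<d}. - s i))"
    then have A: "A \<in> sets G" by simp
    then have [measurable]: "A \<in> sets (sphere_space d)" by (simp add: sets_G)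
    have A2: "(\<lambda>s. \<lambda>i\<in>{..<d}. - s i) -` A \<inter> space G \<in> sets G" using measurable_sets[OF neg A] .
    have usp: "u x \<in> space G" if "x \<in> space N" for x
      using measurable_space[OF u that] sets_eq_imp_space_eq[OF sets_G] by simp
    have "emeasure (distr G G (\<lambda>s. \<lambda>i\<in>{..<d}. - s i)) A = (\<integral>\<^sup>+x. ennreal (r x powr \<alpha>) * indicator A (\<lambda>i\<in>{..<d}. - u x i) \<partial>N)"
      using A A2 neg usp by (subst emeasure_distr) (auto simp: emG intro!: nn_integral_cong split: split_indicator)
    also have "\<dots> = (\<integral>\<^sup>+x. ennreal (r (T x) powr \<alpha>) * indicator A (u (T x)) \<partial>N)"
    proof (rule nn_integral_cong)
      fix x assume x: "x \<in> space N"
      \<comment> \<open>Where r = 0 the default direction is not odd under \<open>T\<close>, but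
        both sides carry the factor 0.\<close>
      show "ennreal (r x powr \<alpha>) * indicator A (\<lambda>i\<in>{..<d}. - u x i) = ennreal (r (T x) powr \<alpha>) * indicator A (u (T x))"
        using uT[OF x] rT[OF x] by (cases "r x = 0") auto
    qed
    also have "\<dots> = (\<integral>\<^sup>+x. ennreal (r x powr \<alpha>) * indicator A (u x) \<partial>distr N N T)"
      by (rule nn_integral_distr[OF T(1), symmetric]) (simp add: T(2))
    also have "\<dots> = emeasure G A" by (simp add: T(2) emG[OF A])
    finally show "emeasure (distr G G (\<lambda>s. \<lambda>i\<in>{..<d}. - s i)) A = emeasure G A" .
  qed simp
  have "(LINT s|G. \<bar>\<Sum>i<d. \<theta> i \<bullet> s i\<bar> powr \<alpha>) = (LINT x|N. \<bar>\<Sum>i<d. \<theta> i \<bullet> h i x\<bar> powr \<alpha>)" for \<theta>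
  proof -
    have m: "(\<lambda>s. \<bar>\<Sum>i<d. \<theta> i \<bullet> s i\<bar> powr \<alpha>) \<in> borel_measurable (sphere_space d)"
    proof -
      have "(\<lambda>s. \<bar>\<Sum>i<d. \<theta> i \<bullet> s i\<bar> powr \<alpha>) \<in> borel_measurable G"
        using G.inner_measurable[of \<theta>] by measurable
      then show ?thesis by (simp only: measurable_cong_sets[OF sets_G refl])
    qed
    have "(LINT s|G. \<bar>\<Sum>i<d. \<theta> i \<bullet> s i\<bar> powr \<alpha>) = (LINT x|D. \<bar>\<Sum>i<d. \<theta> i \<bullet> u x i\<bar> powr \<alpha>)"
      unfolding G_def by (rule integral_distr[OF uD m])
    also have "\<dots> = (LINT x|N. r x powr \<alpha> *\<^sub>R \<bar>\<Sum>i<d. \<theta> i \<bullet> u x i\<bar> powr \<alpha>)"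
      unfolding D_def using measurable_compose[OF u m] by (subst integral_density) auto
    also have "\<dots> = (LINT x|N. \<bar>\<Sum>i<d. \<theta> i \<bullet> h i x\<bar> powr \<alpha>)"
    proof (rule Bochner_Integration.integral_cong[OF refl])
      fix x
      have "(\<Sum>i<d. \<theta> i \<bullet> h i x) = (\<Sum>i<d. \<theta> i \<bullet> (r x *\<^sub>R u x i))" by (intro sum.cong) (auto simp: ru)
      also have "\<dots> = r x * (\<Sum>i<d. \<theta> i \<bullet> u x i)" by (simp add: sum_distrib_left)
      finally show "r x powr \<alpha> *\<^sub>R \<bar>\<Sum>i<d. \<theta> i \<bullet> u x i\<bar> powr \<alpha> = \<bar>\<Sum>i<d. \<theta> i \<bullet> h i x\<bar> powr \<alpha>"
        using r0[of x] by (simp add: abs_mult powr_mult)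
    qed
    finally show ?thesis .
  qed
  then show ?thesis using that[OF sets_G fG sym] by blast
qed

lemma is_spectral_measureD:
  assumes "is_spectral_measure \<alpha> M d X G"
  shows "symmetric_sphere_measure G d"
    "(CLINT \<omega>|M. iexp (\<Sum>i<d. \<theta> i \<bullet> X i \<omega>)) = of_real (exp (- (LINT s|G. \<bar>\<Sum>i<d. \<theta> i \<bullet> s i\<bar> powr \<alpha>)))"
  using assms unfolding is_spectral_measure_def
  by (auto intro!: symmetric_sphere_measure.intro sphere_measure.intro sphere_measure_axioms.intro
    symmetric_sphere_measure_axioms.intro)

lemma is_spectral_measure_spectral_measure:
  "sas_vector \<alpha> M d X \<Longrightarrow> is_spectral_measure \<alpha> M d X (spectral_measure \<alpha> M d X)"
  unfolding sas_vector_def spectral_measure_def by (auto intro: someI_ex)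

lemma sas_vectorI:
  fixes h :: "nat \<Rightarrow> 'b \<Rightarrow> 'a::euclidean_space"
  assumes "0 < \<alpha>" "0 < d" "T \<in> measurable N N" "distr N N T = N"
    and "\<And>i. i < d \<Longrightarrow> h i \<in> borel_measurable N"
    and "\<And>i x. i < d \<Longrightarrow> x \<in> space N \<Longrightarrow> h i (T x) = - h i x"
    and "\<And>i. i < d \<Longrightarrow> integrable N (\<lambda>x. norm (h i x) powr \<alpha>)"
    and "\<And>i. i < d \<Longrightarrow> X i \<in> borel_measurable M"
    and "\<And>\<theta>. (CLINT \<omega>|M. iexp (\<Sum>i<d. \<theta> i \<bullet> X i \<omega>)) =
        of_real (exp (- (LINT x|N. \<bar>\<Sum>i<d. \<theta> i \<bullet> h i x\<bar> powr \<alpha>)))"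
  shows "sas_vector \<alpha> M d X"
proof -
  obtain G where "sets G = sets (sphere_space d :: (nat \<Rightarrow> 'a) measure)" "finite_measure G"
    "distr G G (\<lambda>s. \<lambda>i\<in>{..<d}. - s i) = G"
    "\<And>\<theta>. (LINT s|G. \<bar>\<Sum>i<d. \<theta> i \<bullet> s i\<bar> powr \<alpha>) = (LINT x|N. \<bar>\<Sum>i<d. \<theta> i \<bullet> h i x\<bar> powr \<alpha>)"
    using exists_spectral_measure[where h=h, OF assms(1-7)] by blast
  then have "is_spectral_measure \<alpha> M d X G"
    unfolding is_spectral_measure_def using assms(9) by auto
  then show ?thesis unfolding sas_vector_def using assms(8) by auto
qed

lemma (in sphere_measure) integrable_component_powr:
  assumes "j < n" "0 < \<alpha>"
  shows "integrable G (\<lambda>s. norm (s j) powr \<alpha>)"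
proof (rule integrable_const_bound[where B=1])
  have [measurable]: "(\<lambda>s. s j) \<in> borel_measurable G" using assms(1) by simp
  show "(\<lambda>s. norm (s j) powr \<alpha>) \<in> borel_measurable G" by measurable
  show "AE s in G. norm (norm (s j) powr \<alpha>) \<le> 1"
    using norm_component_le[OF _ assms(1)] assms(2) powr_mono2[of \<alpha> _ 1] by auto
qed

text \<open>Whichever spectral measure \<open>SOME\<close> returns, it has the same joint exponent
  as (h, g) on \<open>N\<close>, so \<open>covariation_integral_unique\<close> identifies the two
  integrals. Any L^\<alpha> representation of the pair may serve to compute the covariation.\<close>

lemma covariation_real_eq:
  fixes h g :: "'b \<Rightarrow> real"
  assumes \<alpha>: "1 < \<alpha>" and sas: "sas_vector \<alpha> M 2 (pair_vector X Y)"
    and m: "h \<in> borel_measurable N" "g \<in> borel_measurable N"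
    and i: "integrable N (\<lambda>x. \<bar>h x\<bar> powr \<alpha>)" "integrable N (\<lambda>x. \<bar>g x\<bar> powr \<alpha>)"
    and cf: "\<And>a b::real. (CLINT \<omega>|M. iexp (a * X \<omega> + b * Y \<omega>)) = of_real (exp (- (LINT x|N. \<bar>a * h x + b * g x\<bar> powr \<alpha>)))"
  shows "covariation_real \<alpha> M X Y = (LINT x|N. h x * spow_real (\<alpha> - 1) (g x))"
proof -
  define G where "G = spectral_measure \<alpha> M 2 (pair_vector X Y)"
  have G: "is_spectral_measure \<alpha> M 2 (pair_vector X Y) G"
    unfolding G_def by (rule is_spectral_measure_spectral_measure[OF sas])
  interpret G: symmetric_sphere_measure G 2 by (rule is_spectral_measureD[OF G])
  have s2: "(\<Sum>i<2. f i) = f 0 + f 1" for f :: "nat \<Rightarrow> real" by (simp add: numeral_2_eq_2)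
  have "(LINT s|G. \<bar>t * s 0 + 1 * s 1\<bar> powr \<alpha>) = (LINT x|N. \<bar>t * h x + 1 * g x\<bar> powr \<alpha>)" for t
  proof -
    define \<theta> where "\<theta> i = (if i = 0 then t else 1)" for i :: nat
    have "of_real (exp (- (LINT s|G. \<bar>\<Sum>i<2. \<theta> i \<bullet> s i\<bar> powr \<alpha>))) = (CLINT \<omega>|M. iexp (\<Sum>i<2. \<theta> i \<bullet> pair_vector X Y i \<omega>))"
      using is_spectral_measureD(2)[OF G, of \<theta>] by simp
    also have "\<dots> = of_real (exp (- (LINT x|N. \<bar>t * h x + 1 * g x\<bar> powr \<alpha>)))"
      using cf[of t 1] by (simp add: s2 \<theta>_def pair_vector_def del: of_real_add of_real_mult)
    finally show ?thesis by (simp add: s2 \<theta>_def)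
  qed
  then show ?thesis
    unfolding covariation_real_def G_def[symmetric]
    using G.integrable_component_powr[of _ \<alpha>] \<alpha> m i
    by (intro covariation_integral_unique) auto
qed

lemma integrable_inner_powr:
  fixes f :: "'b \<Rightarrow> 'a::euclidean_space"
  assumes [measurable]: "f \<in> borel_measurable L" and i: "integrable L (\<lambda>x. norm (f x) powr \<alpha>)" and \<alpha>: "0 < \<alpha>"
  shows "integrable L (\<lambda>x. \<bar>v \<bullet> f x\<bar> powr \<alpha>)"
proof -
  have "integrable L (\<lambda>x. norm v powr \<alpha> * norm (f x) powr \<alpha>)" using i by simp
  then have "integrable L (\<lambda>x. (norm v * norm (f x)) powr \<alpha>)" by (simp add: powr_mult)
  from integrable_powr_mono[OF _ this, of "\<lambda>x. v \<bullet> f x"] show ?thesis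
    using \<alpha> Cauchy_Schwarz_ineq2 by auto
qed

text \<open>For directions v and u, the real uniqueness statement applies to the projections of the
  two components. Averaging over u rebuilds \<open>spow\<close> with the same nonzero factor
  \<open>K\<close> on both sides, and v = 1 and v = \<i> rebuild the first component.\<close>

lemma covariation_eq:
  fixes h g :: "'b \<Rightarrow> complex"
  assumes \<alpha>: "1 < \<alpha>" and sas: "sas_vector \<alpha> M 2 (pair_vector X Y)" and N: "sigma_finite_measure N"
    and m[measurable]: "h \<in> borel_measurable N" "g \<in> borel_measurable N"
    and i: "integrable N (\<lambda>x. norm (h x) powr \<alpha>)" "integrable N (\<lambda>x. norm (g x) powr \<alpha>)"
    and cf: "\<And>a b::complex. (CLINT \<omega>|M. iexp (a \<bullet> X \<omega> + b \<bullet> Y \<omega>)) = of_real (exp (- (LINT x|N. \<bar>a \<bullet> h x + b \<bullet> g x\<bar> powr \<alpha>)))"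
  shows "covariation \<alpha> M X Y = (CLINT x|N. h x * spow (\<alpha> - 1) (g x))"
proof -
  define G where "G = spectral_measure \<alpha> M 2 (pair_vector X Y)"
  have G: "is_spectral_measure \<alpha> M 2 (pair_vector X Y) G"
    unfolding G_def by (rule is_spectral_measure_spectral_measure[OF sas])
  interpret G: symmetric_sphere_measure G 2 by (rule is_spectral_measureD[OF G])
  have s2: "(\<Sum>i<2. f i) = f 0 + f 1" for f :: "nat \<Rightarrow> real" by (simp add: numeral_2_eq_2)
  have mG[measurable]: "(\<lambda>s. s 0) \<in> borel_measurable G" "(\<lambda>s. s 1) \<in> borel_measurable G" by simp_all
  have sG: "sigma_finite_measure G" by unfold_locales
  have iG: "integrable G (\<lambda>s. norm (s 0) powr \<alpha>)" "integrable G (\<lambda>s. norm (s 1) powr \<alpha>)"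
    using G.integrable_component_powr[of _ \<alpha>] \<alpha> by auto
  have eq: "(LINT s|G. (v \<bullet> s 0) * spow_real (\<alpha> - 1) (u \<bullet> s 1)) = (LINT x|N. (v \<bullet> h x) * spow_real (\<alpha> - 1) (u \<bullet> g x))" for u v
  proof (rule covariation_integral_unique[OF \<alpha>])
    fix t :: real
    define \<theta> where "\<theta> i = (if i = 0 then t *\<^sub>R v else u)" for i :: nat
    have "of_real (exp (- (LINT s|G. \<bar>\<Sum>i<2. \<theta> i \<bullet> s i\<bar> powr \<alpha>))) = (CLINT \<omega>|M. iexp (\<Sum>i<2. \<theta> i \<bullet> pair_vector X Y i \<omega>))"
      using is_spectral_measureD(2)[OF G, of \<theta>] by simp
    also have "\<dots> = of_real (exp (- (LINT x|N. \<bar>(t *\<^sub>R v) \<bullet> h x + u \<bullet> g x\<bar> powr \<alpha>)))"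
      using cf[of "t *\<^sub>R v" u] by (simp add: s2 \<theta>_def pair_vector_def del: of_real_add of_real_mult inner_scaleR_left)
    finally show "(LINT s|G. \<bar>t * (v \<bullet> s 0) + u \<bullet> s 1\<bar> powr \<alpha>) = (LINT x|N. \<bar>t * (v \<bullet> h x) + u \<bullet> g x\<bar> powr \<alpha>)"
      by (simp add: s2 \<theta>_def)
  qed (use \<alpha> in \<open>auto intro!: integrable_inner_powr iG iG[unfolded One_nat_def] i\<close>)
  obtain K where K: "K \<noteq> 0"
    "\<And>z. (CLINT u|circle. of_real (spow_real (\<alpha> - 1) (u \<bullet> z)) * cnj u) = K * spow (\<alpha> - 1) z"
    using integral_circle_spow[OF \<alpha>] by blast
  note FG = integral_spow_circle_Fubini[OF \<alpha> sG mG iG K(2)]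
  note FN = integral_spow_circle_Fubini[OF \<alpha> N m i K(2)]
  have part: "(CLINT s|G. of_real (v \<bullet> s 0) * spow (\<alpha> - 1) (s 1)) = (CLINT x|N. of_real (v \<bullet> h x) * spow (\<alpha> - 1) (g x))" for v
    by (rule mult_left_cancel[THEN iffD1, OF K(1) FG(2)[of v, unfolded eq[of v], folded FN(2)[of v]]])
  have dec: "z * w = of_real (1 \<bullet> z) * w + \<i> * (of_real (\<i> \<bullet> z) * w)" for z w :: complex
    by (simp add: complex_eq_iff inner_complex_def)
  have "covariation \<alpha> M X Y = (CLINT s|G. of_real (1 \<bullet> s 0) * spow (\<alpha> - 1) (s 1)) + \<i> * (CLINT s|G. of_real (\<i> \<bullet> s 0) * spow (\<alpha> - 1) (s 1))"
    unfolding covariation_def G_def[symmetric] dec[of "_ 0"]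
    using FG(1)[of 1] FG(1)[of \<i>] by (subst Bochner_Integration.integral_add) (simp_all only: integral_mult_right_zero integrable_mult_right)
  also have "\<dots> = (CLINT x|N. h x * spow (\<alpha> - 1) (g x))"
    unfolding part dec[of "h _"]
    using FN(1)[of 1] FN(1)[of \<i>] by (subst Bochner_Integration.integral_add) (simp_all only: integral_mult_right_zero integrable_mult_right)
  finally show ?thesis .
qed

section \<open>The variation measure\<close>

lemma inverse_1_plus_ennreal_le_iff: "inverse (1 + x) \<le> inverse (1 + y) \<longleftrightarrow> y \<le> (x :: ennreal)"
proof (cases x; cases y)
  fix a b :: real
  assume *: "0 \<le> a" "x = ennreal a" "0 \<le> b" "y = ennreal b"
  have "inverse (1 + ennreal c) = ennreal (inverse (1 + c))" if "0 \<le> c" for c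
    using that by (subst inverse_ennreal[symmetric]) (auto simp: ennreal_plus simp flip: ennreal_1)
  then show ?thesis using * by (auto simp: ennreal_le_iff)
next
  fix a :: real
  assume *: "0 \<le> a" "x = ennreal a" "y = top"
  then show ?thesis by (simp add: top_unique)
qed (auto simp: top_unique)

lemma tendsto_inverse_1_plus_ennreal:
  assumes "(f \<longlongrightarrow> (x :: ennreal)) F"
  shows "((\<lambda>n. inverse (1 + f n)) \<longlongrightarrow> inverse (1 + x)) F"
proof -
  have "continuous_on UNIV (\<lambda>x. inverse (1 + (x::ennreal)))"
    by (intro continuous_on_inverse_ennreal continuous_on_add_ennreal continuous_on_const continuous_on_id)
  from continuous_on_tendsto_compose[OF this assms] show ?thesis by simp
qed

text \<open>The functions may be infinite, so instead of maximising an integral one minimises the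
  bounded functional \<phi>(g) = \<integral> 1/(1 + g). Let v be the supremum of an almost surely
  increasing minimising sequence. By directedness max(f, v) cannot have a smaller value of \<phi>
  than v, and equality of the integrals forces f \<le> v almost everywhere.\<close>

lemma (in finite_measure) directed_maximizing_sequence:
  fixes G :: "('a \<Rightarrow> ennreal) set"
  assumes meas: "\<And>g. g \<in> G \<Longrightarrow> g \<in> borel_measurable M" and ne: "G \<noteq> {}"
    and dir: "\<And>f g. f \<in> G \<Longrightarrow> g \<in> G \<Longrightarrow> \<exists>h\<in>G. AE x in M. f x \<le> h x \<and> g x \<le> h x"
  obtains h where "\<And>n. h n \<in> G" "\<And>n. AE x in M. h n x \<le> h (Suc n) x"
    "\<And>g. g \<in> G \<Longrightarrow> AE x in M. g x \<le> (SUP n::nat. h n x)"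
proof -
  define \<phi> where "\<phi> g = (\<integral>\<^sup>+x. inverse (1 + g x) \<partial>M)" for g :: "'a \<Rightarrow> ennreal"
  have \<phi>_mono: "\<phi> g \<le> \<phi> f" if "AE x in M. f x \<le> g x" for f g
    unfolding \<phi>_def using that by (intro nn_integral_mono_AE) (auto simp: inverse_1_plus_ennreal_le_iff)
  have le1: "inverse (1 + x) \<le> 1" for x :: ennreal
    using inverse_1_plus_ennreal_le_iff[of x 0] by simp
  have \<phi>_fin: "\<phi> g < \<infinity>" for g
  proof -
    have "\<phi> g \<le> (\<integral>\<^sup>+x. 1 \<partial>M)" unfolding \<phi>_def by (intro nn_integral_mono le1)
    also have "\<dots> < \<infinity>" by (simp add: less_top[symmetric])
    finally show ?thesis .
  qed
  define I where "I = (INF g\<in>G. \<phi> g)"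
  have I_fin: "I < \<infinity>" using ne \<phi>_fin unfolding I_def by (meson INF_lower all_not_in_conv le_less_trans)
  have "\<exists>g\<in>G. \<phi> g < I + ennreal (1 / Suc n)" for n
  proof -
    have "I < I + ennreal (1 / Suc n)" using I_fin by (cases I) (auto simp: ennreal_plus[symmetric] simp del: ennreal_plus intro!: ennreal_lessI add_nonneg_pos)
    then show ?thesis unfolding I_def by (simp add: INF_less_iff)
  qed
  then obtain g where g: "\<And>n. g n \<in> G" "\<And>n. \<phi> (g n) < I + ennreal (1 / Suc n)" by metis
  \<comment> \<open>Directedness is used at each stage to find an element above both the current one
    and the next term of the minimising sequence.\<close>
  have "\<exists>h. \<forall>n. (h n \<in> G \<and> (AE x in M. g n x \<le> h n x)) \<and> (AE x in M. h n x \<le> h (Suc n) x)"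
  proof (rule dependent_nat_choice)
    show "\<exists>x. x \<in> G \<and> (AE y in M. g 0 y \<le> x y)" using g by auto
    fix h n assume "h \<in> G \<and> (AE y in M. g n y \<le> h y)"
    then have "h \<in> G" by auto
    from dir[OF this g(1)[of "Suc n"]] obtain k where "k \<in> G" "AE x in M. h x \<le> k x \<and> g (Suc n) x \<le> k x" by auto
    then show "\<exists>k. (k \<in> G \<and> (AE y in M. g (Suc n) y \<le> k y)) \<and> (AE y in M. h y \<le> k y)"
      by (intro exI[of _ k]) auto
  qed
  then obtain h where h: "\<And>n. h n \<in> G" "\<And>n. AE x in M. g n x \<le> h n x" "\<And>n. AE x in M. h n x \<le> h (Suc n) x" by auto
  define v where "v x = (SUP n. h n x)" for x
  have [measurable]: "h n \<in> borel_measurable M" for n using meas h(1) by auto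
  have [measurable]: "v \<in> borel_measurable M" unfolding v_def[abs_def] by measurable
  have "\<phi> v \<le> I + ennreal (1 / Suc n)" for n
  proof -
    have "\<phi> v \<le> \<phi> (h n)" by (intro \<phi>_mono AE_I2) (auto simp: v_def intro: SUP_upper)
    also have "\<dots> \<le> \<phi> (g n)" by (intro \<phi>_mono h)
    finally show ?thesis using g(2)[of n] by auto
  qed
  moreover have "(\<lambda>n. I + ennreal (1 / Suc n)) \<longlonglongrightarrow> I + ennreal 0"
    by (intro tendsto_add tendsto_const tendsto_ennrealI LIMSEQ_inverse_real_of_nat[unfolded inverse_eq_divide])
  ultimately have vI: "\<phi> v \<le> I"
    by (intro LIMSEQ_le_const[of "\<lambda>n. I + ennreal (1 / Suc n)"]) auto
  have "AE x in M. f x \<le> v x" if f: "f \<in> G" for f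
  proof -
    have [measurable]: "f \<in> borel_measurable M" using f meas by auto
    have inc: "AE x in M. incseq (\<lambda>n. h n x)"
      using h(3) by (auto simp: incseq_Suc_iff AE_all_countable)
    have lim: "(\<lambda>n. \<phi> (\<lambda>x. max (f x) (h n x))) \<longlonglongrightarrow> \<phi> (\<lambda>x. max (f x) (v x))"
      unfolding \<phi>_def
    proof (rule nn_integral_dominated_convergence[where w="\<lambda>_. 1"])
      show "AE x in M. (\<lambda>n. inverse (1 + max (f x) (h n x))) \<longlonglongrightarrow> inverse (1 + max (f x) (v x))"
        using inc
      proof eventually_elim
        case (elim x)
        then have "(\<lambda>n. h n x) \<longlonglongrightarrow> v x" unfolding v_def by (rule LIMSEQ_SUP)
        then show ?case by (intro tendsto_inverse_1_plus_ennreal tendsto_max tendsto_const)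
      qed
      show "(\<integral>\<^sup>+x. 1 \<partial>M) < \<infinity>" by (simp add: less_top[symmetric])
    qed (auto simp: le1)
    have "I \<le> \<phi> (\<lambda>x. max (f x) (h n x))" for n
    proof -
      obtain k where k: "k \<in> G" "AE x in M. f x \<le> k x \<and> h n x \<le> k x" using dir[OF f h(1)[of n]] by auto
      have "I \<le> \<phi> k" unfolding I_def using k by (intro INF_lower)
      also have "\<dots> \<le> \<phi> (\<lambda>x. max (f x) (h n x))" using k(2) by (intro \<phi>_mono) auto
      finally show ?thesis .
    qed
    then have mI: "I \<le> \<phi> (\<lambda>x. max (f x) (v x))" using lim by (intro LIMSEQ_le_const[OF lim]) auto
    have "(\<integral>\<^sup>+x. inverse (1 + v x) - inverse (1 + max (f x) (v x)) \<partial>M) = \<phi> v - \<phi> (\<lambda>x. max (f x) (v x))"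
      unfolding \<phi>_def
      by (rule nn_integral_diff) (use \<phi>_fin[of "\<lambda>x. max (f x) (v x)"] in \<open>auto simp: \<phi>_def inverse_1_plus_ennreal_le_iff\<close>)
    also have "\<dots> = 0" using vI mI by (intro diff_eq_0_ennreal) (use le_less_trans[OF vI I_fin] in auto)
    finally have "AE x in M. inverse (1 + v x) - inverse (1 + max (f x) (v x)) = 0"
      by (subst (asm) nn_integral_0_iff_AE) auto
    then show ?thesis
    proof eventually_elim
      case (elim x)
      have "inverse (1 + v x) \<le> inverse (1 + max (f x) (v x))"
        using elim le1[of "v x"] by (subst (asm) diff_eq_0_iff_ennreal) (auto simp: top_unique)
      then show ?case by (simp add: inverse_1_plus_ennreal_le_iff)
    qed
  qed
  then show ?thesis using that h unfolding v_def by blast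
qed

text \<open>The supremum of the monotone sequence is a least upper bound and agrees almost
  everywhere with any other one; monotone convergence then moves the supremum outside the integral.
  Being valid for every essential supremum, the formula covers the one chosen in
  \<open>total_variation\<close>.\<close>

lemma (in finite_measure) is_ess_supremum_directed:
  fixes G :: "('a \<Rightarrow> ennreal) set"
  assumes meas: "\<And>g. g \<in> G \<Longrightarrow> g \<in> borel_measurable M" and ne: "G \<noteq> {}"
    and dir: "\<And>f g. f \<in> G \<Longrightarrow> g \<in> G \<Longrightarrow> \<exists>h\<in>G. AE x in M. f x \<le> h x \<and> g x \<le> h x"
  shows "\<exists>v. is_ess_supremum M G v"
    "is_ess_supremum M G w \<Longrightarrow> (\<integral>\<^sup>+x. w x \<partial>M) = (SUP g\<in>G. \<integral>\<^sup>+x. g x \<partial>M)"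
proof -
  obtain h where h: "\<And>n. h n \<in> G" "\<And>n. AE x in M. h n x \<le> h (Suc n) x"
    "\<And>g. g \<in> G \<Longrightarrow> AE x in M. g x \<le> (SUP n::nat. h n x)"
    using directed_maximizing_sequence[OF assms] by blast
  have [measurable]: "h n \<in> borel_measurable M" for n using meas h(1) by auto
  define v where "v x = (SUP n. h n x)" for x
  have [measurable]: "v \<in> borel_measurable M" unfolding v_def[abs_def] by measurable
  have least: "AE x in M. v x \<le> w x" if "\<forall>g\<in>G. AE x in M. g x \<le> w x" for w
  proof -
    have "AE x in M. \<forall>n. h n x \<le> w x" using that h(1) by (subst AE_all_countable) auto
    then show ?thesis by eventually_elim (auto simp: v_def intro: SUP_least)
  qed
  have v: "is_ess_supremum M G v"
    unfolding is_ess_supremum_def using h(3) least by (auto simp: v_def[abs_def])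
  then show "\<exists>v. is_ess_supremum M G v" by auto
  assume w: "is_ess_supremum M G w"
  have "AE x in M. w x = v x"
  proof -
    have "AE x in M. w x \<le> v x" "AE x in M. v x \<le> w x" using v w unfolding is_ess_supremum_def by auto
    then show ?thesis by eventually_elim simp
  qed
  then have "(\<integral>\<^sup>+x. w x \<partial>M) = (\<integral>\<^sup>+x. v x \<partial>M)" by (rule nn_integral_cong_AE)
  also have "\<dots> = (SUP n. \<integral>\<^sup>+x. h n x \<partial>M)"
    unfolding v_def using h(2) by (intro nn_integral_monotone_convergence_SUP_AE) auto
  finally have eq: "(\<integral>\<^sup>+x. w x \<partial>M) = (SUP n. \<integral>\<^sup>+x. h n x \<partial>M)" .
  show "(\<integral>\<^sup>+x. w x \<partial>M) = (SUP g\<in>G. \<integral>\<^sup>+x. g x \<partial>M)"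
  proof (rule antisym)
    show "(\<integral>\<^sup>+x. w x \<partial>M) \<le> (SUP g\<in>G. \<integral>\<^sup>+x. g x \<partial>M)"
      unfolding eq using h(1) by (intro SUP_least SUP_upper)
    show "(SUP g\<in>G. \<integral>\<^sup>+x. g x \<partial>M) \<le> (\<integral>\<^sup>+x. w x \<partial>M)"
      using w unfolding is_ess_supremum_def by (intro SUP_least nn_integral_mono_AE) auto
  qed
qed

text \<open>The subsequence is chosen so that the k-th deviation exceeds 2^-k with probability below
  2^-k, and the Borel--Cantelli lemma applies.\<close>

lemma (in prob_space) tendsto_in_prob_AE_subseq:
  fixes X :: "nat \<Rightarrow> 'a \<Rightarrow> 'b::{real_normed_vector,second_countable_topology}"
  assumes lim: "tendsto_in_prob M X Y sequentially"
    and [measurable]: "\<And>n. X n \<in> borel_measurable M" "Y \<in> borel_measurable M"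
  shows "\<exists>r::nat \<Rightarrow> nat. strict_mono r \<and> (AE x in M. (\<lambda>n. X (r n) x) \<longlonglongrightarrow> Y x)"
proof -
  define A where "A k n = {x \<in> space M. norm (X n x - Y x) \<ge> (1/2)^k}" for k n :: nat
  have [measurable]: "A k n \<in> sets M" for k n unfolding A_def by measurable
  have ev: "eventually (\<lambda>n. measure M (A k n) < (1/2)^k) sequentially" for k
  proof -
    have "(\<lambda>n. measure M (A k n)) \<longlonglongrightarrow> 0" using lim unfolding tendsto_in_prob_def A_def by auto
    then show ?thesis by (rule order_tendstoD) simp
  qed
  have "\<exists>r. \<forall>k. measure M (A k (r k)) < (1/2)^k \<and> r k < r (Suc k)"
  proof (rule dependent_nat_choice)
    show "\<exists>x. measure M (A 0 x) < (1/2)^0" using eventually_happens[OF ev[of 0]] by (simp only: trivial_limit_sequentially simp_thms)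
    fix x n
    from eventually_happens[OF eventually_conj[OF ev[of "Suc n"] eventually_gt_at_top[of x]]]
    show "\<exists>y. measure M (A (Suc n) y) < (1/2)^Suc n \<and> x < y" by (simp only: trivial_limit_sequentially simp_thms)
  qed
  then obtain r where r: "\<And>k. measure M (A k (r k)) < (1/2)^k" "\<And>k. r k < r (Suc k)" by auto
  have "AE x in M. eventually (\<lambda>k. x \<in> space M - A k (r k)) sequentially"
  proof (rule borel_cantelli_AE1)
    show "summable (\<lambda>k. measure M (A k (r k)))"
    proof (rule summable_comparison_test'[of "\<lambda>k. (1/2)^k" 0])
      fix k show "norm (measure M (A k (r k))) \<le> (1/2)^k" using r(1)[of k] by simp
    qed (simp add: summable_geometric)
    show "A k (r k) \<in> sets M" for k by simp
    show "emeasure M (A k (r k)) < \<infinity>" for k by (simp add: less_top[symmetric])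
  qed
  then have "AE x in M. (\<lambda>k. X (r k) x) \<longlonglongrightarrow> Y x"
  proof eventually_elim
    case (elim x)
    have "(\<lambda>k. X (r k) x - Y x) \<longlonglongrightarrow> 0"
    proof (rule Lim_null_comparison)
      show "\<forall>\<^sub>F k in sequentially. norm (X (r k) x - Y x) \<le> (1/2)^k"
        using elim by eventually_elim (auto simp: A_def)
      show "(\<lambda>k. (1/2)^k :: real) \<longlonglongrightarrow> 0" by (rule LIMSEQ_realpow_zero) auto
    qed
    then show ?case by (simp add: LIM_zero_iff)
  qed
  then show ?thesis using r(2) by (intro exI[of _ r]) (simp add: strict_mono_Suc_iff)
qed

section \<open>Random measures additive in probability and their mean variation\<close>

locale random_measure = prob_space M for M :: "'w measure" +
  fixes X :: "real set \<Rightarrow> 'w \<Rightarrow> complex"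
  assumes X_measurable[measurable]: "\<And>A. A \<in> sets borel \<Longrightarrow> X A \<in> borel_measurable M"
    and X_sigma_additive: "\<And>A::nat \<Rightarrow> real set. range A \<subseteq> sets borel \<Longrightarrow> disjoint_family A \<Longrightarrow>
        tendsto_in_prob M (\<lambda>n \<omega>. \<Sum>i<n. X (A i) \<omega>) (X (\<Union>i. A i)) sequentially"
begin

lemma sigma_additive_subseq:
  fixes A :: "nat \<Rightarrow> real set"
  assumes "range A \<subseteq> sets borel" "disjoint_family A"
  shows "\<exists>r::nat \<Rightarrow> nat. strict_mono r \<and> (AE \<omega> in M. (\<lambda>k. \<Sum>i<r k. X (A i) \<omega>) \<longlonglongrightarrow> X (\<Union>i. A i) \<omega>)"
proof -
  have [measurable]: "A i \<in> sets borel" for i using assms by auto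
  have m: "(\<lambda>\<omega>. \<Sum>i<n. X (A i) \<omega>) \<in> borel_measurable M" for n by measurable
  have m': "X (\<Union>i. A i) \<in> borel_measurable M" by (intro X_measurable sets.countable_UN) (use assms in auto)
  show ?thesis by (rule tendsto_in_prob_AE_subseq[OF X_sigma_additive[OF assms] m m'])
qed

text \<open>If all sets are empty, the partial sums along the subsequence are r(k) times the value
  on the empty set. As r(k) is unbounded, convergence forces this value to be 0.\<close>

lemma X_empty: "AE \<omega> in M. X {} \<omega> = 0"
proof -
  have e: "range (\<lambda>_::nat. {}) \<subseteq> sets (borel :: real measure)" "disjoint_family (\<lambda>_::nat. {} :: real set)"
    by (auto simp: disjoint_family_on_def)
  obtain r :: "nat \<Rightarrow> nat" where r: "strict_mono r" "AE \<omega> in M. (\<lambda>k. \<Sum>i<r k. X {} \<omega>) \<longlonglongrightarrow> X (\<Union>i::nat. {}) \<omega>"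
    using sigma_additive_subseq[OF e] by blast
  have lim: "filterlim (\<lambda>k. real (r k)) at_top sequentially"
    by (intro filterlim_compose[OF filterlim_real_sequentially] filterlim_subseq r(1))
  show ?thesis using r(2)
  proof eventually_elim
    case (elim \<omega>)
    have "(\<lambda>k. norm (\<Sum>i<r k. X {} \<omega>)) \<longlonglongrightarrow> norm (X {} \<omega>)" using elim by (intro tendsto_norm) simp
    then have l: "(\<lambda>k. norm (X {} \<omega>) * real (r k)) \<longlonglongrightarrow> norm (X {} \<omega>)" by (simp add: norm_mult mult.commute)
    show ?case
    proof (rule ccontr)
      assume "X {} \<omega> \<noteq> 0"
      then have "filterlim (\<lambda>k. norm (X {} \<omega>) * real (r k)) at_top sequentially"
        by (intro filterlim_tendsto_pos_mult_at_top[OF tendsto_const _ lim]) auto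
      then show False using not_tendsto_and_filterlim_at_infinity[OF sequentially_bot l filterlim_at_top_imp_at_infinity] by simp
    qed
  qed
qed

lemma X_union:
  assumes AB: "A \<in> sets borel" "B \<in> sets borel" "A \<inter> B = {}"
  shows "AE \<omega> in M. X (A \<union> B) \<omega> = X A \<omega> + X B \<omega>"
proof -
  have "range (binaryset A B) \<subseteq> sets borel" using AB by (auto simp: range_binaryset_eq)
  moreover have "disjoint_family (binaryset A B)" using AB by (auto simp: disjoint_family_on_def binaryset_def)
  note e = calculation this
  obtain r :: "nat \<Rightarrow> nat" where r: "strict_mono r" "AE \<omega> in M. (\<lambda>k. \<Sum>i<r k. X (binaryset A B i) \<omega>) \<longlonglongrightarrow> X (\<Union>i. binaryset A B i) \<omega>"
    using sigma_additive_subseq[OF e] by blast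
  note r(2)[unfolded UN_binaryset_eq]
  note r = r(1) this
  show ?thesis using r(2) X_empty
  proof eventually_elim
    case (elim \<omega>)
    have "\<forall>\<^sub>F k in sequentially. (\<Sum>i<r k. X (binaryset A B i) \<omega>) = X A \<omega> + X B \<omega>"
      using eventually_ge_at_top[of "2::nat"]
    proof eventually_elim
      case (elim k)
      then have rk: "2 \<le> r k" using seq_suble[OF r(1), of k] by linarith
      have "(\<Sum>i<r k. X (binaryset A B i) \<omega>) = (\<Sum>i<2. X (binaryset A B i) \<omega>)"
        by (rule sum.mono_neutral_right) (use rk \<open>X {} \<omega> = 0\<close> in \<open>auto simp: binaryset_def\<close>)
      then show ?case by (simp add: numeral_2_eq_2 binaryset_def)
    qed
    then have "(\<lambda>k. \<Sum>i<r k. X (binaryset A B i) \<omega>) \<longlonglongrightarrow> X A \<omega> + X B \<omega>" by (rule tendsto_eventually)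
    then show ?case using elim LIMSEQ_unique by blast
  qed
qed

lemma X_finite_union:
  assumes "finite I" "\<And>i. i \<in> I \<Longrightarrow> A i \<in> sets borel" "disjoint_family_on A I"
  shows "AE \<omega> in M. X (\<Union>i\<in>I. A i) \<omega> = (\<Sum>i\<in>I. X (A i) \<omega>)"
  using assms
proof (induction I)
  case empty
  then show ?case using X_empty by simp
next
  case (insert j I)
  have dj: "disjoint_family_on A I" "A j \<inter> (\<Union>i\<in>I. A i) = {}"
    using insert.prems insert.hyps by (auto simp: disjoint_family_on_def)
  have "AE \<omega> in M. X (A j \<union> (\<Union>i\<in>I. A i)) \<omega> = X (A j) \<omega> + X (\<Union>i\<in>I. A i) \<omega>"
    by (rule X_union) (use insert dj in auto)
  moreover have "AE \<omega> in M. X (\<Union>i\<in>I. A i) \<omega> = (\<Sum>i\<in>I. X (A i) \<omega>)"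
    using insert dj by auto
  ultimately show ?case
    by eventually_elim (use insert.hyps in auto)
qed

definition mean_abs :: "real set \<Rightarrow> ennreal" where
  "mean_abs A = (\<integral>\<^sup>+\<omega>. ennreal (norm (X A \<omega>)) \<partial>M)"

lemma mean_abs_empty: "mean_abs {} = 0"
proof -
  have "mean_abs {} = (\<integral>\<^sup>+\<omega>. 0 \<partial>M)" unfolding mean_abs_def
    using X_empty by (intro nn_integral_cong_AE) auto
  then show ?thesis by simp
qed

text \<open>Almost sure convergence along a subsequence bounds the modulus on the union by the whole
  series of moduli, whose expectation may be taken term by term.\<close>

lemma mean_abs_UN_le:
  assumes A: "range A \<subseteq> sets borel" "disjoint_family A"
  shows "mean_abs (\<Union>i. A i) \<le> (\<Sum>i. mean_abs (A i))"
proof -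
  have [measurable]: "A i \<in> sets borel" for i using A by auto
  obtain r :: "nat \<Rightarrow> nat" where r: "strict_mono r" "AE \<omega> in M. (\<lambda>k. \<Sum>i<r k. X (A i) \<omega>) \<longlonglongrightarrow> X (\<Union>i. A i) \<omega>"
    using sigma_additive_subseq[OF A] by blast
  have "mean_abs (\<Union>i. A i) \<le> (\<integral>\<^sup>+\<omega>. (\<Sum>i. ennreal (norm (X (A i) \<omega>))) \<partial>M)"
    unfolding mean_abs_def
  proof (rule nn_integral_mono_AE)
    show "AE \<omega> in M. ennreal (norm (X (\<Union>i. A i) \<omega>)) \<le> (\<Sum>i. ennreal (norm (X (A i) \<omega>)))"
      using r(2)
    proof eventually_elim
      case (elim \<omega>)
      have lim: "(\<lambda>k. ennreal (norm (\<Sum>i<r k. X (A i) \<omega>))) \<longlonglongrightarrow> ennreal (norm (X (\<Union>i. A i) \<omega>))"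
        by (intro tendsto_ennrealI tendsto_norm elim)
      moreover have "ennreal (norm (\<Sum>i<r k. X (A i) \<omega>)) \<le> (\<Sum>i. ennreal (norm (X (A i) \<omega>)))" for k
      proof -
        have "ennreal (norm (\<Sum>i<r k. X (A i) \<omega>)) \<le> ennreal (\<Sum>i<r k. norm (X (A i) \<omega>))"
          by (intro ennreal_leI norm_sum)
        also have "\<dots> = (\<Sum>i<r k. ennreal (norm (X (A i) \<omega>)))" by (simp add: sum_ennreal)
        also have "\<dots> \<le> (\<Sum>i. ennreal (norm (X (A i) \<omega>)))" by (intro sum_le_suminf) auto
        finally show ?thesis .
      qed
      ultimately show ?case by (intro LIMSEQ_le_const2[OF lim]) auto
    qed
  qed
  also have "\<dots> = (\<Sum>i. mean_abs (A i))"
    unfolding mean_abs_def by (rule nn_integral_suminf) measurable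
  finally show ?thesis .
qed

definition borel_partitions :: "real set \<Rightarrow> real set set set" where
  "borel_partitions A = {P. finite P \<and> partition_on A P \<and> P \<subseteq> sets borel}"

text \<open>Here the supremum stands outside the expectation. That this equals the expectation of
  \<open>total_variation\<close>, where it stands inside, rests on partitions being directed under
  refinement.\<close>

definition variation :: "real set \<Rightarrow> ennreal" where
  "variation A = (SUP P\<in>borel_partitions A. \<Sum>B\<in>P. mean_abs B)"

end

text \<open>Superadditivity gives monotonicity and bounds the partial sums, and countable
  subadditivity gives the converse inequality. Suprema over partitions or subsets yield these two
  halves naturally.\<close>

lemma countably_additive_if_superadditive:
  fixes N :: "real set \<Rightarrow> ennreal"
  assumes super: "\<And>A B. A \<in> sets borel \<Longrightarrow> B \<in> sets borel \<Longrightarrow> A \<inter> B = {} \<Longrightarrow> N A + N B \<le> N (A \<union> B)"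
    and sub: "\<And>A :: nat \<Rightarrow> real set. range A \<subseteq> sets borel \<Longrightarrow> disjoint_family A \<Longrightarrow> N (\<Union>i. A i) \<le> (\<Sum>i. N (A i))"
  shows "countably_additive (sets borel) N"
proof (rule countably_additiveI)
  fix A :: "nat \<Rightarrow> real set"
  assume A: "range A \<subseteq> sets borel" "disjoint_family A"
  have Ab: "A i \<in> sets borel" for i using A by auto
  have mono: "N B \<le> N C" if "B \<in> sets borel" "C \<in> sets borel" "B \<subseteq> C" for B C
  proof -
    have "N B \<le> N B + N (C - B)" by simp
    also have "\<dots> \<le> N (B \<union> (C - B))" by (rule super) (use that in auto)
    finally show ?thesis using that(3) by (simp add: Un_absorb1)
  qed
  have partial: "(\<Sum>i<n. N (A i)) \<le> N (\<Union>i<n. A i)" for n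
  proof (induction n)
    case (Suc n)
    have "A n \<inter> A i = {}" if "i < n" for i using A(2) that by (simp add: disjoint_family_on_def)
    then have "A n \<inter> (\<Union>i<n. A i) = {}" by blast
    then have "N (\<Union>i<n. A i) + N (A n) \<le> N ((\<Union>i<n. A i) \<union> A n)"
      by (intro super) (use Ab in auto)
    also have "(\<Union>i<n. A i) \<union> A n = (\<Union>i<Suc n. A i)" by (auto simp: less_Suc_eq)
    finally have "N (\<Union>i<n. A i) + N (A n) \<le> N (\<Union>i<Suc n. A i)" .
    from order_trans[OF add_right_mono[OF Suc] this] show ?case by (simp only: sum.lessThan_Suc)
  qed simp
  show "(\<Sum>i. N (A i)) = N (\<Union>i. A i)"
  proof (rule antisym)
    show "(\<Sum>i. N (A i)) \<le> N (\<Union>i. A i)"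
      unfolding suminf_eq_SUP
    proof (rule SUP_least)
      fix n
      have "N (\<Union>i<n. A i) \<le> N (\<Union>i. A i)" by (rule mono) (use Ab in auto)
      then show "(\<Sum>i<n. N (A i)) \<le> N (\<Union>i. A i)" by (rule order_trans[OF partial])
    qed
  qed (rule sub[OF A])
qed

text \<open>Distinct pairs of cells can share an intersection only when it is empty, and f vanishes
  there. Passing from pairs to the set of nonempty intersections therefore keeps the sum.\<close>

lemma sum_refinement:
  fixes f :: "'a set \<Rightarrow> 'b::comm_monoid_add"
  assumes P: "finite P" "partition_on A P" and Q: "finite Q" "partition_on B Q" and f: "f {} = 0"
  shows "(\<Sum>C\<in>P. \<Sum>D\<in>Q. f (C \<inter> D)) = sum f ((\<lambda>(C, D). C \<inter> D) ` (P \<times> Q) - {{}})"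
proof -
  have dP: "C = C'" if "C \<in> P" "C' \<in> P" "x \<in> C" "x \<in> C'" for C C' x
    using that P(2) unfolding partition_on_def disjoint_def by blast
  have dQ: "C = C'" if "C \<in> Q" "C' \<in> Q" "x \<in> C" "x \<in> C'" for C C' x
    using that Q(2) unfolding partition_on_def disjoint_def by blast
  have "(\<Sum>C\<in>P. \<Sum>D\<in>Q. f (C \<inter> D)) = (\<Sum>p\<in>P \<times> Q. f (case p of (C, D) \<Rightarrow> C \<inter> D))"
    by (simp add: sum.cartesian_product split_beta)
  also have "\<dots> = sum f ((\<lambda>(C, D). C \<inter> D) ` (P \<times> Q))"
  proof (subst sum.reindex_nontrivial)
    fix p q assume pq: "p \<in> P \<times> Q" "q \<in> P \<times> Q" "p \<noteq> q" "(case p of (C, D) \<Rightarrow> C \<inter> D) = (case q of (C, D) \<Rightarrow> C \<inter> D)"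
    have "(case p of (C, D) \<Rightarrow> C \<inter> D) = {}"
    proof (rule ccontr)
      assume "(case p of (C, D) \<Rightarrow> C \<inter> D) \<noteq> {}"
      then obtain x where "x \<in> (case p of (C, D) \<Rightarrow> C \<inter> D)" by auto
      then have "x \<in> fst p" "x \<in> snd p" "x \<in> fst q" "x \<in> snd q" using pq(4) by (auto simp: split_beta)
      then have "fst p = fst q" "snd p = snd q"
        using dP[of "fst p" "fst q" x] dQ[of "snd p" "snd q" x] pq(1,2) by auto
      then show False using pq(3) by (simp add: prod_eq_iff)
    qed
    then show "f (case p of (C, D) \<Rightarrow> C \<inter> D) = 0" using f by simp
  qed (use P Q in \<open>auto simp: comp_def\<close>)
  also have "\<dots> = sum f ((\<lambda>(C, D). C \<inter> D) ` (P \<times> Q) - {{}})"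
    by (rule sum.mono_neutral_right) (use P Q f in auto)
  finally show ?thesis .
qed

lemma partition_on_refinement:
  assumes "partition_on A P" "partition_on A Q"
  shows "partition_on A ((\<lambda>(C, D). C \<inter> D) ` (P \<times> Q) - {{}})"
proof (rule partition_onI)
  have "\<Union> ((\<lambda>(C, D). C \<inter> D) ` (P \<times> Q) - {{}}) = \<Union>P \<inter> \<Union>Q" by auto
  then show "\<Union> ((\<lambda>(C, D). C \<inter> D) ` (P \<times> Q) - {{}}) = A"
    using assms by (simp add: partition_on_def)
  fix p q assume pq: "p \<in> (\<lambda>(C, D). C \<inter> D) ` (P \<times> Q) - {{}}" "q \<in> (\<lambda>(C, D). C \<inter> D) ` (P \<times> Q) - {{}}" "p \<noteq> q"
  then obtain C D C' D' where c: "C \<in> P" "D \<in> Q" "C' \<in> P" "D' \<in> Q" "p = C \<inter> D" "q = C' \<inter> D'" by auto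
  then have "C \<noteq> C' \<or> D \<noteq> D'" using pq by auto
  then have "C \<inter> C' = {} \<or> D \<inter> D' = {}"
    using c assms by (auto simp: partition_on_def dest: disjointD)
  then show "disjnt p q" using c by (auto simp: disjnt_def)
qed auto

context random_measure
begin

lemma borel_partitions_refinement:
  assumes "P \<in> borel_partitions A" "Q \<in> borel_partitions A"
  shows "(\<lambda>(C, D). C \<inter> D) ` (P \<times> Q) - {{}} \<in> borel_partitions A"
  using assms partition_on_refinement[of A P Q] by (auto simp: borel_partitions_def)

text \<open>The value on a cell is almost surely the sum over its pieces, so by the triangle
  inequality the sums of norms grow under refinement. Only finitely many null sets are
  involved.\<close>

lemma sum_norm_refinement_le:
  assumes P: "P \<in> borel_partitions A" and Q: "Q \<in> borel_partitions A"
  shows "AE \<omega> in M. (\<Sum>B\<in>P. ennreal (norm (X B \<omega>))) \<le> (\<Sum>B\<in>(\<lambda>(C, D). C \<inter> D) ` (P \<times> Q) - {{}}. ennreal (norm (X B \<omega>)))"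
proof -
  have fin: "finite P" "finite Q" and pP: "partition_on A P" and pQ: "partition_on A Q"
    and bP: "P \<subseteq> sets borel" "Q \<subseteq> sets borel"
    using P Q by (auto simp: borel_partitions_def)
  have "AE \<omega> in M. X C \<omega> = (\<Sum>D\<in>Q. X (C \<inter> D) \<omega>)" if C: "C \<in> P" for C
  proof -
    have "(\<Union>D\<in>Q. C \<inter> D) = C" using C pP pQ by (auto simp: partition_on_def)
    moreover have "AE \<omega> in M. X (\<Union>D\<in>Q. C \<inter> D) \<omega> = (\<Sum>D\<in>Q. X (C \<inter> D) \<omega>)"
    proof (rule X_finite_union)
      show "disjoint_family_on (\<lambda>D. C \<inter> D) Q"
        using pQ by (auto simp: disjoint_family_on_def partition_on_def dest: disjointD)
    qed (use fin C bP in auto)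
    ultimately show ?thesis by simp
  qed
  then have "AE \<omega> in M. \<forall>C\<in>P. X C \<omega> = (\<Sum>D\<in>Q. X (C \<inter> D) \<omega>)" using fin by (intro AE_finite_allI) auto
  then show ?thesis using X_empty
  proof eventually_elim
    case (elim \<omega>)
    have "(\<Sum>C\<in>P. ennreal (norm (X C \<omega>))) \<le> (\<Sum>C\<in>P. \<Sum>D\<in>Q. ennreal (norm (X (C \<inter> D) \<omega>)))"
    proof (rule sum_mono)
      fix C assume "C \<in> P"
      then have "ennreal (norm (X C \<omega>)) \<le> ennreal (\<Sum>D\<in>Q. norm (X (C \<inter> D) \<omega>))"
        using elim by (auto intro!: ennreal_leI norm_sum)
      then show "ennreal (norm (X C \<omega>)) \<le> (\<Sum>D\<in>Q. ennreal (norm (X (C \<inter> D) \<omega>)))"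
        by (simp add: sum_ennreal)
    qed
    also have "\<dots> = (\<Sum>B\<in>(\<lambda>(C, D). C \<inter> D) ` (P \<times> Q) - {{}}. ennreal (norm (X B \<omega>)))"
      by (rule sum_refinement[OF fin(1) pP fin(2) pQ]) (simp add: elim)
    finally show ?case .
  qed
qed

text \<open>\<open>partition_on\<close> excludes empty cells, so the trivial partition of the empty
  set has no cell at all.\<close>

lemma borel_partitions_nonempty: "A \<in> sets borel \<Longrightarrow> (if A = {} then {} else {A}) \<in> borel_partitions A"
  by (auto simp: borel_partitions_def partition_on_def disjoint_def)

text \<open>Common refinements make the family of partition sums directed, and this is what allows
  the expectation and the essential supremum to be exchanged.\<close>

lemma nn_integral_total_variation:
  assumes A: "A \<in> sets borel"
  shows "(\<integral>\<^sup>+\<omega>. total_variation M X A \<omega> \<partial>M) = variation A"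
proof -
  define G where "G = {(\<lambda>\<omega>. \<Sum>B\<in>P. ennreal (norm (X B \<omega>))) | P. finite P \<and> partition_on A P \<and> P \<subseteq> sets borel}"
  have G: "G = (\<lambda>P \<omega>. \<Sum>B\<in>P. ennreal (norm (X B \<omega>))) ` borel_partitions A"
    by (auto simp: G_def borel_partitions_def)
  have meas: "g \<in> borel_measurable M" if "g \<in> G" for g
  proof -
    from that[unfolded G] obtain P where "P \<in> borel_partitions A" and P2: "g = (\<lambda>\<omega>. \<Sum>B\<in>P. ennreal (norm (X B \<omega>)))"
      by (rule imageE)
    then have P: "P \<subseteq> sets borel" by (simp add: borel_partitions_def)
    show ?thesis unfolding P2
    proof (rule borel_measurable_sum)
      fix B assume "B \<in> P"
      then have [measurable]: "B \<in> sets borel" using P by auto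
      show "(\<lambda>\<omega>. ennreal (norm (X B \<omega>))) \<in> borel_measurable M" by measurable
    qed
  qed
  have ne: "G \<noteq> {}" using borel_partitions_nonempty[OF A] by (auto simp: G)
  have dir: "\<exists>h\<in>G. AE x in M. f x \<le> h x \<and> g x \<le> h x" if "f \<in> G" "g \<in> G" for f g
  proof -
    from that(1)[unfolded G] obtain P where P: "f = (\<lambda>\<omega>. \<Sum>B\<in>P. ennreal (norm (X B \<omega>)))" "P \<in> borel_partitions A"
      by (rule imageE)
    from that(2)[unfolded G] obtain Q where Q: "g = (\<lambda>\<omega>. \<Sum>B\<in>Q. ennreal (norm (X B \<omega>)))" "Q \<in> borel_partitions A"
      by (rule imageE)
    note PQ = P(2) Q(2) P(1) Q(1)
    define R where "R = (\<lambda>(C, D). C \<inter> D) ` (P \<times> Q) - {{}}"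
    \<comment> \<open>Symmetry of the intersection lets the one-sided refinement estimate serve both
      partitions.\<close>
    have R': "R = (\<lambda>(C, D). C \<inter> D) ` (Q \<times> P) - {{}}" 
    proof -
      have "(\<lambda>(C, D). C \<inter> D) ` (S \<times> T) \<subseteq> (\<lambda>(C, D). C \<inter> D) ` (T \<times> S)" for S T :: "real set set"
        by (auto intro!: rev_image_eqI[of "(_, _)"] simp: Int_commute)
      then show ?thesis unfolding R_def by (metis equalityI)
    qed
    have "R \<in> borel_partitions A" unfolding R_def by (rule borel_partitions_refinement[OF PQ(1,2)])
    moreover have "AE x in M. f x \<le> (\<Sum>B\<in>R. ennreal (norm (X B x)))"
      unfolding PQ R_def by (rule sum_norm_refinement_le[OF PQ(1,2)])
    moreover have "AE x in M. g x \<le> (\<Sum>B\<in>R. ennreal (norm (X B x)))"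
      unfolding PQ R' by (rule sum_norm_refinement_le[OF PQ(2,1)])
    moreover have "(\<lambda>\<omega>. \<Sum>B\<in>R. ennreal (norm (X B \<omega>))) \<in> G" unfolding G by (rule imageI) fact
    ultimately show ?thesis by (intro bexI[of _ "\<lambda>\<omega>. \<Sum>B\<in>R. ennreal (norm (X B \<omega>))"]) (simp_all only: AE_conj_iff simp_thms)
  qed
  have "is_ess_supremum M G (total_variation M X A)"
    unfolding total_variation_def G_def[symmetric]
    by (rule someI_ex[OF is_ess_supremum_directed(1)[OF meas ne dir]])
  then have "(\<integral>\<^sup>+\<omega>. total_variation M X A \<omega> \<partial>M) = (SUP g\<in>G. \<integral>\<^sup>+\<omega>. g \<omega> \<partial>M)"
    using is_ess_supremum_directed(2)[of G "total_variation M X A", OF meas ne dir] by blast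
  also have "\<dots> = variation A"
    unfolding G variation_def image_image
  proof (rule SUP_cong[OF refl])
    fix P assume "P \<in> borel_partitions A"
    then have "P \<subseteq> sets borel" by (simp add: borel_partitions_def)
    then show "(\<integral>\<^sup>+\<omega>. (\<Sum>B\<in>P. ennreal (norm (X B \<omega>))) \<partial>M) = (\<Sum>B\<in>P. mean_abs B)"
      unfolding mean_abs_def by (intro nn_integral_sum) auto
  qed
  finally show ?thesis .
qed

lemma variation_superadditive:
  assumes "A \<in> sets borel" "B \<in> sets borel" "A \<inter> B = {}"
  shows "variation A + variation B \<le> variation (A \<union> B)"
proof -
  have ne: "borel_partitions A \<noteq> {}" "borel_partitions B \<noteq> {}"
    using borel_partitions_nonempty assms by auto
  show ?thesis
    unfolding variation_def[of A] variation_def[of B]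
    unfolding ennreal_SUP_add_left[OF ne(1), symmetric] ennreal_SUP_add_right[OF ne(2)]
  proof (intro SUP_least)
    fix P Q assume P: "P \<in> borel_partitions A" and Q: "Q \<in> borel_partitions B"
    have disj: "P \<inter> Q = {}"
    proof (rule ccontr)
      assume "P \<inter> Q \<noteq> {}"
      then obtain C where C: "C \<in> P" "C \<in> Q" by auto
      then have "C \<subseteq> A" "C \<subseteq> B" "C \<noteq> {}"
        using P Q unfolding borel_partitions_def partition_on_def by auto
      then show False using assms(3) by auto
    qed
    have "partition_on (A \<union> B) (P \<union> Q)"
    proof (rule partition_onI)
      show "\<Union>(P \<union> Q) = A \<union> B" using P Q by (auto simp: borel_partitions_def partition_on_def)
      fix p q assume pq: "p \<in> P \<union> Q" "q \<in> P \<union> Q" "p \<noteq> q"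
      have "p \<inter> q = {}" if "p \<in> P" "q \<in> P" using that pq(3) P by (auto simp: borel_partitions_def partition_on_def dest: disjointD)
      moreover have "p \<inter> q = {}" if "p \<in> Q" "q \<in> Q" using that pq(3) Q by (auto simp: borel_partitions_def partition_on_def dest: disjointD)
      moreover have "p \<inter> q = {}" if "p \<in> P" "q \<in> Q" for p q
        using that P Q assms(3) unfolding borel_partitions_def partition_on_def by blast
      ultimately show "disjnt p q" using pq unfolding disjnt_def by blast
    qed (use P Q in \<open>auto simp: borel_partitions_def partition_on_def\<close>)
    then have "P \<union> Q \<in> borel_partitions (A \<union> B)"
      using P Q unfolding borel_partitions_def by auto
    then have "(\<Sum>C\<in>P \<union> Q. mean_abs C) \<le> variation (A \<union> B)" unfolding variation_def by (rule SUP_upper)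
    then show "(\<Sum>C\<in>P. mean_abs C) + (\<Sum>C\<in>Q. mean_abs C) \<le> variation (A \<union> B)"
      using P Q disj by (simp add: sum.union_disjoint borel_partitions_def)
  qed
qed

lemma mean_abs_le_variation:
  assumes A: "A \<in> sets borel" shows "mean_abs A \<le> variation A"
proof -
  have "(\<Sum>C\<in>(if A = {} then {} else {A}). mean_abs C) \<le> variation A"
    unfolding variation_def by (rule SUP_upper) (rule borel_partitions_nonempty[OF A])
  then show ?thesis by (cases "A = {}") (auto simp: mean_abs_empty)
qed

text \<open>A partition of the union is cut by the sets A i. Countable subadditivity of
  \<open>mean_abs\<close> handles each cell, and after the sums are exchanged the nonempty pieces
  inside a single A i form a partition of it.\<close>

lemma variation_UN_le:
  assumes A: "range A \<subseteq> sets borel" "disjoint_family A"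
  shows "variation (\<Union>i. A i) \<le> (\<Sum>i. variation (A i))"
  unfolding variation_def[of "\<Union>i. A i"]
proof (rule SUP_least)
  have Ab: "A i \<in> sets borel" for i using A by auto
  fix P assume P: "P \<in> borel_partitions (\<Union>i. A i)"
  then have fin: "finite P" and pP: "partition_on (\<Union>i. A i) P" and bP: "P \<subseteq> sets borel"
    by (auto simp: borel_partitions_def)
  have dP: "C = C'" if "C \<in> P" "C' \<in> P" "x \<in> C" "x \<in> C'" for C C' x
    using that pP unfolding partition_on_def disjoint_def by blast
  have "(\<Sum>C\<in>P. mean_abs C) \<le> (\<Sum>C\<in>P. \<Sum>i. mean_abs (C \<inter> A i))"
  proof (rule sum_mono)
    fix C assume C: "C \<in> P"
    have "C = (\<Union>i. C \<inter> A i)" using C pP by (auto simp: partition_on_def)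
    moreover have "mean_abs (\<Union>i. C \<inter> A i) \<le> (\<Sum>i. mean_abs (C \<inter> A i))"
    proof (rule mean_abs_UN_le)
      show "range (\<lambda>i. C \<inter> A i) \<subseteq> sets borel" using C bP Ab by auto
      show "disjoint_family (\<lambda>i. C \<inter> A i)" using A(2) by (auto simp: disjoint_family_on_def)
    qed
    ultimately show "mean_abs C \<le> (\<Sum>i. mean_abs (C \<inter> A i))" by simp
  qed
  also have "\<dots> = (\<Sum>i. \<Sum>C\<in>P. mean_abs (C \<inter> A i))" by (rule suminf_sum[symmetric]) simp
  also have "\<dots> \<le> (\<Sum>i. variation (A i))"
  proof (rule suminf_le)
    fix i
    define Q where "Q = (\<lambda>C. C \<inter> A i) ` P - {{}}"
    have "(\<Sum>C\<in>P. mean_abs (C \<inter> A i)) = sum mean_abs ((\<lambda>C. C \<inter> A i) ` P)"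
    proof (subst sum.reindex_nontrivial)
      fix C C' assume c: "C \<in> P" "C' \<in> P" "C \<noteq> C'" "C \<inter> A i = C' \<inter> A i"
      have "C \<inter> A i = {}" using c dP by blast
      then show "mean_abs (C \<inter> A i) = 0" by (simp add: mean_abs_empty)
    qed (use fin in \<open>auto simp: comp_def\<close>)
    also have "\<dots> = sum mean_abs Q"
      unfolding Q_def by (rule sum.mono_neutral_right) (use fin in \<open>auto simp: mean_abs_empty\<close>)
    also have "\<dots> \<le> variation (A i)"
      unfolding variation_def
    proof (rule SUP_upper)
      have "partition_on (A i) Q"
      proof (rule partition_onI)
        have "\<Union>Q = \<Union>P \<inter> A i" by (auto simp: Q_def)
        also have "\<dots> = A i" using pP by (auto simp: partition_on_def)
        finally show "\<Union>Q = A i" .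
        fix p q assume pq: "p \<in> Q" "q \<in> Q" "p \<noteq> q"
        then obtain C C' where "C \<in> P" "C' \<in> P" "p = C \<inter> A i" "q = C' \<inter> A i" by (auto simp: Q_def)
        then show "disjnt p q" using pq(3) dP by (auto simp: disjnt_def)
      qed (auto simp: Q_def)
      then show "Q \<in> borel_partitions (A i)"
        using fin bP Ab by (auto simp: borel_partitions_def Q_def)
    qed
    finally show "(\<Sum>C\<in>P. mean_abs (C \<inter> A i)) \<le> variation (A i)" .
  qed auto
  finally show "(\<Sum>C\<in>P. mean_abs C) \<le> (\<Sum>i. variation (A i))" .
qed

text \<open>\<open>measure_of\<close> is known to return the intended values once the set function
  is countably additive; superadditivity and countable subadditivity of \<open>variation\<close>
  provide this.\<close>

lemma emeasure_variation_measure: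
  assumes A: "A \<in> sets borel"
  shows "emeasure (variation_measure M X) A = variation A"
proof -
  have eq: "variation_measure M X = measure_of UNIV (sets borel) variation"
    unfolding variation_measure_def
    by (rule measure_of_eq) (auto simp: nn_integral_total_variation sets.sigma_sets_eq[of borel, simplified])
  have sv: "sets (variation_measure M X) = sets borel"
    by (simp add: eq sets.sigma_sets_eq[of borel, simplified])
  show ?thesis
  proof (rule emeasure_measure_of[OF eq])
    show "positive (sets (variation_measure M X)) variation"
    proof -
      have "borel_partitions {} = {{}}" by (auto simp: borel_partitions_def partition_on_def)
      then show ?thesis by (simp add: positive_def variation_def)
    qed
    show "countably_additive (sets (variation_measure M X)) variation"
      unfolding sv by (rule countably_additive_if_superadditive[OF variation_superadditive variation_UN_le])
  qed (use A in \<open>auto simp: eq sets.sigma_sets_eq[of borel, simplified]\<close>)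
qed

lemma sets_variation_measure[simp, measurable_cong]: "sets (variation_measure M X) = sets borel"
  by (simp add: variation_measure_def sets.sigma_sets_eq[of borel, simplified])

lemma space_variation_measure[simp]: "space (variation_measure M X) = UNIV"
  by (simp add: variation_measure_def)

end

section \<open>Power inequalities and convergence of exponents\<close>

lemma mult_powr_minus_1:
  fixes x a :: real assumes "0 \<le> x" shows "x * x powr (a - 1) = x powr a"
  using assms powr_add[of x 1 "a - 1"] by (cases "x = 0") auto

text \<open>The inclusion of l^1 in l^\<alpha>: one factor of each a_i^\<alpha> is kept, and the
  remaining power \<alpha> - 1 is bounded by that of the total.\<close>

lemma sum_powr_le_powr_sum:
  fixes a :: "'i \<Rightarrow> real"
  assumes "finite I" "\<And>i. i \<in> I \<Longrightarrow> 0 \<le> a i" "1 \<le> \<alpha>"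
  shows "(\<Sum>i\<in>I. a i powr \<alpha>) \<le> (\<Sum>i\<in>I. a i) powr \<alpha>"
proof -
  define S where "S = (\<Sum>i\<in>I. a i)"
  have S: "0 \<le> S" unfolding S_def using assms by (intro sum_nonneg) auto
  have "(\<Sum>i\<in>I. a i powr \<alpha>) = (\<Sum>i\<in>I. a i * a i powr (\<alpha> - 1))"
    using assms by (intro sum.cong refl) (simp add: mult_powr_minus_1)
  also have "\<dots> \<le> (\<Sum>i\<in>I. a i * S powr (\<alpha> - 1))"
    using assms by (intro sum_mono mult_left_mono powr_mono2) (auto simp: S_def intro!: member_le_sum)
  also have "\<dots> = S powr \<alpha>" using S by (simp add: sum_distrib_right[symmetric] S_def[symmetric] mult_powr_minus_1)
  finally show ?thesis by (simp add: S_def)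
qed

lemma powr_sum_le:
  fixes a :: "nat \<Rightarrow> real"
  assumes "\<And>i. i < d \<Longrightarrow> 0 \<le> a i" "0 < \<alpha>"
  shows "(\<Sum>i<d. a i) powr \<alpha> \<le> real d powr \<alpha> * (\<Sum>i<d. a i powr \<alpha>)"
proof (cases "d = 0")
  case False
  define B where "B = Max (a ` {..<d})"
  have fin: "finite (a ` {..<d})" "a ` {..<d} \<noteq> {}" using False by auto
  have "B \<in> a ` {..<d}" unfolding B_def by (rule Max_in[OF fin])
  then obtain j where j: "j < d" "B = a j" by auto
  have "(\<Sum>i<d. a i) \<le> real d * B"
    using sum_bounded_above[of "{..<d}" a B] fin by (auto simp: B_def)
  then have "(\<Sum>i<d. a i) powr \<alpha> \<le> (real d * B) powr \<alpha>"
    using assms by (intro powr_mono2) (auto intro: sum_nonneg)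
  also have "\<dots> = real d powr \<alpha> * B powr \<alpha>" using assms j by (simp add: powr_mult)
  also have "\<dots> \<le> real d powr \<alpha> * (\<Sum>i<d. a i powr \<alpha>)"
    unfolding j(2) using j(1) by (intro mult_left_mono member_le_sum) auto
  finally show ?thesis .
qed simp

text \<open>A Young-type splitting of x y^(\<alpha>-1), according to whether x \<le> \<delta> y. The
  term |v|^\<alpha> gets the small factor \<delta>, while the large factor (1/\<delta>)^(\<alpha>-1)
  falls on |u - v|^\<alpha> only.\<close>

lemma abs_powr_diff_Young:
  fixes u v \<alpha> \<delta> :: real
  assumes \<alpha>: "1 < \<alpha>" and \<delta>: "0 < \<delta>"
  shows "\<bar>\<bar>u\<bar> powr \<alpha> - \<bar>v\<bar> powr \<alpha>\<bar> \<le> \<alpha> * (\<delta> * 2 powr \<alpha> * (\<bar>u - v\<bar> powr \<alpha> + \<bar>v\<bar> powr \<alpha>) + (1/\<delta>) powr (\<alpha> - 1) * \<bar>u - v\<bar> powr \<alpha>)"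
proof -
  define x where "x = \<bar>u - v\<bar>"
  define y where "y = x + \<bar>v\<bar>"
  have x: "0 \<le> x" and y: "0 \<le> y" "x \<le> y" by (auto simp: x_def y_def)
  have my: "max \<bar>u\<bar> \<bar>v\<bar> \<le> y" by (auto simp: x_def y_def)
  have "x * y powr (\<alpha> - 1) \<le> \<delta> * y powr \<alpha> + (1/\<delta>) powr (\<alpha> - 1) * x powr \<alpha>"
  proof (cases "x \<le> \<delta> * y")
    case True
    have "x * y powr (\<alpha> - 1) \<le> (\<delta> * y) * y powr (\<alpha> - 1)" using True by (intro mult_right_mono) auto
    also have "\<dots> = \<delta> * y powr \<alpha>" using y by (simp add: mult.assoc mult_powr_minus_1)
    finally show ?thesis by (simp add: add_increasing2)
  next
    case False
    then have "y \<le> (1/\<delta>) * x" using \<delta> by (simp add: field_simps)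
    then have "x * y powr (\<alpha> - 1) \<le> x * ((1/\<delta>) * x) powr (\<alpha> - 1)"
      using x y \<alpha> by (intro mult_left_mono powr_mono2) auto
    also have "\<dots> = (1/\<delta>) powr (\<alpha> - 1) * (x * x powr (\<alpha> - 1))" using x \<delta> by (simp only: powr_mult mult.left_commute)
    also have "\<dots> = (1/\<delta>) powr (\<alpha> - 1) * x powr \<alpha>" using x by (simp add: mult_powr_minus_1)
    finally show ?thesis using \<delta> by (simp add: add_increasing)
  qed
  also have "\<dots> \<le> \<delta> * (2 powr \<alpha> * (x powr \<alpha> + \<bar>v\<bar> powr \<alpha>)) + (1/\<delta>) powr (\<alpha> - 1) * x powr \<alpha>"
    using powr_add_le[OF x abs_ge_zero, of \<alpha> v] \<alpha> \<delta> by (simp add: y_def)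
  finally have 1: "x * y powr (\<alpha> - 1) \<le> \<delta> * 2 powr \<alpha> * (x powr \<alpha> + \<bar>v\<bar> powr \<alpha>) + (1/\<delta>) powr (\<alpha> - 1) * x powr \<alpha>"
    by (simp add: mult.assoc)
  have "\<bar>\<bar>u\<bar> powr \<alpha> - \<bar>v\<bar> powr \<alpha>\<bar> \<le> \<alpha> * \<bar>\<bar>u\<bar> - \<bar>v\<bar>\<bar> * max \<bar>u\<bar> \<bar>v\<bar> powr (\<alpha> - 1)"
    by (rule powr_diff_le) (use \<alpha> in auto)
  also have "\<dots> \<le> \<alpha> * x * y powr (\<alpha> - 1)"
    using \<alpha> my by (intro mult_mono powr_mono2 mult_left_mono) (auto simp: x_def abs_triangle_ineq3 le_max_iff_disj)
  also have "\<dots> \<le> \<alpha> * (\<delta> * 2 powr \<alpha> * (x powr \<alpha> + \<bar>v\<bar> powr \<alpha>) + (1/\<delta>) powr (\<alpha> - 1) * x powr \<alpha>)"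
    using 1 \<alpha> by (simp add: mult.assoc)
  finally show ?thesis by (simp add: x_def)
qed

lemma tendsto_integral_abs_powr:
  fixes f :: "nat \<Rightarrow> 'a \<Rightarrow> real"
  assumes \<alpha>: "1 < \<alpha>" and [measurable]: "\<And>n. f n \<in> borel_measurable M" "g \<in> borel_measurable M"
    and i: "\<And>n. integrable M (\<lambda>x. \<bar>f n x\<bar> powr \<alpha>)" "integrable M (\<lambda>x. \<bar>g x\<bar> powr \<alpha>)"
      "\<And>n. integrable M (\<lambda>x. \<bar>f n x - g x\<bar> powr \<alpha>)"
    and lim: "(\<lambda>n. LINT x|M. \<bar>f n x - g x\<bar> powr \<alpha>) \<longlonglongrightarrow> 0"
  shows "(\<lambda>n. LINT x|M. \<bar>f n x\<bar> powr \<alpha>) \<longlonglongrightarrow> (LINT x|M. \<bar>g x\<bar> powr \<alpha>)"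
proof -
  define e where "e n = (LINT x|M. \<bar>f n x - g x\<bar> powr \<alpha>)" for n
  define V where "V = (LINT x|M. \<bar>g x\<bar> powr \<alpha>)"
  have V: "0 \<le> V" by (simp add: V_def)
  have bound: "\<bar>(LINT x|M. \<bar>f n x\<bar> powr \<alpha>) - V\<bar> \<le> \<alpha> * (\<delta> * 2 powr \<alpha> * (e n + V) + (1/\<delta>) powr (\<alpha> - 1) * e n)"
    if \<delta>: "0 < \<delta>" for n \<delta>
  proof -
    have "\<bar>(LINT x|M. \<bar>f n x\<bar> powr \<alpha>) - V\<bar> = \<bar>LINT x|M. \<bar>f n x\<bar> powr \<alpha> - \<bar>g x\<bar> powr \<alpha>\<bar>"
      using i by (simp add: V_def)
    also have "\<dots> \<le> (LINT x|M. \<bar>\<bar>f n x\<bar> powr \<alpha> - \<bar>g x\<bar> powr \<alpha>\<bar>)" by (rule integral_abs_bound)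
    also have "\<dots> \<le> (LINT x|M. \<alpha> * (\<delta> * 2 powr \<alpha> * (\<bar>f n x - g x\<bar> powr \<alpha> + \<bar>g x\<bar> powr \<alpha>) + (1/\<delta>) powr (\<alpha> - 1) * \<bar>f n x - g x\<bar> powr \<alpha>))"
      using i by (intro integral_mono abs_powr_diff_Young \<alpha> \<delta>) auto
    also have "\<dots> = \<alpha> * (\<delta> * 2 powr \<alpha> * (e n + V) + (1/\<delta>) powr (\<alpha> - 1) * e n)"
      using i by (simp add: e_def V_def)
    finally show ?thesis .
  qed
  show ?thesis
    unfolding V_def[symmetric]
  proof (rule LIMSEQ_I)
    fix \<epsilon> :: real assume \<epsilon>: "0 < \<epsilon>"
    \<comment> \<open>Chosen so that the limiting error is (\<epsilon>/2) V/(V + 1) < \<epsilon>;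
      the 1 added to \<open>V\<close> covers V = 0.\<close>
    define \<delta> where "\<delta> = \<epsilon> / (2 * \<alpha> * 2 powr \<alpha> * (V + 1))"
    have \<delta>: "0 < \<delta>" using \<epsilon> \<alpha> V by (simp add: \<delta>_def)
    have "(\<lambda>n. \<alpha> * (\<delta> * 2 powr \<alpha> * (e n + V) + (1/\<delta>) powr (\<alpha> - 1) * e n)) \<longlonglongrightarrow> \<alpha> * (\<delta> * 2 powr \<alpha> * (0 + V) + (1/\<delta>) powr (\<alpha> - 1) * 0)"
      using lim unfolding e_def by (intro tendsto_intros)
    moreover have "\<alpha> * (\<delta> * 2 powr \<alpha> * (0 + V) + (1/\<delta>) powr (\<alpha> - 1) * 0) < \<epsilon>"
    proof -
      have "\<alpha> * (\<delta> * 2 powr \<alpha> * V) = (\<epsilon> / 2) * (V / (V + 1))" 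
      proof -
        define P where "P = \<alpha> * 2 powr \<alpha>"
        have P: "P \<noteq> 0" "V + 1 \<noteq> 0" using \<alpha> V by (auto simp: P_def)
        have d: "\<delta> = \<epsilon> / (2 * P * (V + 1))" by (simp add: \<delta>_def P_def mult.assoc)
        have "\<alpha> * (\<delta> * 2 powr \<alpha> * V) = \<delta> * P * V" by (simp add: P_def)
        also have "\<dots> = (\<epsilon> / 2) * (V / (V + 1))" using P by (simp add: d)
        finally show ?thesis .
      qed
      also have "\<dots> \<le> (\<epsilon> / 2) * 1" using \<epsilon> V by (intro mult_left_mono) (auto simp: field_simps)
      finally show ?thesis using \<epsilon> by simp
    qed
    ultimately have "eventually (\<lambda>n. \<alpha> * (\<delta> * 2 powr \<alpha> * (e n + V) + (1/\<delta>) powr (\<alpha> - 1) * e n) < \<epsilon>) sequentially"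
      by (rule order_tendstoD)
    then have "eventually (\<lambda>n. norm ((LINT x|M. \<bar>f n x\<bar> powr \<alpha>) - V) < \<epsilon>) sequentially"
      by eventually_elim (use bound[OF \<delta>] in \<open>auto intro: le_less_trans\<close>)
    then show "\<exists>no. \<forall>n\<ge>no. norm ((LINT x|M. \<bar>f n x\<bar> powr \<alpha>) - V) < \<epsilon>"
      by (simp add: eventually_sequentially)
  qed
qed

text \<open>The integrand satisfies |e^(iX) - e^(iY)| = |e^(i(X-Y)) - 1|, and the square of this is
  2 - 2 cos(X - Y). The change of a characteristic function is thus bounded by the law of the
  difference alone, however X and Y depend on each other.\<close>

lemma (in prob_space) norm_cf_diff_le:
  assumes [measurable]: "X \<in> borel_measurable M" "Y \<in> borel_measurable M"
  shows "norm ((CLINT \<omega>|M. iexp (X \<omega>)) - (CLINT \<omega>|M. iexp (Y \<omega>)))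
    \<le> sqrt (2 * (1 - Re (CLINT \<omega>|M. iexp (X \<omega> - Y \<omega>))))"
proof -
  have i: "integrable M (\<lambda>\<omega>. iexp (Z \<omega>))" if [measurable]: "Z \<in> borel_measurable M" for Z :: "'a \<Rightarrow> real"
    by (rule integrable_const_bound[where B=1]) auto
  define D where "D \<omega> = norm (iexp (X \<omega> - Y \<omega>) - 1)" for \<omega>
  have [measurable]: "D \<in> borel_measurable M" unfolding D_def by measurable
  have D2: "D \<omega> \<le> 2" for \<omega> unfolding D_def using norm_triangle_ineq4[of "iexp (X \<omega> - Y \<omega>)" 1] by simp
  have D0: "0 \<le> D \<omega>" for \<omega> by (simp add: D_def)
  have iD: "integrable M D" by (rule integrable_const_bound[where B=2]) (auto simp: D0 D2)
  have iDD: "integrable M (\<lambda>\<omega>. (D \<omega>)\<^sup>2)"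
    by (rule integrable_const_bound[where B="2\<^sup>2"]) (use power_mono[OF D2 D0, of _ 2] in auto)
  have "norm ((CLINT \<omega>|M. iexp (X \<omega>)) - (CLINT \<omega>|M. iexp (Y \<omega>))) = norm (CLINT \<omega>|M. iexp (X \<omega>) - iexp (Y \<omega>))"
    using i by (simp del: of_real_diff)
  also have "\<dots> \<le> (LINT \<omega>|M. norm (iexp (X \<omega>) - iexp (Y \<omega>)))" by (rule integral_norm_bound)
  also have "\<dots> = (LINT \<omega>|M. D \<omega>)"
  proof (rule Bochner_Integration.integral_cong[OF refl])
    fix \<omega>
    have "iexp (X \<omega>) - iexp (Y \<omega>) = iexp (Y \<omega>) * (iexp (X \<omega> - Y \<omega>) - 1)"
      by (simp add: algebra_simps flip: exp_add)
    then show "norm (iexp (X \<omega>) - iexp (Y \<omega>)) = D \<omega>" by (simp add: norm_mult D_def)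
  qed
  also have "\<dots> \<le> sqrt (LINT \<omega>|M. (D \<omega>)\<^sup>2)"
  proof (rule real_le_rsqrt)
    have "0 \<le> variance D" by simp
    also have "variance D = (LINT \<omega>|M. (D \<omega>)\<^sup>2) - (expectation D)\<^sup>2" by (rule variance_eq[OF iD iDD])
    finally show "(expectation D)\<^sup>2 \<le> (LINT \<omega>|M. (D \<omega>)\<^sup>2)" by simp
  qed
  also have "(LINT \<omega>|M. (D \<omega>)\<^sup>2) = 2 * (1 - Re (CLINT \<omega>|M. iexp (X \<omega> - Y \<omega>)))"
  proof -
    have iX: "integrable M (\<lambda>\<omega>. iexp (X \<omega> - Y \<omega>))" by (rule i) simp
    have "(D \<omega>)\<^sup>2 = 2 - 2 * Re (iexp (X \<omega> - Y \<omega>))" for \<omega>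
    proof -
      define t where "t = X \<omega> - Y \<omega>"
      have "(D \<omega>)\<^sup>2 = (cos t - 1)\<^sup>2 + (sin t)\<^sup>2"
        by (simp add: D_def t_def[symmetric] cmod_power2 Re_exp Im_exp del: of_real_diff)
      also have "\<dots> = 2 - 2 * cos t" using sin_cos_squared_add[of t] by (simp add: power2_eq_square algebra_simps)
      finally show ?thesis by (simp add: t_def[symmetric] Re_exp del: of_real_diff)
    qed
    then have "(LINT \<omega>|M. (D \<omega>)\<^sup>2) = (LINT \<omega>|M. 2 - 2 * Re (iexp (X \<omega> - Y \<omega>)))" by simp
    also have "\<dots> = 2 - 2 * (LINT \<omega>|M. Re (iexp (X \<omega> - Y \<omega>)))"
      using integrable_Re[OF iX] by (simp add: prob_space)
    also have "(LINT \<omega>|M. Re (iexp (X \<omega> - Y \<omega>))) = Re (CLINT \<omega>|M. iexp (X \<omega> - Y \<omega>))" by (rule integral_Re[OF iX])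
    finally show ?thesis by simp
  qed
  finally show ?thesis .
qed

lemma mult_spow_self: "z * spow (\<alpha> - 1) z = of_real (norm z powr \<alpha>)"
proof (cases "z = 0")
  case False
  have "z * spow (\<alpha> - 1) z = of_real (norm z powr (\<alpha> - 2) * (norm z)\<^sup>2)"
    by (simp add: spow_def complex_norm_square[symmetric] mult_ac)
  also have "norm z powr (\<alpha> - 2) * (norm z)\<^sup>2 = norm z powr \<alpha>"
    using False powr_add[of "norm z" "\<alpha> - 2" 2] by simp
  finally show ?thesis .
qed (simp add: spow_def)

text \<open>The pair (X, X) is represented by (h, h), and h times its signed power of order \<alpha>
  - 1 is |h|^\<alpha>.\<close>

lemma cov_norm_eq:
  fixes h :: "'b \<Rightarrow> complex"
  assumes \<alpha>: "1 < \<alpha>" and T: "T \<in> measurable N N" "distr N N T = N" and N: "sigma_finite_measure N"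
    and h: "h \<in> borel_measurable N" "\<And>x. x \<in> space N \<Longrightarrow> h (T x) = - h x"
    and i: "integrable N (\<lambda>x. norm (h x) powr \<alpha>)" and X: "X \<in> borel_measurable M"
    and cf: "\<And>a. (CLINT \<omega>|M. iexp (a \<bullet> X \<omega>)) = of_real (exp (- (LINT x|N. \<bar>a \<bullet> h x\<bar> powr \<alpha>)))"
  shows "sas_vector \<alpha> M 1 (\<lambda>_. X)" "cov_norm \<alpha> M X = (LINT x|N. norm (h x) powr \<alpha>) powr (1 / \<alpha>)"
proof -
  show "sas_vector \<alpha> M 1 (\<lambda>_. X)"
    by (rule sas_vectorI[where h="\<lambda>_. h" and N=N and T=T]) (use assms in auto)
  have s2: "(\<Sum>i<2. f i) = f 0 + f 1" for f :: "nat \<Rightarrow> real" by (simp add: numeral_2_eq_2)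
  have sas: "sas_vector \<alpha> M 2 (pair_vector X X)"
  proof (rule sas_vectorI[where h="\<lambda>_. h" and N=N and T=T])
    fix \<theta> :: "nat \<Rightarrow> complex"
    show "(CLINT \<omega>|M. iexp (\<Sum>i<2. \<theta> i \<bullet> pair_vector X X i \<omega>)) = of_real (exp (- (LINT x|N. \<bar>\<Sum>i<2. \<theta> i \<bullet> h x\<bar> powr \<alpha>)))"
      using cf[of "\<theta> 0 + \<theta> 1"] by (simp add: s2 pair_vector_def inner_add_left del: of_real_add)
  qed (use assms in \<open>auto simp: pair_vector_def\<close>)
  have "covariation \<alpha> M X X = (CLINT x|N. h x * spow (\<alpha> - 1) (h x))"
    by (rule covariation_eq[OF \<alpha> sas N h(1) h(1) i i]) (use cf[of "_ + _"] in \<open>simp add: inner_add_left del: of_real_add\<close>)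
  also have "\<dots> = of_real (LINT x|N. norm (h x) powr \<alpha>)" by (simp add: mult_spow_self)
  finally show "cov_norm \<alpha> M X = (LINT x|N. norm (h x) powr \<alpha>) powr (1 / \<alpha>)" by (simp add: cov_norm_def)
qed

text \<open>The spectral measure of X is itself a representation, with the antipodal map as
  symmetry. The Cauchy--Schwarz inequality inside its exponent turns smallness of
  \<open>cov_norm\<close> into closeness of the characteristic function to 1.\<close>

lemma cf_cov_norm_bound:
  fixes X :: "'w \<Rightarrow> complex"
  assumes \<alpha>: "1 < \<alpha>" and sas: "sas_vector \<alpha> M 1 (\<lambda>_. X)"
  obtains s where "(CLINT \<omega>|M. iexp (a \<bullet> X \<omega>)) = of_real (exp (- s))" "0 \<le> s" "s \<le> norm a powr \<alpha> * cov_norm \<alpha> M X powr \<alpha>"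
proof -
  define G where "G = spectral_measure \<alpha> M 1 (\<lambda>_. X)"
  have G: "is_spectral_measure \<alpha> M 1 (\<lambda>_. X) G"
    unfolding G_def by (rule is_spectral_measure_spectral_measure[OF sas])
  interpret G: symmetric_sphere_measure G 1 by (rule is_spectral_measureD[OF G])
  have mX: "X \<in> borel_measurable M" using sas by (auto simp: sas_vector_def)
  have m[measurable]: "(\<lambda>s. s 0) \<in> borel_measurable G" by simp
  have i: "integrable G (\<lambda>s. norm (s 0) powr \<alpha>)"
    using G.integrable_component_powr[of 0 \<alpha>] \<alpha> by auto
  have cf: "(CLINT \<omega>|M. iexp (a \<bullet> X \<omega>)) = of_real (exp (- (LINT s|G. \<bar>a \<bullet> s 0\<bar> powr \<alpha>)))" for a
    using is_spectral_measureD(2)[OF G, of "\<lambda>_. a"] by simp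
  have N: "sigma_finite_measure G" by unfold_locales
  have cn: "cov_norm \<alpha> M X = (LINT s|G. norm (s 0) powr \<alpha>) powr (1 / \<alpha>)"
    by (rule cov_norm_eq(2)[OF \<alpha> G.neg_measurable G.symmetric N m _ i mX cf]) simp
  have I0: "0 \<le> (LINT s|G. norm (s 0) powr \<alpha>)" by simp
  have "(LINT s|G. \<bar>a \<bullet> s 0\<bar> powr \<alpha>) \<le> (LINT s|G. norm a powr \<alpha> * norm (s 0) powr \<alpha>)"
  proof (rule integral_mono)
    show "integrable G (\<lambda>s. \<bar>a \<bullet> s 0\<bar> powr \<alpha>)" by (rule integrable_inner_powr) (use i \<alpha> in auto)
    fix s show "\<bar>a \<bullet> s 0\<bar> powr \<alpha> \<le> norm a powr \<alpha> * norm (s 0) powr \<alpha>"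
      using Cauchy_Schwarz_ineq2[of a "s 0"] \<alpha> by (subst powr_mult[symmetric]) (auto intro!: powr_mono2)
  qed (use i in simp)
  also have "\<dots> = norm a powr \<alpha> * cov_norm \<alpha> M X powr \<alpha>"
    using I0 \<alpha> by (simp add: cn powr_powr)
  finally show ?thesis using that[OF cf[of a]] by simp
qed

section \<open>Independently scattered stable random measures\<close>

lemma inner_mult_cnj: "a \<bullet> (b * u) = (a * cnj b) \<bullet> (u :: complex)"
  by (simp add: inner_complex_def algebra_simps)

text \<open>\<open>simple_stoch_integral\<close> refers to the level sets of f. Any finite partition
  into cells on which f is constant gives the same variable almost surely, by grouping cells of
  equal value, so several functions can share one partition.\<close>

lemma (in random_measure) simple_stoch_integral_representation:
  assumes I: "finite I" and A: "\<And>i. i \<in> I \<Longrightarrow> A i \<in> sets borel" "\<And>i. i \<in> I \<Longrightarrow> A i \<noteq> {}"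
    "disjoint_family_on A I" "(\<Union>i\<in>I. A i) = UNIV"
    and f: "\<And>i x. i \<in> I \<Longrightarrow> x \<in> A i \<Longrightarrow> f x = b i"
  shows "AE \<omega> in M. simple_stoch_integral X f \<omega> = (\<Sum>i\<in>I. b i * X (A i) \<omega>)"
proof -
  have rng: "range f = b ` I"
  proof (intro equalityI subsetI)
    fix y assume "y \<in> range f"
    then obtain x where x: "y = f x" by auto
    obtain i where "i \<in> I" "x \<in> A i" using A(4) by blast
    then show "y \<in> b ` I" using f x by auto
  next
    fix y assume "y \<in> b ` I"
    then obtain i where i: "i \<in> I" "y = b i" by auto
    then obtain x where "x \<in> A i" using A(2) by blast
    then show "y \<in> range f" using f i by (metis rangeI)
  qed
  have fin: "finite (range f)" using I rng by simp
  have "AE \<omega> in M. X (f -` {y}) \<omega> = (\<Sum>i\<in>{i\<in>I. b i = y}. X (A i) \<omega>)" for y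
  proof -
    have "f -` {y} = (\<Union>i\<in>{i\<in>I. b i = y}. A i)"
    proof (intro equalityI subsetI)
      fix x assume x: "x \<in> f -` {y}"
      obtain i where "i \<in> I" "x \<in> A i" using A(4) by blast
      then show "x \<in> (\<Union>i\<in>{i\<in>I. b i = y}. A i)" using f x by auto
    qed (use f in auto)
    moreover have "AE \<omega> in M. X (\<Union>i\<in>{i\<in>I. b i = y}. A i) \<omega> = (\<Sum>i\<in>{i\<in>I. b i = y}. X (A i) \<omega>)"
      by (rule X_finite_union) (use I A in \<open>auto simp: disjoint_family_on_def\<close>)
    ultimately show ?thesis by simp
  qed
  then have "AE \<omega> in M. \<forall>y\<in>range f. X (f -` {y}) \<omega> = (\<Sum>i\<in>{i\<in>I. b i = y}. X (A i) \<omega>)"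
    using fin by (intro AE_finite_allI)
  then show ?thesis
  proof eventually_elim
    case (elim \<omega>)
    have "simple_stoch_integral X f \<omega> = (\<Sum>y\<in>range f. \<Sum>i\<in>{i\<in>I. b i = y}. b i * X (A i) \<omega>)"
      unfolding simple_stoch_integral_def
    proof (rule sum.cong[OF refl])
      fix y assume "y \<in> range f"
      then have "y * X (f -` {y}) \<omega> = y * (\<Sum>i\<in>{i\<in>I. b i = y}. X (A i) \<omega>)" using elim by auto
      also have "\<dots> = (\<Sum>i\<in>{i\<in>I. b i = y}. b i * X (A i) \<omega>)"
        unfolding sum_distrib_left by (rule sum.cong) auto
      finally show "y * X (f -` {y}) \<omega> = (\<Sum>i\<in>{i\<in>I. b i = y}. b i * X (A i) \<omega>)" .
    qed
    also have "\<dots> = (\<Sum>i\<in>I. b i * X (A i) \<omega>)"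
      by (rule sum.group[OF I fin]) (simp add: rng)
    finally show ?case .
  qed
qed

text \<open>These are the level sets of the joint map x -> (f 0 x, ..., f (d-1) x), indexed by the
  value tuples themselves, so that the index records the values.\<close>

lemma simple_functions_common_level_sets:
  fixes f :: "nat \<Rightarrow> real \<Rightarrow> complex"
  assumes f: "\<And>k. k < d \<Longrightarrow> simple_function borel (f k)"
  obtains I :: "(nat \<Rightarrow> complex) set" and A where "finite I" "\<And>c. c \<in> I \<Longrightarrow> A c \<in> sets borel"
    "\<And>c. c \<in> I \<Longrightarrow> A c \<noteq> {}" "disjoint_family_on A I" "(\<Union>c\<in>I. A c) = UNIV"
    "\<And>c x k. c \<in> I \<Longrightarrow> x \<in> A c \<Longrightarrow> k < d \<Longrightarrow> f k x = c k"
proof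
  define F where "F x = (\<lambda>k\<in>{..<d}. f k x)" for x
  define A where "A c = F -` {c}" for c
  have "F x \<in> (\<Pi>\<^sub>E k\<in>{..<d}. range (f k))" for x by (auto simp: F_def)
  moreover have "finite (\<Pi>\<^sub>E k\<in>{..<d}. range (f k))"
    using simple_functionD(1)[OF f] by (intro finite_PiE) auto
  ultimately show "finite (range F)" by (meson finite_subset image_subsetI)
  show "A c \<in> sets borel" if "c \<in> range F" for c
  proof -
    have "A c = {x\<in>space borel. \<forall>k\<in>{..<d}. f k x = c k}"
    proof (intro equalityI subsetI)
      fix x assume "x \<in> {x\<in>space borel. \<forall>k\<in>{..<d}. f k x = c k}"
      then have "F x k = c k" for k using that by (cases "k < d") (auto simp: F_def)
      then show "x \<in> A c" by (auto simp: A_def)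
    qed (auto simp: A_def F_def)
    moreover have "{x\<in>space borel. f k x = c k} \<in> sets borel" if "k \<in> {..<d}" for k
      using simple_functionD(2)[OF f, of k "{c k}"] that by (simp add: vimage_def)
    then have "{x\<in>space borel. \<forall>k\<in>{..<d}. f k x = c k} \<in> sets borel"
      by (intro sets.sets_Collect_finite_All) auto
    ultimately show ?thesis by simp
  qed
  show "A c \<noteq> {}" if "c \<in> range F" for c using that by (auto simp: A_def)
  show "disjoint_family_on A (range F)" by (auto simp: disjoint_family_on_def A_def)
  show "(\<Union>c\<in>range F. A c) = UNIV" by (auto simp: A_def)
  show "f k x = c k" if "c \<in> range F" "x \<in> A c" "k < d" for c x k
  proof -
    have "F x k = c k" using that(2) by (simp add: A_def)
    then show ?thesis using that(3) by (simp add: F_def)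
  qed
qed

text \<open>The two process types differ only in the direction law \<rho>. The exponent is
  prescribed on disjoint sets alone; overlapping sets are reached through additivity.
  \<open>\<rho>_pos\<close> says that the projection of a direction on the real axis is not
  degenerate, which later bounds m by mean absolute values.\<close>

locale stable_random_measure = random_measure M X for M :: "'w measure" and X :: "real set \<Rightarrow> 'w \<Rightarrow> complex" +
  fixes \<alpha> :: real and m :: "real measure" and \<rho> :: "complex measure"
  assumes \<alpha>: "1 < \<alpha>"
    and finite_m: "finite_measure m" and sets_m[simp, measurable_cong]: "sets m = sets borel"
    and prob_\<rho>: "prob_space \<rho>" and sets_\<rho>[simp, measurable_cong]: "sets \<rho> = sets borel"
    and \<rho>_unit: "AE u in \<rho>. norm u = 1" and \<rho>_symmetric: "distr \<rho> borel uminus = \<rho>"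
    and \<rho>_pos: "0 < (LINT u|\<rho>. \<bar>1 \<bullet> u\<bar> powr \<alpha>)"
    and cf_disjoint: "\<And>n A \<theta>. (\<And>i. i < n \<Longrightarrow> A i \<in> sets borel) \<Longrightarrow> disjoint_family_on A {..<n::nat} \<Longrightarrow>
      (CLINT \<omega>|M. iexp (\<Sum>i<n. \<theta> i \<bullet> X (A i) \<omega>)) =
        of_real (exp (- (\<Sum>i<n. measure m (A i) * (LINT u|\<rho>. \<bar>\<theta> i \<bullet> u\<bar> powr \<alpha>))))"
begin

sublocale m: finite_measure m by (rule finite_m)
sublocale \<rho>: prob_space \<rho> by (rule prob_\<rho>)
sublocale m\<rho>: pair_sigma_finite m \<rho> by unfold_locales

lemma space_m[simp]: "space m = UNIV" and space_\<rho>[simp]: "space \<rho> = UNIV"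
  using sets_eq_imp_space_eq[OF sets_m] sets_eq_imp_space_eq[OF sets_\<rho>] by simp_all

text \<open>On this product \<integral> f d\<xi> is represented by the function f(x) u, in which the
  direction u is a factor of modulus 1.\<close>

definition control :: "(real \<times> complex) measure" where "control = m \<Otimes>\<^sub>M \<rho>"

lemma sets_control[measurable_cong]: "sets control = sets (borel \<Otimes>\<^sub>M borel)"
  unfolding control_def by (intro sets_pair_measure_cong) auto

lemma space_control[simp]: "space control = UNIV"
  by (simp add: control_def space_pair_measure)

lemma finite_control: "finite_measure control"
proof (rule finite_measureI)
  have "emeasure control (space m \<times> space \<rho>) = emeasure m (space m) * emeasure \<rho> (space \<rho>)"
    unfolding control_def by (rule \<rho>.emeasure_pair_measure_Times) auto
  then show "emeasure control (space control) \<noteq> \<infinity>"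
    using m.emeasure_finite[of UNIV] \<rho>.emeasure_space_1 by (simp add: less_top[symmetric])
qed

sublocale control: finite_measure control by (rule finite_control)

lemma AE_control: "AE p in control. norm (snd p) = 1"
  unfolding control_def
proof (rule m\<rho>.AE_pair_measure)
  show "{p \<in> space (m \<Otimes>\<^sub>M \<rho>). norm (snd p) = 1} \<in> sets (m \<Otimes>\<^sub>M \<rho>)" by measurable
qed (use \<rho>_unit in auto)

lemma integral_control:
  fixes g :: "real \<Rightarrow> real"
  assumes [measurable]: "g \<in> borel_measurable borel"
  shows "(LINT p|control. g (fst p)) = (LINT x|m. g x)"
proof -
  have "(LINT x|m. g x) = (LINT x|distr (m \<Otimes>\<^sub>M \<rho>) m fst. g x)" by (simp add: \<rho>.distr_pair_fst)
  also have "\<dots> = (LINT p|control. g (fst p))" unfolding control_def by (rule integral_distr) auto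
  finally show ?thesis by simp
qed

lemma integral_control_norm:
  fixes h :: "real \<Rightarrow> complex"
  assumes [measurable]: "h \<in> borel_measurable borel"
  shows "(LINT p|control. norm (h (fst p) * snd p) powr \<alpha>) = (LINT x|m. norm (h x) powr \<alpha>)"
proof -
  have "(LINT p|control. norm (h (fst p) * snd p) powr \<alpha>) = (LINT p|control. norm (h (fst p)) powr \<alpha>)"
    by (rule integral_cong_AE) (use AE_control in \<open>auto simp: norm_mult elim: eventually_mono\<close>)
  also have "\<dots> = (LINT x|m. norm (h x) powr \<alpha>)" by (rule integral_control) measurable
  finally show ?thesis .
qed

lemma integrable_control:
  fixes h :: "real \<Rightarrow> complex"
  assumes [measurable]: "h \<in> borel_measurable borel" and h: "bounded (range h)"
  shows "integrable control (\<lambda>p. norm (h (fst p) * snd p) powr \<alpha>)"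
proof -
  obtain B where B: "\<And>x. norm (h x) \<le> B" using h by (auto simp: bounded_iff)
  show ?thesis
  proof (rule control.integrable_const_bound[where B="B powr \<alpha>"])
    show "AE p in control. norm (norm (h (fst p) * snd p) powr \<alpha>) \<le> B powr \<alpha>"
      using AE_control
    proof eventually_elim
      case (elim p)
      then show ?case using B[of "fst p"] \<alpha> by (auto simp: norm_mult intro!: powr_mono2)
    qed
  qed measurable
qed

lemma integrable_control_sum:
  fixes f :: "nat \<Rightarrow> real \<Rightarrow> complex"
  assumes f: "\<And>k. k < d \<Longrightarrow> f k \<in> borel_measurable borel" "\<And>k. k < d \<Longrightarrow> bounded (range (f k))"
  shows "integrable control (\<lambda>p. \<bar>\<Sum>k<d. \<theta> k \<bullet> (f k (fst p) * snd p)\<bar> powr \<alpha>)"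
    "(\<lambda>p. \<Sum>k<d. \<theta> k \<bullet> (f k (fst p) * snd p)) \<in> borel_measurable control"
proof -
  \<comment> \<open>All components are merged into one bounded function: moving each coefficient
    across the inner product conjugates it and leaves the fixed direction 1.\<close>
  define h where "h x = (\<Sum>k<d. cnj (\<theta> k) * f k x)" for x
  have [measurable]: "h \<in> borel_measurable borel"
    unfolding h_def by (intro borel_measurable_sum borel_measurable_times) (use f in auto)
  have bh: "bounded (range h)"
  proof -
    have "\<exists>B. \<forall>k\<in>{..<d}. \<forall>x. norm (f k x) \<le> B k" using f(2) unfolding bounded_iff by (intro bchoice) auto
    then obtain B :: "nat \<Rightarrow> real" where B: "\<And>k x. k < d \<Longrightarrow> norm (f k x) \<le> B k" by auto
    have "norm (h x) \<le> (\<Sum>k<d. norm (\<theta> k) * B k)" for x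
      unfolding h_def by (intro sum_norm_le) (auto simp: norm_mult intro!: mult_left_mono B)
    then show ?thesis by (auto simp: bounded_iff)
  qed
  have eq: "(\<Sum>k<d. \<theta> k \<bullet> (f k (fst p) * snd p)) = 1 \<bullet> (h (fst p) * snd p)" for p :: "real \<times> complex"
  proof -
    have "\<theta> k \<bullet> (f k (fst p) * snd p) = 1 \<bullet> (cnj (\<theta> k) * f k (fst p) * snd p)" for k
      by (simp add: inner_complex_def algebra_simps)
    then show ?thesis by (simp add: h_def sum_distrib_right inner_sum_right)
  qed
  show "(\<lambda>p. \<Sum>k<d. \<theta> k \<bullet> (f k (fst p) * snd p)) \<in> borel_measurable control"
    unfolding eq by measurable
  show "integrable control (\<lambda>p. \<bar>\<Sum>k<d. \<theta> k \<bullet> (f k (fst p) * snd p)\<bar> powr \<alpha>)"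
    unfolding eq by (rule integrable_inner_powr) (use integrable_control[OF _ bh] \<alpha> in auto)
qed

lemma cf_finite:
  assumes I: "finite I" and A: "\<And>i. i \<in> I \<Longrightarrow> A i \<in> sets borel" "disjoint_family_on A I"
  shows "(CLINT \<omega>|M. iexp (\<Sum>i\<in>I. \<theta> i \<bullet> X (A i) \<omega>)) =
        of_real (exp (- (\<Sum>i\<in>I. measure m (A i) * (LINT u|\<rho>. \<bar>\<theta> i \<bullet> u\<bar> powr \<alpha>))))"
proof -
  obtain h where h: "bij_betw h {0..<card I} I" using ex_bij_betw_nat_finite[OF I] by auto
  then have h: "bij_betw h {..<card I} I" by (simp add: lessThan_atLeast0)
  have hI: "h i \<in> I" if "i < card I" for i using h that by (auto simp: bij_betw_def)
  have "disjoint_family_on (\<lambda>i. A (h i)) {..<card I}"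
    using h A(2) unfolding disjoint_family_on_def bij_betw_def inj_on_def by blast
  then have "(CLINT \<omega>|M. iexp (\<Sum>i<card I. \<theta> (h i) \<bullet> X (A (h i)) \<omega>)) =
        of_real (exp (- (\<Sum>i<card I. measure m (A (h i)) * (LINT u|\<rho>. \<bar>\<theta> (h i) \<bullet> u\<bar> powr \<alpha>))))"
    using hI A(1) by (intro cf_disjoint) auto
  then show ?thesis
    unfolding sum.reindex_bij_betw[OF h, of "\<lambda>i. \<theta> i \<bullet> X (A i) \<omega>" for \<omega>]
      sum.reindex_bij_betw[OF h, of "\<lambda>i. measure m (A i) * (LINT u|\<rho>. \<bar>\<theta> i \<bullet> u\<bar> powr \<alpha>)"] .
qed

lemma simple_function_bounded:
  fixes f :: "real \<Rightarrow> complex"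
  assumes "simple_function borel f"
  shows "f \<in> borel_measurable borel" "bounded (range f)"
  using assms simple_functionD(1)[OF assms] by (auto intro: borel_measurable_simple_function finite_imp_bounded)

text \<open>On a common partition with value tuples c, the linear form in the integrals becomes one
  in the values on the cells, with coefficients \<open>z c\<close> that collect the conjugated
  values. The exponent over disjoint cells is then the integral of a step function in x.\<close>

lemma cf_simple:
  fixes f :: "nat \<Rightarrow> real \<Rightarrow> complex"
  assumes f: "\<And>k. k < d \<Longrightarrow> simple_function borel (f k)"
  shows "(CLINT \<omega>|M. iexp (\<Sum>k<d. \<theta> k \<bullet> simple_stoch_integral X (f k) \<omega>)) =
    of_real (exp (- (LINT p|control. \<bar>\<Sum>k<d. \<theta> k \<bullet> (f k (fst p) * snd p)\<bar> powr \<alpha>)))"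
proof -
  obtain I :: "(nat \<Rightarrow> complex) set" and A where I: "finite I" and A: "\<And>c. c \<in> I \<Longrightarrow> A c \<in> sets borel"
    "\<And>c. c \<in> I \<Longrightarrow> A c \<noteq> {}" "disjoint_family_on A I" "(\<Union>c\<in>I. A c) = UNIV"
    and fA: "\<And>c x k. c \<in> I \<Longrightarrow> x \<in> A c \<Longrightarrow> k < d \<Longrightarrow> f k x = c k"
    using simple_functions_common_level_sets[of d f, OF f] by blast
  define z where "z c = (\<Sum>k<d. \<theta> k * cnj (c k))" for c :: "nat \<Rightarrow> complex"
  have zi: "z c \<bullet> u = (\<Sum>k<d. \<theta> k \<bullet> (c k * u))" for c u
    by (simp add: z_def inner_sum_left inner_mult_cnj)
  have "AE \<omega> in M. simple_stoch_integral X (f k) \<omega> = (\<Sum>c\<in>I. c k * X (A c) \<omega>)" if "k < d" for k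
    by (rule simple_stoch_integral_representation) (use I A fA that in auto)
  then have "AE \<omega> in M. \<forall>k\<in>{..<d}. simple_stoch_integral X (f k) \<omega> = (\<Sum>c\<in>I. c k * X (A c) \<omega>)"
    by (intro AE_finite_allI) auto
  then have ae: "AE \<omega> in M. iexp (\<Sum>k<d. \<theta> k \<bullet> simple_stoch_integral X (f k) \<omega>) = iexp (\<Sum>c\<in>I. z c \<bullet> X (A c) \<omega>)"
  proof eventually_elim
    case (elim \<omega>)
    have "(\<Sum>k<d. \<theta> k \<bullet> simple_stoch_integral X (f k) \<omega>) = (\<Sum>k<d. \<Sum>c\<in>I. \<theta> k \<bullet> (c k * X (A c) \<omega>))"
      using elim by (intro sum.cong refl) (simp add: inner_sum_right)
    also have "\<dots> = (\<Sum>c\<in>I. z c \<bullet> X (A c) \<omega>)" unfolding zi by (rule sum.swap)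
    finally show ?case by simp
  qed
  have mS[measurable]: "simple_stoch_integral X (f k) \<in> borel_measurable M" if "k < d" for k
    unfolding simple_stoch_integral_def[abs_def]
    using simple_functionD(2)[OF f[OF that]] by (intro borel_measurable_sum borel_measurable_times) auto
  have "(CLINT \<omega>|M. iexp (\<Sum>k<d. \<theta> k \<bullet> simple_stoch_integral X (f k) \<omega>)) = (CLINT \<omega>|M. iexp (\<Sum>c\<in>I. z c \<bullet> X (A c) \<omega>))"
  proof (rule integral_cong_AE[OF _ _ ae])
    have "(\<lambda>\<omega>. \<Sum>k<d. \<theta> k \<bullet> simple_stoch_integral X (f k) \<omega>) \<in> borel_measurable M"
      by (intro borel_measurable_sum borel_measurable_inner) (use mS in auto)
    then show "(\<lambda>\<omega>. iexp (\<Sum>k<d. \<theta> k \<bullet> simple_stoch_integral X (f k) \<omega>)) \<in> borel_measurable M" by measurable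
    have "(\<lambda>\<omega>. \<Sum>c\<in>I. z c \<bullet> X (A c) \<omega>) \<in> borel_measurable M"
      by (intro borel_measurable_sum borel_measurable_inner) (use A in auto)
    then show "(\<lambda>\<omega>. iexp (\<Sum>c\<in>I. z c \<bullet> X (A c) \<omega>)) \<in> borel_measurable M" by measurable
  qed
  also have "\<dots> = of_real (exp (- (\<Sum>c\<in>I. measure m (A c) * (LINT u|\<rho>. \<bar>z c \<bullet> u\<bar> powr \<alpha>))))"
    by (rule cf_finite) (use I A in auto)
  also have "(\<Sum>c\<in>I. measure m (A c) * (LINT u|\<rho>. \<bar>z c \<bullet> u\<bar> powr \<alpha>))
    = (LINT x|m. LINT u|\<rho>. \<bar>\<Sum>k<d. \<theta> k \<bullet> (f k x * u)\<bar> powr \<alpha>)"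
  proof -
    have "(LINT u|\<rho>. \<bar>\<Sum>k<d. \<theta> k \<bullet> (f k x * u)\<bar> powr \<alpha>) = (\<Sum>c\<in>I. indicator (A c) x * (LINT u|\<rho>. \<bar>z c \<bullet> u\<bar> powr \<alpha>))" for x
    proof -
      obtain c where c: "c \<in> I" "x \<in> A c" using A(4) by blast
      have "indicator (A c') x = (if c' = c then 1 else 0 :: real)" if "c' \<in> I" for c'
        using c that A(3) unfolding disjoint_family_on_def by (auto simp: indicator_def)
      then have "(\<Sum>c\<in>I. indicator (A c) x * (LINT u|\<rho>. \<bar>z c \<bullet> u\<bar> powr \<alpha>)) = (\<Sum>c'\<in>I. if c' = c then (LINT u|\<rho>. \<bar>z c \<bullet> u\<bar> powr \<alpha>) else 0)"
        by (intro sum.cong refl) auto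
      also have "\<dots> = (LINT u|\<rho>. \<bar>z c \<bullet> u\<bar> powr \<alpha>)" using c I by simp
      also have "\<dots> = (LINT u|\<rho>. \<bar>\<Sum>k<d. \<theta> k \<bullet> (f k x * u)\<bar> powr \<alpha>)" using fA[OF c] by (simp add: zi)
      finally show ?thesis by simp
    qed
    then have "(LINT x|m. LINT u|\<rho>. \<bar>\<Sum>k<d. \<theta> k \<bullet> (f k x * u)\<bar> powr \<alpha>) = (LINT x|m. (\<Sum>c\<in>I. indicator (A c) x * (LINT u|\<rho>. \<bar>z c \<bullet> u\<bar> powr \<alpha>)))"
      by simp
    also have "\<dots> = (\<Sum>c\<in>I. LINT x|m. indicator (A c) x * (LINT u|\<rho>. \<bar>z c \<bullet> u\<bar> powr \<alpha>))"
      by (rule Bochner_Integration.integral_sum) (use A in \<open>auto simp: less_top[symmetric] intro!: integrable_real_indicator\<close>)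
    also have "\<dots> = (\<Sum>c\<in>I. measure m (A c) * (LINT u|\<rho>. \<bar>z c \<bullet> u\<bar> powr \<alpha>))"
      using A by (intro sum.cong refl) simp
    finally show ?thesis by simp
  qed
  also have "\<dots> = (LINT p|control. \<bar>\<Sum>k<d. \<theta> k \<bullet> (f k (fst p) * snd p)\<bar> powr \<alpha>)"
    unfolding control_def
    using m\<rho>.integral_fst'[OF integrable_control_sum(1)[of d f \<theta>, unfolded control_def]] simple_function_bounded[OF f]
    by simp
  finally show ?thesis .
qed

text \<open>1 minus the characteristic function, at 1, of the real part of the value on a set with
  m(A) = 1.\<close>

definition lower_const :: real where
  "lower_const = 1 - exp (- (LINT u|\<rho>. \<bar>1 \<bullet> u\<bar> powr \<alpha>))"

lemma lower_const_pos: "0 < lower_const"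
  using \<rho>_pos by (simp add: lower_const_def)

text \<open>Scaling the value on A by t = m(A)^(-1/\<alpha>) makes its exponent independent of A.
  The inequality |e^(iy) - 1| \<le> |y| then compares \<open>lower_const\<close>, the distance of
  the characteristic function from 1, with t times the mean modulus.\<close>

lemma mean_abs_lower:
  assumes A[measurable]: "A \<in> sets borel"
  shows "ennreal (lower_const * measure m A powr (1 / \<alpha>)) \<le> mean_abs A"
proof (cases "measure m A = 0 \<or> mean_abs A = \<infinity>")
  case False
  then have pos: "0 < measure m A" and fin: "mean_abs A \<noteq> \<infinity>" by (auto simp: zero_less_measure_iff)
  have int: "integrable M (X A)"
    using fin by (intro integrableI_bounded) (auto simp: mean_abs_def less_top)
  define t where "t = measure m A powr (- 1 / \<alpha>)"
  have t: "0 < t" using pos by (simp add: t_def)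
  define Y where "Y \<omega> = (of_real t :: complex) \<bullet> X A \<omega>" for \<omega>
  have [measurable]: "Y \<in> borel_measurable M" unfolding Y_def by measurable
  have Y: "\<bar>Y \<omega>\<bar> \<le> t * norm (X A \<omega>)" for \<omega>
    unfolding Y_def using Cauchy_Schwarz_ineq2[of "of_real t" "X A \<omega>"] t by simp
  have tY: "integrable M (\<lambda>\<omega>. t * norm (X A \<omega>))" using int by simp
  have "(CLINT \<omega>|M. iexp (Y \<omega>)) = of_real (exp (- (measure m A * (LINT u|\<rho>. \<bar>of_real t \<bullet> u\<bar> powr \<alpha>))))"
    using cf_finite[of "{()}" "\<lambda>_. A" "\<lambda>_. of_real t"] unfolding Y_def by (auto simp: disjoint_family_on_def)
  also have "(LINT u|\<rho>. \<bar>of_real t \<bullet> u\<bar> powr \<alpha>) = (LINT u|\<rho>. t powr \<alpha> * \<bar>1 \<bullet> u\<bar> powr \<alpha>)"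
    using t by (intro Bochner_Integration.integral_cong refl) (simp add: inner_complex_def abs_mult powr_mult)
  also have "measure m A * (LINT u|\<rho>. t powr \<alpha> * \<bar>1 \<bullet> u\<bar> powr \<alpha>) = (measure m A * t powr \<alpha>) * (LINT u|\<rho>. \<bar>1 \<bullet> u\<bar> powr \<alpha>)"
    by simp
  also have "measure m A * t powr \<alpha> = 1"
  proof -
    have "t powr \<alpha> = measure m A powr (- 1)" unfolding t_def powr_powr using \<alpha> by simp
    then show ?thesis using pos by (simp add: powr_minus)
  qed
  finally have cf: "(CLINT \<omega>|M. iexp (Y \<omega>)) = of_real (1 - lower_const)" by (simp add: lower_const_def)
  have iY: "integrable M (\<lambda>\<omega>. iexp (Y \<omega>))" by (rule integrable_const_bound[where B=1]) auto
  have "(CLINT \<omega>|M. iexp (Y \<omega>) - 1) = - of_real lower_const"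
    using iY cf by (simp add: prob_space)
  then have "lower_const = norm (CLINT \<omega>|M. iexp (Y \<omega>) - 1)"
    using lower_const_pos by simp
  also have "\<dots> \<le> (LINT \<omega>|M. norm (iexp (Y \<omega>) - 1))" by (rule integral_norm_bound)
  also have "\<dots> \<le> (LINT \<omega>|M. t * norm (X A \<omega>))"
  proof (rule integral_mono[OF _ tY])
    show "integrable M (\<lambda>\<omega>. norm (iexp (Y \<omega>) - 1))" using iY by simp
    fix \<omega> show "norm (iexp (Y \<omega>) - 1) \<le> t * norm (X A \<omega>)"
      using iexp_approx1[of "Y \<omega>" 0] Y[of \<omega>] by simp
  qed
  also have "\<dots> = t * (LINT \<omega>|M. norm (X A \<omega>))" by simp
  finally have "lower_const * (1 / t) \<le> (LINT \<omega>|M. norm (X A \<omega>))" using t by (simp add: field_simps)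
  also have "1 / t = measure m A powr (1 / \<alpha>)" using pos by (simp add: t_def powr_minus_divide)
  finally have "ennreal (lower_const * measure m A powr (1 / \<alpha>)) \<le> ennreal (LINT \<omega>|M. norm (X A \<omega>))" by (rule ennreal_leI)
  also have "\<dots> = mean_abs A" unfolding mean_abs_def using int by (intro nn_integral_eq_integral[symmetric]) auto
  finally show ?thesis .
qed (use \<alpha> in auto)

end

lemma nn_integral_finite_range:
  fixes V :: "real \<Rightarrow> 'b" and N :: "real measure"
  assumes "finite (range V)" and A: "\<And>y. y \<in> range V \<Longrightarrow> V -` {y} \<in> sets N"
  shows "(\<integral>\<^sup>+x. \<phi> (V x) \<partial>N) = (\<Sum>y\<in>range V. \<phi> y * emeasure N (V -` {y}))"
proof -
  have "(\<integral>\<^sup>+x. \<phi> (V x) \<partial>N) = (\<integral>\<^sup>+x. (\<Sum>y\<in>range V. \<phi> y * indicator (V -` {y}) x) \<partial>N)"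
  proof (rule nn_integral_cong)
    fix x
    have "(\<Sum>y\<in>range V. \<phi> y * indicator (V -` {y}) x) = (\<Sum>y\<in>range V. if y = V x then \<phi> y else 0)"
      by (intro sum.cong) (auto simp: indicator_def)
    then show "\<phi> (V x) = (\<Sum>y\<in>range V. \<phi> y * indicator (V -` {y}) x)" using assms(1) by simp
  qed
  also have "\<dots> = (\<Sum>y\<in>range V. \<integral>\<^sup>+x. \<phi> y * indicator (V -` {y}) x \<partial>N)"
    by (rule nn_integral_sum) (use A in auto)
  also have "\<dots> = (\<Sum>y\<in>range V. \<phi> y * emeasure N (V -` {y}))"
    by (intro sum.cong refl nn_integral_cmult_indicator A)
  finally show ?thesis .
qed

lemma simple_function_borelD:
  assumes "simple_function (borel :: real measure) f"
  shows "finite (range f)" "f -` {y} \<in> sets borel"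
  using simple_functionD(1)[OF assms] simple_functionD(2)[OF assms, of "{y}"] by auto

context random_measure
begin

lemma simple_stoch_integral_measurable[measurable]:
  "simple_function borel f \<Longrightarrow> simple_stoch_integral X f \<in> borel_measurable M"
  unfolding simple_stoch_integral_def[abs_def]
  by (intro borel_measurable_sum borel_measurable_times borel_measurable_const X_measurable simple_function_borelD(2))

lemma nn_integral_simple_stoch_integral_le:
  assumes f: "simple_function borel f"
  shows "(\<integral>\<^sup>+\<omega>. ennreal (norm (simple_stoch_integral X f \<omega>)) \<partial>M) \<le> (\<integral>\<^sup>+x. ennreal (norm (f x)) \<partial>variation_measure M X)"
proof -
  note fD = simple_function_borelD[OF f]
  have "(\<integral>\<^sup>+\<omega>. ennreal (norm (simple_stoch_integral X f \<omega>)) \<partial>M)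
    \<le> (\<integral>\<^sup>+\<omega>. (\<Sum>y\<in>range f. ennreal (norm y) * ennreal (norm (X (f -` {y}) \<omega>))) \<partial>M)"
  proof (rule nn_integral_mono)
    fix \<omega>
    have "norm (simple_stoch_integral X f \<omega>) \<le> (\<Sum>y\<in>range f. norm y * norm (X (f -` {y}) \<omega>))"
      unfolding simple_stoch_integral_def by (intro sum_norm_le) (simp add: norm_mult)
    then have "ennreal (norm (simple_stoch_integral X f \<omega>)) \<le> ennreal (\<Sum>y\<in>range f. norm y * norm (X (f -` {y}) \<omega>))"
      by (rule ennreal_leI)
    also have "\<dots> = (\<Sum>y\<in>range f. ennreal (norm y) * ennreal (norm (X (f -` {y}) \<omega>)))"
      by (simp add: sum_ennreal[symmetric] ennreal_mult)
    finally show "ennreal (norm (simple_stoch_integral X f \<omega>)) \<le> (\<Sum>y\<in>range f. ennreal (norm y) * ennreal (norm (X (f -` {y}) \<omega>)))" .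
  qed
  also have "\<dots> = (\<Sum>y\<in>range f. \<integral>\<^sup>+\<omega>. ennreal (norm y) * ennreal (norm (X (f -` {y}) \<omega>)) \<partial>M)"
    by (rule nn_integral_sum) (use fD in simp)
  also have "\<dots> = (\<Sum>y\<in>range f. ennreal (norm y) * mean_abs (f -` {y}))"
    unfolding mean_abs_def by (intro sum.cong refl nn_integral_cmult) (use fD in simp)
  also have "\<dots> \<le> (\<Sum>y\<in>range f. ennreal (norm y) * emeasure (variation_measure M X) (f -` {y}))"
    using fD by (intro sum_mono mult_left_mono) (auto simp: emeasure_variation_measure mean_abs_le_variation)
  also have "\<dots> = (\<integral>\<^sup>+x. ennreal (norm (f x)) \<partial>variation_measure M X)"
    by (rule nn_integral_finite_range[symmetric]) (use fD in auto)
  finally show ?thesis .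
qed

text \<open>The level sets of f, g and f - g differ in general; a common partition makes the three
  integrals comparable.\<close>

lemma simple_stoch_integral_diff:
  assumes f: "simple_function borel f" and g: "simple_function borel g"
  shows "AE \<omega> in M. simple_stoch_integral X (\<lambda>x. f x - g x) \<omega> = simple_stoch_integral X f \<omega> - simple_stoch_integral X g \<omega>"
proof -
  define F where "F k = (if k = 0 then f else g)" for k :: nat
  have F: "simple_function borel (F k)" if "k < 2" for k using f g by (simp add: F_def)
  obtain I :: "(nat \<Rightarrow> complex) set" and A where I: "finite I" and A: "\<And>c. c \<in> I \<Longrightarrow> A c \<in> sets borel"
    "\<And>c. c \<in> I \<Longrightarrow> A c \<noteq> {}" "disjoint_family_on A I" "(\<Union>c\<in>I. A c) = UNIV"
    and FA: "\<And>c x k. c \<in> I \<Longrightarrow> x \<in> A c \<Longrightarrow> k < 2 \<Longrightarrow> F k x = c k"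
    using simple_functions_common_level_sets[of 2 F, OF F] by blast
  have fA: "f x = c 0" "g x = c 1" if "c \<in> I" "x \<in> A c" for c x
    using FA[OF that, of 0] FA[OF that, of 1] by (auto simp: F_def)
  have "AE \<omega> in M. simple_stoch_integral X (\<lambda>x. f x - g x) \<omega> = (\<Sum>c\<in>I. (c 0 - c 1) * X (A c) \<omega>)"
    by (rule simple_stoch_integral_representation) (use I A fA in auto)
  moreover have "AE \<omega> in M. simple_stoch_integral X f \<omega> = (\<Sum>c\<in>I. c 0 * X (A c) \<omega>)"
    by (rule simple_stoch_integral_representation) (use I A fA in auto)
  moreover have "AE \<omega> in M. simple_stoch_integral X g \<omega> = (\<Sum>c\<in>I. c 1 * X (A c) \<omega>)"
    by (rule simple_stoch_integral_representation) (use I A fA in auto)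
  ultimately show ?thesis
    by eventually_elim (simp add: left_diff_distrib sum_subtractf)
qed

end

lemma L1_approx_simple: "L1_approx M X s f \<Longrightarrow> simple_function borel (s n)"
  by (simp add: L1_approx_def bounded_simple_def)

context stable_random_measure
begin

text \<open>Let b_y = m(V = y)^(1/\<alpha>). By \<open>mean_abs_lower\<close> the integral against
  the variation measure controls the sum of the numbers y b_y. The sum of their \<alpha>-th powers
  is the integral of V^\<alpha> against m, and \<open>sum_powr_le_powr_sum\<close> compares the two
  sums.\<close>

lemma nn_integral_powr_le_simple:
  fixes V :: "real \<Rightarrow> ennreal"
  assumes V: "simple_function borel V" "\<And>x. V x < top"
    and I: "(\<integral>\<^sup>+x. V x \<partial>variation_measure M X) \<le> ennreal I" "0 \<le> I"
  shows "(\<integral>\<^sup>+x. ennreal (enn2real (V x) powr \<alpha>) \<partial>m) \<le> ennreal ((I / lower_const) powr \<alpha>)"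
proof -
  note VD = simple_function_borelD[OF V(1)]
  define a where "a y = enn2real y * measure m (V -` {y}) powr (1 / \<alpha>)" for y
  have a0: "0 \<le> a y" for y by (simp add: a_def)
  have "ennreal (lower_const * (\<Sum>y\<in>range V. a y)) = (\<Sum>y\<in>range V. ennreal (enn2real y) * ennreal (lower_const * measure m (V -` {y}) powr (1 / \<alpha>)))"
    using lower_const_pos by (simp add: sum_distrib_left a_def sum_ennreal[symmetric] ennreal_mult mult_ac sum_nonneg)
  also have "\<dots> \<le> (\<Sum>y\<in>range V. y * emeasure (variation_measure M X) (V -` {y}))"
  proof (rule sum_mono)
    fix y assume y: "y \<in> range V"
    have "ennreal (enn2real y) = y" using V(2) y by auto
    moreover have "ennreal (lower_const * measure m (V -` {y}) powr (1 / \<alpha>)) \<le> emeasure (variation_measure M X) (V -` {y})"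
      using mean_abs_lower[OF VD(2)] mean_abs_le_variation[OF VD(2)] emeasure_variation_measure[OF VD(2)]
      by (metis order_trans)
    ultimately show "ennreal (enn2real y) * ennreal (lower_const * measure m (V -` {y}) powr (1 / \<alpha>)) \<le> y * emeasure (variation_measure M X) (V -` {y})"
      by (intro mult_mono) auto
  qed
  also have "\<dots> = (\<integral>\<^sup>+x. V x \<partial>variation_measure M X)"
    by (rule nn_integral_finite_range[symmetric]) (use VD in auto)
  also have "\<dots> \<le> ennreal I" by (rule I)
  finally have "lower_const * (\<Sum>y\<in>range V. a y) \<le> I" using I by (simp add: ennreal_le_iff)
  then have aI: "(\<Sum>y\<in>range V. a y) \<le> I / lower_const" using lower_const_pos by (simp add: field_simps)
  have "(\<integral>\<^sup>+x. ennreal (enn2real (V x) powr \<alpha>) \<partial>m) = (\<Sum>y\<in>range V. ennreal (enn2real y powr \<alpha>) * emeasure m (V -` {y}))"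
    by (rule nn_integral_finite_range) (use VD in auto)
  also have "\<dots> = (\<Sum>y\<in>range V. ennreal (a y powr \<alpha>))"
    using \<alpha> by (intro sum.cong refl) (simp add: a_def powr_mult powr_powr m.emeasure_eq_measure ennreal_mult)
  also have "\<dots> = ennreal (\<Sum>y\<in>range V. a y powr \<alpha>)" by (simp add: sum_ennreal)
  also have "\<dots> \<le> ennreal ((\<Sum>y\<in>range V. a y) powr \<alpha>)"
    using VD a0 \<alpha> by (intro ennreal_leI sum_powr_le_powr_sum) auto
  also have "\<dots> \<le> ennreal ((I / lower_const) powr \<alpha>)"
    using aI a0 \<alpha> by (intro ennreal_leI powr_mono2) (auto intro: sum_nonneg)
  finally show ?thesis .
qed

text \<open>Fatou's lemma along an increasing sequence of simple functions below g. The bound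
  depends only on \<open>I\<close> and survives the limit.\<close>

lemma nn_integral_powr_le:
  fixes g :: "real \<Rightarrow> real"
  assumes [measurable]: "g \<in> borel_measurable borel" and g: "\<And>x. 0 \<le> g x"
    and I: "(\<integral>\<^sup>+x. ennreal (g x) \<partial>variation_measure M X) \<le> ennreal I" "0 \<le> I"
  shows "(\<integral>\<^sup>+x. ennreal (g x powr \<alpha>) \<partial>m) \<le> ennreal ((I / lower_const) powr \<alpha>)"
proof -
  have m: "(\<lambda>x. ennreal (g x)) \<in> borel_measurable borel" by measurable
  obtain U where U: "\<And>i. simple_function borel (U i)" "incseq U" "\<And>i x. U i x < top" "\<And>x. (SUP i. U i x) = ennreal (g x)"
    using borel_measurable_implies_simple_function_sequence'[OF m] by blast
  have [measurable]: "U i \<in> borel_measurable borel" for i by (rule borel_measurable_simple_function[OF U(1)])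
  have Ule: "U i x \<le> ennreal (g x)" for i x unfolding U(4)[symmetric] by (rule SUP_upper) simp
  have bound: "(\<integral>\<^sup>+x. ennreal (enn2real (U i x) powr \<alpha>) \<partial>m) \<le> ennreal ((I / lower_const) powr \<alpha>)" for i
  proof (rule nn_integral_powr_le_simple[OF U(1) U(3)])
    have "(\<integral>\<^sup>+x. U i x \<partial>variation_measure M X) \<le> (\<integral>\<^sup>+x. ennreal (g x) \<partial>variation_measure M X)"
      by (rule nn_integral_mono) (rule Ule)
    then show "(\<integral>\<^sup>+x. U i x \<partial>variation_measure M X) \<le> ennreal I" using I(1) by (rule order_trans)
  qed (rule I)
  have lim: "(\<lambda>i. ennreal (enn2real (U i x) powr \<alpha>)) \<longlonglongrightarrow> ennreal (g x powr \<alpha>)" for x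
  proof -
    have "(\<lambda>i. U i x) \<longlonglongrightarrow> (SUP i. U i x)"
      using U(2) by (intro LIMSEQ_SUP) (auto simp: incseq_def le_fun_def)
    then have "(\<lambda>i. enn2real (U i x)) \<longlonglongrightarrow> g x" unfolding U(4) by (rule tendsto_enn2real[OF _ g])
    then show ?thesis using \<alpha> by (intro tendsto_ennrealI tendsto_powr') (auto intro: tendsto_const)
  qed
  have "(\<integral>\<^sup>+x. ennreal (g x powr \<alpha>) \<partial>m) = (\<integral>\<^sup>+x. liminf (\<lambda>i. ennreal (enn2real (U i x) powr \<alpha>)) \<partial>m)"
    by (intro nn_integral_cong lim_imp_Liminf[symmetric] lim) simp
  also have "\<dots> \<le> liminf (\<lambda>i. \<integral>\<^sup>+x. ennreal (enn2real (U i x) powr \<alpha>) \<partial>m)"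
    by (rule nn_integral_liminf) measurable
  also have "\<dots> \<le> limsup (\<lambda>i. \<integral>\<^sup>+x. ennreal (enn2real (U i x) powr \<alpha>) \<partial>m)"
    by (rule Liminf_le_Limsup) simp
  also have "\<dots> \<le> ennreal ((I / lower_const) powr \<alpha>)"
    by (rule Limsup_bounded) (simp add: bound)
  finally show ?thesis .
qed

lemma integrable_m_powr:
  fixes h :: "real \<Rightarrow> complex"
  assumes [measurable]: "h \<in> borel_measurable borel" and h: "bounded (range h)"
  shows "integrable m (\<lambda>x. norm (h x) powr \<alpha>)"
proof -
  obtain B where B: "\<And>x. norm (h x) \<le> B" using h by (auto simp: bounded_iff)
  show ?thesis
    by (rule m.integrable_const_bound[where B="B powr \<alpha>"]) (use B \<alpha> in \<open>auto intro!: powr_mono2\<close>)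
qed

text \<open>The error against the variation measure may be infinite for finitely many n, so the
  comparison of norms is made only eventually.\<close>

lemma L1_approx_tendsto:
  assumes f[measurable]: "f \<in> borel_measurable borel" and b: "bounded (range f)" and s: "L1_approx M X s f"
  shows "(\<lambda>n. LINT x|m. norm (s n x - f x) powr \<alpha>) \<longlonglongrightarrow> 0"
proof -
  define e where "e n = (\<integral>\<^sup>+x. ennreal (norm (s n x - f x)) \<partial>variation_measure M X)" for n
  have e: "e \<longlonglongrightarrow> 0" using s by (simp add: L1_approx_def e_def[abs_def])
  have [measurable]: "s n \<in> borel_measurable borel" and sb: "bounded (range (s n))" for n
    using simple_function_bounded[OF L1_approx_simple[OF s]] by auto
  have int: "integrable m (\<lambda>x. norm (s n x - f x) powr \<alpha>)" for n
    by (rule integrable_m_powr) (auto intro: bounded_minus_comp sb b)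
  have ev: "eventually (\<lambda>n. e n < top) sequentially" using e by (rule order_tendstoD) simp
  have "(\<lambda>n. (enn2real (e n) / lower_const) powr \<alpha>) \<longlonglongrightarrow> (0 / lower_const) powr \<alpha>"
  proof -
    have "(\<lambda>n. enn2real (e n)) \<longlonglongrightarrow> 0" using e by (intro tendsto_enn2real) auto
    then have "(\<lambda>n. enn2real (e n) / lower_const) \<longlonglongrightarrow> 0 / lower_const"
      using lower_const_pos by (intro tendsto_divide tendsto_const) auto
    then show ?thesis using \<alpha> lower_const_pos by (intro tendsto_powr' tendsto_const) auto
  qed
  then have lim: "(\<lambda>n. (enn2real (e n) / lower_const) powr \<alpha>) \<longlonglongrightarrow> 0" by simp
  show ?thesis
  proof (rule Lim_null_comparison[OF _ lim])
    show "\<forall>\<^sub>F n in sequentially. norm (LINT x|m. norm (s n x - f x) powr \<alpha>) \<le> (enn2real (e n) / lower_const) powr \<alpha>"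
      using ev
    proof eventually_elim
      case (elim n)
      have "(\<integral>\<^sup>+x. ennreal (norm (s n x - f x) powr \<alpha>) \<partial>m) \<le> ennreal ((enn2real (e n) / lower_const) powr \<alpha>)"
        by (rule nn_integral_powr_le) (use elim in \<open>auto simp: e_def[symmetric]\<close>)
      moreover have "(\<integral>\<^sup>+x. ennreal (norm (s n x - f x) powr \<alpha>) \<partial>m) = ennreal (LINT x|m. norm (s n x - f x) powr \<alpha>)"
        by (rule nn_integral_eq_integral[OF int]) simp
      ultimately show ?case by (simp add: ennreal_le_iff)
    qed
  qed
qed

text \<open>The difference of the two linear forms is a linear form in the component errors. The
  integral of its \<alpha>-th power is at most a constant times the sum of theirs, and |u| = 1
  removes the direction from the norms.\<close>

lemma tendsto_control:
  fixes f :: "nat \<Rightarrow> nat \<Rightarrow> real \<Rightarrow> complex" and g :: "nat \<Rightarrow> real \<Rightarrow> complex"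
  assumes f: "\<And>n k. k < d \<Longrightarrow> f n k \<in> borel_measurable borel" "\<And>n k. k < d \<Longrightarrow> bounded (range (f n k))"
    and g: "\<And>k. k < d \<Longrightarrow> g k \<in> borel_measurable borel" "\<And>k. k < d \<Longrightarrow> bounded (range (g k))"
    and lim: "\<And>k. k < d \<Longrightarrow> (\<lambda>n. LINT x|m. norm (f n k x - g k x) powr \<alpha>) \<longlonglongrightarrow> 0"
  shows "(\<lambda>n. LINT p|control. \<bar>\<Sum>k<d. \<theta> k \<bullet> (f n k (fst p) * snd p)\<bar> powr \<alpha>)
    \<longlonglongrightarrow> (LINT p|control. \<bar>\<Sum>k<d. \<theta> k \<bullet> (g k (fst p) * snd p)\<bar> powr \<alpha>)"
proof (rule tendsto_integral_abs_powr[OF \<alpha>])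
  have fg: "k < d \<Longrightarrow> (\<lambda>x. f n k x - g k x) \<in> borel_measurable borel" "k < d \<Longrightarrow> bounded (range (\<lambda>x. f n k x - g k x))" for n k
    using f g by (auto intro: bounded_minus_comp)
  have eq: "(\<Sum>k<d. \<theta> k \<bullet> (f n k (fst p) * snd p)) - (\<Sum>k<d. \<theta> k \<bullet> (g k (fst p) * snd p))
    = (\<Sum>k<d. \<theta> k \<bullet> ((f n k (fst p) - g k (fst p)) * snd p))" for n and p :: "real \<times> complex"
    by (simp add: sum_subtractf left_diff_distrib inner_diff_right)
  show "(\<lambda>p. \<Sum>k<d. \<theta> k \<bullet> (f n k (fst p) * snd p)) \<in> borel_measurable control" for n
    using integrable_control_sum(2)[of d "f n"] f by auto
  show "(\<lambda>p. \<Sum>k<d. \<theta> k \<bullet> (g k (fst p) * snd p)) \<in> borel_measurable control"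
    using integrable_control_sum(2)[of d g] g by auto
  show "integrable control (\<lambda>p. \<bar>\<Sum>k<d. \<theta> k \<bullet> (f n k (fst p) * snd p)\<bar> powr \<alpha>)" for n
    using integrable_control_sum(1)[of d "f n"] f by auto
  show "integrable control (\<lambda>p. \<bar>\<Sum>k<d. \<theta> k \<bullet> (g k (fst p) * snd p)\<bar> powr \<alpha>)"
    using integrable_control_sum(1)[of d g] g by auto
  have idiff: "integrable control (\<lambda>p. \<bar>\<Sum>k<d. \<theta> k \<bullet> ((f n k (fst p) - g k (fst p)) * snd p)\<bar> powr \<alpha>)" for n
    using integrable_control_sum(1)[of d "\<lambda>k x. f n k x - g k x"] fg by auto
  then show "integrable control (\<lambda>p. \<bar>(\<Sum>k<d. \<theta> k \<bullet> (f n k (fst p) * snd p)) - (\<Sum>k<d. \<theta> k \<bullet> (g k (fst p) * snd p))\<bar> powr \<alpha>)" for n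
    unfolding eq .
  have l0: "(\<lambda>n. real d powr \<alpha> * (\<Sum>k<d. norm (\<theta> k) powr \<alpha> * (LINT x|m. norm (f n k x - g k x) powr \<alpha>)))
     \<longlonglongrightarrow> real d powr \<alpha> * (\<Sum>k<d. norm (\<theta> k) powr \<alpha> * 0)"
    by (intro tendsto_mult tendsto_const tendsto_sum lim) simp
  then have l0: "(\<lambda>n. real d powr \<alpha> * (\<Sum>k<d. norm (\<theta> k) powr \<alpha> * (LINT x|m. norm (f n k x - g k x) powr \<alpha>))) \<longlonglongrightarrow> 0"
    by simp
  show "(\<lambda>n. LINT p|control. \<bar>(\<Sum>k<d. \<theta> k \<bullet> (f n k (fst p) * snd p)) - (\<Sum>k<d. \<theta> k \<bullet> (g k (fst p) * snd p))\<bar> powr \<alpha>) \<longlonglongrightarrow> 0"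
    unfolding eq
  proof (rule Lim_null_comparison[OF _ l0], intro always_eventually allI)
    fix n
    have ic: "integrable control (\<lambda>p. norm ((f n k (fst p) - g k (fst p)) * snd p) powr \<alpha>)" if "k < d" for k
      using integrable_control[OF fg[OF that]] .
    have "(LINT p|control. \<bar>\<Sum>k<d. \<theta> k \<bullet> ((f n k (fst p) - g k (fst p)) * snd p)\<bar> powr \<alpha>)
      \<le> (LINT p|control. real d powr \<alpha> * (\<Sum>k<d. norm (\<theta> k) powr \<alpha> * norm ((f n k (fst p) - g k (fst p)) * snd p) powr \<alpha>))"
    proof (rule integral_mono[OF idiff])
      show "integrable control (\<lambda>p. real d powr \<alpha> * (\<Sum>k<d. norm (\<theta> k) powr \<alpha> * norm ((f n k (fst p) - g k (fst p)) * snd p) powr \<alpha>))"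
        using ic by (intro integrable_mult_right Bochner_Integration.integrable_sum) auto
      fix p :: "real \<times> complex"
      have "\<bar>\<Sum>k<d. \<theta> k \<bullet> ((f n k (fst p) - g k (fst p)) * snd p)\<bar> \<le> (\<Sum>k<d. norm (\<theta> k) * norm ((f n k (fst p) - g k (fst p)) * snd p))"
        by (rule order_trans[OF sum_abs sum_mono]) (rule Cauchy_Schwarz_ineq2)
      then have "\<bar>\<Sum>k<d. \<theta> k \<bullet> ((f n k (fst p) - g k (fst p)) * snd p)\<bar> powr \<alpha>
        \<le> (\<Sum>k<d. norm (\<theta> k) * norm ((f n k (fst p) - g k (fst p)) * snd p)) powr \<alpha>"
        using \<alpha> by (intro powr_mono2) auto
      also have "\<dots> \<le> real d powr \<alpha> * (\<Sum>k<d. (norm (\<theta> k) * norm ((f n k (fst p) - g k (fst p)) * snd p)) powr \<alpha>)"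
        using \<alpha> by (intro powr_sum_le) auto
      finally show "\<bar>\<Sum>k<d. \<theta> k \<bullet> ((f n k (fst p) - g k (fst p)) * snd p)\<bar> powr \<alpha>
        \<le> real d powr \<alpha> * (\<Sum>k<d. norm (\<theta> k) powr \<alpha> * norm ((f n k (fst p) - g k (fst p)) * snd p) powr \<alpha>)"
        by (simp only: powr_mult norm_ge_zero)
    qed
    also have "\<dots> = real d powr \<alpha> * (\<Sum>k<d. norm (\<theta> k) powr \<alpha> * (LINT p|control. norm ((f n k (fst p) - g k (fst p)) * snd p) powr \<alpha>))"
      using ic by (subst integral_mult_right_zero, subst Bochner_Integration.integral_sum) auto
    also have "\<dots> = real d powr \<alpha> * (\<Sum>k<d. norm (\<theta> k) powr \<alpha> * (LINT x|m. norm (f n k x - g k x) powr \<alpha>))"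
      using integral_control_norm[OF fg(1)] by (intro arg_cong2[where f="(*)"] sum.cong refl) auto
    finally show "norm (LINT p|control. \<bar>\<Sum>k<d. \<theta> k \<bullet> ((f n k (fst p) - g k (fst p)) * snd p)\<bar> powr \<alpha>)
       \<le> real d powr \<alpha> * (\<Sum>k<d. norm (\<theta> k) powr \<alpha> * (LINT x|m. norm (f n k x - g k x) powr \<alpha>))" by simp
  qed
qed

text \<open>Dominated convergence passes to the limit in the characteristic functions, and
  L^\<alpha>(m) convergence does so in the exponents of the simple integrals.\<close>

lemma cf_limit:
  fixes q :: "nat \<Rightarrow> real \<Rightarrow> complex" and h :: "real \<Rightarrow> complex"
  assumes q: "\<And>n. simple_function borel (q n)" and h: "h \<in> borel_measurable borel" "bounded (range h)"
    and lim: "(\<lambda>n. LINT x|m. norm (q n x - h x) powr \<alpha>) \<longlonglongrightarrow> 0"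
    and [measurable]: "Z \<in> borel_measurable M" and Z: "AE \<omega> in M. (\<lambda>n. simple_stoch_integral X (q n) \<omega>) \<longlonglongrightarrow> Z \<omega>"
  shows "(CLINT \<omega>|M. iexp (a \<bullet> Z \<omega>)) = of_real (exp (- (LINT p|control. \<bar>a \<bullet> (h (fst p) * snd p)\<bar> powr \<alpha>)))"
proof (rule LIMSEQ_unique)
  have [measurable]: "simple_stoch_integral X (q n) \<in> borel_measurable M" for n
    by (rule simple_stoch_integral_measurable[OF q])
  show "(\<lambda>n. CLINT \<omega>|M. iexp (a \<bullet> simple_stoch_integral X (q n) \<omega>)) \<longlonglongrightarrow> (CLINT \<omega>|M. iexp (a \<bullet> Z \<omega>))"
  proof (rule integral_dominated_convergence[where w="\<lambda>_. 1"])
    show "AE \<omega> in M. (\<lambda>n. iexp (a \<bullet> simple_stoch_integral X (q n) \<omega>)) \<longlonglongrightarrow> iexp (a \<bullet> Z \<omega>)"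
      using Z by eventually_elim (intro tendsto_intros)
  qed auto
  have s1: "(\<Sum>k<(1::nat). g k) = g 0" for g :: "nat \<Rightarrow> real" by simp
  have "(\<lambda>n. LINT p|control. \<bar>a \<bullet> (q n (fst p) * snd p)\<bar> powr \<alpha>) \<longlonglongrightarrow> (LINT p|control. \<bar>a \<bullet> (h (fst p) * snd p)\<bar> powr \<alpha>)"
    by (rule tendsto_control[of 1 "\<lambda>n k. q n" "\<lambda>k. h" "\<lambda>_. a", unfolded s1])
      (use simple_function_bounded[OF q] h lim in auto)
  then have "(\<lambda>n. of_real (exp (- (LINT p|control. \<bar>a \<bullet> (q n (fst p) * snd p)\<bar> powr \<alpha>))))
    \<longlonglongrightarrow> complex_of_real (exp (- (LINT p|control. \<bar>a \<bullet> (h (fst p) * snd p)\<bar> powr \<alpha>)))"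
    by (intro tendsto_of_real tendsto_exp tendsto_minus) simp
  moreover have "(CLINT \<omega>|M. iexp (a \<bullet> simple_stoch_integral X (q n) \<omega>)) = of_real (exp (- (LINT p|control. \<bar>a \<bullet> (q n (fst p) * snd p)\<bar> powr \<alpha>)))" for n
    using cf_simple[of 1 "\<lambda>_. q n" "\<lambda>_. a", unfolded s1] q by simp
  ultimately show "(\<lambda>n. CLINT \<omega>|M. iexp (a \<bullet> simple_stoch_integral X (q n) \<omega>)) \<longlonglongrightarrow> of_real (exp (- (LINT p|control. \<bar>a \<bullet> (h (fst p) * snd p)\<bar> powr \<alpha>)))"
    by simp
qed

end

section \<open>Existence and joint laws of stochastic integrals\<close>

context stable_random_measure
begin

text \<open>The measure-preserving involution under which f(x) u is odd, as
  \<open>sas_vectorI\<close> and \<open>cov_norm_eq\<close> require.\<close>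

definition flip :: "real \<times> complex \<Rightarrow> real \<times> complex" where "flip p = (fst p, - snd p)"

lemma flip_measurable: "flip \<in> measurable control control"
  unfolding flip_def[abs_def] by measurable

lemma distr_flip: "distr control control flip = control"
proof -
  have d: "distr \<rho> \<rho> uminus = \<rho>"
  proof -
    have "distr \<rho> \<rho> uminus = distr \<rho> borel uminus" by (rule distr_cong) auto
    then show ?thesis by (simp add: \<rho>_symmetric)
  qed
  have sf: "sigma_finite_measure (distr \<rho> \<rho> uminus)" unfolding d by unfold_locales
  have "distr m m (\<lambda>x. x) \<Otimes>\<^sub>M distr \<rho> \<rho> uminus = distr (m \<Otimes>\<^sub>M \<rho>) (m \<Otimes>\<^sub>M \<rho>) (\<lambda>(x, y). (x, - y))"
    by (rule pair_measure_distr[OF _ _ sf]) auto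
  then show ?thesis by (simp add: d control_def flip_def[abs_def] split_beta')
qed

lemma control_odd: "h (fst (flip p)) * snd (flip p) = - (h (fst p) * snd p)"
  by (simp add: flip_def)

lemma control_component_measurable:
  assumes [measurable]: "h \<in> borel_measurable borel"
  shows "(\<lambda>p. h (fst p) * snd p :: complex) \<in> borel_measurable control"
  by measurable

lemma cov_norm_control:
  fixes h :: "real \<Rightarrow> complex"
  assumes h: "h \<in> borel_measurable borel" "bounded (range h)" and Z: "Z \<in> borel_measurable M"
    and cf: "\<And>a. (CLINT \<omega>|M. iexp (a \<bullet> Z \<omega>)) = of_real (exp (- (LINT p|control. \<bar>a \<bullet> (h (fst p) * snd p)\<bar> powr \<alpha>)))"
  shows "sas_vector \<alpha> M 1 (\<lambda>_. Z)" "cov_norm \<alpha> M Z = (LINT x|m. norm (h x) powr \<alpha>) powr (1 / \<alpha>)"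
proof -
  have sf: "sigma_finite_measure control" by unfold_locales
  note * = cov_norm_eq[OF \<alpha> flip_measurable distr_flip sf control_component_measurable[OF h(1)] control_odd
      integrable_control[OF h] Z cf]
  show "sas_vector \<alpha> M 1 (\<lambda>_. Z)" by (rule *(1))
  show "cov_norm \<alpha> M Z = (LINT x|m. norm (h x) powr \<alpha>) powr (1 / \<alpha>)"
    using *(2) by (simp add: integral_control_norm[OF h(1)])
qed

lemma simple_function_diff_complex:
  fixes f g :: "real \<Rightarrow> complex"
  shows "simple_function N f \<Longrightarrow> simple_function N g \<Longrightarrow> simple_function N (\<lambda>x. f x - g x)"
  by (rule simple_function_compose2)

text \<open>A simple integral may have infinite mean. But two terms of finite error differ by an
  integrable variable, whose mean modulus is at most the sum of the two errors. The differences from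
  the fixed term \<open>s N0\<close> are therefore Cauchy in L^1 and converge almost surely along a
  subsequence.\<close>

lemma L1_approx_AE_limit:
  assumes f[measurable]: "f \<in> borel_measurable borel" and s: "L1_approx M X s f"
  shows "\<exists>Y r. Y \<in> borel_measurable M \<and> strict_mono r \<and>
    (AE \<omega> in M. (\<lambda>k. simple_stoch_integral X (s (r k)) \<omega>) \<longlonglongrightarrow> Y \<omega>)"
proof -
  define e where "e n = (\<integral>\<^sup>+x. ennreal (norm (s n x - f x)) \<partial>variation_measure M X)" for n
  have e: "e \<longlonglongrightarrow> 0" using s by (simp add: L1_approx_def e_def[abs_def])
  note sS = L1_approx_simple[OF s]
  have [measurable]: "s n \<in> borel_measurable borel" for n
    using simple_function_bounded[OF sS] by auto
  have [measurable]: "simple_stoch_integral X (s n) \<in> borel_measurable M" for n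
    by (rule simple_stoch_integral_measurable[OF sS])
  have diff: "(\<integral>\<^sup>+\<omega>. ennreal (norm (simple_stoch_integral X (s i) \<omega> - simple_stoch_integral X (s j) \<omega>)) \<partial>M) \<le> e i + e j" for i j
  proof -
    have "(\<integral>\<^sup>+\<omega>. ennreal (norm (simple_stoch_integral X (s i) \<omega> - simple_stoch_integral X (s j) \<omega>)) \<partial>M)
      = (\<integral>\<^sup>+\<omega>. ennreal (norm (simple_stoch_integral X (\<lambda>x. s i x - s j x) \<omega>)) \<partial>M)"
      by (rule nn_integral_cong_AE) (use simple_stoch_integral_diff[OF sS sS, of i j] in \<open>auto elim: eventually_mono\<close>)
    also have "\<dots> \<le> (\<integral>\<^sup>+x. ennreal (norm (s i x - s j x)) \<partial>variation_measure M X)"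
      by (rule nn_integral_simple_stoch_integral_le[OF simple_function_diff_complex[OF sS sS]])
    also have "\<dots> \<le> (\<integral>\<^sup>+x. ennreal (norm (s i x - f x)) + ennreal (norm (s j x - f x)) \<partial>variation_measure M X)"
    proof (rule nn_integral_mono)
      fix x
      have "norm (s i x - s j x) \<le> norm (s i x - f x) + norm (s j x - f x)"
        using norm_triangle_ineq4[of "s i x - f x" "s j x - f x"] by simp
      then show "ennreal (norm (s i x - s j x)) \<le> ennreal (norm (s i x - f x)) + ennreal (norm (s j x - f x))"
        by (simp add: ennreal_leI flip: ennreal_plus)
    qed
    also have "\<dots> = e i + e j" unfolding e_def by (rule nn_integral_add) auto
    finally show ?thesis .
  qed
  obtain N0 where N0: "\<And>n. N0 \<le> n \<Longrightarrow> e n < top"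
    using order_tendstoD(2)[OF e, of top] by (auto simp: eventually_sequentially)
  define D where "D n \<omega> = simple_stoch_integral X (s (n + N0)) \<omega> - simple_stoch_integral X (s N0) \<omega>" for n \<omega>
  have [measurable]: "D n \<in> borel_measurable M" for n unfolding D_def[abs_def] by measurable
  have iD: "integrable M (D n)" for n
  proof (rule integrableI_bounded)
    have "(\<integral>\<^sup>+\<omega>. ennreal (norm (D n \<omega>)) \<partial>M) \<le> e (n + N0) + e N0" unfolding D_def by (rule diff)
    also have "\<dots> < \<infinity>" using N0[of "n + N0"] N0[of N0] by (simp add: less_top[symmetric])
    finally show "(\<integral>\<^sup>+\<omega>. ennreal (norm (D n \<omega>)) \<partial>M) < \<infinity>" .
  qed measurable
  have "\<exists>N. \<forall>i\<ge>N. \<forall>j\<ge>N. (LINT \<omega>|M. norm (D i \<omega> - D j \<omega>)) < \<epsilon>" if \<epsilon>: "0 < \<epsilon>" for \<epsilon> :: real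
  proof -
    have "eventually (\<lambda>n. e n < ennreal (\<epsilon> / 2)) sequentially" using e \<epsilon> by (intro order_tendstoD) auto
    then obtain N1 where N1: "\<And>n. N1 \<le> n \<Longrightarrow> e n < ennreal (\<epsilon> / 2)" by (auto simp: eventually_sequentially)
    have "(LINT \<omega>|M. norm (D i \<omega> - D j \<omega>)) < \<epsilon>" if ij: "N1 \<le> i" "N1 \<le> j" for i j
    proof -
      have "ennreal (LINT \<omega>|M. norm (D i \<omega> - D j \<omega>)) = (\<integral>\<^sup>+\<omega>. ennreal (norm (D i \<omega> - D j \<omega>)) \<partial>M)"
        using iD by (intro nn_integral_eq_integral[symmetric]) auto
      also have "\<dots> \<le> e (i + N0) + e (j + N0)" unfolding D_def using diff[of "i + N0" "j + N0"] by simp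
      also have "\<dots> < ennreal (\<epsilon> / 2) + ennreal (\<epsilon> / 2)" using N1[of "i + N0"] N1[of "j + N0"] ij by (intro add_strict_mono) auto
      also have "\<dots> = ennreal \<epsilon>" using \<epsilon> by (simp flip: ennreal_plus)
      finally show ?thesis using \<epsilon> by (simp add: ennreal_less_iff)
    qed
    then show ?thesis by blast
  qed
  then obtain r where r: "strict_mono r" "AE \<omega> in M. Cauchy (\<lambda>i. D (r i) \<omega>)"
    using cauchy_L1_AE_cauchy_subseq[of M D] iD by blast
  define r' where "r' k = r k + N0" for k
  define Y where "Y \<omega> = lim (\<lambda>k. simple_stoch_integral X (s (r' k)) \<omega>)" for \<omega>
  have "AE \<omega> in M. (\<lambda>k. simple_stoch_integral X (s (r' k)) \<omega>) \<longlonglongrightarrow> Y \<omega>"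
    using r(2)
  proof eventually_elim
    case (elim \<omega>)
    then obtain l where "(\<lambda>i. D (r i) \<omega>) \<longlonglongrightarrow> l" by (auto simp: Cauchy_convergent_iff convergent_def)
    then have "(\<lambda>i. D (r i) \<omega> + simple_stoch_integral X (s N0) \<omega>) \<longlonglongrightarrow> l + simple_stoch_integral X (s N0) \<omega>"
      by (intro tendsto_intros)
    then have "convergent (\<lambda>k. simple_stoch_integral X (s (r' k)) \<omega>)"
      by (auto simp: D_def r'_def convergent_def)
    then show ?case unfolding Y_def by (simp add: convergent_LIMSEQ_iff)
  qed
  moreover have "Y \<in> borel_measurable M" unfolding Y_def[abs_def] by measurable
  moreover have "strict_mono r'" using r(1) by (auto simp: r'_def strict_mono_def)
  ultimately show ?thesis by blast
qed

text \<open>The candidate \<open>Y\<close> is the almost sure limit along a subsequence of one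
  approximating sequence, whereas the definition quantifies over all of them. For another sequence
  s', letting k grow in s' n - s (r k) shows that the error at stage n has the exponent of s' n - f,
  and the L^\<alpha>(m) estimate finishes.\<close>

lemma ex_stoch_integral:
  assumes f: "f \<in> Lambda M X" and b: "bounded (range f)"
  shows "\<exists>Y. is_stoch_integral \<alpha> M X f Y"
proof -
  have fm[measurable]: "f \<in> borel_measurable borel" using f by (simp add: Lambda_def)
  obtain s where s: "L1_approx M X s f" using f by (auto simp: Lambda_def)
  obtain Y r where [measurable]: "Y \<in> borel_measurable M" and r: "strict_mono r"
    and Y: "AE \<omega> in M. (\<lambda>k. simple_stoch_integral X (s (r k)) \<omega>) \<longlonglongrightarrow> Y \<omega>"
    using L1_approx_AE_limit[OF fm s] by blast
  note sS = L1_approx_simple[OF s]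
  note sb = simple_function_bounded[OF sS]
  have l0: "(\<lambda>k. LINT x|m. norm (f x - s (r k) x) powr \<alpha>) \<longlonglongrightarrow> 0"
    using LIMSEQ_subseq_LIMSEQ[OF L1_approx_tendsto[OF fm b s] r] by (simp add: comp_def norm_minus_commute)
  have "is_stoch_integral \<alpha> M X f Y"
    unfolding is_stoch_integral_def
  proof (intro conjI allI impI)
    fix s' assume s': "L1_approx M X s' f"
    note s'S = L1_approx_simple[OF s']
    note s'b = simple_function_bounded[OF s'S]
    have hb: "(\<lambda>x. s' n x - f x) \<in> borel_measurable borel" "bounded (range (\<lambda>x. s' n x - f x))" for n
      using s'b fm b by (auto intro: bounded_minus_comp)
    have [measurable]: "simple_stoch_integral X (s' n) \<in> borel_measurable M" for n
      by (rule simple_stoch_integral_measurable[OF s'S])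
    have cf: "(CLINT \<omega>|M. iexp (a \<bullet> (simple_stoch_integral X (s' n) \<omega> - Y \<omega>)))
      = of_real (exp (- (LINT p|control. \<bar>a \<bullet> ((s' n (fst p) - f (fst p)) * snd p)\<bar> powr \<alpha>)))" for a n
    proof (rule cf_limit[where q="\<lambda>k x. s' n x - s (r k) x"])
      show "simple_function borel (\<lambda>x. s' n x - s (r k) x)" for k
        by (rule simple_function_diff_complex[OF s'S sS])
      show "(\<lambda>k. LINT x|m. norm (s' n x - s (r k) x - (s' n x - f x)) powr \<alpha>) \<longlonglongrightarrow> 0"
        using l0 by simp
      have "AE \<omega> in M. \<forall>k. simple_stoch_integral X (\<lambda>x. s' n x - s (r k) x) \<omega> = simple_stoch_integral X (s' n) \<omega> - simple_stoch_integral X (s (r k)) \<omega>"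
        unfolding AE_all_countable using simple_stoch_integral_diff[OF s'S sS] by blast
      then show "AE \<omega> in M. (\<lambda>k. simple_stoch_integral X (\<lambda>x. s' n x - s (r k) x) \<omega>) \<longlonglongrightarrow> simple_stoch_integral X (s' n) \<omega> - Y \<omega>"
        using Y by eventually_elim (auto intro: tendsto_intros)
    qed (use hb in auto)
    have mD: "(\<lambda>\<omega>. simple_stoch_integral X (s' n) \<omega> - Y \<omega>) \<in> borel_measurable M" for n by measurable
    show "sas_vector \<alpha> M 1 (\<lambda>_ \<omega>. simple_stoch_integral X (s' n) \<omega> - Y \<omega>)" for n
      by (rule cov_norm_control(1)[OF hb mD cf])
    have "cov_norm \<alpha> M (\<lambda>\<omega>. simple_stoch_integral X (s' n) \<omega> - Y \<omega>) = (LINT x|m. norm (s' n x - f x) powr \<alpha>) powr (1 / \<alpha>)" for n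
      by (rule cov_norm_control(2)[OF hb mD cf])
    moreover have "(\<lambda>n. (LINT x|m. norm (s' n x - f x) powr \<alpha>) powr (1 / \<alpha>)) \<longlonglongrightarrow> 0 powr (1 / \<alpha>)"
      using L1_approx_tendsto[OF fm b s'] \<alpha> by (intro tendsto_powr' tendsto_const) auto
    ultimately show "(\<lambda>n. cov_norm \<alpha> M (\<lambda>\<omega>. simple_stoch_integral X (s' n) \<omega> - Y \<omega>)) \<longlonglongrightarrow> 0" by simp
  qed measurable
  then show ?thesis by blast
qed

text \<open>All that is known of the Y k is convergence in \<open>cov_norm\<close>, one variable at
  a time. They are therefore replaced by simple integrals successively, and by
  \<open>norm_cf_diff_le\<close> each replacement costs only the characteristic function of a single
  error.\<close>

lemma cf_stoch_integrals:
  fixes f :: "nat \<Rightarrow> real \<Rightarrow> complex"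
  assumes f: "\<And>k. k < d \<Longrightarrow> f k \<in> Lambda M X" "\<And>k. k < d \<Longrightarrow> bounded (range (f k))"
    and Y: "\<And>k. k < d \<Longrightarrow> is_stoch_integral \<alpha> M X (f k) (Y k)"
  shows "(CLINT \<omega>|M. iexp (\<Sum>k<d. \<theta> k \<bullet> Y k \<omega>)) =
    of_real (exp (- (LINT p|control. \<bar>\<Sum>k<d. \<theta> k \<bullet> (f k (fst p) * snd p)\<bar> powr \<alpha>)))"
proof -
  have fm: "f k \<in> borel_measurable borel" if "k < d" for k using f(1)[OF that] by (simp add: Lambda_def)
  have "\<exists>s. \<forall>k\<in>{..<d}. L1_approx M X (s k) (f k)" using f(1) by (intro bchoice) (auto simp: Lambda_def)
  then obtain s :: "nat \<Rightarrow> nat \<Rightarrow> real \<Rightarrow> complex" where s: "\<And>k. k < d \<Longrightarrow> L1_approx M X (s k) (f k)" by auto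
  have sS: "k < d \<Longrightarrow> simple_function borel (s k n)" for k n using L1_approx_simple[OF s] .
  have Ym: "k < d \<Longrightarrow> Y k \<in> borel_measurable M" for k using Y by (simp add: is_stoch_integral_def)
  have Sm: "k < d \<Longrightarrow> simple_stoch_integral X (s k n) \<in> borel_measurable M" for k n
    by (rule simple_stoch_integral_measurable[OF sS])
  define D where "D k n \<omega> = simple_stoch_integral X (s k n) \<omega> - Y k \<omega>" for k n \<omega>
  have cD: "(\<lambda>n. CLINT \<omega>|M. iexp (\<theta> k \<bullet> D k n \<omega>)) \<longlonglongrightarrow> 1" if k: "k < d" for k
  proof -
    have sas: "sas_vector \<alpha> M 1 (\<lambda>_. D k n)" for n
      using Y[OF k] s[OF k] unfolding is_stoch_integral_def D_def by blast
    have cn: "(\<lambda>n. cov_norm \<alpha> M (D k n)) \<longlonglongrightarrow> 0"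
      using Y[OF k] s[OF k] unfolding is_stoch_integral_def D_def by blast
    have "\<exists>t. (CLINT \<omega>|M. iexp (\<theta> k \<bullet> D k n \<omega>)) = of_real (exp (- t)) \<and> 0 \<le> t \<and> t \<le> norm (\<theta> k) powr \<alpha> * cov_norm \<alpha> M (D k n) powr \<alpha>" for n
      using cf_cov_norm_bound[OF \<alpha> sas[of n], of "\<theta> k"] by blast
    then obtain t where t: "\<And>n. (CLINT \<omega>|M. iexp (\<theta> k \<bullet> D k n \<omega>)) = of_real (exp (- t n))" "\<And>n. 0 \<le> t n"
      "\<And>n. t n \<le> norm (\<theta> k) powr \<alpha> * cov_norm \<alpha> M (D k n) powr \<alpha>" by metis
    have "(\<lambda>n. norm (\<theta> k) powr \<alpha> * cov_norm \<alpha> M (D k n) powr \<alpha>) \<longlonglongrightarrow> norm (\<theta> k) powr \<alpha> * 0 powr \<alpha>"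
      using cn \<alpha> by (intro tendsto_mult tendsto_powr' tendsto_const) (auto simp: cov_norm_def)
    then have "t \<longlonglongrightarrow> 0"
      by (intro tendsto_sandwich[of "\<lambda>_. 0" t sequentially "\<lambda>n. norm (\<theta> k) powr \<alpha> * cov_norm \<alpha> M (D k n) powr \<alpha>" 0])
        (auto simp: t(2,3))
    then have "(\<lambda>n. complex_of_real (exp (- t n))) \<longlonglongrightarrow> of_real (exp (- 0))" by (intro tendsto_intros)
    then show ?thesis unfolding t(1) by simp
  qed
  have step: "(\<lambda>n. (CLINT \<omega>|M. iexp (\<Sum>k<d. \<theta> k \<bullet> simple_stoch_integral X (s k n) \<omega>))) \<longlonglongrightarrow> (CLINT \<omega>|M. iexp (\<Sum>k<d. \<theta> k \<bullet> Y k \<omega>))"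
  proof -
    \<comment> \<open>The first j variables are already simple integrals, the others still the
      limits; j = 0 and j = d are the two ends of the telescope.\<close>
    define V where "V j n \<omega> = (\<Sum>k<d. \<theta> k \<bullet> (if k < j then simple_stoch_integral X (s k n) \<omega> else Y k \<omega>))" for j n \<omega>
    have Vm: "V j n \<in> borel_measurable M" for j n
      unfolding V_def[abs_def] by (intro borel_measurable_sum borel_measurable_inner) (use Sm Ym in auto)
    have "(\<lambda>n. (CLINT \<omega>|M. iexp (V j n \<omega>)) - (CLINT \<omega>|M. iexp (V 0 n \<omega>))) \<longlonglongrightarrow> 0" if "j \<le> d" for j
      using that
    proof (induction j)
      case (Suc j)
      then have j: "j < d" by simp
      have Vd: "V (Suc j) n \<omega> - V j n \<omega> = \<theta> j \<bullet> D j n \<omega>" for n \<omega>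
      proof -
        have "V (Suc j) n \<omega> - V j n \<omega> = (\<Sum>k<d. if k = j then \<theta> j \<bullet> D j n \<omega> else 0)"
          unfolding V_def sum_subtractf[symmetric] by (intro sum.cong) (auto simp: D_def inner_diff_right)
        then show ?thesis using j by simp
      qed
      have "(\<lambda>n. sqrt (2 * (1 - Re (CLINT \<omega>|M. iexp (\<theta> j \<bullet> D j n \<omega>))))) \<longlonglongrightarrow> sqrt (2 * (1 - Re 1))"
        by (intro tendsto_intros cD j)
      then have l: "(\<lambda>n. sqrt (2 * (1 - Re (CLINT \<omega>|M. iexp (\<theta> j \<bullet> D j n \<omega>))))) \<longlonglongrightarrow> 0" by simp
      have "(\<lambda>n. (CLINT \<omega>|M. iexp (V (Suc j) n \<omega>)) - (CLINT \<omega>|M. iexp (V j n \<omega>))) \<longlonglongrightarrow> 0"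
      proof (rule Lim_null_comparison[OF _ l], intro always_eventually allI)
        fix n
        show "norm ((CLINT \<omega>|M. iexp (V (Suc j) n \<omega>)) - (CLINT \<omega>|M. iexp (V j n \<omega>))) \<le> sqrt (2 * (1 - Re (CLINT \<omega>|M. iexp (\<theta> j \<bullet> D j n \<omega>))))"
          using norm_cf_diff_le[OF Vm[of "Suc j" n] Vm[of j n]] unfolding Vd .
      qed
      from tendsto_add[OF this Suc.IH] show ?case using Suc.prems by simp
    qed simp
    from this[of d] have "(\<lambda>n. (CLINT \<omega>|M. iexp (V d n \<omega>)) - (CLINT \<omega>|M. iexp (V 0 n \<omega>))) \<longlonglongrightarrow> 0" by simp
    moreover have "V d n \<omega> = (\<Sum>k<d. \<theta> k \<bullet> simple_stoch_integral X (s k n) \<omega>)" "V 0 n \<omega> = (\<Sum>k<d. \<theta> k \<bullet> Y k \<omega>)" for n \<omega>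
      by (auto simp: V_def intro!: sum.cong)
    ultimately show ?thesis by (simp add: LIM_zero_iff del: of_real_sum)
  qed
  have "(CLINT \<omega>|M. iexp (\<Sum>k<d. \<theta> k \<bullet> simple_stoch_integral X (s k n) \<omega>)) = of_real (exp (- (LINT p|control. \<bar>\<Sum>k<d. \<theta> k \<bullet> (s k n (fst p) * snd p)\<bar> powr \<alpha>)))" for n
    by (rule cf_simple) (rule sS)
  moreover have "(\<lambda>n. LINT p|control. \<bar>\<Sum>k<d. \<theta> k \<bullet> ((\<lambda>n k. s k n) n k (fst p) * snd p)\<bar> powr \<alpha>)
    \<longlonglongrightarrow> (LINT p|control. \<bar>\<Sum>k<d. \<theta> k \<bullet> (f k (fst p) * snd p)\<bar> powr \<alpha>)"
    by (rule tendsto_control) (use simple_function_bounded[OF sS] fm f(2) L1_approx_tendsto[OF fm f(2) s] in auto)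
  then have "(\<lambda>n. complex_of_real (exp (- (LINT p|control. \<bar>\<Sum>k<d. \<theta> k \<bullet> (s k n (fst p) * snd p)\<bar> powr \<alpha>))))
    \<longlonglongrightarrow> of_real (exp (- (LINT p|control. \<bar>\<Sum>k<d. \<theta> k \<bullet> (f k (fst p) * snd p)\<bar> powr \<alpha>)))"
    by (intro tendsto_intros)
  ultimately show ?thesis using LIMSEQ_unique[OF step] by simp
qed

lemma is_stoch_integral_stoch_integral:
  assumes "f \<in> Lambda M X" "bounded (range f)"
  shows "is_stoch_integral \<alpha> M X f (stoch_integral \<alpha> M X f)"
  unfolding stoch_integral_def by (rule someI_ex[OF ex_stoch_integral[OF assms]])

text \<open>The direction enters the product as u times \<open>cnj u\<close>, which is 1 for almost
  every u.\<close>

lemma integral_control_spow: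
  fixes h g :: "real \<Rightarrow> complex"
  assumes [measurable]: "h \<in> borel_measurable borel" "g \<in> borel_measurable borel"
  shows "(CLINT p|control. (h (fst p) * snd p) * spow (\<alpha> - 1) (g (fst p) * snd p)) = (CLINT x|m. h x * spow (\<alpha> - 1) (g x))"
proof -
  have "(CLINT p|control. (h (fst p) * snd p) * spow (\<alpha> - 1) (g (fst p) * snd p)) = (CLINT p|control. h (fst p) * spow (\<alpha> - 1) (g (fst p)))"
  proof (rule integral_cong_AE)
    show "AE p in control. (h (fst p) * snd p) * spow (\<alpha> - 1) (g (fst p) * snd p) = h (fst p) * spow (\<alpha> - 1) (g (fst p))"
      using AE_control
    proof eventually_elim
      case (elim p)
      have "snd p * cnj (snd p) = 1" using elim complex_norm_square[of "snd p"] by simp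
      moreover have "(h (fst p) * snd p) * spow (\<alpha> - 1) (g (fst p) * snd p) = h (fst p) * spow (\<alpha> - 1) (g (fst p)) * (snd p * cnj (snd p))"
        using elim by (simp add: spow_def norm_mult)
      ultimately show ?case by simp
    qed
  qed measurable
  also have "\<dots> = (CLINT x|distr (m \<Otimes>\<^sub>M \<rho>) m fst. h x * spow (\<alpha> - 1) (g x))"
    unfolding control_def by (rule integral_distr[symmetric]) measurable
  also have "\<dots> = (CLINT x|m. h x * spow (\<alpha> - 1) (g x))" by (simp add: \<rho>.distr_pair_fst)
  finally show ?thesis .
qed

lemma covariation_stoch_integral:
  assumes h: "h \<in> Lambda M X" "bounded (range h)" and g: "g \<in> Lambda M X" "bounded (range g)"
  shows "covariation \<alpha> M (stoch_integral \<alpha> M X h) (stoch_integral \<alpha> M X g) = (CLINT x|m. h x * spow (\<alpha> - 1) (g x))"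
proof -
  define Y where "Y = stoch_integral \<alpha> M X h"
  define Z where "Z = stoch_integral \<alpha> M X g"
  have Y: "is_stoch_integral \<alpha> M X h Y" and Z: "is_stoch_integral \<alpha> M X g Z"
    unfolding Y_def Z_def using is_stoch_integral_stoch_integral h g by auto
  have YZm: "Y \<in> borel_measurable M" "Z \<in> borel_measurable M" using Y Z by (auto simp: is_stoch_integral_def)
  have hm[measurable]: "h \<in> borel_measurable borel" and gm[measurable]: "g \<in> borel_measurable borel"
    using h g by (auto simp: Lambda_def)
  have s2: "(\<Sum>i<2. f i) = f 0 + f 1" for f :: "nat \<Rightarrow> real" by (simp add: numeral_2_eq_2)
  define f where "f k = (if k = 0 then h else g)" for k :: nat
  have f: "f k \<in> Lambda M X" "bounded (range (f k))" "is_stoch_integral \<alpha> M X (f k) (pair_vector Y Z k)" for k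
    using h g Y Z by (auto simp: f_def pair_vector_def)
  have fm: "f k \<in> borel_measurable borel" for k by (auto simp: f_def)
  note cf = cf_stoch_integrals[of 2 f "pair_vector Y Z", OF f]
  have sas: "sas_vector \<alpha> M 2 (pair_vector Y Z)"
  proof (rule sas_vectorI[where h="\<lambda>k p. f k (fst p) * snd p" and N=control and T=flip])
    show "(CLINT \<omega>|M. iexp (\<Sum>i<2. \<theta> i \<bullet> pair_vector Y Z i \<omega>)) = of_real (exp (- (LINT p|control. \<bar>\<Sum>i<2. \<theta> i \<bullet> (f i (fst p) * snd p)\<bar> powr \<alpha>)))" for \<theta>
      by (rule cf)
    show "(\<lambda>p. f i (fst p) * snd p) \<in> borel_measurable control" for i by (rule control_component_measurable[OF fm])
    show "integrable control (\<lambda>p. norm (f i (fst p) * snd p) powr \<alpha>)" for i by (rule integrable_control[OF fm f(2)])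
  qed (use \<alpha> YZm in \<open>auto simp: flip_measurable distr_flip control_odd pair_vector_def\<close>)
  have sf: "sigma_finite_measure control" by unfold_locales
  have "covariation \<alpha> M Y Z = (CLINT p|control. (h (fst p) * snd p) * spow (\<alpha> - 1) (g (fst p) * snd p))"
  proof (rule covariation_eq[OF \<alpha> sas sf])
    fix a b :: complex
    show "(CLINT \<omega>|M. iexp (a \<bullet> Y \<omega> + b \<bullet> Z \<omega>)) = of_real (exp (- (LINT p|control. \<bar>a \<bullet> (h (fst p) * snd p) + b \<bullet> (g (fst p) * snd p)\<bar> powr \<alpha>)))"
      using cf[of "\<lambda>k. if k = 0 then a else b"] by (simp add: s2 f_def pair_vector_def del: of_real_add)
  qed (use h g in \<open>auto intro: control_component_measurable integrable_control\<close>)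
  also have "\<dots> = (CLINT x|m. h x * spow (\<alpha> - 1) (g x))" by (rule integral_control_spow) auto
  finally show ?thesis by (simp add: Y_def Z_def)
qed

end

section \<open>Complex measures and the Morse--Transue integral\<close>

definition signed_measure :: "(real set \<Rightarrow> real) \<Rightarrow> bool" where
  "signed_measure \<mu> \<longleftrightarrow> (\<forall>A::nat \<Rightarrow> real set. range A \<subseteq> sets borel \<longrightarrow> disjoint_family A \<longrightarrow> (\<lambda>i. \<mu> (A i)) sums \<mu> (\<Union>i. A i))"

text \<open>The truncation of negative values by \<open>ennreal\<close> is harmless: for a signed
  measure the empty set already contributes 0 to the supremum.\<close>

definition pos_part :: "(real set \<Rightarrow> real) \<Rightarrow> real set \<Rightarrow> ennreal" where
  "pos_part \<mu> A = (SUP B\<in>{B \<in> sets borel. B \<subseteq> A}. ennreal (\<mu> B))"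

lemma pos_part_measure_eq: "pos_part_measure \<mu> = measure_of UNIV (sets borel) (pos_part \<mu>)"
  by (simp add: pos_part_measure_def pos_part_def[abs_def])

lemma pos_part_measure_cong:
  "(\<And>A. A \<in> sets borel \<Longrightarrow> \<mu> A = \<nu> A) \<Longrightarrow> pos_part_measure \<mu> = pos_part_measure \<nu>"
  unfolding pos_part_measure_def
  by (intro arg_cong[where f="measure_of UNIV (sets borel)"] ext SUP_cong) auto

lemma sets_pos_part_measure[simp, measurable_cong]: "sets (pos_part_measure \<mu>) = sets borel"
  by (simp add: pos_part_measure_def sets.sigma_sets_eq[of borel, simplified])

lemma space_pos_part_measure[simp]: "space (pos_part_measure \<mu>) = UNIV"
  by (simp add: pos_part_measure_def)

context
  fixes \<mu> :: "real set \<Rightarrow> real"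
  assumes \<mu>: "signed_measure \<mu>"
begin

lemma signed_measure_sums: "range A \<subseteq> sets borel \<Longrightarrow> disjoint_family A \<Longrightarrow> (\<lambda>i::nat. \<mu> (A i)) sums \<mu> (\<Union>i. A i)"
  using \<mu> unfolding signed_measure_def by blast

lemma signed_measure_empty: "\<mu> {} = 0"
proof -
  have "(\<lambda>i::nat. \<mu> {}) sums \<mu> (\<Union>i::nat. {})" by (rule signed_measure_sums) (auto simp: disjoint_family_on_def)
  then have "summable (\<lambda>i::nat. \<mu> {})" by (rule sums_summable)
  then show ?thesis by (simp add: summable_const_iff)
qed

lemma signed_measure_union:
  assumes "A \<in> sets borel" "B \<in> sets borel" "A \<inter> B = {}"
  shows "\<mu> (A \<union> B) = \<mu> A + \<mu> B"
proof -
  have "range (binaryset A B) \<subseteq> sets borel" using assms by (auto simp: range_binaryset_eq)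
  moreover have "disjoint_family (binaryset A B)" using assms by (auto simp: disjoint_family_on_def binaryset_def)
  ultimately have s: "(\<lambda>i. \<mu> (binaryset A B i)) sums \<mu> (\<Union>i. binaryset A B i)" by (rule signed_measure_sums)
  have "(\<lambda>i. \<mu> (binaryset A B i)) sums (\<mu> A + \<mu> B)" by (rule binaryset_sums) (rule signed_measure_empty)
  then show ?thesis using s unfolding UN_binaryset_eq by (rule sums_unique2[symmetric])
qed

lemma signed_measure_Diff:
  assumes "A \<in> sets borel" "B \<in> sets borel" "B \<subseteq> A"
  shows "\<mu> (A - B) = \<mu> A - \<mu> B"
proof -
  have "\<mu> (B \<union> (A - B)) = \<mu> B + \<mu> (A - B)" by (rule signed_measure_union) (use assms in auto)
  moreover have "B \<union> (A - B) = A" using assms by auto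
  ultimately show ?thesis by simp
qed

lemma pos_part_superadditive:
  assumes "A \<in> sets borel" "B \<in> sets borel" "A \<inter> B = {}"
  shows "pos_part \<mu> A + pos_part \<mu> B \<le> pos_part \<mu> (A \<union> B)"
proof -
  have ne: "{C \<in> sets borel. C \<subseteq> A} \<noteq> {}" "{C \<in> sets borel. C \<subseteq> B} \<noteq> {}" using assms by auto
  show ?thesis
    unfolding pos_part_def[of \<mu> A] pos_part_def[of \<mu> B]
    unfolding ennreal_SUP_add_left[OF ne(1), symmetric] ennreal_SUP_add_right[OF ne(2)]
  proof (intro SUP_least)
    fix C D assume C: "C \<in> {C \<in> sets borel. C \<subseteq> A}" and D: "D \<in> {C \<in> sets borel. C \<subseteq> B}"
    have up: "ennreal (\<mu> E) \<le> pos_part \<mu> (A \<union> B)" if "E \<in> sets borel" "E \<subseteq> A \<union> B" for E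
      unfolding pos_part_def using that by (intro SUP_upper) auto
    show "ennreal (\<mu> C) + ennreal (\<mu> D) \<le> pos_part \<mu> (A \<union> B)"
    proof (cases "0 \<le> \<mu> C \<and> 0 \<le> \<mu> D")
      case True
      have "\<mu> (C \<union> D) = \<mu> C + \<mu> D" by (rule signed_measure_union) (use C D assms in auto)
      then have "ennreal (\<mu> C) + ennreal (\<mu> D) = ennreal (\<mu> (C \<union> D))" using True by simp
      then show ?thesis using up[of "C \<union> D"] C D by auto
    next
      \<comment> \<open>A set of negative value counts as 0, so it is dropped and the other set
        alone bounds the sum.\<close>
      case False
      then have "ennreal (\<mu> C) = 0 \<or> ennreal (\<mu> D) = 0" by (auto simp: ennreal_neg)
      moreover have "C \<subseteq> A \<union> B" "D \<subseteq> A \<union> B" using C D by auto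
      ultimately show ?thesis using up[of C] up[of D] C D by auto
    qed
  qed
qed

lemma pos_part_UN_le:
  fixes A :: "nat \<Rightarrow> real set"
  assumes A: "range A \<subseteq> sets borel" "disjoint_family A"
  shows "pos_part \<mu> (\<Union>i. A i) \<le> (\<Sum>i. pos_part \<mu> (A i))"
  unfolding pos_part_def[of \<mu> "\<Union>i. A i"]
proof (rule SUP_least)
  fix B assume B: "B \<in> {B \<in> sets borel. B \<subseteq> (\<Union>i. A i)}"
  have Ab: "A i \<in> sets borel" for i using A by auto
  have BA: "(\<Union>i. B \<inter> A i) = B" using B by auto
  have "(\<lambda>i. \<mu> (B \<inter> A i)) sums \<mu> (\<Union>i. B \<inter> A i)"
    by (rule signed_measure_sums) (use A Ab B in \<open>auto simp: disjoint_family_on_def\<close>)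
  then have "(\<lambda>n. \<Sum>i<n. \<mu> (B \<inter> A i)) \<longlonglongrightarrow> \<mu> B" unfolding BA by (simp add: sums_def)
  then have lim: "(\<lambda>n. ennreal (\<Sum>i<n. \<mu> (B \<inter> A i))) \<longlonglongrightarrow> ennreal (\<mu> B)" by (rule tendsto_ennrealI)
  have bound: "ennreal (\<Sum>i<n. \<mu> (B \<inter> A i)) \<le> (\<Sum>i. pos_part \<mu> (A i))" for n
  proof -
    have "ennreal (\<Sum>i<n. \<mu> (B \<inter> A i)) \<le> ennreal (\<Sum>i<n. max 0 (\<mu> (B \<inter> A i)))"
      by (intro ennreal_leI sum_mono) auto
    also have "\<dots> = (\<Sum>i<n. ennreal (max 0 (\<mu> (B \<inter> A i))))" by (rule sum_ennreal[symmetric]) simp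
    also have "\<dots> \<le> (\<Sum>i<n. pos_part \<mu> (A i))"
    proof (rule sum_mono)
      fix i
      have "ennreal (max 0 (\<mu> (B \<inter> A i))) = ennreal (\<mu> (B \<inter> A i))" by (simp add: max_def ennreal_neg)
      also have "\<dots> \<le> pos_part \<mu> (A i)" unfolding pos_part_def using B Ab by (intro SUP_upper) auto
      finally show "ennreal (max 0 (\<mu> (B \<inter> A i))) \<le> pos_part \<mu> (A i)" .
    qed
    also have "\<dots> \<le> (\<Sum>i. pos_part \<mu> (A i))" by (intro sum_le_suminf) auto
    finally show ?thesis .
  qed
  show "ennreal (\<mu> B) \<le> (\<Sum>i. pos_part \<mu> (A i))"
    by (rule LIMSEQ_le_const2[OF lim]) (use bound in blast)
qed

lemma emeasure_pos_part_measure: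
  assumes "A \<in> sets borel" shows "emeasure (pos_part_measure \<mu>) A = pos_part \<mu> A"
proof (rule emeasure_measure_of[OF pos_part_measure_eq])
  have "pos_part \<mu> {} = 0" by (simp add: pos_part_def signed_measure_empty)
  then show "positive (sets (pos_part_measure \<mu>)) (pos_part \<mu>)" by (simp add: positive_def)
  show "countably_additive (sets (pos_part_measure \<mu>)) (pos_part \<mu>)"
    unfolding sets_pos_part_measure
    by (rule countably_additive_if_superadditive[OF pos_part_superadditive pos_part_UN_le])
qed (use assms in auto)

text \<open>Exhaustion argument: a set of infinite positive part is cut so that one piece is again
  of this kind and the other has |\<mu>| \<ge> 1. Iteration yields disjoint sets whose values do not
  tend to 0, against countable additivity.\<close>

lemma finite_pos_part: "pos_part \<mu> UNIV < \<infinity>"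
proof (rule ccontr)
  assume "\<not> pos_part \<mu> UNIV < \<infinity>"
  then have inf: "pos_part \<mu> UNIV = \<infinity>" by (simp add: less_top[symmetric])
  define bad where "bad E \<longleftrightarrow> E \<in> sets borel \<and> pos_part \<mu> E = \<infinity>" for E
  have step: "\<exists>E'. bad E' \<and> E' \<subseteq> E \<and> 1 \<le> \<bar>\<mu> (E - E')\<bar>" if E: "bad E" for E
  proof -
    \<comment> \<open>The margin 1 + |\<mu> E| forces |\<mu>| \<ge> 1 on \<open>B\<close> and on
      \<open>E - B\<close> alike, so either of them may be split off.\<close>
    have "ennreal (1 + \<bar>\<mu> E\<bar>) < pos_part \<mu> E" using E by (simp add: bad_def)
    then obtain B where B: "B \<in> sets borel" "B \<subseteq> E" "ennreal (1 + \<bar>\<mu> E\<bar>) < ennreal (\<mu> B)"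
      unfolding pos_part_def by (auto simp: less_SUP_iff)
    then have mB: "1 + \<bar>\<mu> E\<bar> < \<mu> B" by (subst (asm) ennreal_less_iff) auto
    have EB: "E \<in> sets borel" "E - B \<in> sets borel" using E B by (auto simp: bad_def)
    have mEB: "\<mu> (E - B) = \<mu> E - \<mu> B" by (rule signed_measure_Diff[OF EB(1) B(1,2)])
    have "emeasure (pos_part_measure \<mu>) B + emeasure (pos_part_measure \<mu>) (E - B) = emeasure (pos_part_measure \<mu>) (B \<union> (E - B))"
      by (rule plus_emeasure) (use B EB in auto)
    moreover have "B \<union> (E - B) = E" using B by auto
    ultimately have "pos_part \<mu> B + pos_part \<mu> (E - B) = \<infinity>"
      using E B EB by (simp add: emeasure_pos_part_measure bad_def)
    then consider "pos_part \<mu> B = \<infinity>" | "pos_part \<mu> (E - B) = \<infinity>" by (auto simp: ennreal_add_eq_top)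
    then show ?thesis
    proof cases
      case 1
      then show ?thesis using B EB mB mEB by (intro exI[of _ B]) (auto simp: bad_def)
    next
      case 2
      moreover have "E - (E - B) = B" using B by auto
      ultimately show ?thesis using B EB mB by (intro exI[of _ "E - B"]) (auto simp: bad_def)
    qed
  qed
  have "\<exists>E. \<forall>n. bad (E n) \<and> (E (Suc n) \<subseteq> E n \<and> 1 \<le> \<bar>\<mu> (E n - E (Suc n))\<bar>)"
    by (rule dependent_nat_choice) (use inf step in \<open>auto simp: bad_def\<close>)
  then obtain E where E: "\<And>n. bad (E n)" "\<And>n. E (Suc n) \<subseteq> E n" "\<And>n. 1 \<le> \<bar>\<mu> (E n - E (Suc n))\<bar>" by auto
  define A where "A n = E n - E (Suc n)" for n
  have dec: "E j \<subseteq> E i" if "i \<le> j" for i j using that E(2) by (rule lift_Suc_antimono_le[rotated])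
  have d: "A i \<inter> A j = {}" if "i < j" for i j
    using dec[of "Suc i" j] that by (auto simp: A_def)
  have "disjoint_family A"
    unfolding disjoint_family_on_def using d by (metis Int_commute linorder_neqE_nat)
  moreover have "range A \<subseteq> sets borel" using E(1) by (auto simp: A_def bad_def)
  ultimately have "(\<lambda>i. \<mu> (A i)) sums \<mu> (\<Union>i. A i)" using signed_measure_sums by blast
  then have "(\<lambda>i. \<mu> (A i)) \<longlonglongrightarrow> 0" by (intro summable_LIMSEQ_zero sums_summable)
  then have "eventually (\<lambda>i. \<bar>\<mu> (A i)\<bar> < 1) sequentially"
    using order_tendstoD(2)[OF tendsto_rabs_zero, of "\<lambda>i. \<mu> (A i)" sequentially 1] by simp
  then obtain i where "\<bar>\<mu> (A i)\<bar> < 1" by (auto simp: eventually_sequentially)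
  then show False using E(3)[of i] by (simp add: A_def)
qed

lemma finite_measure_pos_part_measure: "finite_measure (pos_part_measure \<mu>)"
  using finite_pos_part by (intro finite_measureI) (simp add: emeasure_pos_part_measure)

end

lemma signed_measure_uminus: "signed_measure \<mu> \<Longrightarrow> signed_measure (\<lambda>A. - \<mu> A)"
  by (auto simp: signed_measure_def sums_minus)

text \<open>For B inside A, \<mu> B = \<mu> A - \<mu> (A - B), and -\<mu> (A - B) is bounded by the
  negative part. With the same inequality for -\<mu> this becomes the Jordan decomposition, reached
  without choosing a Hahn set.\<close>

lemma measure_pos_part_le:
  assumes \<mu>: "signed_measure \<mu>" and A: "A \<in> sets borel"
  shows "measure (pos_part_measure \<mu>) A \<le> \<mu> A + measure (pos_part_measure (\<lambda>A. - \<mu> A)) A"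
proof -
  note \<mu>' = signed_measure_uminus[OF \<mu>]
  interpret p: finite_measure "pos_part_measure \<mu>" by (rule finite_measure_pos_part_measure[OF \<mu>])
  interpret n: finite_measure "pos_part_measure (\<lambda>A. - \<mu> A)" by (rule finite_measure_pos_part_measure[OF \<mu>'])
  have le: "\<mu> B \<le> \<mu> A + measure (pos_part_measure (\<lambda>A. - \<mu> A)) A" if B: "B \<in> sets borel" "B \<subseteq> A" for B
  proof -
    have "ennreal (- \<mu> (A - B)) \<le> pos_part (\<lambda>A. - \<mu> A) A"
      unfolding pos_part_def using A B by (intro SUP_upper) auto
    also have "\<dots> = ennreal (measure (pos_part_measure (\<lambda>A. - \<mu> A)) A)"
      using A by (simp add: emeasure_pos_part_measure[OF \<mu>', symmetric] n.emeasure_eq_measure)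
    finally have "- \<mu> (A - B) \<le> measure (pos_part_measure (\<lambda>A. - \<mu> A)) A" by (simp add: ennreal_le_iff)
    then show ?thesis using signed_measure_Diff[OF \<mu> A B] by simp
  qed
  have "pos_part \<mu> A \<le> ennreal (\<mu> A + measure (pos_part_measure (\<lambda>A. - \<mu> A)) A)"
    unfolding pos_part_def by (intro SUP_least ennreal_leI le) auto
  then have "ennreal (measure (pos_part_measure \<mu>) A) \<le> ennreal (\<mu> A + measure (pos_part_measure (\<lambda>A. - \<mu> A)) A)"
    using A by (simp add: emeasure_pos_part_measure[OF \<mu>, symmetric] p.emeasure_eq_measure)
  moreover have "0 \<le> \<mu> A + measure (pos_part_measure (\<lambda>A. - \<mu> A)) A"
    using le[of "{}"] A signed_measure_empty[OF \<mu>] by simp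
  ultimately show ?thesis by (simp add: ennreal_le_iff)
qed

lemma Jordan_decomposition:
  assumes \<mu>: "signed_measure \<mu>" and A: "A \<in> sets borel"
  shows "\<mu> A = measure (pos_part_measure \<mu>) A - measure (pos_part_measure (\<lambda>A. - \<mu> A)) A"
  using measure_pos_part_le[OF \<mu> A] measure_pos_part_le[OF signed_measure_uminus[OF \<mu>] A] by simp

lemma signed_integral_indicator:
  assumes \<mu>: "signed_measure \<mu>" and A: "A \<in> sets borel"
  shows "signed_integral \<mu> (indicator A) = of_real (\<mu> A)"
proof -
  have i: "(CLINT x|N. indicator A x) = of_real (measure N A)" if "space N = UNIV" for N :: "real measure"
  proof -
    have "(\<lambda>x. indicator A x) = (\<lambda>x. complex_of_real (indicator A x))" by (auto simp: indicator_def)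
    then show ?thesis using that by (simp only: integral_complex_of_real) simp
  qed
  show ?thesis
    unfolding signed_integral_def by (simp add: i Jordan_decomposition[OF assms])
qed

lemma complex_measure_integral_indicator:
  assumes \<mu>: "\<And>A::nat \<Rightarrow> real set. range A \<subseteq> sets borel \<Longrightarrow> disjoint_family A \<Longrightarrow> (\<lambda>i. \<mu> (A i)) sums \<mu> (\<Union>i. A i)"
    and A: "A \<in> sets borel"
  shows "complex_measure_integral \<mu> (indicator A) = \<mu> A"
proof -
  have "signed_measure (\<lambda>A. Re (\<mu> A))" "signed_measure (\<lambda>A. Im (\<mu> A))"
    unfolding signed_measure_def using \<mu> by (auto simp: sums_complex_iff)
  then show ?thesis
    unfolding complex_measure_integral_def
    by (simp add: signed_integral_indicator A complex_eq[symmetric])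
qed

text \<open>This lets an inner integral be replaced, inside the outer one, by a formula that is
  known for Borel sets only.\<close>

lemma complex_measure_integral_cong:
  "(\<And>A. A \<in> sets borel \<Longrightarrow> \<mu> A = \<nu> A) \<Longrightarrow> complex_measure_integral \<mu> f = complex_measure_integral \<nu> f"
  unfolding complex_measure_integral_def signed_integral_def
  using pos_part_measure_cong[of "\<lambda>A. Re (\<mu> A)" "\<lambda>A. Re (\<nu> A)"] pos_part_measure_cong[of "\<lambda>A. - Re (\<mu> A)" "\<lambda>A. - Re (\<nu> A)"]
    pos_part_measure_cong[of "\<lambda>A. Im (\<mu> A)" "\<lambda>A. Im (\<nu> A)"] pos_part_measure_cong[of "\<lambda>A. - Im (\<mu> A)" "\<lambda>A. - Im (\<nu> A)"]
  by simp

text \<open>Integrating an indicator against a complex measure evaluates that measure; doing so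
  twice reads off the bimeasure.\<close>

lemma has_MT_integral_indicators:
  assumes F: "bimeasure F" and AB: "A \<in> sets borel" "B \<in> sets borel"
    and I: "has_MT_integral F (indicator A) (indicator B) I"
  shows "F A B = I"
proof -
  have inner: "complex_measure_integral (\<lambda>A. F A C) (indicator A) = F A C" if "C \<in> sets borel" for C
    by (rule complex_measure_integral_indicator) (use F that AB in \<open>auto simp: bimeasure_def\<close>)
  have "MT_I1 F (indicator A) (indicator B) = complex_measure_integral (\<lambda>C. F A C) (indicator B)"
    unfolding MT_I1_def by (rule complex_measure_integral_cong) (rule inner)
  also have "\<dots> = F A B"
    by (rule complex_measure_integral_indicator) (use F AB in \<open>auto simp: bimeasure_def\<close>)
  finally show ?thesis using I by (simp add: has_MT_integral_def)
qed

text \<open>As \<open>ennreal\<close> truncates negative numbers to \<open>0\<close>, the density below is the positive part of \<open>w\<close>.\<close>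

lemma pos_part_measure_density:
  fixes w :: "real \<Rightarrow> real" and m :: "real measure"
  assumes m: "finite_measure m" and sets_m[simp, measurable_cong]: "sets m = sets borel"
    and [measurable]: "w \<in> borel_measurable borel" and w: "\<And>x. \<bar>w x\<bar> \<le> C"
  shows "pos_part_measure (\<lambda>A. LINT x|m. indicator A x * w x) = density m (\<lambda>x. ennreal (w x))"
proof -
  interpret finite_measure m by fact
  have sp: "space m = UNIV" using sets_eq_imp_space_eq[OF sets_m] by simp
  have int: "integrable m (\<lambda>x. indicator A x * w x)" if [measurable]: "A \<in> sets borel" for A
    by (rule integrable_const_bound[where B=C]) (use w in \<open>auto simp: abs_mult indicator_def intro: order_trans[OF abs_ge_zero]\<close>)
  have int': "integrable m (\<lambda>x. indicator A x * max 0 (w x))" if [measurable]: "A \<in> sets borel" for A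
  proof (rule integrable_const_bound[where B=C])
    show "AE x in m. norm (indicator A x * max 0 (w x)) \<le> C"
    proof (intro AE_I2)
      fix x show "norm (indicator A x * max 0 (w x)) \<le> C" using w[of x] by (auto simp: indicator_def max_def)
    qed
  qed measurable
  have dens: "emeasure (density m (\<lambda>x. ennreal (w x))) A = ennreal (LINT x|m. indicator A x * max 0 (w x))"
    if [measurable]: "A \<in> sets borel" for A
  proof -
    have "emeasure (density m (\<lambda>x. ennreal (w x))) A = (\<integral>\<^sup>+x. ennreal (indicator A x * max 0 (w x)) \<partial>m)"
      by (subst emeasure_density) (auto intro!: nn_integral_cong simp: indicator_def max_def ennreal_neg)
    also have "\<dots> = ennreal (LINT x|m. indicator A x * max 0 (w x))"
      by (rule nn_integral_eq_integral[OF int']) (auto simp: that)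
    finally show ?thesis .
  qed
  have eq: "pos_part (\<lambda>A. LINT x|m. indicator A x * w x) A = emeasure (density m (\<lambda>x. ennreal (w x))) A"
    if A[measurable]: "A \<in> sets borel" for A
  proof (rule antisym)
    show "pos_part (\<lambda>A. LINT x|m. indicator A x * w x) A \<le> emeasure (density m (\<lambda>x. ennreal (w x))) A"
      unfolding pos_part_def dens[OF A]
    proof (intro SUP_least ennreal_leI)
      fix B assume B: "B \<in> {B \<in> sets borel. B \<subseteq> A}"
      then show "(LINT x|m. indicator B x * w x) \<le> (LINT x|m. indicator A x * max 0 (w x))"
        by (intro integral_mono int int') (auto simp: indicator_def max_def)
    qed
    \<comment> \<open>The part of A on which w is positive attains the supremum.\<close>
    define B where "B = A \<inter> {x. 0 < w x}"
    have B: "B \<in> sets borel" unfolding B_def by measurable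
    have "(LINT x|m. indicator A x * max 0 (w x)) = (LINT x|m. indicator B x * w x)"
      by (intro Bochner_Integration.integral_cong) (auto simp: B_def indicator_def max_def)
    then show "emeasure (density m (\<lambda>x. ennreal (w x))) A \<le> pos_part (\<lambda>A. LINT x|m. indicator A x * w x) A"
      unfolding pos_part_def dens[OF A] using B by (intro SUP_upper2[of B]) (auto simp: B_def)
  qed
  have "pos_part_measure (\<lambda>A. LINT x|m. indicator A x * w x) = measure_of UNIV (sets borel) (emeasure (density m (\<lambda>x. ennreal (w x))))"
    unfolding pos_part_measure_eq by (rule measure_of_eq) (auto simp: eq sets.sigma_sets_eq[of borel, simplified])
  also have "\<dots> = density m (\<lambda>x. ennreal (w x))"
    using measure_of_of_measure[of "density m (\<lambda>x. ennreal (w x))"] by (simp add: sp)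
  finally show ?thesis .
qed

lemma signed_integral_density:
  fixes w :: "real \<Rightarrow> real" and f :: "real \<Rightarrow> complex" and m :: "real measure"
  assumes m: "finite_measure m" and sets_m[simp, measurable_cong]: "sets m = sets borel"
    and [measurable]: "w \<in> borel_measurable borel" and w: "\<And>x. \<bar>w x\<bar> \<le> C"
    and [measurable]: "f \<in> borel_measurable borel" and f: "\<And>x. norm (f x) \<le> D"
  shows "signed_integral (\<lambda>A. LINT x|m. indicator A x * w x) f = (CLINT x|m. of_real (w x) * f x)"
proof -
  interpret finite_measure m by fact
  have C: "0 \<le> C" using w[of 0] by simp
  have part: "(CLINT x|density m (\<lambda>x. ennreal (v x)). f x) = (CLINT x|m. of_real (max 0 (v x)) * f x)"
    if [measurable]: "v \<in> borel_measurable borel" for v :: "real \<Rightarrow> real"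
  proof -
    have "density m (\<lambda>x. ennreal (v x)) = density m (\<lambda>x. ennreal (max 0 (v x)))"
      by (intro density_cong) (auto simp: max_def ennreal_neg)
    then have "(CLINT x|density m (\<lambda>x. ennreal (v x)). f x) = (CLINT x|density m (\<lambda>x. ennreal (max 0 (v x))). f x)"
      by (simp only:)
    also have "\<dots> = (CLINT x|m. max 0 (v x) *\<^sub>R f x)" by (rule integral_density) auto
    finally show ?thesis by (simp add: scaleR_conv_of_real)
  qed
  have int: "integrable m (\<lambda>x. complex_of_real (max 0 (v x)) * f x)"
    if [measurable]: "v \<in> borel_measurable borel" and v: "\<And>x. \<bar>v x\<bar> \<le> C" for v :: "real \<Rightarrow> real"
  proof (rule integrable_const_bound[where B="C * D"])
    have "\<bar>max 0 (v x)\<bar> * norm (f x) \<le> C * D" for x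
      using v[of x] f[of x] C by (intro mult_mono) (auto simp: max_def)
    then show "AE x in m. norm (complex_of_real (max 0 (v x)) * f x) \<le> C * D" by (simp add: norm_mult)
  qed measurable
  have e: "pos_part_measure (\<lambda>A. - (LINT x|m. indicator A x * w x)) = density m (\<lambda>x. ennreal (- w x))"
    using pos_part_measure_density[OF m sets_m, of "\<lambda>x. - w x" C] w by simp
  have "signed_integral (\<lambda>A. LINT x|m. indicator A x * w x) f
    = (CLINT x|m. of_real (max 0 (w x)) * f x) - (CLINT x|m. of_real (max 0 (- w x)) * f x)"
    unfolding signed_integral_def e pos_part_measure_density[OF m sets_m assms(3) w] by (simp add: part)
  also have "\<dots> = (CLINT x|m. of_real (max 0 (w x)) * f x - of_real (max 0 (- w x)) * f x)"
    by (rule Bochner_Integration.integral_diff[symmetric]) (use int[of w] int[of "\<lambda>x. - w x"] w in auto)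
  also have "\<dots> = (CLINT x|m. of_real (w x) * f x)"
    by (intro Bochner_Integration.integral_cong refl) (auto simp: max_def)
  finally show ?thesis .
qed

lemma complex_measure_integral_density:
  fixes w f :: "real \<Rightarrow> complex" and m :: "real measure"
  assumes m: "finite_measure m" and sets_m[simp, measurable_cong]: "sets m = sets borel"
    and w[measurable]: "w \<in> borel_measurable borel" "bounded (range w)"
    and f[measurable]: "f \<in> borel_measurable borel" "bounded (range f)"
    and \<mu>: "\<And>A. A \<in> sets borel \<Longrightarrow> \<mu> A = (CLINT x|m. indicator A x * w x)"
  shows "complex_measure_integral \<mu> f = (CLINT x|m. w x * f x)"
proof -
  interpret finite_measure m by fact
  obtain C where C: "\<And>x. norm (w x) \<le> C" using w by (auto simp: bounded_iff)
  obtain D where D: "\<And>x. norm (f x) \<le> D" using f by (auto simp: bounded_iff)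
  have C0: "0 \<le> C" using C[of 0] norm_ge_zero order_trans by blast
  have ReIm: "\<bar>Re (w x)\<bar> \<le> C" "\<bar>Im (w x)\<bar> \<le> C" for x
    using C[of x] abs_Re_le_cmod[of "w x"] abs_Im_le_cmod[of "w x"] by linarith+
  have intw: "integrable m (\<lambda>x. indicator A x * w x)" if [measurable]: "A \<in> sets borel" for A
    by (rule integrable_const_bound[where B=C]) (use C C0 in \<open>auto simp: norm_mult indicator_def\<close>)
  have re: "Re (CLINT x|m. indicator A x * w x) = (LINT x|m. indicator A x * Re (w x))"
    and im: "Im (CLINT x|m. indicator A x * w x) = (LINT x|m. indicator A x * Im (w x))" if A: "A \<in> sets borel" for A
    unfolding integral_Re[OF intw[OF A], symmetric] integral_Im[OF intw[OF A], symmetric]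
    by (intro Bochner_Integration.integral_cong refl; simp add: indicator_def)+
  have "complex_measure_integral \<mu> f = complex_measure_integral (\<lambda>A. Complex (LINT x|m. indicator A x * Re (w x)) (LINT x|m. indicator A x * Im (w x))) f"
    by (rule complex_measure_integral_cong) (simp add: complex_eq_iff \<mu> re im)
  also have "\<dots> = (CLINT x|m. of_real (Re (w x)) * f x) + \<i> * (CLINT x|m. of_real (Im (w x)) * f x)"
    unfolding complex_measure_integral_def complex.sel
    using signed_integral_density[OF m sets_m _ ReIm(1) f(1) D] signed_integral_density[OF m sets_m _ ReIm(2) f(1) D] by simp
  also have "\<dots> = (CLINT x|m. of_real (Re (w x)) * f x + \<i> * (of_real (Im (w x)) * f x))"
  proof -
    have b: "\<bar>v\<bar> * norm z \<le> C * D" if "\<bar>v\<bar> \<le> C" "norm z \<le> D" for v and z :: complex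
      using that C0 by (intro mult_mono) auto
    have "integrable m (\<lambda>x. of_real (Re (w x)) * f x)" "integrable m (\<lambda>x. of_real (Im (w x)) * f x)"
      by (rule integrable_const_bound[where B="C * D"], simp add: norm_mult b ReIm D, measurable)+
    then show ?thesis
      by (subst Bochner_Integration.integral_add) (simp_all only: integral_mult_right_zero integrable_mult_right)
  qed
  also have "\<dots> = (CLINT x|m. w x * f x)"
    by (intro Bochner_Integration.integral_cong refl) (simp add: complex_eq_iff algebra_simps)
  finally show ?thesis .
qed

text \<open>Against the diagonal bimeasure the inner integral is the complex measure with density f,
  respectively h, relative to m. The outer integral is then \<integral> f h dm in both
  orders.\<close>

lemma has_MT_integral_diagonal:
  fixes f h :: "real \<Rightarrow> complex" and m :: "real measure"
  assumes m: "finite_measure m" and sets_m: "sets m = sets borel"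
    and f[measurable]: "f \<in> borel_measurable borel" "bounded (range f)"
    and h[measurable]: "h \<in> borel_measurable borel" "bounded (range h)"
    and F: "\<And>A B. A \<in> sets borel \<Longrightarrow> B \<in> sets borel \<Longrightarrow> F A B = of_real (measure m (A \<inter> B))"
  shows "has_MT_integral F f h (CLINT x|m. f x * h x)"
proof -
  interpret finite_measure m by fact
  have sp: "space m = UNIV" using sets_eq_imp_space_eq[OF sets_m] by simp
  have ind: "(indicator A :: real \<Rightarrow> complex) \<in> borel_measurable borel" "bounded (range (indicator A :: real \<Rightarrow> complex))"
    if [measurable]: "A \<in> sets borel" for A
    by (auto simp: bounded_iff indicator_def intro!: exI[of _ 1])
  have FI: "F A B = (CLINT x|m. indicator A x * indicator B x)" if "A \<in> sets borel" "B \<in> sets borel" for A B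
  proof -
    have "(CLINT x|m. indicator A x * indicator B x) = (CLINT x|m. of_real (indicator (A \<inter> B) x))"
      by (intro Bochner_Integration.integral_cong) (auto simp: indicator_def)
    also have "\<dots> = of_real (measure m (A \<inter> B))" by (simp only: integral_complex_of_real) (simp add: sp)
    finally show ?thesis by (simp add: F[OF that])
  qed
  have swap: "F A B = F B A" if "A \<in> sets borel" "B \<in> sets borel" for A B
    using that by (simp add: F Int_commute)
  have in1: "complex_measure_integral (\<lambda>A. F A B) f = (CLINT x|m. indicator B x * f x)" if B: "B \<in> sets borel" for B
    by (rule complex_measure_integral_density[OF m sets_m ind[OF B] f]) (simp add: FI B)
  have in2: "complex_measure_integral (\<lambda>B. F A B) h = (CLINT x|m. indicator A x * h x)" if A: "A \<in> sets borel" for A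
    by (rule complex_measure_integral_density[OF m sets_m ind[OF A] h]) (simp add: FI[OF _ A] swap[OF A])
  have "MT_I1 F f h = (CLINT x|m. f x * h x)"
    unfolding MT_I1_def by (rule complex_measure_integral_density[OF m sets_m f h]) (rule in1)
  moreover have "MT_I2 F f h = (CLINT x|m. h x * f x)"
    unfolding MT_I2_def by (rule complex_measure_integral_density[OF m sets_m h f]) (rule in2)
  ultimately show ?thesis by (simp add: has_MT_integral_def mult.commute)
qed

lemma bimeasure_diagonal:
  assumes m: "finite_measure m" and sets_m: "sets m = sets borel"
    and F: "\<And>A B. A \<in> sets borel \<Longrightarrow> B \<in> sets borel \<Longrightarrow> F A B = of_real (measure m (A \<inter> B))"
  shows "bimeasure F"
proof -
  interpret finite_measure m by fact
  have main: "(\<lambda>i. complex_of_real (measure m (A i \<inter> B))) sums of_real (measure m ((\<Union>i. A i) \<inter> B))"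
    if A: "range A \<subseteq> sets borel" "disjoint_family A" and B: "B \<in> sets borel" for A :: "nat \<Rightarrow> real set" and B
  proof -
    have "(\<lambda>i. measure m (A i \<inter> B)) sums measure m (\<Union>i. A i \<inter> B)"
      by (rule finite_measure_UNION) (use A B sets_m in \<open>auto simp: disjoint_family_on_def\<close>)
    moreover have "(\<Union>i. A i \<inter> B) = (\<Union>i. A i) \<inter> B" by auto
    ultimately show ?thesis by (simp add: sums_of_real)
  qed
  show ?thesis
    unfolding bimeasure_def
  proof (intro conjI ballI allI impI)
    fix A :: "nat \<Rightarrow> real set" and B :: "real set" assume *: "B \<in> sets borel" "range A \<subseteq> sets borel" "disjoint_family A"
    have "A i \<in> sets borel" "(\<Union>i. A i) \<in> sets borel" for i using * by auto
    then show "(\<lambda>i. F (A i) B) sums F (\<Union>i. A i) B" "(\<lambda>i. F B (A i)) sums F B (\<Union>i. A i)"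
      using main[OF *(2,3,1)] *(1) by (simp_all add: F Int_commute)
  qed
qed

section \<open>From the additivity condition to independent scattering\<close>

text \<open>The integral form shows nonnegativity and homogeneity of degree \<alpha>. For stable
  \<open>Z\<close> the value is minus the logarithm of the characteristic function and hence does
  not depend on the spectral measure chosen.\<close>

definition scale_exponent :: "real \<Rightarrow> 'w measure \<Rightarrow> ('w \<Rightarrow> 'a::euclidean_space) \<Rightarrow> 'a \<Rightarrow> real" where
  "scale_exponent \<alpha> M Z \<theta> = (LINT s|spectral_measure \<alpha> M 1 (\<lambda>_. Z). \<bar>\<theta> \<bullet> s 0\<bar> powr \<alpha>)"

lemma scale_exponent_nonneg: "0 \<le> scale_exponent \<alpha> M Z \<theta>"
  by (simp add: scale_exponent_def)

lemma scale_exponent_scaleR: "scale_exponent \<alpha> M Z (t *\<^sub>R \<theta>) = \<bar>t\<bar> powr \<alpha> * scale_exponent \<alpha> M Z \<theta>"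
  by (simp add: scale_exponent_def abs_mult powr_mult)

lemma cf_scale_exponent:
  assumes "sas_vector \<alpha> M 1 (\<lambda>_. Z)"
  shows "(CLINT \<omega>|M. iexp (\<theta> \<bullet> Z \<omega>)) = of_real (exp (- scale_exponent \<alpha> M Z \<theta>))"
  using is_spectral_measureD(2)[OF is_spectral_measure_spectral_measure[OF assms], of "\<lambda>_. \<theta>"]
  by (simp add: scale_exponent_def)

text \<open>A spectral measure concentrated on the coordinate axes means independent components.\<close>

lemma cf_axes:
  fixes Y :: "nat \<Rightarrow> 'w \<Rightarrow> 'a::euclidean_space"
  assumes \<alpha>: "0 < \<alpha>" and sas: "sas_vector \<alpha> M n Y" and sas1: "\<And>i. i < n \<Longrightarrow> sas_vector \<alpha> M 1 (\<lambda>_. Y i)"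
    and axes: "\<And>i j. i < n \<Longrightarrow> j < n \<Longrightarrow> i \<noteq> j \<Longrightarrow> AE s in spectral_measure \<alpha> M n Y. s i = 0 \<or> s j = 0"
  shows "(CLINT \<omega>|M. iexp (\<Sum>i<n. \<theta> i \<bullet> Y i \<omega>)) = of_real (exp (- (\<Sum>i<n. scale_exponent \<alpha> M (Y i) (\<theta> i))))"
proof -
  define G where "G = spectral_measure \<alpha> M n Y"
  have G: "is_spectral_measure \<alpha> M n Y G"
    unfolding G_def by (rule is_spectral_measure_spectral_measure[OF sas])
  interpret G: symmetric_sphere_measure G n by (rule is_spectral_measureD[OF G])
  have comp: "integrable G (\<lambda>s. \<bar>\<theta> i \<bullet> s i\<bar> powr \<alpha>)" if "i < n" for i
    by (rule integrable_inner_powr[OF _ G.integrable_component_powr[OF that \<alpha>] \<alpha>]) (use that in simp)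
  have "AE s in G. \<forall>i\<in>{..<n}. \<forall>j\<in>{..<n}. i \<noteq> j \<longrightarrow> s i = 0 \<or> s j = 0"
  proof (intro AE_finite_allI)
    fix i j assume "i \<in> {..<n}" "j \<in> {..<n}"
    then show "AE s in G. i \<noteq> j \<longrightarrow> s i = 0 \<or> s j = 0"
      using axes[of i j] unfolding G_def by (cases "i = j") simp_all
  qed simp_all
  \<comment> \<open>At most one coordinate of s is nonzero, so the \<alpha>-th power of the sum is
    the sum of the \<alpha>-th powers.\<close>
  then have ae: "AE s in G. \<bar>\<Sum>i<n. \<theta> i \<bullet> s i\<bar> powr \<alpha> = (\<Sum>i<n. \<bar>\<theta> i \<bullet> s i\<bar> powr \<alpha>)"
  proof eventually_elim
    case (elim s)
    show ?case
    proof (cases "\<exists>i<n. s i \<noteq> 0")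
      case True
      then obtain i where i: "i < n" "s i \<noteq> 0" by auto
      have z: "s j = 0" if "j < n" "j \<noteq> i" for j using elim i that by auto
      have "(\<Sum>j<n. \<theta> j \<bullet> s j) = (\<Sum>j<n. if j = i then \<theta> i \<bullet> s i else 0)" using z by (intro sum.cong) auto
      moreover have "(\<Sum>j<n. \<bar>\<theta> j \<bullet> s j\<bar> powr \<alpha>) = (\<Sum>j<n. if j = i then \<bar>\<theta> i \<bullet> s i\<bar> powr \<alpha> else 0)"
        using z by (intro sum.cong) auto
      ultimately show ?thesis using i by simp
    qed (auto intro!: sum.neutral)
  qed
  have cfG: "(LINT s|G. \<bar>\<Sum>i<n. \<theta> i \<bullet> s i\<bar> powr \<alpha>) = (\<Sum>i<n. LINT s|G. \<bar>\<theta> i \<bullet> s i\<bar> powr \<alpha>)"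
  proof -
    have "(LINT s|G. \<bar>\<Sum>i<n. \<theta> i \<bullet> s i\<bar> powr \<alpha>) = (LINT s|G. (\<Sum>i<n. \<bar>\<theta> i \<bullet> s i\<bar> powr \<alpha>))"
    proof (rule integral_cong_AE[OF _ _ ae])
      show "(\<lambda>s. \<bar>\<Sum>i<n. \<theta> i \<bullet> s i\<bar> powr \<alpha>) \<in> borel_measurable G" using G.inner_measurable[of \<theta>] by measurable
      show "(\<lambda>s. \<Sum>i<n. \<bar>\<theta> i \<bullet> s i\<bar> powr \<alpha>) \<in> borel_measurable G" using comp by (intro borel_measurable_sum) auto
    qed
    also have "\<dots> = (\<Sum>i<n. LINT s|G. \<bar>\<theta> i \<bullet> s i\<bar> powr \<alpha>)" by (rule Bochner_Integration.integral_sum) (use comp in auto)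
    finally show ?thesis .
  qed
  have "(LINT s|G. \<bar>\<theta> i \<bullet> s i\<bar> powr \<alpha>) = scale_exponent \<alpha> M (Y i) (\<theta> i)" if i: "i < n" for i
  proof -
    \<comment> \<open>Testing with a single nonzero coordinate identifies the i-th integral with the
      exponent of the i-th component.\<close>
    define \<theta>' where "\<theta>' j = (if j = i then \<theta> i else 0)" for j
    have e: "(\<Sum>j<n. \<theta>' j \<bullet> v j) = \<theta> i \<bullet> v i" for v :: "nat \<Rightarrow> 'a"
    proof -
      have "(\<Sum>j<n. \<theta>' j \<bullet> v j) = (\<Sum>j<n. if j = i then \<theta> i \<bullet> v i else 0)" by (intro sum.cong) (auto simp: \<theta>'_def)
      then show ?thesis using i by simp
    qed
    have "complex_of_real (exp (- (LINT s|G. \<bar>\<theta> i \<bullet> s i\<bar> powr \<alpha>))) = of_real (exp (- scale_exponent \<alpha> M (Y i) (\<theta> i)))"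
      using is_spectral_measureD(2)[OF G, of \<theta>'] cf_scale_exponent[OF sas1[OF i], of "\<theta> i"]
      unfolding e e[of "\<lambda>j. Y j _"] by simp
    then show ?thesis by simp
  qed
  then show ?thesis
    using is_spectral_measureD(2)[OF G, of \<theta>] unfolding cfG by simp
qed

section \<open>From additive exponents to a control measure\<close>

text \<open>The exponent \<open>L A\<close> is left a general function of \<theta>. Its
  factorisation into a control measure and a direction integral needs rotation invariance in the
  isotropic case, which is itself derived in this setting.\<close>

locale independent_random_measure = random_measure M X for M :: "'w measure" and X +
  fixes L :: "real set \<Rightarrow> complex \<Rightarrow> real"
  assumes cf_L: "\<And>n A \<theta>. (\<And>i. i < n \<Longrightarrow> A i \<in> sets borel) \<Longrightarrow> disjoint_family_on A {..<n::nat} \<Longrightarrow>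
      (CLINT \<omega>|M. iexp (\<Sum>i<n. \<theta> i \<bullet> X (A i) \<omega>)) = of_real (exp (- (\<Sum>i<n. L (A i) (\<theta> i))))"
begin

text \<open>Additivity in probability gives an almost surely convergent subsequence, hence
  convergence of characteristic functions, and these are positive, so logarithms may be taken. The
  subsequence is the same for all \<theta>, so exponents at different \<theta> can be compared along
  it.\<close>

lemma L_UN_subseq:
  fixes A :: "nat \<Rightarrow> real set"
  assumes A: "range A \<subseteq> sets borel" "disjoint_family A"
  shows "\<exists>r::nat \<Rightarrow> nat. strict_mono r \<and> (\<forall>\<theta>. (\<lambda>k. \<Sum>i<r k. L (A i) \<theta>) \<longlonglongrightarrow> L (\<Union>i. A i) \<theta>)"
proof -
  obtain r :: "nat \<Rightarrow> nat" where r: "strict_mono r" "AE \<omega> in M. (\<lambda>k. \<Sum>i<r k. X (A i) \<omega>) \<longlonglongrightarrow> X (\<Union>i. A i) \<omega>"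
    using sigma_additive_subseq[OF A] by blast
  have Ab[measurable]: "A i \<in> sets borel" for i using A by auto
  have U[measurable]: "(\<Union>i. A i) \<in> sets borel" using Ab by auto
  have "(\<lambda>k. \<Sum>i<r k. L (A i) \<theta>) \<longlonglongrightarrow> L (\<Union>i. A i) \<theta>" for \<theta>
  proof -
    have "(\<lambda>k. CLINT \<omega>|M. iexp (\<theta> \<bullet> (\<Sum>i<r k. X (A i) \<omega>))) \<longlonglongrightarrow> (CLINT \<omega>|M. iexp (\<theta> \<bullet> X (\<Union>i. A i) \<omega>))"
    proof (rule integral_dominated_convergence[where w="\<lambda>_. 1"])
      show "AE \<omega> in M. (\<lambda>k. iexp (\<theta> \<bullet> (\<Sum>i<r k. X (A i) \<omega>))) \<longlonglongrightarrow> iexp (\<theta> \<bullet> X (\<Union>i. A i) \<omega>)"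
        using r(2) by eventually_elim (intro tendsto_intros)
    qed auto
    moreover have "(CLINT \<omega>|M. iexp (\<theta> \<bullet> (\<Sum>i<n. X (A i) \<omega>))) = of_real (exp (- (\<Sum>i<n. L (A i) \<theta>)))" for n
      using cf_L[of n A "\<lambda>_. \<theta>"] Ab A(2) by (simp add: inner_sum_right disjoint_family_on_def)
    moreover have "(CLINT \<omega>|M. iexp (\<theta> \<bullet> X (\<Union>i. A i) \<omega>)) = of_real (exp (- L (\<Union>i. A i) \<theta>))"
      using cf_L[of 1 "\<lambda>_. \<Union>i. A i" "\<lambda>_. \<theta>"] U by (simp add: disjoint_family_on_def)
    ultimately have "(\<lambda>k. complex_of_real (exp (- (\<Sum>i<r k. L (A i) \<theta>)))) \<longlonglongrightarrow> of_real (exp (- L (\<Union>i. A i) \<theta>))" by simp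
    then have "(\<lambda>k. exp (- (\<Sum>i<r k. L (A i) \<theta>))) \<longlonglongrightarrow> exp (- L (\<Union>i. A i) \<theta>)" by (simp only: tendsto_of_real_iff)
    then have "(\<lambda>k. ln (exp (- (\<Sum>i<r k. L (A i) \<theta>)))) \<longlonglongrightarrow> ln (exp (- L (\<Union>i. A i) \<theta>))" by (rule tendsto_ln) simp
    then have "(\<lambda>k. - (- (\<Sum>i<r k. L (A i) \<theta>))) \<longlonglongrightarrow> - (- L (\<Union>i. A i) \<theta>)" unfolding ln_exp by (rule tendsto_minus)
    then show ?thesis by simp
  qed
  then show ?thesis using r(1) by blast
qed

lemma L_union:
  assumes AB: "A \<in> sets borel" "B \<in> sets borel" "A \<inter> B = {}"
  shows "L (A \<union> B) \<theta> = L A \<theta> + L B \<theta>"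
proof -
  have s2: "(\<Sum>i<2. f i) = f 0 + f 1" for f :: "nat \<Rightarrow> real" by (simp add: numeral_2_eq_2)
  define C where "C i = (if i = 0 then A else B)" for i :: nat
  have "complex_of_real (exp (- (\<Sum>i<2. L (C i) \<theta>))) = (CLINT \<omega>|M. iexp (\<Sum>i<2. \<theta> \<bullet> X (C i) \<omega>))"
    using cf_L[of 2 C "\<lambda>_. \<theta>"] AB by (simp add: C_def disjoint_family_on_def Int_commute)
  also have "\<dots> = (CLINT \<omega>|M. iexp (\<theta> \<bullet> X (A \<union> B) \<omega>))"
    by (rule integral_cong_AE) (use X_union[OF AB] AB in \<open>auto simp: s2 C_def inner_add_right elim: eventually_mono\<close>)
  also have "\<dots> = of_real (exp (- L (A \<union> B) \<theta>))"
    using cf_L[of 1 "\<lambda>_. A \<union> B" "\<lambda>_. \<theta>"] AB by (simp add: disjoint_family_on_def)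
  finally show ?thesis by (simp add: s2 C_def)
qed

text \<open>The constant \<open>c\<close> is meant to be the direction integral at \<theta> = 1, so
  that m(A) c is the exponent there. Convergence along a subsequence is enough for countable
  subadditivity, because the terms are nonnegative.\<close>

lemma control_measure:
  assumes L0: "\<And>A. A \<in> sets borel \<Longrightarrow> 0 \<le> L A 1" and c: "0 < c"
  shows "\<exists>m. sets m = sets borel \<and> finite_measure m \<and> (\<forall>A\<in>sets borel. measure m A = L A 1 / c)"
proof -
  define N where "N A = ennreal (L A 1 / c)" for A
  define m where "m = measure_of UNIV (sets borel) N"
  have sm[simp]: "sets m = sets borel" by (simp add: m_def sets.sigma_sets_eq[of borel, simplified])
  have spm: "space m = UNIV" by (simp add: m_def)
  have em: "emeasure m A = N A" if "A \<in> sets borel" for A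
  proof (rule emeasure_measure_of[OF m_def])
    have "L {} 1 = 0" using L_union[of "{}" "{}" 1] by simp
    then show "positive (sets m) N" by (simp add: positive_def N_def)
    show "countably_additive (sets m) N"
      unfolding sm
    proof (rule countably_additive_if_superadditive)
      fix A B :: "real set" assume "A \<in> sets borel" "B \<in> sets borel" "A \<inter> B = {}"
      then show "N A + N B \<le> N (A \<union> B)" using L0 c by (simp add: N_def L_union add_divide_distrib)
    next
      fix A :: "nat \<Rightarrow> real set" assume A: "range A \<subseteq> sets borel" "disjoint_family A"
      obtain r :: "nat \<Rightarrow> nat" where r: "\<forall>\<theta>. (\<lambda>k. \<Sum>i<r k. L (A i) \<theta>) \<longlonglongrightarrow> L (\<Union>i. A i) \<theta>"
        using L_UN_subseq[OF A] by blast
      have lim: "(\<lambda>k. ennreal ((\<Sum>i<r k. L (A i) 1) / c)) \<longlonglongrightarrow> N (\<Union>i. A i)"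
        unfolding N_def by (intro tendsto_ennrealI tendsto_divide tendsto_const) (use r c in auto)
      have b: "ennreal ((\<Sum>i<r k. L (A i) 1) / c) \<le> (\<Sum>i. N (A i))" for k
      proof -
        have "ennreal ((\<Sum>i<r k. L (A i) 1) / c) = (\<Sum>i<r k. N (A i))"
          unfolding N_def sum_divide_distrib by (rule sum_ennreal[symmetric]) (use L0 A c in auto)
        also have "\<dots> \<le> (\<Sum>i. N (A i))" by (intro sum_le_suminf) auto
        finally show ?thesis .
      qed
      show "N (\<Union>i. A i) \<le> (\<Sum>i. N (A i))" by (rule LIMSEQ_le_const2[OF lim]) (use b in blast)
    qed
  qed (use that in auto)
  have "finite_measure m" by (rule finite_measureI) (simp add: spm em N_def)
  moreover have "measure m A = L A 1 / c" if "A \<in> sets borel" for A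
    using em[OF that] L0[OF that] c by (simp add: measure_def N_def)
  ultimately show ?thesis using sm by blast
qed

end

text \<open>The intervals [z, z + 1) for integers z, numbered by \<open>int_decode\<close>: a
  countable partition of the line into bounded pieces.\<close>

definition unit_interval_nr :: "nat \<Rightarrow> real set" where
  "unit_interval_nr i = {of_int (int_decode i)..<of_int (int_decode i) + 1}"

lemma unit_interval_nr:
  shows "unit_interval_nr i \<in> sets borel" "bounded (unit_interval_nr i)"
    and "disjoint_family unit_interval_nr" "(\<Union>i. unit_interval_nr i) = UNIV"
proof -
  show "unit_interval_nr i \<in> sets borel" "bounded (unit_interval_nr i)"
    by (auto simp: unit_interval_nr_def)
  show "disjoint_family unit_interval_nr"
    unfolding disjoint_family_on_def
  proof (intro ballI impI)
    fix i j :: nat assume ij: "i \<noteq> j"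
    have "int_decode i \<noteq> int_decode j" using ij inj_int_decode[THEN injD] by blast
    then show "unit_interval_nr i \<inter> unit_interval_nr j = {}"
      by (auto simp: unit_interval_nr_def)
  qed
  have "x \<in> unit_interval_nr (int_encode \<lfloor>x\<rfloor>)" for x
    by (simp add: unit_interval_nr_def)
  then show "(\<Union>i. unit_interval_nr i) = UNIV" by blast
qed

text \<open>
  Isotropy passes from the increments of the process to all Borel sets: differences of exponents and
  limits of sums of exponents of independent increments inherit rotation invariance.
\<close>

lemma (in independent_random_measure) L_rotation_invariant:
  assumes int: "\<And>a b \<theta> r. L {a..<b} (\<theta> * cis r) = L {a..<b} \<theta>"
    and A: "A \<in> sets borel"
  shows "L A (\<theta> * cis r) = L A \<theta>"
proof -
  define P where "P A \<longleftrightarrow> (\<forall>\<theta> r. L A (\<theta> * cis r) = L A \<theta>)" for A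
  have PUN: "P (\<Union>i. A i)" if A: "range A \<subseteq> sets borel" "disjoint_family A" and PA: "\<And>i. P (A i)" for A :: "nat \<Rightarrow> real set"
  proof -
    obtain r :: "nat \<Rightarrow> nat" where r: "\<And>\<theta>. (\<lambda>k. \<Sum>i<r k. L (A i) \<theta>) \<longlonglongrightarrow> L (\<Union>i. A i) \<theta>"
      using L_UN_subseq[OF A] by blast
    have eq: "(\<Sum>i<r k. L (A i) (\<theta> * cis t)) = (\<Sum>i<r k. L (A i) \<theta>)" for k \<theta> t
      using PA by (simp add: P_def)
    have "L (\<Union>i. A i) (\<theta> * cis t) = L (\<Union>i. A i) \<theta>" for \<theta> t
      by (rule LIMSEQ_unique[OF r[of "\<theta> * cis t", unfolded eq] r[of \<theta>]])
    then show ?thesis by (simp add: P_def)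
  qed
  define G where "G = range (\<lambda>(a, b). {a..<b::real})"
  have bG: "sets borel = sigma_sets UNIV G"
    unfolding G_def borel_eq_atLeastLessThan by (rule sets_measure_of) simp
  \<comment> \<open>Complements will be handled by subtraction from the exponent of the whole line.
    The line is no member of \<open>G\<close> and is reached as a countable union of unit
    intervals.\<close>
  have PU: "P UNIV"
  proof -
    have "P (\<Union>i. unit_interval_nr i)"
    proof (rule PUN)
      show "range unit_interval_nr \<subseteq> sets borel" using unit_interval_nr(1) by blast
      show "P (unit_interval_nr i)" for i by (simp add: P_def unit_interval_nr_def int)
    qed (rule unit_interval_nr(3))
    then show ?thesis by (simp only: unit_interval_nr(4))
  qed
  have "P A"
  proof (rule sigma_sets_induct_disjoint[of G UNIV A P])
    show "Int_stable G"
    proof (rule Int_stableI)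
      fix C D assume "C \<in> G" "D \<in> G"
      then obtain a b c d where "C = {a..<b}" "D = {c..<d}" by (auto simp: G_def)
      then have "C \<inter> D = {max a c..<min b d}" by auto
      then show "C \<inter> D \<in> G" by (auto simp: G_def)
    qed
    show "A \<in> sigma_sets UNIV G" using A bG by simp
    show "P C" if "C \<in> G" for C using that int by (auto simp: G_def P_def)
    show "P {}" using int[of 0 0] by (simp add: P_def)
    show "P (UNIV - C)" if "C \<in> sigma_sets UNIV G" "P C" for C
    proof -
      have C: "C \<in> sets borel" using that bG by simp
      have "L UNIV \<theta> = L C \<theta> + L (UNIV - C) \<theta>" for \<theta>
        using L_union[of C "UNIV - C" \<theta>] C by auto
      then have "L (UNIV - C) \<theta> = L UNIV \<theta> - L C \<theta>" for \<theta> by simp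
      then show ?thesis using PU that(2) by (simp add: P_def)
    qed
    show "P (\<Union>i. C i)" if "disjoint_family C" "range C \<subseteq> sigma_sets UNIV G" "\<And>i. P (C i)" for C :: "nat \<Rightarrow> real set"
      by (rule PUN) (use that bG in auto)
  qed simp
  then show ?thesis by (simp add: P_def)
qed

text \<open>The law of a random sign, placed on the complex plane so that real processes fit the
  frame of directions of modulus 1.\<close>

definition sign_measure :: "complex measure" where
  "sign_measure = distr (measure_pmf (pmf_of_set {1, -1})) borel (\<lambda>u. u)"

lemma sets_sign_measure[simp]: "sets sign_measure = sets borel"
  by (simp add: sign_measure_def)

lemma prob_space_sign_measure: "prob_space sign_measure"
  unfolding sign_measure_def by (rule measure_pmf.prob_space_distr) simp

lemma AE_sign_measure: "AE u in sign_measure. \<bar>Re u\<bar> = 1 \<and> norm u = 1"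
proof -
  have m: "(\<lambda>u. u) \<in> measurable (measure_pmf (pmf_of_set {1, -1 :: complex})) borel" by simp
  show ?thesis
    unfolding sign_measure_def by (subst AE_distr_iff[OF m]) (auto simp: AE_measure_pmf_iff)
qed

lemma sign_measure_symmetric: "distr sign_measure borel uminus = sign_measure"
proof -
  have "map_pmf uminus (pmf_of_set {1, -1 :: complex}) = pmf_of_set (uminus ` {1, -1})"
    by (rule map_pmf_of_set_inj) auto
  also have "uminus ` {1, -1 :: complex} = {1, -1}" by auto
  finally have p: "map_pmf uminus (pmf_of_set {1, -1 :: complex}) = pmf_of_set {1, -1}" .
  have "distr sign_measure borel uminus = distr (measure_pmf (pmf_of_set {1, -1})) borel (uminus :: complex \<Rightarrow> complex)"
    unfolding sign_measure_def by (subst distr_distr) (auto simp: comp_def)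
  also have "\<dots> = distr (measure_pmf (map_pmf uminus (pmf_of_set {1, -1 :: complex}))) borel (\<lambda>u. u)"
    unfolding map_pmf_rep_eq by (subst distr_distr) (auto simp: comp_def)
  finally show ?thesis by (simp add: p sign_measure_def)
qed

lemma integral_sign_measure: "(LINT u|sign_measure. \<bar>\<theta> \<bullet> u\<bar> powr \<alpha>) = \<bar>Re \<theta>\<bar> powr \<alpha>"
proof -
  have "(LINT u|sign_measure. \<bar>\<theta> \<bullet> u\<bar> powr \<alpha>) = (LINT u|measure_pmf (pmf_of_set {1, -1}). \<bar>\<theta> \<bullet> u\<bar> powr \<alpha>)"
    unfolding sign_measure_def by (rule integral_distr) auto
  also have "\<dots> = (\<Sum>u\<in>{1, -1}. \<bar>\<theta> \<bullet> u\<bar> powr \<alpha>) / card {1, -1 :: complex}"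
    by (rule integral_pmf_of_set) auto
  also have "\<dots> = \<bar>Re \<theta>\<bar> powr \<alpha>" by (simp add: inner_complex_def)
  finally show ?thesis .
qed

lemma (in random_measure) simple_stoch_integral_indicator:
  "AE \<omega> in M. simple_stoch_integral X (indicator A) \<omega> = X A \<omega>"
proof (cases "A = {}")
  case True
  have "simple_stoch_integral X (indicator A) \<omega> = 0" for \<omega>
    using True by (simp add: simple_stoch_integral_def)
  then show ?thesis using X_empty True by simp
next
  case False
  have "simple_stoch_integral X (indicator A) \<omega> = X A \<omega>" for \<omega>
  proof -
    have rng: "1 \<in> range (indicator A :: real \<Rightarrow> complex)" using False by (auto simp: indicator_def image_iff)
    have fin: "finite (range (indicator A :: real \<Rightarrow> complex))"
      by (rule finite_subset[of _ "{0, 1}"]) (auto simp: indicator_def)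
    have "simple_stoch_integral X (indicator A) \<omega> = (\<Sum>y\<in>range (indicator A :: real \<Rightarrow> complex). if y = 1 then X A \<omega> else 0)"
      unfolding simple_stoch_integral_def
    proof (rule sum.cong[OF refl])
      fix y :: complex assume "y \<in> range (indicator A :: real \<Rightarrow> complex)"
      then have "y = 0 \<or> y = 1" by (auto simp: indicator_def split: if_splits)
      moreover have "(indicator A :: real \<Rightarrow> complex) -` {1} = A" by (auto simp: indicator_def)
      ultimately show "y * X (indicator A -` {y}) \<omega> = (if y = 1 then X A \<omega> else 0)" by auto
    qed
    then show ?thesis using rng fin by simp
  qed
  then show ?thesis by simp
qed

context stable_random_measure
begin

text \<open>A and B may overlap, so the exponent for disjoint sets does not apply directly. Their
  indicators are simple functions, which \<open>cf_simple\<close> refines to a common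
  partition.\<close>

lemma cf_pair_sets:
  assumes A: "A \<in> sets borel" and B: "B \<in> sets borel"
  shows "(CLINT \<omega>|M. iexp (a \<bullet> X A \<omega> + b \<bullet> X B \<omega>)) =
    of_real (exp (- (LINT p|control. \<bar>a \<bullet> (indicator A (fst p) * snd p) + b \<bullet> (indicator B (fst p) * snd p)\<bar> powr \<alpha>)))"
proof -
  have s2: "(\<Sum>i<2. f i) = f 0 + f 1" for f :: "nat \<Rightarrow> real" by (simp add: numeral_2_eq_2)
  define f where "f k = (if k = 0 then indicator A else indicator B :: real \<Rightarrow> complex)" for k :: nat
  have f: "simple_function borel (f k)" for k using A B by (simp add: f_def)
  have Sm: "simple_stoch_integral X (f k) \<in> borel_measurable M" for k
    by (rule simple_stoch_integral_measurable[OF f])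
  have ae: "AE \<omega> in M. iexp (a \<bullet> X A \<omega> + b \<bullet> X B \<omega>) = iexp (\<Sum>k<2. (if k = 0 then a else b) \<bullet> simple_stoch_integral X (f k) \<omega>)"
    using simple_stoch_integral_indicator[of A] simple_stoch_integral_indicator[of B]
    by eventually_elim (simp add: s2 f_def)
  have "(CLINT \<omega>|M. iexp (a \<bullet> X A \<omega> + b \<bullet> X B \<omega>)) = (CLINT \<omega>|M. iexp (\<Sum>k<2. (if k = 0 then a else b) \<bullet> simple_stoch_integral X (f k) \<omega>))"
  proof (rule integral_cong_AE[OF _ _ ae])
    show "(\<lambda>\<omega>. iexp (a \<bullet> X A \<omega> + b \<bullet> X B \<omega>)) \<in> borel_measurable M" using A B by measurable
    have "(\<lambda>\<omega>. \<Sum>k<2. (if k = 0 then a else b) \<bullet> simple_stoch_integral X (f k) \<omega>) \<in> borel_measurable M"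
      by (intro borel_measurable_sum borel_measurable_inner Sm) auto
    then show "(\<lambda>\<omega>. iexp (\<Sum>k<2. (if k = 0 then a else b) \<bullet> simple_stoch_integral X (f k) \<omega>)) \<in> borel_measurable M"
      by measurable
  qed
  also have "\<dots> = of_real (exp (- (LINT p|control. \<bar>\<Sum>k<2. (if k = 0 then a else b) \<bullet> (f k (fst p) * snd p)\<bar> powr \<alpha>)))"
    by (rule cf_simple) (rule f)
  finally show ?thesis by (simp add: s2 f_def)
qed

lemma indicator_bounded_measurable:
  assumes "A \<in> sets borel"
  shows "(indicator A :: real \<Rightarrow> complex) \<in> borel_measurable borel" "bounded (range (indicator A :: real \<Rightarrow> complex))"
  using assms by (auto simp: bounded_iff indicator_def intro!: exI[of _ 1])

lemma covariation_sets:
  assumes A: "A \<in> sets borel" and B: "B \<in> sets borel" and sas: "sas_vector \<alpha> M 2 (pair_vector (X A) (X B))"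
  shows "covariation \<alpha> M (X A) (X B) = of_real (measure m (A \<inter> B))"
proof -
  note iA = indicator_bounded_measurable[OF A] and iB = indicator_bounded_measurable[OF B]
  have sf: "sigma_finite_measure control" by unfold_locales
  have "covariation \<alpha> M (X A) (X B) = (CLINT p|control. (indicator A (fst p) * snd p) * spow (\<alpha> - 1) (indicator B (fst p) * snd p))"
    by (rule covariation_eq[OF \<alpha> sas sf control_component_measurable[OF iA(1)] control_component_measurable[OF iB(1)]
        integrable_control[OF iA] integrable_control[OF iB] cf_pair_sets[OF A B]])
  also have "\<dots> = (CLINT x|m. indicator A x * spow (\<alpha> - 1) (indicator B x))"
    by (rule integral_control_spow[OF iA(1) iB(1)])
  also have "\<dots> = (CLINT x|m. of_real (indicator (A \<inter> B) x))"
    by (intro Bochner_Integration.integral_cong refl) (auto simp: indicator_def spow_def)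
  also have "\<dots> = of_real (measure m (A \<inter> B))" by (simp only: integral_complex_of_real) simp
  finally show ?thesis .
qed

text \<open>For a real process the covariation refers to spectral measures of real vectors, while
  \<open>control\<close> has complex directions. The real function 1_C(x) Re u represents the value
  on C, and since Re u is 1 or -1 almost surely the two signs cancel in the product.\<close>

lemma covariation_real_sets:
  assumes A: "A \<in> sets borel" and B: "B \<in> sets borel"
    and sas: "sas_vector \<alpha> M 2 (pair_vector (\<lambda>\<omega>. Re (X A \<omega>)) (\<lambda>\<omega>. Re (X B \<omega>)))"
    and \<rho>_real: "AE u in \<rho>. \<bar>Re u\<bar> = 1"
  shows "covariation_real \<alpha> M (\<lambda>\<omega>. Re (X A \<omega>)) (\<lambda>\<omega>. Re (X B \<omega>)) = measure m (A \<inter> B)"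
proof -
  have [measurable]: "A \<in> sets borel" "B \<in> sets borel" using A B by auto
  have ae: "AE p in control. \<bar>Re (snd p)\<bar> = 1"
    unfolding control_def
  proof (rule m\<rho>.AE_pair_measure)
    show "{p \<in> space (m \<Otimes>\<^sub>M \<rho>). \<bar>Re (snd p)\<bar> = 1} \<in> sets (m \<Otimes>\<^sub>M \<rho>)" by measurable
  qed (use \<rho>_real in auto)
  define h where "h C p = indicator C (fst p) * Re (snd p)" for C and p :: "real \<times> complex"
  have hm: "h C \<in> borel_measurable control" if [measurable]: "C \<in> sets borel" for C
    unfolding h_def[abs_def] by measurable
  have hi: "integrable control (\<lambda>p. \<bar>h C p\<bar> powr \<alpha>)" if C: "C \<in> sets borel" for C
  proof (rule control.integrable_const_bound[where B=1])
    show "AE p in control. norm (\<bar>h C p\<bar> powr \<alpha>) \<le> 1"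
      using ae by eventually_elim (auto simp: h_def indicator_def)
    show "(\<lambda>p. \<bar>h C p\<bar> powr \<alpha>) \<in> borel_measurable control" using hm[OF C] by measurable
  qed
  have re: "(of_real a :: complex) \<bullet> z = a * Re z" for a z by (simp add: inner_complex_def)
  have "covariation_real \<alpha> M (\<lambda>\<omega>. Re (X A \<omega>)) (\<lambda>\<omega>. Re (X B \<omega>)) = (LINT p|control. h A p * spow_real (\<alpha> - 1) (h B p))"
  proof (rule covariation_real_eq[OF \<alpha> sas hm[OF A] hm[OF B] hi[OF A] hi[OF B]])
    fix a b :: real
    have ind: "Re (indicator C x * z) = indicator C x * Re z" for C and x :: real and z by (simp add: indicator_def)
    show "(CLINT \<omega>|M. iexp (a * Re (X A \<omega>) + b * Re (X B \<omega>))) = of_real (exp (- (LINT p|control. \<bar>a * h A p + b * h B p\<bar> powr \<alpha>)))"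
      using cf_pair_sets[OF A B, of "of_real a" "of_real b"] unfolding re ind h_def .
  qed
  also have "\<dots> = (LINT p|control. indicator (A \<inter> B) (fst p))"
  proof (rule integral_cong_AE)
    show "AE p in control. h A p * spow_real (\<alpha> - 1) (h B p) = indicator (A \<inter> B) (fst p)"
      using ae
    proof eventually_elim
      case (elim p)
      then have "Re (snd p) = 1 \<or> Re (snd p) = - 1" by linarith
      then show ?case by (auto simp: h_def indicator_def spow_real_def)
    qed
    show "(\<lambda>p. h A p * spow_real (\<alpha> - 1) (h B p)) \<in> borel_measurable control" using hm[OF A] hm[OF B] by measurable
  qed measurable
  also have "\<dots> = (LINT x|m. indicator (A \<inter> B) x)" by (rule integral_control) measurable
  also have "\<dots> = measure m (A \<inter> B)" by simp
  finally show ?thesis .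
qed

text \<open>The indicator of a bounded set is its own approximating sequence, with error 0 whatever
  the variation measure of the set.\<close>

lemma indicator_Lambda:
  assumes A: "A \<in> sets borel" "bounded A"
  shows "(indicator A :: real \<Rightarrow> complex) \<in> Lambda M X"
proof -
  have "{x. indicator A x \<noteq> (0::complex)} = A" by (auto simp: indicator_def)
  then have "bounded_simple (indicator A)" using A by (simp add: bounded_simple_def)
  then have "L1_approx M X (\<lambda>_. indicator A) (indicator A)" by (simp add: L1_approx_def)
  then show ?thesis using indicator_bounded_measurable[OF A(1)] by (auto simp: Lambda_def)
qed

lemma spow_bounded:
  assumes "g \<in> borel_measurable borel" "bounded (range g)"
  shows "(\<lambda>x. spow (\<alpha> - 1) (g x)) \<in> borel_measurable borel" "bounded (range (\<lambda>x. spow (\<alpha> - 1) (g x)))"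
proof -
  show "(\<lambda>x. spow (\<alpha> - 1) (g x)) \<in> borel_measurable borel"
    by (rule measurable_compose[OF assms(1) spow_measurable])
  obtain C where C: "\<And>x. norm (g x) \<le> C" using assms(2) by (auto simp: bounded_iff)
  have "norm (spow (\<alpha> - 1) (g x)) \<le> C powr (\<alpha> - 1)" for x
    using C[of x] \<alpha> by (auto simp: norm_spow intro!: powr_mono2)
  then show "bounded (range (\<lambda>x. spow (\<alpha> - 1) (g x)))" by (auto simp: bounded_iff)
qed

lemma integral_representation_diagonal:
  assumes F: "\<And>A B. A \<in> sets borel \<Longrightarrow> B \<in> sets borel \<Longrightarrow> F A B = of_real (measure m (A \<inter> B))"
  shows "integral_representation \<alpha> M X F"
  unfolding integral_representation_def
proof (intro allI impI)
  fix h g assume hg: "h \<in> Lambda M X" "bounded (range h)" "g \<in> Lambda M X" "bounded (range g)"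
  then have m: "h \<in> borel_measurable borel" "g \<in> borel_measurable borel" by (auto simp: Lambda_def)
  show "has_MT_integral F h (\<lambda>x. spow (\<alpha> - 1) (g x)) (covariation \<alpha> M (stoch_integral \<alpha> M X h) (stoch_integral \<alpha> M X g))"
    unfolding covariation_stoch_integral[OF hg]
    by (rule has_MT_integral_diagonal[OF finite_m sets_m m(1) hg(2) spow_bounded[OF m(2) hg(4)] F])
qed

text \<open>The signed power fixes indicators, so the representation tested on two of them returns a
  value of F. Boundedness of the sets puts the indicators into \<open>Lambda\<close>.\<close>

lemma integral_representation_bounded_sets:
  assumes F: "bimeasure F" "integral_representation \<alpha> M X F"
    and A: "A \<in> sets borel" "bounded A" and B: "B \<in> sets borel" "bounded B"
  shows "F A B = covariation \<alpha> M (stoch_integral \<alpha> M X (indicator A)) (stoch_integral \<alpha> M X (indicator B))"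
proof (rule has_MT_integral_indicators[OF F(1) A(1) B(1)])
  have "(\<lambda>x. spow (\<alpha> - 1) (indicator B x)) = indicator B"
    by (auto simp: spow_def indicator_def)
  then show "has_MT_integral F (indicator A) (indicator B) (covariation \<alpha> M (stoch_integral \<alpha> M X (indicator A)) (stoch_integral \<alpha> M X (indicator B)))"
    using F(2) indicator_Lambda[OF A] indicator_Lambda[OF B]
      indicator_bounded_measurable(2)[OF A(1)] indicator_bounded_measurable(2)[OF B(1)]
    unfolding integral_representation_def by metis
qed

end

text \<open>Each argument is cut by the unit intervals: the second one first, with the first
  argument bounded, and then the first. Separate \<sigma>-additivity recombines the pieces.\<close>

lemma bimeasure_eqI:
  assumes F: "bimeasure F" and F': "bimeasure F'"
    and eq: "\<And>A B. A \<in> sets borel \<Longrightarrow> bounded A \<Longrightarrow> B \<in> sets borel \<Longrightarrow> bounded B \<Longrightarrow> F' A B = F A B"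
    and A: "A \<in> sets borel" and B: "B \<in> sets borel"
  shows "F' A B = F A B"
proof -
  have pieces: "range (\<lambda>i. C \<inter> unit_interval_nr i) \<subseteq> sets borel" "disjoint_family (\<lambda>i. C \<inter> unit_interval_nr i)"
    "(\<Union>i. C \<inter> unit_interval_nr i) = C" "C \<inter> unit_interval_nr i \<in> sets borel" "bounded (C \<inter> unit_interval_nr i)"
    if C: "C \<in> sets borel" for C i
  proof -
    show *: "C \<inter> unit_interval_nr i \<in> sets borel" for i using C unit_interval_nr(1) by (rule sets.Int)
    then show "range (\<lambda>i. C \<inter> unit_interval_nr i) \<subseteq> sets borel" by blast
    show "disjoint_family (\<lambda>i. C \<inter> unit_interval_nr i)"
      using unit_interval_nr(3) by (auto simp: disjoint_family_on_def)
    have "(\<Union>i. C \<inter> unit_interval_nr i) = C \<inter> (\<Union>i. unit_interval_nr i)" by blast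
    then show "(\<Union>i. C \<inter> unit_interval_nr i) = C" by (simp add: unit_interval_nr(4))
    show "bounded (C \<inter> unit_interval_nr i)" by (rule bounded_subset[OF unit_interval_nr(2)]) auto
  qed
  have 1: "F' A B = F A B" if A: "A \<in> sets borel" "bounded A" and B: "B \<in> sets borel" for A B
  proof -
    have "(\<lambda>i. H A (B \<inter> unit_interval_nr i)) sums H A B" if "bimeasure H" for H
      using that pieces[OF B] A(1) unfolding bimeasure_def by metis
    from this[OF F] this[OF F'] show ?thesis
      using eq[OF A pieces(4)[OF B] pieces(5)[OF B]] by (simp add: sums_unique2)
  qed
  have "(\<lambda>i. H (A \<inter> unit_interval_nr i) B) sums H A B" if "bimeasure H" for H
    using that pieces[OF A] B unfolding bimeasure_def by metis
  from this[OF F] this[OF F'] show ?thesis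
    using 1[OF pieces(4)[OF A] pieces(5)[OF A] B] by (simp add: sums_unique2)
qed

section \<open>The two process types and the conclusion\<close>

fun direction_measure :: "process_type \<Rightarrow> complex measure" where
  "direction_measure Real_Process = sign_measure"
| "direction_measure Isotropic_Process = circle"

text \<open>The conditions concern the real variables \<open>Y\<close>, while the frame uses complex
  \<theta>; as the values are real, only Re \<theta> matters. Homogeneity alone makes the exponent a
  multiple of |Re \<theta>|^\<alpha>, which is the direction integral of the sign law, with constant
  1.\<close>

lemma stable_setting_real:
  assumes \<alpha>: "1 < \<alpha>" and S: "stable_setting Real_Process \<alpha> M \<xi> d\<xi>"
  shows "\<exists>m. stable_random_measure M d\<xi> \<alpha> m sign_measure \<and>
    (\<forall>A\<in>sets borel. \<forall>B\<in>sets borel. covariation_bimeasure Real_Process \<alpha> M d\<xi> A B = of_real (measure m (A \<inter> B)))"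
proof -
  define Y where "Y A \<omega> = Re (d\<xi> A \<omega>)" for A \<omega>
  have prob: "prob_space M" and Im0: "\<And>A \<omega>. A \<in> sets borel \<Longrightarrow> Im (d\<xi> A \<omega>) = 0"
    and arm: "associated_random_measure \<alpha> M (\<lambda>t \<omega>. Re (\<xi> t \<omega>)) Y"
    and cA: "condition_A_real \<alpha> M Y"
    using S by (auto simp: Y_def[abs_def])
  have sas: "sas_vector \<alpha> M n (\<lambda>i. Y (A i))" if "\<And>i. i < n \<Longrightarrow> A i \<in> sets borel" for n A
    using arm that unfolding associated_random_measure_def by blast
  have sas1: "sas_vector \<alpha> M 1 (\<lambda>_. Y A)" if "A \<in> sets borel" for A
    using sas[of 1 "\<lambda>_. A"] that by simp
  have Ym[measurable]: "Y A \<in> borel_measurable M" if "A \<in> sets borel" for A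
    using sas1[OF that] by (auto simp: sas_vector_def)
  have dY: "d\<xi> A \<omega> = of_real (Y A \<omega>)" if "A \<in> sets borel" for A \<omega>
    using Im0[OF that] by (simp add: Y_def complex_eq_iff)
  interpret prob_space M by (rule prob)
  have rm: "random_measure M d\<xi>"
  proof (intro random_measure.intro prob random_measure_axioms.intro)
    show "d\<xi> A \<in> borel_measurable M" if [measurable]: "A \<in> sets borel" for A
    proof -
      have "d\<xi> A = (\<lambda>\<omega>. complex_of_real (Y A \<omega>))" using dY[OF that] by auto
      then show ?thesis by simp
    qed
    fix A :: "nat \<Rightarrow> real set" assume A: "range A \<subseteq> sets borel" "disjoint_family A"
    then have Ab: "A i \<in> sets borel" "(\<Union>i. A i) \<in> sets borel" for i by auto
    have "tendsto_in_prob M (\<lambda>n \<omega>. \<Sum>i<n. Y (A i) \<omega>) (Y (\<Union>i. A i)) sequentially"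
      using arm A unfolding associated_random_measure_def by blast
    moreover have "norm ((\<Sum>i<n. d\<xi> (A i) \<omega>) - d\<xi> (\<Union>i. A i) \<omega>) = norm ((\<Sum>i<n. Y (A i) \<omega>) - Y (\<Union>i. A i) \<omega>)" for n \<omega>
      unfolding dY[OF Ab(1)] dY[OF Ab(2)] of_real_sum[symmetric] of_real_diff[symmetric] norm_of_real by simp
    ultimately show "tendsto_in_prob M (\<lambda>n \<omega>. \<Sum>i<n. d\<xi> (A i) \<omega>) (d\<xi> (\<Union>i. A i)) sequentially"
      unfolding tendsto_in_prob_def by simp
  qed
  define L where "L A \<theta> = scale_exponent \<alpha> M (Y A) (Re \<theta>)" for A \<theta>
  have cf: "(CLINT \<omega>|M. iexp (\<Sum>i<n. \<theta> i \<bullet> d\<xi> (A i) \<omega>)) = of_real (exp (- (\<Sum>i<n. L (A i) (\<theta> i))))"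
    if A: "\<And>i. i < n \<Longrightarrow> A i \<in> sets borel" "disjoint_family_on A {..<n}" for n :: nat and A \<theta>
  proof -
    have e: "(\<Sum>i<n. \<theta> i \<bullet> d\<xi> (A i) \<omega>) = (\<Sum>i<n. Re (\<theta> i) \<bullet> Y (A i) \<omega>)" for \<omega>
      using A(1) by (intro sum.cong) (auto simp: dY inner_complex_def)
    have G: "symmetric_sphere_measure (spectral_measure \<alpha> M n (\<lambda>i. Y (A i))) n"
      by (rule is_spectral_measureD(1)[OF is_spectral_measure_spectral_measure[OF sas[OF A(1)]]])
    have "(CLINT \<omega>|M. iexp (\<Sum>i<n. Re (\<theta> i) \<bullet> Y (A i) \<omega>)) = of_real (exp (- (\<Sum>i<n. scale_exponent \<alpha> M (Y (A i)) (Re (\<theta> i)))))"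
    proof (rule cf_axes)
      fix i j assume ij: "i < n" "j < n" "i \<noteq> j"
      \<comment> \<open>The triple i, i, j is not constant, so the additivity condition covers it;
        two distinct indices below n also give n \<ge> 2.\<close>
      have "partial_real i (partial_real i (partial_real j (phi_real n (spectral_measure \<alpha> M n (\<lambda>i. Y (A i)))))) \<theta>' = 0" for \<theta>'
        using cA A ij unfolding condition_A_real_def by auto
      then have "AE s in spectral_measure \<alpha> M n (\<lambda>i. Y (A i)). s i * s j = 0"
        by (rule AE_product_0_real[OF G ij(2,1)])
      then show "AE s in spectral_measure \<alpha> M n (\<lambda>i. Y (A i)). s i = 0 \<or> s j = 0" by simp
    qed (use \<alpha> sas[OF A(1)] sas1 A(1) in auto)
    then show ?thesis unfolding e L_def .
  qed
  interpret I: independent_random_measure M d\<xi> L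
    by (intro independent_random_measure.intro rm independent_random_measure_axioms.intro cf)
  have L: "L A \<theta> = \<bar>Re \<theta>\<bar> powr \<alpha> * L A 1" for A \<theta>
    using scale_exponent_scaleR[of \<alpha> M "Y A" "Re \<theta>" 1] by (simp add: L_def)
  obtain m where m: "sets m = sets borel" "finite_measure m" "\<And>A. A \<in> sets borel \<Longrightarrow> measure m A = L A 1"
    using I.control_measure[of 1] by (auto simp: L_def scale_exponent_nonneg)
  have srm: "stable_random_measure M d\<xi> \<alpha> m sign_measure"
  proof (intro stable_random_measure.intro rm stable_random_measure_axioms.intro)
    show "AE u in sign_measure. norm u = 1" using AE_sign_measure by eventually_elim simp
    show "0 < (LINT u|sign_measure. \<bar>1 \<bullet> u\<bar> powr \<alpha>)" unfolding integral_sign_measure by simp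
    fix n :: nat and A :: "nat \<Rightarrow> real set" and \<theta> :: "nat \<Rightarrow> complex"
    assume A: "\<And>i. i < n \<Longrightarrow> A i \<in> sets borel" "disjoint_family_on A {..<n}"
    have "(\<Sum>i<n. L (A i) (\<theta> i)) = (\<Sum>i<n. measure m (A i) * (LINT u|sign_measure. \<bar>\<theta> i \<bullet> u\<bar> powr \<alpha>))"
      using A(1) m(3) by (intro sum.cong refl) (simp add: integral_sign_measure L[of _ "\<theta> _"])
    then show "(CLINT \<omega>|M. iexp (\<Sum>i<n. \<theta> i \<bullet> d\<xi> (A i) \<omega>)) =
        of_real (exp (- (\<Sum>i<n. measure m (A i) * (LINT u|sign_measure. \<bar>\<theta> i \<bullet> u\<bar> powr \<alpha>))))"
      using cf[OF A, of \<theta>] by simp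
  qed (use \<alpha> m prob_space_sign_measure sign_measure_symmetric in auto)
  interpret S: stable_random_measure M d\<xi> \<alpha> m sign_measure by (rule srm)
  have "covariation_real \<alpha> M (Y A) (Y B) = measure m (A \<inter> B)" if AB: "A \<in> sets borel" "B \<in> sets borel" for A B
    unfolding Y_def[abs_def]
  proof (rule S.covariation_real_sets[OF AB])
    have "sas_vector \<alpha> M 2 (\<lambda>i. Y (if i = 0 then A else B))" by (rule sas) (use AB in auto)
    moreover have "(\<lambda>i. Y (if i = 0 then A else B)) = pair_vector (Y A) (Y B)" by (auto simp: pair_vector_def)
    ultimately show "sas_vector \<alpha> M 2 (pair_vector (\<lambda>\<omega>. Re (d\<xi> A \<omega>)) (\<lambda>\<omega>. Re (d\<xi> B \<omega>)))"
      by (simp add: Y_def[abs_def])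
    show "AE u in sign_measure. \<bar>Re u\<bar> = 1" using AE_sign_measure by eventually_elim simp
  qed
  then show ?thesis using srm by (auto simp: Y_def[abs_def])
qed

text \<open>Isotropy of the increments gives rotation invariance of the exponent on intervals, which
  spreads to all Borel sets. With homogeneity the exponent becomes |\<theta>|^\<alpha> times its
  value at 1, and division by \<open>circle_const \<alpha>\<close> yields the control
  measure.\<close>

lemma stable_setting_isotropic:
  assumes \<alpha>: "1 < \<alpha>" and S: "stable_setting Isotropic_Process \<alpha> M \<xi> d\<xi>"
  shows "\<exists>m. stable_random_measure M d\<xi> \<alpha> m circle \<and>
    (\<forall>A\<in>sets borel. \<forall>B\<in>sets borel. covariation_bimeasure Isotropic_Process \<alpha> M d\<xi> A B = of_real (measure m (A \<inter> B)))"
proof -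
  have prob: "prob_space M" and arm: "associated_random_measure \<alpha> M \<xi> d\<xi>"
    and cA: "condition_A_complex \<alpha> M d\<xi>" and iso: "isotropic_process M \<xi>" and sp: "sas_process \<alpha> M \<xi>"
    using S by auto
  have sas: "sas_vector \<alpha> M n (\<lambda>i. d\<xi> (A i))" if "\<And>i. i < n \<Longrightarrow> A i \<in> sets borel" for n A
    using arm that unfolding associated_random_measure_def by blast
  have sas1: "sas_vector \<alpha> M 1 (\<lambda>_. d\<xi> A)" if "A \<in> sets borel" for A
    using sas[of 1 "\<lambda>_. A"] that by simp
  have dm: "d\<xi> A \<in> borel_measurable M" if "A \<in> sets borel" for A
    using sas1[OF that] by (auto simp: sas_vector_def)
  have xm[measurable]: "\<xi> t \<in> borel_measurable M" for t
  proof -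
    have "sas_vector \<alpha> M 1 (\<lambda>i. \<xi> t)" by (rule sp[unfolded sas_process_def, rule_format])
    then show ?thesis by (simp add: sas_vector_def)
  qed
  have rm: "random_measure M d\<xi>"
    by (intro random_measure.intro prob random_measure_axioms.intro dm)
      (use arm in \<open>auto simp: associated_random_measure_def\<close>)
  define L where "L A \<theta> = scale_exponent \<alpha> M (d\<xi> A) \<theta>" for A \<theta>
  have cf: "(CLINT \<omega>|M. iexp (\<Sum>i<n. \<theta> i \<bullet> d\<xi> (A i) \<omega>)) = of_real (exp (- (\<Sum>i<n. L (A i) (\<theta> i))))"
    if A: "\<And>i. i < n \<Longrightarrow> A i \<in> sets borel" "disjoint_family_on A {..<n}" for n :: nat and A \<theta>
    unfolding L_def
  proof (rule cf_axes)
    have G: "symmetric_sphere_measure (spectral_measure \<alpha> M n (\<lambda>i. d\<xi> (A i))) n"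
      by (rule is_spectral_measureD(1)[OF is_spectral_measure_spectral_measure[OF sas[OF A(1)]]])
    fix i j assume ij: "i < n" "j < n" "i \<noteq> j"
    have "partial_bar i (partial_bar i (partial_bar j (phi_complex n (spectral_measure \<alpha> M n (\<lambda>i. d\<xi> (A i)))))) \<theta>' = 0" for \<theta>'
      using cA A ij unfolding condition_A_complex_def by auto
    then have "AE s in spectral_measure \<alpha> M n (\<lambda>i. d\<xi> (A i)). s i * s j = 0"
      by (rule AE_product_0_complex[OF G ij(2,1)])
    then show "AE s in spectral_measure \<alpha> M n (\<lambda>i. d\<xi> (A i)). s i = 0 \<or> s j = 0" by simp
  qed (use \<alpha> sas[OF A(1)] sas1 A(1) in auto)
  interpret I: independent_random_measure M d\<xi> L
    by (intro independent_random_measure.intro rm independent_random_measure_axioms.intro cf)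
  have rot: "L {a..<b} (\<theta> * cis r) = L {a..<b} \<theta>" for a b \<theta> r
  proof (cases "a \<le> b")
    case False
    \<comment> \<open>The interval is empty in this case, and additivity gives the empty set the
      exponent 0.\<close>
    then show ?thesis using I.L_union[of "{}" "{}"] by simp
  next
    case True
    define Z where "Z \<omega> = \<xi> b \<omega> - \<xi> a \<omega>" for \<omega>
    have [measurable]: "Z \<in> borel_measurable M" unfolding Z_def[abs_def] by measurable
    have Zd: "AE \<omega> in M. d\<xi> {a..<b} \<omega> = Z \<omega>" using arm True by (simp add: associated_random_measure_def Z_def)
    have "isotropic M (\<lambda>\<omega>. \<Sum>i<(2::nat). (if i = 0 then 1 else -1) * \<xi> (if i = 0 then b else a) \<omega>)"
      by (rule iso[unfolded isotropic_process_def, rule_format])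
    moreover have "(\<lambda>\<omega>. \<Sum>i<(2::nat). (if i = 0 then 1 else -1) * \<xi> (if i = 0 then b else a) \<omega>) = Z"
      by (auto simp: Z_def numeral_2_eq_2)
    \<comment> \<open>Rotating \<theta> by r amounts to rotating \<open>Z\<close> by -r in the real
      inner product, whence the sign.\<close>
    ultimately have isoZ: "distr M borel (\<lambda>\<omega>. Z \<omega> * iexp (- r)) = distr M borel Z"
      unfolding isotropic_def by metis
    have cfL: "(CLINT \<omega>|M. iexp (\<eta> \<bullet> Z \<omega>)) = of_real (exp (- L {a..<b} \<eta>))" for \<eta>
    proof -
      have "(CLINT \<omega>|M. iexp (\<eta> \<bullet> Z \<omega>)) = (CLINT \<omega>|M. iexp (\<eta> \<bullet> d\<xi> {a..<b} \<omega>))"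
        by (rule integral_cong_AE) (use Zd dm in \<open>auto elim: eventually_mono\<close>)
      then show ?thesis using cf_scale_exponent[OF sas1, of "{a..<b}" \<eta>] by (simp add: L_def)
    qed
    have "(\<theta> * cis r) \<bullet> Z \<omega> = \<theta> \<bullet> (Z \<omega> * iexp (- r))" for \<omega>
    proof -
      have "iexp (- r) = cnj (cis r)" unfolding cis_cnj by (rule cis_conv_exp[symmetric])
      then show ?thesis using inner_mult_cnj[of \<theta> "cnj (cis r)" "Z \<omega>"] by (simp only: complex_cnj_cnj mult.commute)
    qed
    then have "(CLINT \<omega>|M. iexp ((\<theta> * cis r) \<bullet> Z \<omega>)) = (CLINT \<omega>|M. iexp (\<theta> \<bullet> (Z \<omega> * iexp (- r))))" by simp
    also have "\<dots> = (CLINT z|distr M borel (\<lambda>\<omega>. Z \<omega> * iexp (- r)). iexp (\<theta> \<bullet> z))"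
      by (rule integral_distr[symmetric]) measurable
    also have "\<dots> = (CLINT z|distr M borel Z. iexp (\<theta> \<bullet> z))" by (simp only: isoZ)
    also have "\<dots> = (CLINT \<omega>|M. iexp (\<theta> \<bullet> Z \<omega>))" by (rule integral_distr) measurable
    finally show ?thesis unfolding cfL by simp
  qed
  have L: "L A \<theta> = norm \<theta> powr \<alpha> * L A 1" if A: "A \<in> sets borel" for A \<theta>
  proof -
    have "\<theta> = (norm \<theta> *\<^sub>R 1) * cis (Arg \<theta>)" by (metis rcis_cmod_Arg rcis_def scaleR_conv_of_real mult.right_neutral)
    then have "L A \<theta> = L A ((norm \<theta> *\<^sub>R 1) * cis (Arg \<theta>))" by simp
    also have "\<dots> = L A (norm \<theta> *\<^sub>R 1)" by (rule I.L_rotation_invariant[OF rot A])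
    also have "\<dots> = norm \<theta> powr \<alpha> * L A 1" unfolding L_def scale_exponent_scaleR by simp
    finally show ?thesis .
  qed
  have c: "0 < circle_const \<alpha>" using \<alpha> by (intro circle_const_pos) simp
  obtain m where m: "sets m = sets borel" "finite_measure m" "\<And>A. A \<in> sets borel \<Longrightarrow> measure m A = L A 1 / circle_const \<alpha>"
    using I.control_measure[OF _ c] by (auto simp: L_def scale_exponent_nonneg)
  have srm: "stable_random_measure M d\<xi> \<alpha> m circle"
  proof (intro stable_random_measure.intro rm stable_random_measure_axioms.intro)
    show "0 < (LINT u|circle. \<bar>1 \<bullet> u\<bar> powr \<alpha>)" using c unfolding integral_circle_inner_powr by simp
    fix n :: nat and A :: "nat \<Rightarrow> real set" and \<theta> :: "nat \<Rightarrow> complex"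
    assume A: "\<And>i. i < n \<Longrightarrow> A i \<in> sets borel" "disjoint_family_on A {..<n}"
    have "(\<Sum>i<n. L (A i) (\<theta> i)) = (\<Sum>i<n. measure m (A i) * (LINT u|circle. \<bar>\<theta> i \<bullet> u\<bar> powr \<alpha>))"
      using A(1) m(3) c by (intro sum.cong refl) (simp add: integral_circle_inner_powr L[of _ "\<theta> _"])
    then show "(CLINT \<omega>|M. iexp (\<Sum>i<n. \<theta> i \<bullet> d\<xi> (A i) \<omega>)) =
        of_real (exp (- (\<Sum>i<n. measure m (A i) * (LINT u|circle. \<bar>\<theta> i \<bullet> u\<bar> powr \<alpha>))))"
      using cf[OF A, of \<theta>] by simp
  qed (use \<alpha> m prob_space_circle circle_symmetric AE_circle in auto)
  interpret S: stable_random_measure M d\<xi> \<alpha> m circle by (rule srm)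
  have "covariation \<alpha> M (d\<xi> A) (d\<xi> B) = of_real (measure m (A \<inter> B))" if AB: "A \<in> sets borel" "B \<in> sets borel" for A B
  proof (rule S.covariation_sets[OF AB])
    have "sas_vector \<alpha> M 2 (\<lambda>i. d\<xi> (if i = 0 then A else B))" by (rule sas) (use AB in auto)
    moreover have "(\<lambda>i. d\<xi> (if i = 0 then A else B)) = pair_vector (d\<xi> A) (d\<xi> B)" by (auto simp: pair_vector_def)
    ultimately show "sas_vector \<alpha> M 2 (pair_vector (d\<xi> A) (d\<xi> B))" by simp
  qed
  then show ?thesis using srm by auto
qed

lemma stable_setting:
  assumes "1 < \<alpha>" "stable_setting k \<alpha> M \<xi> d\<xi>"
  shows "\<exists>m. stable_random_measure M d\<xi> \<alpha> m (direction_measure k) \<and>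
    (\<forall>A\<in>sets borel. \<forall>B\<in>sets borel. covariation_bimeasure k \<alpha> M d\<xi> A B = of_real (measure m (A \<inter> B)))"
proof (cases k)
  case Real_Process
  then show ?thesis using stable_setting_real assms by simp
next
  case Isotropic_Process
  then show ?thesis using stable_setting_isotropic assms by simp
qed

text \<open>\<open>control\<close> is built from m and \<rho> only, so the joint exponents of the
  integrals agree on the two probability spaces, and characteristic functions determine the
  laws.\<close>

lemma same_fdd_stoch_integrals:
  fixes M :: "'w measure" and M' :: "'v measure"
  assumes "stable_random_measure M X \<alpha> m \<rho>" "stable_random_measure M' X' \<alpha> m \<rho>"
    and f: "\<And>t. f t \<in> Lambda M X" "\<And>t. f t \<in> Lambda M' X'" "\<And>t. bounded (range (f t))"
  shows "same_fdd M (\<lambda>t. stoch_integral \<alpha> M X (f t)) M' (\<lambda>t. stoch_integral \<alpha> M' X' (f t))"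
  unfolding same_fdd_def
proof (intro allI)
  interpret S: stable_random_measure M X \<alpha> m \<rho> by fact
  interpret S': stable_random_measure M' X' \<alpha> m \<rho> by fact
  fix n and t :: "nat \<Rightarrow> real"
  have Y: "is_stoch_integral \<alpha> M X (f (t i)) (stoch_integral \<alpha> M X (f (t i)))" for i
    by (rule S.is_stoch_integral_stoch_integral[OF f(1) f(3)])
  have Y': "is_stoch_integral \<alpha> M' X' (f (t i)) (stoch_integral \<alpha> M' X' (f (t i)))" for i
    by (rule S'.is_stoch_integral_stoch_integral[OF f(2) f(3)])
  show "distr M (\<Pi>\<^sub>M i\<in>{..<n}. borel) (\<lambda>\<omega>. \<lambda>i\<in>{..<n}. stoch_integral \<alpha> M X (f (t i)) \<omega>) =
        distr M' (\<Pi>\<^sub>M i\<in>{..<n}. borel) (\<lambda>\<omega>. \<lambda>i\<in>{..<n}. stoch_integral \<alpha> M' X' (f (t i)) \<omega>)"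
  proof (rule distr_PiM_cf_eq_euclidean[OF S.finite_measure_axioms S'.finite_measure_axioms])
    fix \<theta> :: "nat \<Rightarrow> complex"
    show "(CLINT \<omega>|M. iexp (\<Sum>i<n. \<theta> i \<bullet> stoch_integral \<alpha> M X (f (t i)) \<omega>)) =
      (CLINT \<omega>|M'. iexp (\<Sum>i<n. \<theta> i \<bullet> stoch_integral \<alpha> M' X' (f (t i)) \<omega>))"
      unfolding S.cf_stoch_integrals[OF f(1) f(3) Y] S'.cf_stoch_integrals[OF f(2) f(3) Y'] ..
  qed (use Y Y' in \<open>auto simp: is_stoch_integral_def\<close>)
qed

theorem proposition4:
  fixes \<alpha> :: real and k :: process_type
    and M :: "'w measure" and \<xi> :: "real \<Rightarrow> 'w \<Rightarrow> complex" and d\<xi> :: "real set \<Rightarrow> 'w \<Rightarrow> complex"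
    and F :: "real set \<Rightarrow> real set \<Rightarrow> complex"
    and f :: "real \<Rightarrow> real \<Rightarrow> complex" and X :: "real \<Rightarrow> 'w \<Rightarrow> complex"
  assumes "1 < \<alpha>" and "\<alpha> < 2"
    and "stable_setting k \<alpha> M \<xi> d\<xi>"
    and "F = covariation_bimeasure k \<alpha> M d\<xi>"
    and "condition_BV \<alpha> F"
    and "\<And>t. f t \<in> Lambda M d\<xi>" and "\<And>t. bounded (range (f t))"
    and "\<And>t. X t = stoch_integral \<alpha> M d\<xi> (f t)"
  shows "bimeasure F \<and> integral_representation \<alpha> M d\<xi> F \<and>
    (\<forall>F'. bimeasure F' \<and> integral_representation \<alpha> M d\<xi> F' \<longrightarrow>
       (\<forall>A\<in>sets borel. \<forall>B\<in>sets borel. F' A B = F A B)) \<and>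
    (\<forall>(M' :: 'v measure) \<xi>' d\<xi>' X'.
       stable_setting k \<alpha> M' \<xi>' d\<xi>' \<and>
       (\<forall>A\<in>sets borel. \<forall>B\<in>sets borel. covariation_bimeasure k \<alpha> M' d\<xi>' A B = F A B) \<and>
       condition_BV \<alpha> (covariation_bimeasure k \<alpha> M' d\<xi>') \<and>
       (\<forall>t. f t \<in> Lambda M' d\<xi>') \<and>
       (\<forall>t. X' t = stoch_integral \<alpha> M' d\<xi>' (f t)) \<longrightarrow>
       same_fdd M X M' X')"
proof -
  obtain m where m: "stable_random_measure M d\<xi> \<alpha> m (direction_measure k)"
    and Fm: "\<And>A B. A \<in> sets borel \<Longrightarrow> B \<in> sets borel \<Longrightarrow> F A B = of_real (measure m (A \<inter> B))"
    using stable_setting[OF assms(1,3)] assms(4) by blast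
  interpret S: stable_random_measure M d\<xi> \<alpha> m "direction_measure k" by (rule m)
  have bi: "bimeasure F" by (rule bimeasure_diagonal[OF S.finite_m S.sets_m Fm])
  have rep: "integral_representation \<alpha> M d\<xi> F" by (rule S.integral_representation_diagonal[OF Fm])
  \<comment> \<open>On bounded sets both bimeasures equal the covariation of the integrals of the
    two indicators.\<close>
  have unique: "F' A B = F A B"
    if F': "bimeasure F'" "integral_representation \<alpha> M d\<xi> F'" and AB: "A \<in> sets borel" "B \<in> sets borel" for F' A B
    by (rule bimeasure_eqI[OF bi F'(1) _ AB])
      (simp add: S.integral_representation_bounded_sets[OF bi rep] S.integral_representation_bounded_sets[OF F'])
  have fdd: "same_fdd M X M' X'"
    if S': "stable_setting k \<alpha> M' \<xi>' d\<xi>'"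
      and F': "\<forall>A\<in>sets borel. \<forall>B\<in>sets borel. covariation_bimeasure k \<alpha> M' d\<xi>' A B = F A B"
      and f': "\<forall>t. f t \<in> Lambda M' d\<xi>'" and X': "\<forall>t. X' t = stoch_integral \<alpha> M' d\<xi>' (f t)"
    for M' :: "'v measure" and \<xi>' d\<xi>' X'
  proof -
    obtain m' where m': "stable_random_measure M' d\<xi>' \<alpha> m' (direction_measure k)"
      and Fm': "\<And>A B. A \<in> sets borel \<Longrightarrow> B \<in> sets borel \<Longrightarrow> covariation_bimeasure k \<alpha> M' d\<xi>' A B = of_real (measure m' (A \<inter> B))"
      using stable_setting[OF assms(1) S'] by blast
    interpret S': stable_random_measure M' d\<xi>' \<alpha> m' "direction_measure k" by (rule m')
    \<comment> \<open>The diagonal values F(A, A) = m(A) recover the control measure, and the type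
      \<open>k\<close> fixes the direction law; together they determine all joint exponents.\<close>
    have "m' = m"
    proof (rule measure_eqI)
      fix A assume "A \<in> sets m'"
      then have A: "A \<in> sets borel" by simp
      have "measure m' A = measure m A" using Fm[OF A A] Fm'[OF A A] F' A by simp
      then show "emeasure m' A = emeasure m A" by (simp add: S.m.emeasure_eq_measure S'.m.emeasure_eq_measure)
    qed simp
    then have "same_fdd M (\<lambda>t. stoch_integral \<alpha> M d\<xi> (f t)) M' (\<lambda>t. stoch_integral \<alpha> M' d\<xi>' (f t))"
      using same_fdd_stoch_integrals[OF m, of M' d\<xi>' f] m' assms(6,7) f' by blast
    moreover have "X = (\<lambda>t. stoch_integral \<alpha> M d\<xi> (f t))" "X' = (\<lambda>t. stoch_integral \<alpha> M' d\<xi>' (f t))"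
      using assms(8) X' by auto
    ultimately show ?thesis by simp
  qed
  show ?thesis
  proof (intro conjI allI impI ballI bi rep)
    fix F' and A B :: "real set"
    assume "bimeasure F' \<and> integral_representation \<alpha> M d\<xi> F'" "A \<in> sets borel" "B \<in> sets borel"
    then show "F' A B = F A B" by (elim conjE) (rule unique)
  qed (elim conjE, rule fdd)
qed

end
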